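(* Let $T>0$ and let $a\in L^\infty([0,T])$ satisfy $a\ge0$ a.e., $a\not\equiv0$, and be even, i.e. $a(T-t)=a(t)$ for a.e. $t\in[0,T]$. Consider the problem $$-u''=\lambda u+a(t)u^3\text{ in }(0,T),\qquad u(0)=u(T),\ u'(0)=u'(T).\tag{$*$}$$ Then: (i) the unique bifurcation points of $\mathfrak{F}:\mathbb{R}\times H^2(\mathbb{T})\to L^2(\mathbb{T})$, $\mathfrak{F}(\lambda,u)=u''+\lambda u+a(t)u^3$, from the branch of trivial solutions $\mathcal{T}$ are $(\sigma_k,0)$ with $k\in\mathbb{N}\cup\{0\}$; (ii) a connected component of nontrivial solutions $\mathscr{C}_k\subset\mathfrak{S}$ emanates at $(\sigma_k,0)$ for all $k\in\mathbb{N}\cup\{0\}$; (iii) there exists $\rho>0$ such that $B_\rho(\sigma_0,0)\cap(\mathscr{C}_0\setminus\{(\sigma_0,0)\})=\mathscr{C}_{0,\mathrm{loc}}^+\uplus\mathscr{C}_{0,\mathrm{loc}}^-$, where $\mathscr{C}_{0,\mathrm{loc}}^+$ (resp. $\mathscr{C}_{0,\mathrm{loc}}^-$) is a local curve consisting of positive (resp. negative) even solutions of $( * )$; moreover $-\mathscr{C}_{0,\mathrm{loc}}^+=\mathscr{C}_{0,\mathrm{loc}}^-$; (iv) for each $k\in\mathbb{N}$, $k\ge1$, the component $\mathscr{C}_k$ contains two subcomponents $\mathscr{C}_{\mathrm{ev},k}\subset\mathbb{R}\times H^2_{\mathrm{ev}}(\mathbb{T})$ and $\mathscr{C}_{\mathrm{odd},k}\subset\mathbb{R}\times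 H^2_{\mathrm{odd}}(\mathbb{T})$ of even and odd solutions of $( * )$, respectively. Moreover, there exists $\rho>0$ such that $$B_\rho(\sigma_k,0)\cap(\mathscr{C}_{\mathrm{ev},k}\setminus\{(\sigma_k,0)\})=\mathscr{C}_{\mathrm{ev},k,\mathrm{loc}}^+\uplus\mathscr{C}_{\mathrm{ev},k,\mathrm{loc}}^-,$$ $$B_\rho(\sigma_k,0)\cap(\mathscr{C}_{\mathrm{odd},k}\setminus\{(\sigma_k,0)\})=\mathscr{C}_{\mathrm{odd},k,\mathrm{loc}}^+\uplus\mathscr{C}_{\mathrm{odd},k,\mathrm{loc}}^-,$$ where $\mathscr{C}_{\mathrm{ev},k,\mathrm{loc}}^\pm$ (resp. $\mathscr{C}_{\mathrm{odd},k,\mathrm{loc}}^\pm$) are local curves consisting of even (resp. odd) solutions of $( * )$ with exactly $2k$ zeros in $[0,T)$. Finally, $-\mathscr{C}_{\mathrm{ev},k,\mathrm{loc}}^+=\mathscr{C}_{\mathrm{ev},k,\mathrm{loc}}^-$ and $-\mathscr{C}_{\mathrm{odd},k,\mathrm{loc}}^+=\mathscr{C}_{\mathrm{odd},k,\mathrm{loc}}^-$.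
   Context: $\mathbb{T}=\mathbb{R}/(T\mathbb{Z})$; $H^s(\mathbb{T})$ is the space of real $u\in H^s([0,T])$ with $D^\alpha u(0)=D^\alpha u(T)$ for integers $0\le\alpha<s$; $L^2(\mathbb{T})=H^0(\mathbb{T})$. $H^s_{\mathrm{ev}}(\mathbb{T})$ (resp. $H^s_{\mathrm{odd}}(\mathbb{T})$): those $u$ with $u(T-t)=u(t)$ (resp. $u(T-t)=-u(t)$) a.e.; these are called even (resp. odd). Solutions are $u\in H^2(\mathbb{T})$ satisfying the equation a.e. $\sigma_k=(2\pi k/T)^2$; $\mathcal{T}=\{(\lambda,0):\lambda\in\mathbb{R}\}$. $(\lambda_0,0)$ is a bifurcation point from $\mathcal{T}$ if every neighborhood of it contains a zero $(\lambda,u)$ of $\mathfrak{F}$ with $u\neq0$. $\mathfrak{S}=(\mathfrak{F}^{-1}(0)\setminus\mathcal{T})\cup\{(\sigma_k,0):k\ge0\}$; $\mathfrak{S}_{\mathrm{ev}}=(\mathfrak{S}\setminus\mathcal{T})\cap(\mathbb{R}\times H^2_{\mathrm{ev}}(\mathbb{T}))\cup\{(\sigma_k,0):k\ge0\}$ and $\mathfrak{S}_{\mathrm{odd}}=(\mathfrak{S}\setminus\mathcal{T})\cap(\mathbb{R}\times H^2_{\mathrm{odd}}(\mathbb{T}))\cup\{(\sigma_k,0):k\ge1\}$. $\mathscr{C}_k$, $\mathscr{C}_{\mathrm{ev},k}$, $\mathscr{C}_{\mathrm{odd},k}$ are the connected components of $\mathfrak{S}$, $\mathfrak{S}_{\mathrm{ev}}$,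 $\mathfrak{S}_{\mathrm{odd}}$, respectively, containing $(\sigma_k,0)$. For $\mathscr{C}\subset\mathbb{R}\times H^2(\mathbb{T})$, $-\mathscr{C}=\{(\lambda,-u):(\lambda,u)\in\mathscr{C}\}$. $\uplus$ is disjoint union; $B_\rho$ denotes the open ball of radius $\rho$ in $\mathbb{R}\times H^2(\mathbb{T})$ (intersected with the relevant subspace). Local curves: each pair $\mathscr{C}^{\pm}_{\cdot,\mathrm{loc}}$ is of the form $\mathscr{C}^+=\{(\Lambda(s),s(\chi+\Gamma(s))):0<s<\varepsilon\}$, $\mathscr{C}^-=\{(\Lambda(s),s(\chi+\Gamma(s))):-\varepsilon<s<0\}$ for some $\varepsilon>0$ and $\mathcal{C}^\infty$ maps $\Lambda:(-\varepsilon,\varepsilon)\to\mathbb{R}$, $\Gamma:(-\varepsilon,\varepsilon)\to Y$, with $\Lambda(0)=\sigma_k$, $\Gamma(0)=0$; here $\chi=1$ for $k=0$, $\chi=\sqrt{2/T}\cos(2\pi kt/T)$ in the even case and $\chi=\sqrt{2/T}\sin(2\pi kt/T)$ in the odd case ($k\ge1$), and $Y$ is the $H^2$-orthogonal complement of $\chi$ in $H^2(\mathbb{T})$, $H^2_{\mathrm{ev}}(\mathbb{T})$, $H^2_{\mathrm{odd}}(\mathbb{T})$, respectively. *)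

theory Defs
  imports "HOL-Analysis.Analysis"
begin

definition smooth_on :: "real set \<Rightarrow> (real \<Rightarrow> real) \<Rightarrow> bool" where
  "smooth_on S f \<longleftrightarrow> (\<forall>n. \<forall>x\<in>S. (deriv ^^ n) f field_differentiable (at x))"

definition test_functions :: "real \<Rightarrow> (real \<Rightarrow> real) set" where
  "test_functions T = {\<phi>. smooth_on UNIV \<phi> \<and>
     (\<exists>K. compact K \<and> K \<subseteq> {0<..<T} \<and> (\<forall>t. t \<notin> K \<longrightarrow> \<phi> t = 0))}"

definition L2 :: "real \<Rightarrow> (real \<Rightarrow> real) set" where
  "L2 T = {f \<in> borel_measurable (lebesgue_on {0..T}).
     integrable (lebesgue_on {0..T}) (\<lambda>t. (f t)\<^sup>2)}"

definition Linf :: "real \<Rightarrow> (real \<Rightarrow> real) set" where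
  "Linf T = {f \<in> borel_measurable (lebesgue_on {0..T}).
     \<exists>M. AE t in lebesgue_on {0..T}. \<bar>f t\<bar> \<le> M}"

text \<open>The function \<open>v\<close> is the weak derivative of order \<open>n\<close> of \<open>u\<close> on \<open>(0,T)\<close>, both lying in
  the space \<open>L2\<close>.\<close>

definition has_weak_deriv :: "real \<Rightarrow> nat \<Rightarrow> (real \<Rightarrow> real) \<Rightarrow> (real \<Rightarrow> real) \<Rightarrow> bool" where
  "has_weak_deriv T n u v \<longleftrightarrow> u \<in> L2 T \<and> v \<in> L2 T \<and>
     (\<forall>\<phi>\<in>test_functions T.
        (LINT t|lebesgue_on {0..T}. u t * (deriv ^^ n) \<phi> t) =
        (- 1) ^ n * (LINT t|lebesgue_on {0..T}. v t * \<phi> t))"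

text \<open>A representative of the weak derivative; it is determined only up to null sets and is used
  only in integrals and almost-everywhere statements.\<close>

definition wderiv :: "real \<Rightarrow> nat \<Rightarrow> (real \<Rightarrow> real) \<Rightarrow> real \<Rightarrow> real" where
  "wderiv T n u = (SOME v. has_weak_deriv T n u v)"

text \<open>The functions (not yet identified almost everywhere) of class \<open>H\<^sup>s\<close> on the circle of length
  \<open>T\<close>. The endpoint values of a derivative of order below \<open>s\<close> are those of its continuous
  representative.\<close>

definition periodic_sobolev :: "real \<Rightarrow> nat \<Rightarrow> (real \<Rightarrow> real) set" where
  "periodic_sobolev T s = {u. (\<forall>\<alpha>\<le>s. \<exists>v. has_weak_deriv T \<alpha> u v) \<and>
     (\<forall>\<alpha><s. \<exists>v. has_weak_deriv T \<alpha> u v \<and> continuous_on {0..T} v \<and> v 0 = v T)}"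

text \<open>An element of \<open>H\<^sup>2\<close> is represented by the unique member of its almost-everywhere class that
  is continuous on \<open>[0,T]\<close> and vanishes outside, so that equality in \<open>H\<^sup>2\<close> is equality of
  functions.\<close>

definition H2 :: "real \<Rightarrow> (real \<Rightarrow> real) set" where
  "H2 T = {u \<in> periodic_sobolev T 2. continuous_on {0..T} u \<and> (\<forall>t. t \<notin> {0..T} \<longrightarrow> u t = 0)}"

definition even_fun :: "real \<Rightarrow> (real \<Rightarrow> real) \<Rightarrow> bool" where
  "even_fun T u \<longleftrightarrow> (AE t in lebesgue_on {0..T}. u (T - t) = u t)"

definition odd_fun :: "real \<Rightarrow> (real \<Rightarrow> real) \<Rightarrow> bool" where
  "odd_fun T u \<longleftrightarrow> (AE t in lebesgue_on {0..T}. u (T - t) = - u t)"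

definition H2_ev :: "real \<Rightarrow> (real \<Rightarrow> real) set" where
  "H2_ev T = {u \<in> H2 T. even_fun T u}"

definition H2_odd :: "real \<Rightarrow> (real \<Rightarrow> real) set" where
  "H2_odd T = {u \<in> H2 T. odd_fun T u}"

definition H2_inner :: "real \<Rightarrow> (real \<Rightarrow> real) \<Rightarrow> (real \<Rightarrow> real) \<Rightarrow> real" where
  "H2_inner T u v = (\<Sum>\<alpha>\<le>2. LINT t|lebesgue_on {0..T}. wderiv T \<alpha> u t * wderiv T \<alpha> v t)"

definition H2_norm :: "real \<Rightarrow> (real \<Rightarrow> real) \<Rightarrow> real" where
  "H2_norm T u = sqrt (H2_inner T u u)"

definition H2_dist :: "real \<Rightarrow> (real \<Rightarrow> real) \<Rightarrow> (real \<Rightarrow> real) \<Rightarrow> real" where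
  "H2_dist T u v = H2_norm T (\<lambda>t. u t - v t)"

definition RH2_top :: "real \<Rightarrow> (real \<times> (real \<Rightarrow> real)) topology" where
  "RH2_top T = Metric_space.mtopology (UNIV \<times> H2 T) (prod_dist dist (H2_dist T))"

definition RH2_ball :: "real \<Rightarrow> real \<times> (real \<Rightarrow> real) \<Rightarrow> real \<Rightarrow> (real \<times> (real \<Rightarrow> real)) set" where
  "RH2_ball T p \<rho> = Metric_space.mball (UNIV \<times> H2 T) (prod_dist dist (H2_dist T)) p \<rho>"

definition zero_fun :: "real \<Rightarrow> real" where
  "zero_fun = (\<lambda>_. 0)"

definition FF :: "real \<Rightarrow> (real \<Rightarrow> real) \<Rightarrow> real \<times> (real \<Rightarrow> real) \<Rightarrow> real \<Rightarrow> real" where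
  "FF T a = (\<lambda>(l, u) t. wderiv T 2 u t + l * u t + a t * (u t) ^ 3)"

text \<open>The preimage of \<open>0\<close> under \<open>FF\<close>, equality in \<open>L2\<close> being equality almost everywhere. These
  are the solutions of the boundary value problem: the periodic boundary conditions are part of
  the membership in \<open>H2 T\<close>.\<close>

definition zeros_FF :: "real \<Rightarrow> (real \<Rightarrow> real) \<Rightarrow> (real \<times> (real \<Rightarrow> real)) set" where
  "zeros_FF T a = {p \<in> UNIV \<times> H2 T. AE t in lebesgue_on {0..T}. FF T a p t = 0}"

definition trivial_branch :: "(real \<times> (real \<Rightarrow> real)) set" where
  "trivial_branch = UNIV \<times> {zero_fun}"

definition bifurcation_point :: "real \<Rightarrow> (real \<Rightarrow> real) \<Rightarrow> real \<Rightarrow> bool" where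
  "bifurcation_point T a l0 \<longleftrightarrow>
     (\<forall>U. openin (RH2_top T) U \<and> (l0, zero_fun) \<in> U \<longrightarrow>
        (\<exists>l u. (l, u) \<in> U \<and> (l, u) \<in> zeros_FF T a \<and> u \<noteq> zero_fun))"

definition sigma :: "real \<Rightarrow> nat \<Rightarrow> real" where
  "sigma T k = (2 * pi * real k / T)\<^sup>2"

definition SS :: "real \<Rightarrow> (real \<Rightarrow> real) \<Rightarrow> (real \<times> (real \<Rightarrow> real)) set" where
  "SS T a = (zeros_FF T a - trivial_branch) \<union> {(sigma T k, zero_fun) | k. k \<ge> 0}"

definition SS_ev :: "real \<Rightarrow> (real \<Rightarrow> real) \<Rightarrow> (real \<times> (real \<Rightarrow> real)) set" where
  "SS_ev T a = (SS T a - trivial_branch) \<inter> (UNIV \<times> H2_ev T) \<union> {(sigma T k, zero_fun) | k. k \<ge> 0}"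

definition SS_odd :: "real \<Rightarrow> (real \<Rightarrow> real) \<Rightarrow> (real \<times> (real \<Rightarrow> real)) set" where
  "SS_odd T a = (SS T a - trivial_branch) \<inter> (UNIV \<times> H2_odd T) \<union> {(sigma T k, zero_fun) | k. k \<ge> 1}"

definition CC :: "real \<Rightarrow> (real \<Rightarrow> real) \<Rightarrow> nat \<Rightarrow> (real \<times> (real \<Rightarrow> real)) set" where
  "CC T a k = connected_component_of_set (subtopology (RH2_top T) (SS T a)) (sigma T k, zero_fun)"

definition CC_ev :: "real \<Rightarrow> (real \<Rightarrow> real) \<Rightarrow> nat \<Rightarrow> (real \<times> (real \<Rightarrow> real)) set" where
  "CC_ev T a k = connected_component_of_set (subtopology (RH2_top T) (SS_ev T a)) (sigma T k, zero_fun)"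

definition CC_odd :: "real \<Rightarrow> (real \<Rightarrow> real) \<Rightarrow> nat \<Rightarrow> (real \<times> (real \<Rightarrow> real)) set" where
  "CC_odd T a k = connected_component_of_set (subtopology (RH2_top T) (SS_odd T a)) (sigma T k, zero_fun)"

definition neg_set :: "(real \<times> (real \<Rightarrow> real)) set \<Rightarrow> (real \<times> (real \<Rightarrow> real)) set" where
  "neg_set C = (\<lambda>(l, u). (l, \<lambda>t. - u t)) ` C"

text \<open>The kernel directions; the indicator puts them into the normal form used in \<open>H2 T\<close>.\<close>

definition chi_const :: "real \<Rightarrow> real \<Rightarrow> real" where
  "chi_const T t = indicat_real {0..T} t"

definition chi_cos :: "real \<Rightarrow> nat \<Rightarrow> real \<Rightarrow> real" where
  "chi_cos T k t = indicat_real {0..T} t * (sqrt (2 / T) * cos (2 * pi * real k * t / T))"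

definition chi_sin :: "real \<Rightarrow> nat \<Rightarrow> real \<Rightarrow> real" where
  "chi_sin T k t = indicat_real {0..T} t * (sqrt (2 / T) * sin (2 * pi * real k * t / T))"

text \<open>The orthogonal complement of \<open>e\<close> in the subspace \<open>X\<close> of \<open>H2 T\<close>.\<close>

definition ortho_in :: "real \<Rightarrow> (real \<Rightarrow> real) set \<Rightarrow> (real \<Rightarrow> real) \<Rightarrow> (real \<Rightarrow> real) set" where
  "ortho_in T X e = {y \<in> X. H2_inner T y e = 0}"

text \<open>A \<open>C\<^sup>\<infinity>\<close> map from \<open>(-\<epsilon>,\<epsilon>)\<close> into \<open>Y\<close>, a closed subspace of \<open>H2 T\<close>: \<open>D n\<close> is the derivative of
  order \<open>n\<close>, the difference quotients converging in the norm of \<open>H2 T\<close>.\<close>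

definition smooth_map_H2 :: "real \<Rightarrow> (real \<Rightarrow> real) set \<Rightarrow> real \<Rightarrow> (real \<Rightarrow> real \<Rightarrow> real) \<Rightarrow> bool" where
  "smooth_map_H2 T Y \<epsilon> \<Gamma> \<longleftrightarrow> (\<exists>D :: nat \<Rightarrow> real \<Rightarrow> real \<Rightarrow> real.
     (\<forall>s\<in>{-\<epsilon><..<\<epsilon>}. D 0 s = \<Gamma> s) \<and>
     (\<forall>n. \<forall>s\<in>{-\<epsilon><..<\<epsilon>}. D n s \<in> Y) \<and>
     (\<forall>n. \<forall>s\<in>{-\<epsilon><..<\<epsilon>}.
        ((\<lambda>h. H2_norm T (\<lambda>t. (D n (s + h) t - D n s t) / h - D (Suc n) s t)) \<longlongrightarrow> 0) (at 0)))"

definition local_curves ::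
  "real \<Rightarrow> (real \<Rightarrow> real) set \<Rightarrow> real \<Rightarrow> (real \<Rightarrow> real) \<Rightarrow>
   (real \<times> (real \<Rightarrow> real)) set \<Rightarrow> (real \<times> (real \<Rightarrow> real)) set \<Rightarrow> bool" where
  "local_curves T X l0 e Cp Cm \<longleftrightarrow> (\<exists>\<epsilon>>0. \<exists>\<Lambda> \<Gamma>.
     smooth_on {-\<epsilon><..<\<epsilon>} \<Lambda> \<and> smooth_map_H2 T (ortho_in T X e) \<epsilon> \<Gamma> \<and>
     \<Lambda> 0 = l0 \<and> \<Gamma> 0 = zero_fun \<and>
     Cp = {(\<Lambda> s, \<lambda>t. s * (e t + \<Gamma> s t)) | s. 0 < s \<and> s < \<epsilon>} \<and>
     Cm = {(\<Lambda> s, \<lambda>t. s * (e t + \<Gamma> s t)) | s. - \<epsilon> < s \<and> s < 0})"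

text \<open>The point \<open>(l0,0)\<close> is in \<open>C\<close> and is a limit of nontrivial elements of \<open>C\<close>.\<close>

definition emanates_at :: "real \<Rightarrow> (real \<times> (real \<Rightarrow> real)) set \<Rightarrow> real \<Rightarrow> bool" where
  "emanates_at T C l0 \<longleftrightarrow> (l0, zero_fun) \<in> C \<and>
     (l0, zero_fun) \<in> RH2_top T closure_of (C - trivial_branch)"

end

(* Write lambda = sigma + mu and u = s (e + g), where e spans the kernel of u'' + sigma u in a
   symmetry class (all, even or odd functions) and g is orthogonal to e. With r = s^2 the equation
   becomes g'' + sigma g = -mu (e + g) - r a (e + g)^3. Solvability determines mu, and expanding g
   and mu in powers of r gives a recursion which, the nonlinearity being a polynomial, converges by
   a majorant argument. The branch is thus a power series in s^2, hence smooth and symmetric under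
   s -> -s. An a priori estimate shows that every small solution arises by such a blow-up, and the
   distance to (sigma, 0) increases with |s|; so a small ball meets the solution set in exactly one
   curve. Zeros are counted because g is small in C^1, and the curve for the constant kernel consists
   of even functions since reflection preserves its coordinate along e. *)
theory Submission
  imports Defs
begin

section \<open>Smooth functions and test functions\<close>

text \<open>For k \<ge> 1 the kernel at \<open>sigma T k\<close> is spanned by a cosine and a sine,
  so a one-dimensional kernel is available only inside the even and the odd class; for k = 0 it is
  one-dimensional in the whole space. One locale treats the three cases, and at k \<ge> 1 the
  component \<open>CC\<close> inherits nontrivial points near the bifurcation point from
  \<open>CC_ev\<close>. Weak derivatives come as arbitrary representatives; they are traded for
  triples (u, u', u'') of indefinite integrals, in which periodicity and the product rule can be
  used literally, and the coefficient is replaced by one that is bounded and symmetric at every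
  point. A power series is used because a single numerical majorant controls u, u', u'' uniformly in
  t, which gives smoothness into H^2, symmetry and Lipschitz bounds at once. Dividing by s removes
  the trivial solution and leaves a problem in which small solutions are unique. The even and the
  odd curve must share a radius, so the local result is proved for every sufficiently small ball.
  Off the spectrum the linear part is inverted with an explicit bound that absorbs the
  perturbation.\<close>

definition flat :: "nat \<Rightarrow> real \<Rightarrow> real" where
  "flat p x = (if x > 0 then (1 / x) ^ p * exp (- (1 / x)) else 0)"

text \<open>Differentiating exp(-1/x) produces powers of 1/x; carrying them as the parameter
  \<open>p\<close> closes the family under differentiation. At 0 both one-sided difference quotients
  tend to 0 because the exponential beats every power.\<close>

lemma flat_deriv: "(flat p has_real_derivative (flat (p + 2) x - real p * flat (p + 1) x)) (at x)"
proof (cases "x = 0")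
  case True
  \<comment> \<open>The exponent is \<open>p + 1\<close> since the difference quotient at 0
    contributes one more factor 1/h.\<close>
  have lim: "((\<lambda>h. (1 / h) ^ (p + 1) * exp (- (1 / h))) \<longlongrightarrow> 0) (at_right (0::real))"
  proof -
    have "filterlim (\<lambda>h::real. inverse h) at_top (at_right 0)" by (rule filterlim_inverse_at_top_right)
    from filterlim_compose[OF tendsto_power_div_exp_0[of "p + 1"] this] show ?thesis
      by (simp add: exp_minus divide_inverse)
  qed
  have 1: "((\<lambda>h. (flat p h - flat p 0) / (h - 0)) \<longlongrightarrow> 0) (at_right 0)"
  proof (rule Lim_transform_eventually[OF lim])
    show "\<forall>\<^sub>F h in at_right 0. (1 / h) ^ (p + 1) * exp (- (1 / h)) = (flat p h - flat p 0) / (h - 0)"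
      by (rule eventually_at_rightI[of 0 1]) (auto simp: flat_def field_simps)
  qed
  have 2: "((\<lambda>h. (flat p h - flat p 0) / (h - 0)) \<longlongrightarrow> 0) (at_left 0)"
  proof (rule Lim_transform_eventually[OF tendsto_const])
    show "\<forall>\<^sub>F h in at_left 0. 0 = (flat p h - flat p 0) / (h - 0)"
      by (rule eventually_at_leftI[of "-1" 0]) (auto simp: flat_def)
  qed
  show ?thesis
    unfolding has_field_derivative_iff True
    using filterlim_split_at[OF 2 1] by (simp add: flat_def)
next
  case False
  then consider "x < 0" | "x > 0" by linarith
  then show ?thesis
  proof cases
    case 1
    have "((\<lambda>x. 0) has_real_derivative 0) (at x)" by simp
    then have "(flat p has_real_derivative 0) (at x)"
      by (rule has_field_derivative_transform_within_open[where S = "{..<0}"])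
         (use 1 in \<open>auto simp: flat_def\<close>)
    then show ?thesis using 1 by (simp add: flat_def)
  next
    case 2
    have eq: "real p * (1 / x) ^ (p - 1) = real p * ((1 / x) ^ p * x)"
      using 2 by (cases p) (auto simp: field_simps)
    have "((\<lambda>x. (1 / x) ^ p * exp (- (1 / x))) has_real_derivative
        flat (p + 2) x - real p * flat (p + 1) x) (at x)"
    proof -
      have d: "((\<lambda>x. 1 / x) has_real_derivative - (1 / x^2)) (at x)"
        using 2 by (auto intro!: derivative_eq_intros simp: power2_eq_square)
      have d1: "((\<lambda>x. (1 / x) ^ p) has_real_derivative real p * (1 / x) ^ (p - 1) * (- (1 / x^2))) (at x)"
        by (rule derivative_eq_intros refl d)+ simp
      have d2: "((\<lambda>x. exp (- (1 / x))) has_real_derivative exp (- (1 / x)) * (1 / x^2)) (at x)"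
        by (rule derivative_eq_intros refl d)+ simp
      have "((\<lambda>x. (1 / x) ^ p * exp (- (1 / x))) has_real_derivative
        (real p * (1 / x) ^ (p - 1) * (- (1 / x^2))) * exp (- (1 / x)) +
        (1 / x) ^ p * (exp (- (1 / x)) * (1 / x^2))) (at x)"
        using DERIV_mult[OF d1 d2] by (simp add: algebra_simps)
      also have "(real p * (1 / x) ^ (p - 1) * (- (1 / x^2))) * exp (- (1 / x)) +
        (1 / x) ^ p * (exp (- (1 / x)) * (1 / x^2)) = flat (p + 2) x - real p * flat (p + 1) x"
        unfolding eq using 2 by (simp add: flat_def field_simps power2_eq_square)
      finally show ?thesis .
    qed
    then show ?thesis
      by (rule has_field_derivative_transform_within_open[where S = "{0<..}"])
         (use 2 in \<open>auto simp: flat_def\<close>)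
  qed
qed

text \<open>An algebra of functions that contains the derivative of each of its elements. Smoothness
  then follows by iteration, with no formula for the higher derivatives.\<close>

inductive_set flat_algebra :: "(real \<Rightarrow> real) set" where
  flat: "(\<lambda>x. flat p (c * x + d)) \<in> flat_algebra"
| const: "(\<lambda>x. c) \<in> flat_algebra"
| add: "f \<in> flat_algebra \<Longrightarrow> g \<in> flat_algebra \<Longrightarrow> (\<lambda>x. f x + g x) \<in> flat_algebra"
| mult: "f \<in> flat_algebra \<Longrightarrow> g \<in> flat_algebra \<Longrightarrow> (\<lambda>x. f x * g x) \<in> flat_algebra"

lemma flat_algebra_power: "f \<in> flat_algebra \<Longrightarrow> (\<lambda>x. f x ^ n) \<in> flat_algebra"
  by (induction n) (auto intro: flat_algebra.intros)

lemma flat_algebra_diff: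
  "f \<in> flat_algebra \<Longrightarrow> g \<in> flat_algebra \<Longrightarrow> (\<lambda>x. f x - g x) \<in> flat_algebra"
  using flat_algebra.add[OF _ flat_algebra.mult[OF flat_algebra.const[of "-1"]], of f g] by simp

lemma flat_algebra_deriv:
  "f \<in> flat_algebra \<Longrightarrow> \<exists>g\<in>flat_algebra. \<forall>x. (f has_real_derivative g x) (at x)"
proof (induction rule: flat_algebra.induct)
  case (flat p c d)
  let ?g = "\<lambda>x. (flat (p + 2) (c * x + d) - real p * flat (p + 1) (c * x + d)) * c"
  have "?g \<in> flat_algebra" by (intro flat_algebra.intros flat_algebra_diff)
  moreover have "((\<lambda>x. flat p (c * x + d)) has_real_derivative ?g x) (at x)" for x
    by (rule DERIV_chain2[OF flat_deriv]) (auto intro!: derivative_eq_intros)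
  ultimately show ?case by (intro bexI[where x = ?g]) auto
next
  case (const c)
  show ?case by (intro bexI[OF _ flat_algebra.const[of 0]]) auto
next
  case (add f g)
  then obtain f' g' where "f' \<in> flat_algebra" "g' \<in> flat_algebra"
    "\<forall>x. (f has_real_derivative f' x) (at x)" "\<forall>x. (g has_real_derivative g' x) (at x)" by blast
  then show ?case
    by (intro bexI[where x = "\<lambda>x. f' x + g' x"] flat_algebra.intros)
       (auto intro!: derivative_eq_intros)
next
  case (mult f g)
  then obtain f' g' where "f' \<in> flat_algebra" "g' \<in> flat_algebra"
    "\<forall>x. (f has_real_derivative f' x) (at x)" "\<forall>x. (g has_real_derivative g' x) (at x)" by blast
  then show ?case
    using mult.hyps
    by (intro bexI[where x = "\<lambda>x. f' x * g x + g' x * f x"] flat_algebra.intros)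
       (auto intro!: derivative_eq_intros)
qed

lemma flat_algebra_smooth:
  assumes "f \<in> flat_algebra"
  shows "smooth_on UNIV f"
proof -
  have "(deriv ^^ n) f \<in> flat_algebra" for n
  proof (induction n)
    case 0 then show ?case using assms by simp
  next
    case (Suc n)
    from flat_algebra_deriv[OF Suc] obtain g where
      g: "g \<in> flat_algebra" "\<forall>x. ((deriv ^^ n) f has_real_derivative g x) (at x)" by blast
    then have "deriv ((deriv ^^ n) f) = g" by (auto intro!: DERIV_imp_deriv)
    then show ?case using g by simp
  qed
  then show ?thesis
    unfolding smooth_on_def field_differentiable_def using flat_algebra_deriv by blast
qed

lemma smooth_onD_deriv:
  "smooth_on UNIV f \<Longrightarrow> ((deriv ^^ n) f has_real_derivative (deriv ^^ Suc n) f x) (at x)"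
  by (simp add: smooth_on_def DERIV_deriv_iff_field_differentiable)

lemma smooth_on_deriv: "smooth_on UNIV f \<Longrightarrow> smooth_on UNIV (deriv f)"
  unfolding smooth_on_def by (metis funpow_Suc_right o_apply)

lemma smooth_on_lincomb:
  assumes f: "smooth_on UNIV f" and g: "smooth_on UNIV g"
  shows "smooth_on UNIV (\<lambda>x. f x - c * g x)"
proof -
  have eq: "(deriv ^^ n) (\<lambda>x. f x - c * g x) = (\<lambda>x. (deriv ^^ n) f x - c * (deriv ^^ n) g x)" for n
  proof (induction n)
    case (Suc n)
    have "deriv ((deriv ^^ n) (\<lambda>x. f x - c * g x)) x =
        (deriv ^^ Suc n) f x - c * (deriv ^^ Suc n) g x" for x
      unfolding Suc
      by (rule DERIV_imp_deriv)
         (auto intro!: derivative_eq_intros smooth_onD_deriv[OF f, simplified] smooth_onD_deriv[OF g, simplified])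
    then show ?case by (simp add: fun_eq_iff)
  qed simp
  show ?thesis
    unfolding smooth_on_def field_differentiable_def eq
    using smooth_onD_deriv[OF f] smooth_onD_deriv[OF g]
    by (metis DERIV_cmult DERIV_diff)
qed

lemma smooth_on_antideriv:
  assumes "\<And>x. (F has_real_derivative f x) (at x)" and f: "smooth_on UNIV f"
  shows "smooth_on UNIV F"
proof -
  have "deriv F = f" using assms(1) by (auto intro!: DERIV_imp_deriv)
  then have "(deriv ^^ Suc n) F = (deriv ^^ n) f" for n by (simp add: funpow_swap1)
  then have "(deriv ^^ n) F field_differentiable at x" for n x
    using assms(1)[of x] f
    by (cases n) (auto simp: smooth_on_def field_differentiable_def simp del: funpow.simps)
  then show ?thesis by (simp add: smooth_on_def)
qed

lemma smooth_on_continuous: "smooth_on UNIV f \<Longrightarrow> continuous_on S f"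
  by (rule DERIV_continuous_on[where D = "deriv f"], rule has_field_derivative_at_within)
     (use smooth_onD_deriv[of f 0] in simp)

lemma test_functions_interval:
  assumes "\<phi> \<in> test_functions T" "T > 0"
  obtains c d where "0 < c" "c < d" "d < T" "\<And>t. t \<le> c \<Longrightarrow> \<phi> t = 0" "\<And>t. d \<le> t \<Longrightarrow> \<phi> t = 0"
proof -
  from assms obtain K where K: "compact K" "K \<subseteq> {0<..<T}" "\<And>t. t \<notin> K \<Longrightarrow> \<phi> t = 0"
    by (auto simp: test_functions_def)
  \<comment> \<open>The point T/2 makes the set nonempty, so that its minimum and maximum exist even
    when K is empty.\<close>
  define K' where "K' = insert (T / 2) K"
  have K': "compact K'" "K' \<noteq> {}" "K' \<subseteq> {0<..<T}"
    using K assms by (auto simp: K'_def)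
  obtain l where l: "l \<in> K'" "\<forall>t\<in>K'. l \<le> t" using compact_attains_inf K' by metis
  obtain m where m: "m \<in> K'" "\<forall>t\<in>K'. t \<le> m" using compact_attains_sup K' by metis
  show ?thesis
  \<comment> \<open>Midpoints between the extreme points of \<open>K'\<close> and the ends of the
    interval, so that \<phi> already vanishes at the chosen bounds.\<close>
  proof (rule that[of "l / 2" "(m + T) / 2"])
    show "0 < l / 2" "(m + T) / 2 < T" using l m K' by auto
    show "l / 2 < (m + T) / 2" using l m K' by force
    fix t
    show "\<phi> t = 0" if "t \<le> l / 2"
    proof (rule K(3))
      show "t \<notin> K" using l that K' unfolding K'_def by force
    qed
    show "\<phi> t = 0" if "(m + T) / 2 \<le> t"
    proof (rule K(3))
      show "t \<notin> K" using m that K' unfolding K'_def by force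
    qed
  qed
qed

lemma test_functionsI:
  assumes "smooth_on UNIV \<phi>" "0 < c" "d < T" "\<And>t. t \<le> c \<Longrightarrow> \<phi> t = 0" "\<And>t. d \<le> t \<Longrightarrow> \<phi> t = 0"
  shows "\<phi> \<in> test_functions T"
  unfolding test_functions_def using assms
  by (auto intro!: exI[where x = "{c..d}"])

lemma test_functions_lincomb:
  assumes "\<phi> \<in> test_functions T" "\<psi> \<in> test_functions T" "T > 0"
  shows "(\<lambda>t. \<phi> t - c * \<psi> t) \<in> test_functions T"
proof -
  obtain a b where 1: "0 < a" "a < b" "b < T" "\<And>t. t \<le> a \<Longrightarrow> \<phi> t = 0" "\<And>t. b \<le> t \<Longrightarrow> \<phi> t = 0"
    using test_functions_interval[OF assms(1,3)] by blast
  obtain a' b' where 2: "0 < a'" "a' < b'" "b' < T" "\<And>t. t \<le> a' \<Longrightarrow> \<psi> t = 0" "\<And>t. b' \<le> t \<Longrightarrow> \<psi> t = 0"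
    using test_functions_interval[OF assms(2,3)] by blast
  show ?thesis
    by (rule test_functionsI[of _ "min a a'" "max b b'"])
       (use 1 2 assms in \<open>auto intro!: smooth_on_lincomb simp: test_functions_def\<close>)
qed

lemma deriv_zero_nbhd:
  fixes f :: "real \<Rightarrow> real"
  assumes "open S" "x \<in> S" "\<And>y. y \<in> S \<Longrightarrow> f y = 0"
  shows "deriv f x = 0"
proof (rule DERIV_imp_deriv)
  have "((\<lambda>_. 0) has_real_derivative 0) (at x)" by simp
  then show "(f has_real_derivative 0) (at x)"
    by (rule has_field_derivative_transform_within_open) (use assms in auto)
qed

lemma test_functions_deriv:
  assumes "\<phi> \<in> test_functions T" "T > 0"
  shows "deriv \<phi> \<in> test_functions T"
proof -
  obtain a b where 1: "0 < a" "a < b" "b < T" "\<And>t. t \<le> a \<Longrightarrow> \<phi> t = 0" "\<And>t. b \<le> t \<Longrightarrow> \<phi> t = 0"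
    using test_functions_interval[OF assms] by blast
  show ?thesis
  proof (rule test_functionsI[of _ "a/2" "(b+T)/2"])
    show "smooth_on UNIV (deriv \<phi>)" using assms by (auto intro: smooth_on_deriv simp: test_functions_def)
    show "deriv \<phi> t = 0" if "t \<le> a/2" for t
      by (rule deriv_zero_nbhd[of "{..<a}"]) (use that 1 in auto)
    show "deriv \<phi> t = 0" if "(b+T)/2 \<le> t" for t
      by (rule deriv_zero_nbhd[of "{b<..}"]) (use that 1 in auto)
  qed (use 1 in auto)
qed

text \<open>Vanishing of the integral is what gives the primitive compact support: it is normalised
  to vanish at 0, hence left of the support, and the total integral makes it vanish right of the
  support as well.\<close>

lemma test_functions_antideriv:
  assumes \<phi>: "\<phi> \<in> test_functions T" and T: "T > 0" and int: "integral {0..T} \<phi> = 0"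
  obtains \<Phi> where "\<Phi> \<in> test_functions T" "deriv \<Phi> = \<phi>"
proof -
  obtain a b where 1: "0 < a" "a < b" "b < T" "\<And>t. t \<le> a \<Longrightarrow> \<phi> t = 0" "\<And>t. b \<le> t \<Longrightarrow> \<phi> t = 0"
    using test_functions_interval[OF \<phi> T] by blast
  have sm: "smooth_on UNIV \<phi>" using \<phi> by (simp add: test_functions_def)
  have "isCont \<phi> x" for x
    using smooth_on_continuous[OF sm, of UNIV] by (simp add: continuous_on_eq_continuous_at)
  then obtain F where F: "\<And>x. (F has_real_derivative \<phi> x) (at x)"
    using einterval_antiderivative[of "-\<infinity>" \<infinity> \<phi>]
    by (auto simp: has_real_derivative_iff_has_vector_derivative)
  define G where "G t = F t - F 0" for t
  have G: "(G has_real_derivative \<phi> x) (at x)" for x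
    unfolding G_def by (auto intro!: derivative_eq_intros F)
  have G_int: "(\<phi> has_integral (G y - G x)) {x..y}" if "x \<le> y" for x y
    by (rule fundamental_theorem_of_calculus[OF that])
       (use G in \<open>auto simp: has_real_derivative_iff_has_vector_derivative[symmetric] intro: has_field_derivative_at_within\<close>)
  have [simp]: "G 0 = 0" by (simp add: G_def)
  have "G T = 0" using G_int[of 0 T] int T by (auto simp: integral_unique)
  have left: "G t = 0" if "t \<le> a" for t
  proof -
    \<comment> \<open>The use of min and max covers t on either side of 0.\<close>
    have "(\<phi> has_integral 0) {min 0 t..max 0 t}"
      by (rule has_integral_is_0) (use 1 that in auto)
    from has_integral_unique[OF this G_int[of "min 0 t" "max 0 t"]] show ?thesis
      by (cases "0 \<le> t") (auto simp: min_def max_def)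
  qed
  have right: "G t = 0" if "b \<le> t" for t
  proof -
    have "(\<phi> has_integral 0) {min T t..max T t}"
      by (rule has_integral_is_0) (use 1 that in auto)
    from has_integral_unique[OF this G_int[of "min T t" "max T t"]] \<open>G T = 0\<close> show ?thesis
      by (cases "T \<le> t") (auto simp: min_def max_def)
  qed
  show ?thesis
  proof (rule that)
    show "G \<in> test_functions T"
      by (rule test_functionsI[OF smooth_on_antideriv[OF G sm], of a b]) (use 1 left right in auto)
    show "deriv G = \<phi>" using G by (auto intro!: DERIV_imp_deriv)
  qed
qed

text \<open>With a bump h that has values in [0,1) and is positive exactly on (a,b), the functions 1
  - (1 - h)^n are bounded by 1 and increase to the indicator; as polynomials in h they stay in
  \<open>flat_algebra\<close>.\<close>

lemma test_functions_indicator_limit: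
  assumes "0 < a" "a < b" "b < T"
  obtains \<phi> where "\<And>n. \<phi> n \<in> test_functions T" "\<And>n t. \<bar>\<phi> n t\<bar> \<le> 1"
    "\<And>t. (\<lambda>n. \<phi> n t) \<longlonglongrightarrow> indicat_real {a<..<b} t"
proof -
  define h where "h = (\<lambda>t. flat 0 (1 * t + (- a)) * flat 0 ((-1) * t + b))"
  have h: "h \<in> flat_algebra" unfolding h_def by (intro flat_algebra.intros)
  have h0: "h t = 0" if "t \<notin> {a<..<b}" for t using that by (auto simp: h_def flat_def)
  have fl1: "flat 0 x < 1" "0 \<le> flat 0 x" for x by (auto simp: flat_def)
  have h1: "0 \<le> h t" "h t < 1" for t
  proof -
    show "0 \<le> h t" unfolding h_def by (intro mult_nonneg_nonneg fl1)
    have "h t \<le> flat 0 (1 * t + (- a)) * 1"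
      unfolding h_def by (intro mult_left_mono fl1 less_imp_le[OF fl1(1)])
    then show "h t < 1" using fl1(1)[of "1 * t + (- a)"] by linarith
  qed
  have hpos: "0 < h t" if "t \<in> {a<..<b}" for t using that by (auto simp: h_def flat_def)
  define \<phi> where "\<phi> n t = 1 - (1 - h t) ^ n" for n t
  show ?thesis
  proof (rule that)
    fix n
    have "\<phi> n \<in> flat_algebra"
      unfolding \<phi>_def by (intro flat_algebra_diff flat_algebra_power flat_algebra.const h)
    then show "\<phi> n \<in> test_functions T"
      by (intro test_functionsI[of _ a b] flat_algebra_smooth) (use assms h0 in \<open>auto simp: \<phi>_def\<close>)
    fix t
    have "0 \<le> (1 - h t) ^ n" "(1 - h t) ^ n \<le> 1"
      using h1[of t] by (auto intro: power_le_one)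
    then show "\<bar>\<phi> n t\<bar> \<le> 1" by (auto simp: \<phi>_def)
  next
    fix t
    show "(\<lambda>n. \<phi> n t) \<longlonglongrightarrow> indicat_real {a<..<b} t"
    proof (cases "t \<in> {a<..<b}")
      case True
      have "(\<lambda>n. (1 - h t) ^ n) \<longlonglongrightarrow> 0"
        by (rule LIMSEQ_realpow_zero) (use h1[of t] hpos[OF True] in auto)
      from tendsto_diff[OF tendsto_const[of 1] this] True show ?thesis by (simp add: \<phi>_def)
    next
      case False then show ?thesis by (simp add: \<phi>_def h0)
    qed
  qed
qed

section \<open>Integrals over compact intervals\<close>

abbreviation lint :: "real \<Rightarrow> real \<Rightarrow> (real \<Rightarrow> real) \<Rightarrow> real" where
  "lint a b f \<equiv> integral\<^sup>L (lebesgue_on {a..b}) f"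

lemma finite_measure_interval: "finite_measure (lebesgue_on {a..b::real})"
  by (rule finite_measure_lebesgue_on) simp

lemma measure_interval: "a \<le> b \<Longrightarrow> measure (lebesgue_on {a..b::real}) {a..b} = b - a"
  by (simp add: measure_restrict_space)

lemma continuous_measurable: "continuous_on {a..b} f \<Longrightarrow> f \<in> borel_measurable (lebesgue_on {a..b::real})"
  by (rule continuous_imp_measurable_on_sets_lebesgue) auto

lemma continuous_bounded:
  fixes f :: "real \<Rightarrow> real"
  assumes "continuous_on {a..b} f"
  obtains B where "B > 0" "\<And>t. t \<in> {a..b} \<Longrightarrow> \<bar>f t\<bar> \<le> B"
proof -
  have "bounded (f ` {a..b})" by (rule compact_imp_bounded, rule compact_continuous_image[OF assms]) auto
  then obtain B where "B > 0" "\<forall>y\<in>f ` {a..b}. norm y \<le> B" by (auto simp: bounded_pos)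
  then show ?thesis by (intro that[of B]) auto
qed

lemma integrable_bdd:
  fixes f :: "real \<Rightarrow> real"
  assumes "f \<in> borel_measurable (lebesgue_on {a..b})" "\<And>t. t \<in> {a..b} \<Longrightarrow> \<bar>f t\<bar> \<le> (B::real)"
  shows "integrable (lebesgue_on {a..b}) f"
proof -
  interpret finite_measure "lebesgue_on {a..b}" by (rule finite_measure_interval)
  show ?thesis
    by (rule integrable_const_bound[where B = B]) (use assms in \<open>auto intro: AE_I2\<close>)
qed

lemma integrable_cont: 
  fixes f :: "real \<Rightarrow> real"
  assumes "continuous_on {a..b} f" shows "integrable (lebesgue_on {a..b}) f"
proof -
  obtain B where "\<And>t. t \<in> {a..b} \<Longrightarrow> \<bar>f t\<bar> \<le> B" using continuous_bounded[OF assms] by blast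
  then show ?thesis by (rule integrable_bdd[OF continuous_measurable[OF assms]])
qed

lemma integrable_mult_bdd:
  fixes f g :: "real \<Rightarrow> real"
  assumes f: "integrable (lebesgue_on {a..b}) f" and g: "g \<in> borel_measurable (lebesgue_on {a..b})"
    and B: "\<And>t. t \<in> {a..b} \<Longrightarrow> \<bar>g t\<bar> \<le> (B::real)"
  shows "integrable (lebesgue_on {a..b}) (\<lambda>t. f t * g t)"
proof (rule Bochner_Integration.integrable_bound)
  show "integrable (lebesgue_on {a..b}) (\<lambda>t. B * f t)" using f by simp
  show "(\<lambda>t. f t * g t) \<in> borel_measurable (lebesgue_on {a..b})" using f g by measurable
  show "AE t in lebesgue_on {a..b}. norm (f t * g t) \<le> norm (B * f t)"
  proof (rule AE_I2)
    fix t assume "t \<in> space (lebesgue_on {a..b})"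
    then have "\<bar>g t\<bar> \<le> \<bar>B\<bar>" using B[of t] by auto
    then show "norm (f t * g t) \<le> norm (B * f t)" by (simp add: abs_mult mult.commute[of "\<bar>B\<bar>"] mult_left_mono)
  qed
qed

lemma integrable_mult_cont:
  assumes f: "integrable (lebesgue_on {a..b}) f" and g: "continuous_on {a..b} (g :: real \<Rightarrow> real)"
  shows "integrable (lebesgue_on {a..b}) (\<lambda>t. f t * g t)"
proof -
  obtain B where "\<And>t. t \<in> {a..b} \<Longrightarrow> \<bar>g t\<bar> \<le> B" using continuous_bounded[OF g] by blast
  then show ?thesis by (rule integrable_mult_bdd[OF f continuous_measurable[OF g]])
qed

lemma lint_abs_le:
  fixes a b :: real
  assumes "a \<le> b" "f \<in> borel_measurable (lebesgue_on {a..b})" "\<And>t. t \<in> {a..b} \<Longrightarrow> \<bar>f t\<bar> \<le> B"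
  shows "\<bar>lint a b f\<bar> \<le> (b - a) * B"
proof -
  interpret finite_measure "lebesgue_on {a..b}" by (rule finite_measure_interval)
  have i: "integrable (lebesgue_on {a..b}) f" by (rule integrable_bdd[OF assms(2,3)])
  have "\<bar>lint a b f\<bar> \<le> lint a b (\<lambda>t. \<bar>f t\<bar>)" by (rule integral_abs_bound)
  also have "\<dots> \<le> lint a b (\<lambda>t. B)"
    by (rule integral_mono) (use i assms in auto)
  also have "\<dots> = (b - a) * B" using measure_interval[OF assms(1)] by simp
  finally show ?thesis .
qed

lemma lint_cong: "(\<And>t. t \<in> {a..b} \<Longrightarrow> f t = g t) \<Longrightarrow> lint a b f = lint a b g"
  by (rule Bochner_Integration.integral_cong) auto

lemma AE_subinterval:
  assumes "AE t in lebesgue_on {a..b::real}. P t" "{c..d} \<subseteq> {a..b}"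
  shows "AE t in lebesgue_on {c..d}. P t"
  using assms by (auto simp: AE_restrict_space_iff elim!: eventually_mono)

lemma lint_cong_AE:
  fixes a b c d :: real
  assumes "AE t in lebesgue_on {a..b}. f t = g t" "{c..d} \<subseteq> {a..b}"
    "f \<in> borel_measurable (lebesgue_on {a..b})" "g \<in> borel_measurable (lebesgue_on {a..b})"
  shows "lint c d f = lint c d g"
proof (rule integral_cong_AE)
  have "h \<in> borel_measurable (lebesgue_on {c..d})" if "h \<in> borel_measurable (lebesgue_on {a..b})"
    for h :: "real \<Rightarrow> real"
    using that assms(2) by (rule measurable_restrict_mono)
  then show "f \<in> borel_measurable (lebesgue_on {c..d})" "g \<in> borel_measurable (lebesgue_on {c..d})"
    using assms(3,4) by blast+
qed (rule AE_subinterval[OF assms(1,2)])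

lemma lint_0 [simp]: "lint a a f = 0"
proof -
  have "{a} \<in> null_sets lebesgue" by simp
  from has_bochner_integral_null[OF this, of f] show ?thesis
    by (simp add: has_bochner_integral_iff)
qed

lemma integrable_sub:
  "integrable (lebesgue_on {a..b}) (f :: real \<Rightarrow> real) \<Longrightarrow> a \<le> c \<Longrightarrow> d \<le> b \<Longrightarrow> integrable (lebesgue_on {c..d}) f"
  by (rule integrable_subinterval) auto

lemma lint_combine:
  "integrable (lebesgue_on {a..b}) f \<Longrightarrow> a \<le> c \<Longrightarrow> c \<le> b \<Longrightarrow> lint a b f = lint a c f + lint c b f"
  by (rule integral_combine)

lemma lint_eq_HK: "integrable (lebesgue_on {a..b}) f \<Longrightarrow> lint a b f = integral {a..b} f"
  by (rule lebesgue_integral_eq_integral) auto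

lemma lint_continuous:
  assumes "integrable (lebesgue_on {0..T}) f"
  shows "continuous_on {0..T} (\<lambda>t. lint 0 t f)"
proof -
  have "f integrable_on {0..T}" using assms by (rule integrable_on_lebesgue_on) auto
  then have "continuous_on {0..T} (\<lambda>t. integral {0..t} f)" by (rule indefinite_integral_continuous_1)
  then show ?thesis
    by (rule continuous_on_eq) (auto intro!: lint_eq_HK[symmetric] integrable_sub[OF assms])
qed

lemma lint_fundamental:
  fixes a b :: real
  assumes "a \<le> b" "\<And>t. t \<in> {a..b} \<Longrightarrow> (g has_real_derivative g' t) (at t within {a..b})" "continuous_on {a..b} g'"
  shows "lint a b g' = g b - g a"
proof -
  have "(g' has_integral (g b - g a)) {a..b}"
    by (rule fundamental_theorem_of_calculus)
       (use assms in \<open>auto simp: has_real_derivative_iff_has_vector_derivative[symmetric]\<close>)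
  then show ?thesis using lint_eq_HK[OF integrable_cont[OF assms(3)]] by (simp add: integral_unique)
qed

lemma continuous_AE_zero:
  fixes a b :: real
  assumes f: "continuous_on {a..b} f" and "a < b" and ae: "AE t in lebesgue_on {a..b}. f t = (0::real)"
    and t: "t \<in> {a..b}"
  shows "f t = 0"
proof -
  have "lint a b (\<lambda>t. \<bar>f t\<bar>) = lint a b (\<lambda>t. 0)"
    by (rule lint_cong_AE[where a = a and b = b]) (use ae continuous_measurable[OF f] in \<open>auto elim: eventually_mono\<close>)
  moreover have c: "continuous_on {a..b} (\<lambda>t. \<bar>f t\<bar>)" using f by (intro continuous_intros)
  ultimately have "integral {a..b} (\<lambda>t. \<bar>f t\<bar>) = 0" using lint_eq_HK[OF integrable_cont[OF c]] by simp
  then show ?thesis using integral_eq_0_iff[OF c] \<open>a < b\<close> t by auto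
qed

text \<open>The density argument: positive and negative parts of \<open>g\<close> induce the same measure.\<close>

lemma lborel_zero_of_intervals:
  fixes g :: "real \<Rightarrow> real"
  assumes g: "integrable lborel g" and z: "\<And>x. (LINT t|lborel. g t * indicat_real {x<..} t) = 0"
  shows "AE t in lborel. g t = 0"
proof -
  have [measurable]: "g \<in> borel_measurable borel" using g by simp
  \<comment> \<open>Since \<open>ennreal\<close> cuts off negative values, s = 1 and s = -1 select
    the positive and the negative part of g.\<close>
  let ?M = "\<lambda>s::real. density lborel (\<lambda>t. ennreal (s * g t))"
  have int: "integrable lborel (\<lambda>t. g t * indicat_real {x<..} t)" for x
    by (rule Bochner_Integration.integrable_bound[OF g]) (auto split: split_indicator)
  have em: "emeasure (?M s) {x<..} = (\<integral>\<^sup>+t. ennreal (s * (g t * indicat_real {x<..} t)) \<partial>lborel)" for s x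
    by (subst emeasure_density) (auto intro!: nn_integral_cong split: split_indicator)
  have fin: "emeasure (?M s) {x<..} < \<infinity>" for s x
  proof -
    have "integrable lborel (\<lambda>t. s * (g t * indicat_real {x<..} t))" using int by simp
    then have "(\<integral>\<^sup>+t. ennreal (norm (s * (g t * indicat_real {x<..} t))) \<partial>lborel) < \<infinity>"
      by (simp only: integrable_iff_bounded)
    moreover have "(\<integral>\<^sup>+t. ennreal (s * (g t * indicat_real {x<..} t)) \<partial>lborel) \<le>
        (\<integral>\<^sup>+t. ennreal (norm (s * (g t * indicat_real {x<..} t))) \<partial>lborel)"
      by (intro nn_integral_mono ennreal_leI) auto
    ultimately show ?thesis unfolding em by (rule le_less_trans[rotated])
  qed
  have "?M 1 = ?M (-1)"
  proof (rule measure_eqI_lessThan)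
    fix x
    show "emeasure (?M 1) {x<..} < \<infinity>" by (rule fin)
    have "(LINT t|lborel. g t * indicat_real {x<..} t) =
      enn2real (emeasure (?M 1) {x<..}) - enn2real (emeasure (?M (-1)) {x<..})"
      unfolding em by (subst real_lebesgue_integral_def[OF int]) simp
    with z[of x] have "enn2real (emeasure (?M 1) {x<..}) = enn2real (emeasure (?M (-1)) {x<..})" by simp
    then show "emeasure (?M 1) {x<..} = emeasure (?M (-1)) {x<..}"
      using fin[of 1 x] fin[of "-1" x]
      by (metis ennreal_enn2real infinity_ennreal_def)
  qed auto
  then have "AE t in lborel. ennreal (1 * g t) = ennreal ((-1) * g t)"
    by (intro sigma_finite_measure.density_unique[OF sigma_finite_lborel]) auto
  then show ?thesis
  proof (rule eventually_mono)
    fix t assume "ennreal (1 * g t) = ennreal ((-1) * g t)"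
    then show "g t = 0" by (cases "0 \<le> g t") (auto simp: ennreal_neg)
  qed
qed

lemma lint_singleton [simp]: "integral\<^sup>L (lebesgue_on {a::real}) (f :: real \<Rightarrow> real) = 0"
  using lint_0[of a f] by simp

lemma lint_lebesgue: "lint a b g = (LINT t|lebesgue. indicat_real {a..b} t * g t)"
  by (subst integral_restrict_space) auto

lemma lint_indicator:
  assumes "a \<le> c" "d \<le> b"
  shows "lint a b (\<lambda>t. g t * indicat_real {c<..<d} t) = lint c d g"
  unfolding lint_lebesgue
  by (rule integral_discrete_difference[where X = "{c, d}"])
     (use assms in \<open>auto split: split_indicator\<close>)

text \<open>The fundamental lemma of the calculus of variations for an integrable function.
  Dominated convergence passes from test functions to indicators, so the integrals over all
  intervals vanish, and \<open>lborel_zero_of_intervals\<close> concludes.\<close>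

lemma AE_zero_of_test_functions:
  assumes T: "T > 0" and g: "integrable (lebesgue_on {0..T}) g"
    and z: "\<And>\<phi>. \<phi> \<in> test_functions T \<Longrightarrow> lint 0 T (\<lambda>t. g t * \<phi> t) = 0"
  shows "AE t in lebesgue_on {0..T}. g t = 0"
proof -
  have gm [measurable]: "g \<in> borel_measurable (lebesgue_on {0..T})" using g by auto
  have int0: "lint a b g = 0" if ab: "0 < a" "a < b" "b < T" for a b
  proof -
    obtain \<phi> where \<phi>: "\<And>n. \<phi> n \<in> test_functions T" "\<And>n t. \<bar>\<phi> n t\<bar> \<le> 1"
      "\<And>t. (\<lambda>n. \<phi> n t) \<longlonglongrightarrow> indicat_real {a<..<b} t"
      using test_functions_indicator_limit[OF ab] by metis
    have m [measurable]: "\<phi> n \<in> borel_measurable (lebesgue_on {0..T})" for n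
      using \<phi>(1)[of n] by (intro continuous_measurable smooth_on_continuous) (simp add: test_functions_def)
    have [measurable]: "indicat_real {a<..<b} \<in> borel_measurable (lebesgue_on {0..T})"
      by (rule borel_measurable_LIMSEQ_real[OF \<phi>(3) m])
    have "(\<lambda>n. lint 0 T (\<lambda>t. g t * \<phi> n t)) \<longlonglongrightarrow> lint 0 T (\<lambda>t. g t * indicat_real {a<..<b} t)"
    proof (rule integral_dominated_convergence[where w = "\<lambda>t. \<bar>g t\<bar>"])
      show "AE t in lebesgue_on {0..T}. (\<lambda>n. g t * \<phi> n t) \<longlonglongrightarrow> g t * indicat_real {a<..<b} t"
        by (intro AE_I2 tendsto_mult tendsto_const \<phi>)
      show "AE t in lebesgue_on {0..T}. norm (g t * \<phi> n t) \<le> \<bar>g t\<bar>" for n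
        by (intro AE_I2) (use \<phi>(2) in \<open>simp add: abs_mult mult_left_le\<close>)
    qed (use g in \<open>auto intro: borel_measurable_times\<close>)
    then have "lint 0 T (\<lambda>t. g t * indicat_real {a<..<b} t) = 0"
      using z[OF \<phi>(1)] by (simp add: LIMSEQ_const_iff)
    then show ?thesis using lint_indicator[of 0 a b T g] ab by simp
  qed
  let ?F = "\<lambda>t. lint 0 t g"
  have cF: "continuous_on {0..T} ?F" by (rule lint_continuous[OF g])
  \<comment> \<open>Integrals are known to vanish only over intervals compactly inside (0,T), so the
    primitive is constant on the open interval; continuity extends this to the endpoints.\<close>
  have const: "?F t = ?F (T / 2)" if "t \<in> {0..T}" for t
  proof -
    have "?F s = ?F (T / 2)" if s: "s \<in> {0<..<T}" for s
    proof (cases s "T/2" rule: linorder_cases)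
      case less
      then show ?thesis
        using lint_combine[OF integrable_sub[OF g, of 0 "T/2"], of s] int0[of s "T/2"] s by simp
    next
      case greater
      then show ?thesis
        using lint_combine[OF integrable_sub[OF g, of 0 s], of "T/2"] int0[of "T/2" s] s T by simp
    next
      case equal then show ?thesis by (simp only:)
    qed
    note * = this
    have cl: "closure {0<..<T} = {0..T}" using T by simp
    show ?thesis
      by (rule continuous_constant_on_closure[of "{0<..<T}" ?F])
         (simp_all only: cl cF that, rule *)
  qed
  have Fz: "lint s T g = 0" if "s \<in> {0..T}" for s
    using lint_combine[OF g, of s] const[OF that] const[of T] that T by auto
  \<comment> \<open>Extension by zero to the real line, followed by a change to a Borel
    representative, because the density argument lives on \<open>lborel\<close>.\<close>
  define h where "h t = indicat_real {0..T} t * g t" for t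
  have h: "integrable lebesgue h" using g unfolding h_def by (simp add: integrable_restrict_space)
  then have "h \<in> borel_measurable lebesgue" by auto
  from completion_ex_borel_measurable_real[OF this] obtain h' where
    h': "h' \<in> borel_measurable lborel" "AE t in lborel. h t = h' t" by blast
  note [measurable] = h'(1)
  have ae: "AE t in lebesgue. h' t = h t" using h'(2) by (auto intro: AE_completion elim: eventually_mono)
  have h'i: "integrable lborel h'"
  proof -
    have "integrable lebesgue h'"
      by (rule integrable_cong_AE_imp[OF h]) (use ae h'(1) in \<open>auto intro: measurable_completion elim: eventually_mono\<close>)
    then show ?thesis using integrable_completion[OF h'(1)] by simp
  qed
  have "AE t in lborel. h' t = 0"
  proof (rule lborel_zero_of_intervals[OF h'i])
    fix x
    have mm: "(\<lambda>t. h' t * indicat_real {x<..} t) \<in> borel_measurable lborel" by measurable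
    have "(LINT t|lborel. h' t * indicat_real {x<..} t) = (LINT t|lebesgue. h' t * indicat_real {x<..} t)"
      by (rule integral_completion[OF mm, symmetric])
    also have "\<dots> = (LINT t|lebesgue. indicat_real {0..T} t * (g t * indicat_real {max 0 x<..<T} t))"
    proof (rule integral_cong_AE)
      show "(\<lambda>t. h' t * indicat_real {x<..} t) \<in> borel_measurable lebesgue"
        by (rule measurable_completion[OF mm])
      have "(\<lambda>t. h t * indicat_real {max 0 x<..<T} t) \<in> borel_measurable lebesgue"
        using h by (intro borel_measurable_times) (auto intro: measurable_completion)
      then show "(\<lambda>t. indicat_real {0..T} t * (g t * indicat_real {max 0 x<..<T} t)) \<in> borel_measurable lebesgue"
        by (simp add: h_def mult.assoc)
      have "AE t in lborel. t \<noteq> 0" "AE t in lborel. t \<noteq> T" by (auto intro: AE_lborel_singleton)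
      then have "AE t in lebesgue. t \<noteq> 0" "AE t in lebesgue. t \<noteq> T" by (auto intro: AE_completion)
      with ae show "AE t in lebesgue. h' t * indicat_real {x<..} t =
          indicat_real {0..T} t * (g t * indicat_real {max 0 x<..<T} t)"
        by eventually_elim (auto simp: h_def split: split_indicator)
    qed
    also have "\<dots> = lint 0 T (\<lambda>t. g t * indicat_real {max 0 x<..<T} t)" by (rule lint_lebesgue[symmetric])
    also have "\<dots> = lint (max 0 x) T g" by (rule lint_indicator) auto
    also have "\<dots> = 0" using Fz[of "max 0 x"] by (cases "max 0 x \<le> T") (auto simp: lint_lebesgue)
    finally show "(LINT t|lborel. h' t * indicat_real {x<..} t) = 0" .
  qed
  then have "AE t in lebesgue. h' t = 0" by (rule AE_completion)
  with ae have "AE t in lebesgue. t \<in> {0..T} \<longrightarrow> g t = 0"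
    by eventually_elim (auto simp: h_def split: split_indicator_asm)
  then show ?thesis by (simp add: AE_restrict_space_iff)
qed

section \<open>Absolutely continuous functions\<close>

text \<open>Absolute continuity with derivative \<open>v\<close>, encoded as the fundamental theorem
  of calculus; \<open>v\<close> matters only up to null sets.\<close>

definition acd :: "real \<Rightarrow> (real \<Rightarrow> real) \<Rightarrow> (real \<Rightarrow> real) \<Rightarrow> bool" where
  "acd T u v \<longleftrightarrow> integrable (lebesgue_on {0..T}) v \<and> (\<forall>t\<in>{0..T}. u t = u 0 + lint 0 t v)"

lemma acd_integrable: "acd T u v \<Longrightarrow> integrable (lebesgue_on {0..T}) v"
  by (simp add: acd_def)

lemma acdD: "acd T u v \<Longrightarrow> 0 \<le> t \<Longrightarrow> t \<le> T \<Longrightarrow> u t = u 0 + lint 0 t v"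
  unfolding acd_def by (meson atLeastAtMost_iff)

lemma acdI:
  "integrable (lebesgue_on {0..T}) v \<Longrightarrow> (\<And>t. 0 \<le> t \<Longrightarrow> t \<le> T \<Longrightarrow> u t = u 0 + lint 0 t v) \<Longrightarrow> acd T u v"
  unfolding acd_def by (meson atLeastAtMost_iff)

lemma acd_lint: "integrable (lebesgue_on {0..T}) v \<Longrightarrow> acd T (\<lambda>t. c + lint 0 t v) v"
  by (simp add: acd_def)

lemma acd_increment:
  assumes "acd T u v" "0 \<le> s" "s \<le> t" "t \<le> T"
  shows "u t - u s = lint s t v"
proof -
  have "u t = u 0 + lint 0 t v" "u s = u 0 + lint 0 s v"
    using assms by (auto intro: acdD)
  moreover have "lint 0 t v = lint 0 s v + lint s t v"
    by (rule lint_combine[OF integrable_sub[OF acd_integrable[OF assms(1)]]]) (use assms in auto)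
  ultimately show ?thesis by simp
qed

lemma acd_continuous: "acd T u v \<Longrightarrow> continuous_on {0..T} u"
  by (rule continuous_on_eq[where f = "\<lambda>t. u 0 + lint 0 t v"])
     (auto intro!: continuous_intros lint_continuous acd_integrable acdD[symmetric])

lemma acd_add:
  assumes u: "acd T u v" and x: "acd T x y"
  shows "acd T (\<lambda>t. u t + x t) (\<lambda>t. v t + y t)"
proof (rule acdI)
  note i = acd_integrable[OF u] acd_integrable[OF x]
  then show "integrable (lebesgue_on {0..T}) (\<lambda>t. v t + y t)" by simp
  fix t assume t: "0 \<le> t" "t \<le> T"
  have "lint 0 t (\<lambda>t. v t + y t) = lint 0 t v + lint 0 t y"
    by (rule Bochner_Integration.integral_add) (use t in \<open>auto intro: integrable_sub[OF i(1)] integrable_sub[OF i(2)]\<close>)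
  then show "u t + x t = u 0 + x 0 + lint 0 t (\<lambda>t. v t + y t)"
    using acdD[OF u t] acdD[OF x t] by linarith
qed

lemma acd_cmult:
  assumes u: "acd T u v"
  shows "acd T (\<lambda>t. c * u t) (\<lambda>t. c * v t)"
proof (rule acdI)
  show "integrable (lebesgue_on {0..T}) (\<lambda>t. c * v t)" using acd_integrable[OF u] by simp
  fix t assume t: "0 \<le> t" "t \<le> T"
  have "c * u t = c * (u 0 + lint 0 t v)" using acdD[OF u t] by simp
  then show "c * u t = c * u 0 + lint 0 t (\<lambda>t. c * v t)" by (simp add: ring_distribs(1))
qed

lemma acd_diff: "acd T u v \<Longrightarrow> acd T x y \<Longrightarrow> acd T (\<lambda>t. u t - x t) (\<lambda>t. v t - y t)"
  using acd_add[of T u v "\<lambda>t. (-1) * x t" "\<lambda>t. (-1) * y t"] acd_cmult[of T x y "-1"] by simp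

lemma acd_cong_AE:
  assumes "acd T u v" "T > 0" "\<And>t. t \<in> {0..T} \<Longrightarrow> u' t = u t"
    "AE t in lebesgue_on {0..T}. v' t = v t" "v' \<in> borel_measurable (lebesgue_on {0..T})"
  shows "acd T u' v'"
proof (rule acdI)
  have vm: "v \<in> borel_measurable (lebesgue_on {0..T})" using acd_integrable[OF assms(1)] by auto
  have ae: "AE t in lebesgue_on {0..T}. v t = v' t"
    using assms(4) by (rule eventually_mono) (rule sym)
  show "integrable (lebesgue_on {0..T}) v'"
    by (rule integrable_cong_AE_imp[OF acd_integrable[OF assms(1)] assms(5) ae])
  fix t assume t: "0 \<le> t" "t \<le> T"
  have "lint 0 t v' = lint 0 t v" by (rule lint_cong_AE[OF assms(4) _ assms(5) vm]) (use t in auto)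
  then show "u' t = u' 0 + lint 0 t v'"
    using acdD[OF assms(1) t] assms(3)[of t] assms(3)[of 0] t \<open>T > 0\<close> by simp
qed

lemma acd_cong:
  assumes "acd T u v" "\<And>t. t \<in> {0..T} \<Longrightarrow> u' t = u t" "\<And>t. t \<in> {0..T} \<Longrightarrow> v' t = v t"
  shows "acd T u' v'"
proof (rule acdI)
  have "integrable (lebesgue_on {0..T}) v' = integrable (lebesgue_on {0..T}) v"
    by (rule Bochner_Integration.integrable_cong) (use assms(3) in auto)
  then show "integrable (lebesgue_on {0..T}) v'" using acd_integrable[OF assms(1)] by simp
  fix t assume t: "0 \<le> t" "t \<le> T"
  have "lint 0 t v' = lint 0 t v" by (rule lint_cong) (use assms(3) t in auto)
  then show "u' t = u' 0 + lint 0 t v'"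
    using acdD[OF assms(1) t] assms(2)[of t] assms(2)[of 0] t by simp
qed

lemma acd_C1:
  assumes "\<And>t. t \<in> {0..T} \<Longrightarrow> (g has_real_derivative g' t) (at t within {0..T})" "continuous_on {0..T} g'"
  shows "acd T g g'"
proof (rule acdI)
  show "integrable (lebesgue_on {0..T}) g'" by (rule integrable_cont[OF assms(2)])
  fix t assume t: "0 \<le> t" "t \<le> T"
  have "lint 0 t g' = g t - g 0"
  proof (rule lint_fundamental)
    show "continuous_on {0..t} g'" by (rule continuous_on_subset[OF assms(2)]) (use t in auto)
    show "(g has_real_derivative g' s) (at s within {0..t})" if "s \<in> {0..t}" for s
      by (rule has_field_derivative_subset[OF assms(1)]) (use t that in auto)
  qed (use t in auto)
  then show "g t = g 0 + lint 0 t g'" by simp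
qed

lemma acd_has_derivative:
  assumes "acd T u v" "continuous_on {0..T} v" "t \<in> {0..T}"
  shows "(u has_real_derivative v t) (at t within {0..T})"
proof -
  have "((\<lambda>t. integral {0..t} v) has_real_derivative v t) (at t within {0..T})"
    by (rule integral_has_real_derivative[OF assms(2,3)])
  then have "((\<lambda>t. u 0 + integral {0..t} v) has_real_derivative v t) (at t within {0..T})"
    by (auto intro!: derivative_eq_intros)
  then show ?thesis
  proof (rule has_field_derivative_transform_within[OF _ zero_less_one assms(3)])
    fix s assume s: "s \<in> {0..T}"
    have "integrable (lebesgue_on {0..s}) v"
      by (rule integrable_sub[OF acd_integrable[OF assms(1)]]) (use s in auto)
    then show "u 0 + integral {0..s} v = u s" using acdD[OF assms(1), of s] lint_eq_HK[of 0 s v] s by simp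
  qed
qed

text \<open>Both sides of the product rule agree on \<open>[s,t]\<close> up to an error bounded by \<open>t - s\<close> times
  the variation of the absolutely continuous factor, hence their difference has zero derivative.\<close>

lemma acd_mult:
  assumes u: "acd T u v"
    and g: "\<And>t. t \<in> {0..T} \<Longrightarrow> (g has_real_derivative g' t) (at t within {0..T})"
    and g': "continuous_on {0..T} g'"
  shows "acd T (\<lambda>t. u t * g t) (\<lambda>t. v t * g t + u t * g' t)"
proof -
  have ag: "acd T g g'" by (rule acd_C1[OF g g'])
  have cu: "continuous_on {0..T} u" and cg: "continuous_on {0..T} g"
    using u ag by (auto intro: acd_continuous)
  have iv: "integrable (lebesgue_on {0..T}) v" using u by (rule acd_integrable)
  have i1: "integrable (lebesgue_on {0..T}) (\<lambda>t. v t * g t)" by (rule integrable_mult_cont[OF iv cg])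
  have i2: "integrable (lebesgue_on {0..T}) (\<lambda>t. u t * g' t)"
    by (intro integrable_cont continuous_intros cu g')
  let ?w = "\<lambda>t. v t * g t + u t * g' t"
  have iw: "integrable (lebesgue_on {0..T}) ?w" using i1 i2 by simp
  obtain Y where Y: "Y > 0" "\<And>t. t \<in> {0..T} \<Longrightarrow> \<bar>g' t\<bar> \<le> Y" using continuous_bounded[OF g'] by metis
  define V where "V t = lint 0 t (\<lambda>t. \<bar>v t\<bar>)" for t
  have ia: "integrable (lebesgue_on {0..T}) (\<lambda>t. \<bar>v t\<bar>)" using iv by simp
  have aV: "acd T V (\<lambda>t. \<bar>v t\<bar>)" unfolding V_def using acd_lint[OF ia, of 0] by simp
  \<comment> \<open>The error of the product rule integrated up to t; it has to be constant.\<close>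
  define E where "E t = lint 0 t ?w - u t * g t" for t
  have key: "\<bar>E t - E s\<bar> \<le> 2 * Y * (t - s) * (V t - V s)" if st: "0 \<le> s" "s \<le> t" "t \<le> T" for s t
  proof -
    note sub = integrable_sub[where a = 0 and b = T and c = s and d = t, OF _ st(1,3)]
    have su: "continuous_on {s..t} u" "continuous_on {s..t} g" "continuous_on {s..t} g'"
      using st by (auto intro: continuous_on_subset[OF cu] continuous_on_subset[OF cg] continuous_on_subset[OF g'])
    have i: "integrable (lebesgue_on {s..t}) (\<lambda>r. v r * (g r - g t))"
      "integrable (lebesgue_on {s..t}) (\<lambda>r. (u r - u s) * g' r)"
      by (rule integrable_mult_cont[OF sub[OF iv]], intro continuous_intros su)
         (intro integrable_cont continuous_intros su)
    have "lint 0 t ?w - lint 0 s ?w = lint s t ?w"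
      using lint_combine[OF integrable_sub[OF iw, of 0 t], of s] st by simp
    \<comment> \<open>Freezing g at the right end and u at the left end turns the main terms into
      g(t)(u(t) - u(s)) + u(s)(g(t) - g(s)), which is exactly the increment of u g; only
      second-order errors remain.\<close>
    moreover have "lint s t ?w = lint s t (\<lambda>r. v r * (g r - g t)) + g t * lint s t v
        + (lint s t (\<lambda>r. (u r - u s) * g' r) + u s * lint s t g')"
    proof -
      have "lint s t ?w = lint s t (\<lambda>r. (v r * (g r - g t) + g t * v r) + ((u r - u s) * g' r + u s * g' r))"
        by (rule lint_cong) (simp add: algebra_simps)
      also have "\<dots> = lint s t (\<lambda>r. v r * (g r - g t)) + g t * lint s t v
        + (lint s t (\<lambda>r. (u r - u s) * g' r) + u s * lint s t g')"
        using i sub[OF iv] integrable_cont[OF su(3)] by simp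
      finally show ?thesis .
    qed
    moreover have "lint s t v = u t - u s" "lint s t g' = g t - g s" "lint s t (\<lambda>t. \<bar>v t\<bar>) = V t - V s"
      using acd_increment[OF u st] acd_increment[OF ag st] acd_increment[OF aV st] by auto
    ultimately have eq: "E t - E s = lint s t (\<lambda>r. v r * (g r - g t)) + lint s t (\<lambda>r. (u r - u s) * g' r)"
      by (simp add: E_def algebra_simps)
    have Vmono: "V r - V q \<ge> 0" if "0 \<le> q" "q \<le> r" "r \<le> T" for q r
      using acd_increment[OF aV that] by (metis Bochner_Integration.integral_nonneg abs_ge_zero)
    have "\<bar>lint s t (\<lambda>r. v r * (g r - g t))\<bar> \<le> lint s t (\<lambda>r. \<bar>v r * (g r - g t)\<bar>)" by (rule integral_abs_bound)
    also have "\<dots> \<le> lint s t (\<lambda>r. \<bar>v r\<bar> * (Y * (t - s)))"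
    proof (rule integral_mono)
      fix r assume "r \<in> space (lebesgue_on {s..t})"
      then have r: "s \<le> r" "r \<le> t" by auto
      have "\<bar>g t - g r\<bar> = \<bar>lint r t g'\<bar>" using acd_increment[OF ag, of r t] r st by simp
      also have "\<dots> \<le> (t - r) * Y"
        by (rule lint_abs_le) (use r st Y in \<open>auto intro!: continuous_measurable continuous_on_subset[OF g']\<close>)
      also have "\<dots> \<le> (t - s) * Y" using r Y by (intro mult_right_mono) auto
      finally show "\<bar>v r * (g r - g t)\<bar> \<le> \<bar>v r\<bar> * (Y * (t - s))"
        unfolding abs_mult by (intro mult_left_mono) (auto simp: abs_minus_commute mult.commute)
    qed (use i sub[OF ia] in auto)
    also have "\<dots> = Y * (t - s) * (V t - V s)"
      using \<open>lint s t (\<lambda>t. \<bar>v t\<bar>) = V t - V s\<close> by (simp add: mult.commute)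
    finally have b1: "\<bar>lint s t (\<lambda>r. v r * (g r - g t))\<bar> \<le> Y * (t - s) * (V t - V s)" .
    have "\<bar>lint s t (\<lambda>r. (u r - u s) * g' r)\<bar> \<le> (t - s) * ((V t - V s) * Y)"
    proof (rule lint_abs_le)
      show "(\<lambda>r. (u r - u s) * g' r) \<in> borel_measurable (lebesgue_on {s..t})" using i(2) by auto
      fix r assume r: "r \<in> {s..t}"
      have "\<bar>u r - u s\<bar> = \<bar>lint s r v\<bar>" using acd_increment[OF u, of s r] r st by simp
      also have "\<dots> \<le> lint s r (\<lambda>t. \<bar>v t\<bar>)" by (rule integral_abs_bound)
      also have "\<dots> = V r - V s" using acd_increment[OF aV, of s r] r st by simp
      also have "\<dots> \<le> V t - V s" using Vmono[of r t] r st by simp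
      finally show "\<bar>(u r - u s) * g' r\<bar> \<le> (V t - V s) * Y"
        unfolding abs_mult using Y(2)[of r] r st by (intro mult_mono) auto
    qed (use st in auto)
    with b1 show ?thesis unfolding eq by (simp add: algebra_simps)
  qed
  have "(E has_real_derivative 0) (at t within {0..T})" if t: "t \<in> {0..T}" for t
    unfolding has_field_derivative_iff
  proof (rule Lim_null_comparison)
    show "((\<lambda>s. 2 * Y * \<bar>V s - V t\<bar>) \<longlongrightarrow> 0) (at t within {0..T})"
    proof -
      have "(V \<longlongrightarrow> V t) (at t within {0..T})"
        using acd_continuous[OF aV] t by (auto simp: continuous_on)
      from tendsto_mult[OF tendsto_const tendsto_rabs[OF tendsto_diff[OF this tendsto_const[of "V t"]]]]
      show ?thesis by simp
    qed
    show "\<forall>\<^sub>F s in at t within {0..T}. norm ((E s - E t) / (s - t)) \<le> 2 * Y * \<bar>V s - V t\<bar>"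
    proof (rule eventually_at_topological[THEN iffD2], intro exI[of _ UNIV] conjI ballI impI)
      fix s assume s: "s \<noteq> t" "s \<in> {0..T}"
      have "\<bar>E s - E t\<bar> \<le> 2 * Y * \<bar>V s - V t\<bar> * \<bar>s - t\<bar>"
      proof (cases "s \<le> t")
        case True
        then have "\<bar>E t - E s\<bar> \<le> 2 * Y * (t - s) * (V t - V s)" using key[of s t] s t by auto
        also have "\<dots> \<le> 2 * Y * (t - s) * \<bar>V t - V s\<bar>" using True Y by (intro mult_left_mono) auto
        finally show ?thesis using True by (simp add: abs_minus_commute algebra_simps)
      next
        case False
        then have "\<bar>E s - E t\<bar> \<le> 2 * Y * (s - t) * (V s - V t)" using key[of t s] s t by auto
        also have "\<dots> \<le> 2 * Y * (s - t) * \<bar>V s - V t\<bar>" using False Y by (intro mult_left_mono) auto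
        finally show ?thesis using False by (simp add: algebra_simps)
      qed
      then show "norm ((E s - E t) / (s - t)) \<le> 2 * Y * \<bar>V s - V t\<bar>"
        using s by (simp add: abs_divide pos_divide_le_eq)
    qed auto
  qed
  then obtain c where c: "\<forall>t\<in>{0..T}. E t = c"
    using has_field_derivative_zero_constant[of "{0..T}" E] by auto
  show ?thesis
  proof (rule acdI[OF iw])
    fix t assume "0 \<le> t" "t \<le> T"
    then have "E t = E 0" using c by auto
    then show "u t * g t = u 0 * g 0 + lint 0 t ?w" by (simp add: E_def)
  qed
qed

section \<open>The space \<open>H\<^sup>2\<close> of the circle\<close>

lemma L2_measurable: "f \<in> L2 T \<Longrightarrow> f \<in> borel_measurable (lebesgue_on {0..T})"
  by (simp add: L2_def)

lemma L2_square: "f \<in> L2 T \<Longrightarrow> integrable (lebesgue_on {0..T}) (\<lambda>t. (f t)\<^sup>2)"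
  by (simp add: L2_def)

lemma L2_mult:
  assumes f: "f \<in> L2 T" and g: "g \<in> L2 T"
  shows "integrable (lebesgue_on {0..T}) (\<lambda>t. f t * g t)"
proof (rule Bochner_Integration.integrable_bound)
  show "integrable (lebesgue_on {0..T}) (\<lambda>t. (f t)\<^sup>2 + (g t)\<^sup>2)"
    using L2_square[OF f] L2_square[OF g] by simp
  show "(\<lambda>t. f t * g t) \<in> borel_measurable (lebesgue_on {0..T})"
    using L2_measurable[OF f] L2_measurable[OF g] by measurable
  show "AE t in lebesgue_on {0..T}. norm (f t * g t) \<le> norm ((f t)\<^sup>2 + (g t)\<^sup>2)"
  proof (rule AE_I2)
    fix t
    have "\<bar>x * y\<bar> \<le> x\<^sup>2 + y\<^sup>2" for x y :: real
    proof -
      have "2 * (\<bar>x\<bar> * \<bar>y\<bar>) \<le> x\<^sup>2 + y\<^sup>2"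
        using sum_squares_bound[of "\<bar>x\<bar>" "\<bar>y\<bar>"] by simp
      moreover have "0 \<le> \<bar>x\<bar> * \<bar>y\<bar>" by simp
      ultimately show ?thesis unfolding abs_mult by linarith
    qed
    then show "norm (f t * g t) \<le> norm ((f t)\<^sup>2 + (g t)\<^sup>2)" by simp
  qed
qed

lemma L2_bdd:
  assumes "f \<in> borel_measurable (lebesgue_on {0..T})" "\<And>t. t \<in> {0..T} \<Longrightarrow> \<bar>f t\<bar> \<le> B"
  shows "f \<in> L2 T"
proof -
  have "integrable (lebesgue_on {0..T}) (\<lambda>t. (f t)\<^sup>2)"
  proof (rule integrable_bdd)
    show "(\<lambda>t. (f t)\<^sup>2) \<in> borel_measurable (lebesgue_on {0..T})" using assms(1) by measurable
    show "\<bar>(f t)\<^sup>2\<bar> \<le> B\<^sup>2" if "t \<in> {0..T}" for t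
      using power_mono[OF assms(2)[OF that], of 2] by simp
  qed
  then show ?thesis using assms(1) by (simp add: L2_def)
qed

lemma L2_cont: "continuous_on {0..T} f \<Longrightarrow> f \<in> L2 T"
  using continuous_bounded[of 0 T f] L2_bdd[OF continuous_measurable] by metis

lemma L2_integrable: "f \<in> L2 T \<Longrightarrow> integrable (lebesgue_on {0..T}) f"
  using L2_mult[OF _ L2_cont[of T "\<lambda>_. 1"]] by simp

lemma L2_cmult: "f \<in> L2 T \<Longrightarrow> (\<lambda>t. c * f t) \<in> L2 T"
  by (auto simp: L2_def power_mult_distrib)

lemma L2_add:
  assumes f: "f \<in> L2 T" and g: "g \<in> L2 T"
  shows "(\<lambda>t. f t + g t) \<in> L2 T"
  unfolding L2_def using L2_measurable[OF f] L2_measurable[OF g] L2_square[OF f] L2_square[OF g] L2_mult[OF f g]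
  by (simp add: power2_sum mult.assoc)

lemma L2_diff: "f \<in> L2 T \<Longrightarrow> g \<in> L2 T \<Longrightarrow> (\<lambda>t. f t - g t) \<in> L2 T"
  using L2_add[of f T "\<lambda>t. (-1) * g t"] L2_cmult[of g T "-1"] by simp

lemma quadratic_nonneg_discriminant:
  fixes A B C :: real
  assumes "\<And>x. 0 \<le> A * x\<^sup>2 + 2 * B * x + C" "0 \<le> A"
  shows "B\<^sup>2 \<le> A * C"
proof (cases "A = 0")
  case True
  have "B = 0"
  proof (rule ccontr)
    assume "B \<noteq> 0"
    \<comment> \<open>At this point the affine function takes the value -1.\<close>
    then show False using assms(1)[of "- (C + 1) / (2 * B)"] True by simp
  qed
  then show ?thesis using True by simp
next
  case False
  then have A: "A > 0" using assms by simp
  have "A * (- B / A)\<^sup>2 + 2 * B * (- B / A) + C = C - B\<^sup>2 / A"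
    using A by (simp add: field_simps power2_eq_square)
  with assms(1)[of "- B / A"] have "B\<^sup>2 / A \<le> C" by simp
  then show ?thesis using A by (simp add: field_simps)
qed

lemma L2_Cauchy_Schwarz:
  assumes f: "f \<in> L2 T" and g: "g \<in> L2 T"
  shows "(lint 0 T (\<lambda>t. f t * g t))\<^sup>2 \<le> lint 0 T (\<lambda>t. (f t)\<^sup>2) * lint 0 T (\<lambda>t. (g t)\<^sup>2)"
proof (rule quadratic_nonneg_discriminant)
  fix x
  have "0 \<le> lint 0 T (\<lambda>t. (x * f t + g t)\<^sup>2)" by (rule Bochner_Integration.integral_nonneg) simp
  also have "\<dots> = lint 0 T (\<lambda>t. x\<^sup>2 * (f t)\<^sup>2 + 2 * x * (f t * g t) + (g t)\<^sup>2)"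
    by (rule lint_cong) (simp add: power2_eq_square algebra_simps)
  also have "\<dots> = lint 0 T (\<lambda>t. (f t)\<^sup>2) * x\<^sup>2 + 2 * lint 0 T (\<lambda>t. f t * g t) * x + lint 0 T (\<lambda>t. (g t)\<^sup>2)"
    using L2_square[OF f] L2_square[OF g] L2_mult[OF f g] by (simp add: mult.assoc)
  finally show "0 \<le> \<dots>" .
qed (rule Bochner_Integration.integral_nonneg, simp)

lemma test_functions_continuous: "\<phi> \<in> test_functions T \<Longrightarrow> continuous_on S \<phi>"
  by (simp add: test_functions_def smooth_on_continuous)

lemma test_functions_derivD: "\<phi> \<in> test_functions T \<Longrightarrow> (\<phi> has_real_derivative deriv \<phi> t) (at t)"
  using smooth_onD_deriv[of \<phi> 0 t] by (simp add: test_functions_def)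

lemma acd_by_parts_test:
  assumes "acd T u v" "T > 0" and \<phi>: "\<phi> \<in> test_functions T"
  shows "lint 0 T (\<lambda>t. u t * deriv \<phi> t) = - lint 0 T (\<lambda>t. v t * \<phi> t)"
proof -
  note d = test_functions_deriv[OF \<phi> assms(2)]
  have "acd T (\<lambda>t. u t * \<phi> t) (\<lambda>t. v t * \<phi> t + u t * deriv \<phi> t)"
    by (rule acd_mult[OF assms(1)])
       (auto intro: has_field_derivative_at_within test_functions_derivD[OF \<phi>] test_functions_continuous[OF d])
  from acd_increment[OF this, of 0 T] have
    "lint 0 T (\<lambda>t. v t * \<phi> t + u t * deriv \<phi> t) = u T * \<phi> T - u 0 * \<phi> 0" using assms by simp
  moreover have "\<phi> T = 0" "\<phi> 0 = 0" using test_functions_interval[OF \<phi> assms(2)]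
    by (metis assms(2) dual_order.strict_implies_order)+
  moreover have "integrable (lebesgue_on {0..T}) (\<lambda>t. v t * \<phi> t)"
    "integrable (lebesgue_on {0..T}) (\<lambda>t. u t * deriv \<phi> t)"
    by (intro integrable_mult_cont acd_integrable[OF assms(1)] test_functions_continuous[OF \<phi>])
       (intro integrable_cont continuous_intros acd_continuous[OF assms(1)] test_functions_continuous[OF d])
  ultimately show ?thesis by simp
qed

text \<open>After subtraction of the primitive of \<open>w\<close>, the function is orthogonal to
  all derivatives of test functions, that is, to all test functions of integral zero. Every test
  function differs from one of these by a multiple of a fixed \<theta>, so the function is
  constant.\<close>

lemma du_Bois_Reymond:
  assumes T: "T > 0" and v: "v \<in> L2 T" and w: "w \<in> L2 T"
    and eq: "\<And>\<phi>. \<phi> \<in> test_functions T \<Longrightarrow> lint 0 T (\<lambda>t. v t * deriv \<phi> t) = - lint 0 T (\<lambda>t. w t * \<phi> t)"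
  obtains c where "AE t in lebesgue_on {0..T}. v t = c + lint 0 t w"
proof -
  define W where "W t = 0 + lint 0 t w" for t
  have aW: "acd T W w" unfolding W_def by (rule acd_lint[OF L2_integrable[OF w]])
  define g where "g t = v t - W t" for t
  have gi: "integrable (lebesgue_on {0..T}) g"
    unfolding g_def using L2_integrable[OF v] integrable_cont[OF acd_continuous[OF aW]] by simp
  have gint: "integrable (lebesgue_on {0..T}) (\<lambda>t. g t * \<phi> t)" if "\<phi> \<in> test_functions T" for \<phi>
    by (rule integrable_mult_cont[OF gi test_functions_continuous[OF that]])
  have g0: "lint 0 T (\<lambda>t. g t * deriv \<phi> t) = 0" if \<phi>: "\<phi> \<in> test_functions T" for \<phi>
  proof -
    have c: "continuous_on {0..T} (deriv \<phi>)"
      by (rule test_functions_continuous[OF test_functions_deriv[OF \<phi> T]])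
    have "lint 0 T (\<lambda>t. g t * deriv \<phi> t) = lint 0 T (\<lambda>t. v t * deriv \<phi> t - W t * deriv \<phi> t)"
      by (rule lint_cong) (simp add: g_def algebra_simps)
    also have "\<dots> = lint 0 T (\<lambda>t. v t * deriv \<phi> t) - lint 0 T (\<lambda>t. W t * deriv \<phi> t)"
      by (intro Bochner_Integration.integral_diff integrable_mult_cont L2_integrable[OF v] c
          integrable_cont[OF acd_continuous[OF aW]])
    also have "\<dots> = 0" using eq[OF \<phi>] acd_by_parts_test[OF aW T \<phi>] by simp
    finally show ?thesis .
  qed
  have ti: "integrable (lebesgue_on {0..T}) \<phi>" if "\<phi> \<in> test_functions T" for \<phi>
    by (rule integrable_cont[OF test_functions_continuous[OF that]])
  obtain \<theta> where \<theta>: "\<theta> \<in> test_functions T" "lint 0 T \<theta> \<noteq> 0"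
  \<comment> \<open>If every test function had integral zero, the constant 1 would vanish almost
    everywhere.\<close>
  proof (rule ccontr)
    assume "\<not> thesis"
    then have "\<forall>\<theta>\<in>test_functions T. lint 0 T (\<lambda>t. 1 * \<theta> t) = 0" using that by auto
    then have "AE t in lebesgue_on {0..T}. (1::real) = 0"
      by (intro AE_zero_of_test_functions[OF T integrable_cont]) auto
    from continuous_AE_zero[OF _ T this, of 0] show False using T by auto
  qed
  \<comment> \<open>The only possible constant, read off by testing with \<theta>.\<close>
  define c where "c = lint 0 T (\<lambda>t. g t * \<theta> t) / lint 0 T \<theta>"
  have "AE t in lebesgue_on {0..T}. g t - c = 0"
  proof (rule AE_zero_of_test_functions[OF T])
    show "integrable (lebesgue_on {0..T}) (\<lambda>t. g t - c)"
      using gi integrable_cont[of 0 T "\<lambda>_. c"] by simp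
    fix \<psi> assume \<psi>: "\<psi> \<in> test_functions T"
    define k where "k = lint 0 T \<psi> / lint 0 T \<theta>"
    let ?\<psi> = "\<lambda>t. \<psi> t - k * \<theta> t"
    have \<psi>': "?\<psi> \<in> test_functions T" by (rule test_functions_lincomb[OF \<psi> \<theta>(1) T])
    have "lint 0 T ?\<psi> = 0"
      using ti[OF \<psi>] ti[OF \<theta>(1)] \<theta>(2) by (simp add: k_def)
    then have "integral {0..T} ?\<psi> = 0" using lint_eq_HK[OF ti[OF \<psi>']] by simp
    then obtain \<Phi> where "\<Phi> \<in> test_functions T" "deriv \<Phi> = ?\<psi>"
      using test_functions_antideriv[OF \<psi>' T] by blast
    then have "lint 0 T (\<lambda>t. g t * ?\<psi> t) = 0" using g0[of \<Phi>] by simp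
    moreover have "lint 0 T (\<lambda>t. g t * ?\<psi> t) = lint 0 T (\<lambda>t. g t * \<psi> t - k * (g t * \<theta> t))"
      by (rule lint_cong) (simp add: algebra_simps)
    moreover have "\<dots> = lint 0 T (\<lambda>t. g t * \<psi> t) - k * lint 0 T (\<lambda>t. g t * \<theta> t)"
      using gint[OF \<psi>] gint[OF \<theta>(1)] by simp
    moreover have "k * lint 0 T (\<lambda>t. g t * \<theta> t) = c * lint 0 T \<psi>"
      by (simp add: k_def c_def)
    moreover have "lint 0 T (\<lambda>t. (g t - c) * \<psi> t) = lint 0 T (\<lambda>t. g t * \<psi> t) - c * lint 0 T \<psi>"
      using gint[OF \<psi>] ti[OF \<psi>] by (simp add: left_diff_distrib)
    ultimately show "lint 0 T (\<lambda>t. (g t - c) * \<psi> t) = 0" by simp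
  qed
  then have "AE t in lebesgue_on {0..T}. v t = c + lint 0 t w"
    by (rule eventually_mono) (simp add: g_def W_def)
  then show ?thesis by (rule that)
qed

lemma weak_deriv_unique:
  assumes "T > 0" "has_weak_deriv T n u v" "has_weak_deriv T n u w"
  shows "AE t in lebesgue_on {0..T}. v t = w t"
proof -
  have L: "v \<in> L2 T" "w \<in> L2 T" using assms by (auto simp: has_weak_deriv_def)
  have "AE t in lebesgue_on {0..T}. v t - w t = 0"
  proof (rule AE_zero_of_test_functions[OF assms(1)])
    show "integrable (lebesgue_on {0..T}) (\<lambda>t. v t - w t)" by (rule L2_integrable[OF L2_diff[OF L]])
    fix \<phi> assume \<phi>: "\<phi> \<in> test_functions T"
    have eq: "lint 0 T (\<lambda>t. u t * (deriv ^^ n) \<phi> t) = (- 1) ^ n * lint 0 T (\<lambda>t. h t * \<phi> t)"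
      if "has_weak_deriv T n u h" for h
      using that \<phi> unfolding has_weak_deriv_def by blast
    have "(- 1) ^ n * lint 0 T (\<lambda>t. v t * \<phi> t) = (- 1) ^ n * lint 0 T (\<lambda>t. w t * \<phi> t)"
      using eq[OF assms(2)] eq[OF assms(3)] by (simp only:)
    then have "lint 0 T (\<lambda>t. v t * \<phi> t) = lint 0 T (\<lambda>t. w t * \<phi> t)" by simp
    moreover have "integrable (lebesgue_on {0..T}) (\<lambda>t. v t * \<phi> t)" "integrable (lebesgue_on {0..T}) (\<lambda>t. w t * \<phi> t)"
      by (intro L2_mult L L2_cont test_functions_continuous[OF \<phi>])+
    ultimately show "lint 0 T (\<lambda>t. (v t - w t) * \<phi> t) = 0" by (simp add: left_diff_distrib)
  qed
  then show ?thesis by (rule eventually_mono) simp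
qed

text \<open>The triple \<open>(u, u', u'')\<close> of a periodic function, in terms of absolutely continuous functions.\<close>

definition H2rep :: "real \<Rightarrow> (real \<Rightarrow> real) \<Rightarrow> (real \<Rightarrow> real) \<Rightarrow> (real \<Rightarrow> real) \<Rightarrow> bool" where
  "H2rep T u u1 u2 \<longleftrightarrow> acd T u u1 \<and> acd T u1 u2 \<and> u2 \<in> L2 T \<and> u T = u 0 \<and> u1 T = u1 0"

lemma H2repD:
  assumes "H2rep T u u1 u2"
  shows "acd T u u1" "acd T u1 u2" "u2 \<in> L2 T" "u T = u 0" "u1 T = u1 0"
    "continuous_on {0..T} u" "continuous_on {0..T} u1" "u \<in> L2 T" "u1 \<in> L2 T"
  using assms by (auto simp: H2rep_def intro: acd_continuous L2_cont)

lemma H2rep_weak_deriv: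
  assumes "T > 0" "H2rep T u u1 u2"
  shows "has_weak_deriv T 0 u u" "has_weak_deriv T 1 u u1" "has_weak_deriv T 2 u u2"
proof -
  note r = H2repD[OF assms(2)]
  show "has_weak_deriv T 0 u u" using r by (simp add: has_weak_deriv_def)
  show "has_weak_deriv T 1 u u1"
    using r acd_by_parts_test[OF r(1) assms(1)] by (simp add: has_weak_deriv_def)
  show "has_weak_deriv T 2 u u2"
    using r acd_by_parts_test[OF r(1) assms(1) test_functions_deriv[OF _ assms(1)]]
      acd_by_parts_test[OF r(2) assms(1)]
    by (simp add: has_weak_deriv_def numeral_2_eq_2)
qed

lemma wderiv_weak_deriv: "has_weak_deriv T n u v \<Longrightarrow> has_weak_deriv T n u (wderiv T n u)"
  unfolding wderiv_def by (rule someI[where P = "has_weak_deriv T n u"])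

text \<open>\<open>wderiv\<close> is an arbitrary choice; uniqueness of weak derivatives identifies
  it almost everywhere with the entries of the triple, which is all that inner products and the
  equation see.\<close>

lemma H2rep_wderiv:
  assumes "T > 0" "H2rep T u u1 u2"
  shows "AE t in lebesgue_on {0..T}. wderiv T 0 u t = u t" "AE t in lebesgue_on {0..T}. wderiv T 1 u t = u1 t"
    "AE t in lebesgue_on {0..T}. wderiv T 2 u t = u2 t"
    "wderiv T 0 u \<in> L2 T" "wderiv T 1 u \<in> L2 T" "wderiv T 2 u \<in> L2 T"
proof -
  note w = H2rep_weak_deriv[OF assms]
  have L: "wderiv T n u \<in> L2 T" if "has_weak_deriv T n u v" for n v
    using wderiv_weak_deriv[OF that] by (simp add: has_weak_deriv_def)
  show "wderiv T 0 u \<in> L2 T" "wderiv T 1 u \<in> L2 T" "wderiv T 2 u \<in> L2 T"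
    by (rule L[OF w(1)] L[OF w(2)] L[OF w(3)])+
  show "AE t in lebesgue_on {0..T}. wderiv T 0 u t = u t" "AE t in lebesgue_on {0..T}. wderiv T 1 u t = u1 t"
    "AE t in lebesgue_on {0..T}. wderiv T 2 u t = u2 t"
    by (rule weak_deriv_unique[OF assms(1) wderiv_weak_deriv[OF w(1)] w(1)]
        weak_deriv_unique[OF assms(1) wderiv_weak_deriv[OF w(2)] w(2)]
        weak_deriv_unique[OF assms(1) wderiv_weak_deriv[OF w(3)] w(3)])+
qed

text \<open>The bridge between the Sobolev definition and calculus: \<open>du_Bois_Reymond\<close>,
  applied to u and then to its derivative, turns weak derivatives into integrands, and periodicity
  becomes equality of endpoint values.\<close>

lemma H2_iff:
  assumes T: "T > 0"
  shows "u \<in> H2 T \<longleftrightarrow> (\<forall>t. t \<notin> {0..T} \<longrightarrow> u t = 0) \<and> (\<exists>u1 u2. H2rep T u u1 u2)"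
proof
  assume "u \<in> H2 T"
  then have u: "continuous_on {0..T} u" "\<forall>t. t \<notin> {0..T} \<longrightarrow> u t = 0" and s: "u \<in> periodic_sobolev T 2"
    by (auto simp: H2_def)
  have p: "\<exists>v. has_weak_deriv T \<alpha> u v \<and> continuous_on {0..T} v \<and> v 0 = v T" if "\<alpha> < 2" for \<alpha>
    using s that unfolding periodic_sobolev_def by blast
  obtain v0 where v0: "has_weak_deriv T 0 u v0" "continuous_on {0..T} v0" "v0 0 = v0 T"
    using p[of 0] by auto
  obtain v1 where v1: "has_weak_deriv T 1 u v1" "continuous_on {0..T} v1" "v1 0 = v1 T"
    using p[of 1] by auto
  obtain v2 where v2: "has_weak_deriv T 2 u v2"
    using s unfolding periodic_sobolev_def by blast
  have L: "u \<in> L2 T" "v1 \<in> L2 T" "v2 \<in> L2 T" using v1 v2 by (auto simp: has_weak_deriv_def)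
  have "has_weak_deriv T 0 u u" using L by (simp add: has_weak_deriv_def)
  \<comment> \<open>The definition only provides some continuous representative with equal endpoint
    values; it coincides with u on all of [0,T] because u is continuous there too.\<close>
  then have "AE t in lebesgue_on {0..T}. u t = v0 t" by (rule weak_deriv_unique[OF T _ v0(1)])
  then have "AE t in lebesgue_on {0..T}. u t - v0 t = 0" by (rule eventually_mono) simp
  then have "u t - v0 t = 0" if "t \<in> {0..T}" for t
    by (rule continuous_AE_zero[rotated 2, OF _ that]) (use T u v0 in \<open>auto intro!: continuous_intros\<close>)
  from this[of 0] this[of T] v0 T have per: "u T = u 0" by simp
  have acd: "acd T f f1" if f: "continuous_on {0..T} f" "f1 \<in> L2 T"
    and eq: "\<And>\<phi>. \<phi> \<in> test_functions T \<Longrightarrow> lint 0 T (\<lambda>t. f t * deriv \<phi> t) = - lint 0 T (\<lambda>t. f1 t * \<phi> t)" for f f1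
  proof -
    obtain c where c: "AE t in lebesgue_on {0..T}. f t = c + lint 0 t f1"
      using du_Bois_Reymond[OF T L2_cont[OF f(1)] f(2) eq] by blast
    have a: "acd T (\<lambda>t. c + lint 0 t f1) f1" by (rule acd_lint[OF L2_integrable[OF f(2)]])
    from c have "AE t in lebesgue_on {0..T}. f t - (c + lint 0 t f1) = 0" by (rule eventually_mono) simp
    then have "f t - (c + lint 0 t f1) = 0" if "t \<in> {0..T}" for t
      by (rule continuous_AE_zero[rotated 2, OF _ that]) (use T in \<open>auto intro!: continuous_on_diff f(1) acd_continuous[OF a]\<close>)
    then show ?thesis by (intro acd_cong[OF a]) auto
  qed
  have a1: "acd T u v1" by (rule acd[OF u(1) L(2)]) (use v1 in \<open>auto simp: has_weak_deriv_def\<close>)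
  have a2: "acd T v1 v2"
  proof (rule acd[OF v1(2) L(3)])
    fix \<phi> assume \<phi>: "\<phi> \<in> test_functions T"
    \<comment> \<open>The second weak derivative of u is tested with \<phi>, the first with the test
      function \<open>deriv \<phi>\<close>; the comparison makes \<open>v2\<close> the weak
      derivative of \<open>v1\<close>.\<close>
    have "lint 0 T (\<lambda>t. u t * deriv (deriv \<phi>) t) = lint 0 T (\<lambda>t. v2 t * \<phi> t)"
      using v2 \<phi> by (auto simp: has_weak_deriv_def numeral_2_eq_2)
    moreover have "lint 0 T (\<lambda>t. u t * deriv (deriv \<phi>) t) = - lint 0 T (\<lambda>t. v1 t * deriv \<phi> t)"
      using v1 test_functions_deriv[OF \<phi> T] by (auto simp: has_weak_deriv_def)
    ultimately show "lint 0 T (\<lambda>t. v1 t * deriv \<phi> t) = - lint 0 T (\<lambda>t. v2 t * \<phi> t)" by simp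
  qed
  have "H2rep T u v1 v2" using a1 a2 L v1 per by (simp add: H2rep_def)
  then show "(\<forall>t. t \<notin> {0..T} \<longrightarrow> u t = 0) \<and> (\<exists>u1 u2. H2rep T u u1 u2)" using u by blast
next
  assume "(\<forall>t. t \<notin> {0..T} \<longrightarrow> u t = 0) \<and> (\<exists>u1 u2. H2rep T u u1 u2)"
  then obtain u1 u2 where z: "\<forall>t. t \<notin> {0..T} \<longrightarrow> u t = 0" and rep: "H2rep T u u1 u2" by blast
  note r = H2repD[OF rep] and w = H2rep_weak_deriv[OF T rep]
  have "\<exists>v. has_weak_deriv T \<alpha> u v" if "\<alpha> \<le> 2" for \<alpha>
  proof -
    have "\<alpha> = 0 \<or> \<alpha> = 1 \<or> \<alpha> = 2" using that by auto
    then show ?thesis using w by auto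
  qed
  moreover have "\<exists>v. has_weak_deriv T \<alpha> u v \<and> continuous_on {0..T} v \<and> v 0 = v T" if "\<alpha> < 2" for \<alpha>
  proof -
    have "\<alpha> = 0 \<or> \<alpha> = 1" using that by auto
    then show ?thesis using w r by metis
  qed
  ultimately show "u \<in> H2 T" using z r by (simp add: H2_def periodic_sobolev_def)
qed

lemma H2rep_add: "H2rep T u u1 u2 \<Longrightarrow> H2rep T v v1 v2 \<Longrightarrow>
    H2rep T (\<lambda>t. u t + v t) (\<lambda>t. u1 t + v1 t) (\<lambda>t. u2 t + v2 t)"
  by (auto simp: H2rep_def intro: acd_add L2_add)

lemma H2rep_cmult: "H2rep T u u1 u2 \<Longrightarrow> H2rep T (\<lambda>t. c * u t) (\<lambda>t. c * u1 t) (\<lambda>t. c * u2 t)"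
  by (auto simp: H2rep_def intro: acd_cmult L2_cmult)

lemma H2rep_diff: "H2rep T u u1 u2 \<Longrightarrow> H2rep T v v1 v2 \<Longrightarrow>
    H2rep T (\<lambda>t. u t - v t) (\<lambda>t. u1 t - v1 t) (\<lambda>t. u2 t - v2 t)"
  by (auto simp: H2rep_def intro: acd_diff L2_diff)

lemma H2rep_cong:
  assumes "H2rep T u u1 u2" "T > 0" "\<And>t. t \<in> {0..T} \<Longrightarrow> u' t = u t" "\<And>t. t \<in> {0..T} \<Longrightarrow> u2' t = u2 t"
  shows "H2rep T u' u1 u2'"
proof -
  have "u2' \<in> L2 T"
  proof -
    have "u2' \<in> borel_measurable (lebesgue_on {0..T})"
      using measurable_cong[of "lebesgue_on {0..T}" u2' u2] assms(4) L2_measurable[OF H2repD(3)[OF assms(1)]] by simp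
    moreover have "integrable (lebesgue_on {0..T}) (\<lambda>t. (u2' t)\<^sup>2) = integrable (lebesgue_on {0..T}) (\<lambda>t. (u2 t)\<^sup>2)"
      by (rule Bochner_Integration.integrable_cong) (use assms(4) in auto)
    ultimately show ?thesis using L2_square[OF H2repD(3)[OF assms(1)]] by (simp add: L2_def)
  qed
  then show ?thesis
    using assms unfolding H2rep_def
    by (auto intro: acd_cong[of T u u1 u' u1] acd_cong[of T u1 u2 u1 u2'])
qed

lemma H2rep_cong_AE:
  assumes "H2rep T u u1 u2" "T > 0" "AE t in lebesgue_on {0..T}. u2' t = u2 t" "u2' \<in> L2 T"
  shows "H2rep T u u1 u2'"
  using assms unfolding H2rep_def by (auto intro: acd_cong_AE[of T u1 u2] L2_measurable)

section \<open>Reflection, Green's formula and the inner product of H^2\<close>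

lemma lint_reflect:
  fixes s t T :: real
  shows "lint s t (\<lambda>r. f (T - r)) = lint (T - t) (T - s) f"
proof -
  have "lint s t (\<lambda>r. f (T - r)) = (LINT r|lebesgue. indicat_real {T - t..T - s} (T + (-1) * r) * f (T + (-1) * r))"
    unfolding lint_lebesgue by (rule Bochner_Integration.integral_cong) (auto split: split_indicator)
  also have "\<dots> = (LINT r|lebesgue. indicat_real {T - t..T - s} r * f r)"
    using lebesgue_integral_real_affine[of "-1" "\<lambda>r. indicat_real {T - t..T - s} r * f r" T] by simp
  finally show ?thesis by (simp add: lint_lebesgue)
qed

lemma integrable_reflect:
  fixes f :: "real \<Rightarrow> real"
  assumes "integrable (lebesgue_on {0..T}) f"
  shows "integrable (lebesgue_on {0..T}) (\<lambda>r. f (T - r))"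
proof -
  have "integrable lebesgue (\<lambda>r. indicat_real {0..T} r * f r)"
    using assms by (simp add: integrable_restrict_space)
  then have "integrable lebesgue (\<lambda>r. indicat_real {0..T} (T + (-1) * r) * f (T + (-1) * r))"
    by (rule lebesgue_integrable_real_affine) simp
  also have "(\<lambda>r. indicat_real {0..T} (T + (-1) * r) * f (T + (-1) * r)) = (\<lambda>r. indicat_real {0..T} r * f (T - r))"
    by (auto split: split_indicator)
  finally show ?thesis by (simp add: integrable_restrict_space)
qed

lemma L2_reflect:
  assumes "f \<in> L2 T" shows "(\<lambda>r. f (T - r)) \<in> L2 T"
  using integrable_reflect[OF L2_integrable[OF assms]] integrable_reflect[OF L2_square[OF assms]]
  by (auto simp: L2_def)

lemma acd_reflect:
  assumes u: "acd T u v"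
  shows "acd T (\<lambda>t. u (T - t)) (\<lambda>t. - v (T - t))"
proof (rule acdI)
  show "integrable (lebesgue_on {0..T}) (\<lambda>t. - v (T - t))"
    using integrable_reflect[OF acd_integrable[OF u]] by simp
  fix t assume t: "0 \<le> t" "t \<le> T"
  have "lint 0 t (\<lambda>t. - v (T - t)) = - lint (T - t) T v" using lint_reflect[of 0 t v T] by simp
  then show "u (T - t) = u (T - 0) + lint 0 t (\<lambda>t. - v (T - t))"
    using acd_increment[OF u, of "T - t" T] t by simp
qed

lemma H2rep_reflect:
  assumes "H2rep T u u1 u2"
  shows "H2rep T (\<lambda>t. u (T - t)) (\<lambda>t. - u1 (T - t)) (\<lambda>t. u2 (T - t))"
proof -
  have "acd T (\<lambda>t. (-1) * u1 (T - t)) (\<lambda>t. (-1) * (- u2 (T - t)))"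
    by (intro acd_cmult acd_reflect H2repD(2)[OF assms])
  then show ?thesis
    using assms by (auto simp: H2rep_def intro: acd_reflect L2_reflect)
qed

text \<open>The product rule integrated over a full period: the boundary terms cancel by
  periodicity.\<close>

lemma H2rep_Green:
  assumes T: "T > 0" and u: "H2rep T u u1 u2" and e: "H2rep T e e1 e2"
  shows "lint 0 T (\<lambda>t. u1 t * e1 t) = - lint 0 T (\<lambda>t. u t * e2 t)"
    "lint 0 T (\<lambda>t. u2 t * e t) = lint 0 T (\<lambda>t. u t * e2 t)"
proof -
  note U = H2repD[OF u] and E = H2repD[OF e]
  have d: "\<And>t. t \<in> {0..T} \<Longrightarrow> (e has_real_derivative e1 t) (at t within {0..T})"
    "\<And>t. t \<in> {0..T} \<Longrightarrow> (u has_real_derivative u1 t) (at t within {0..T})"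
    using acd_has_derivative[OF E(1,7)] acd_has_derivative[OF U(1,7)] by auto
  have 1: "lint 0 T (\<lambda>t. u2 t * e t + u1 t * e1 t) = 0"
    using acd_increment[OF acd_mult[OF U(2) d(1) E(7)], of 0 T] T U(5) E(4) by simp
  have 2: "lint 0 T (\<lambda>t. e2 t * u t + e1 t * u1 t) = 0"
    using acd_increment[OF acd_mult[OF E(2) d(2) U(7)], of 0 T] T U(4) E(5) by simp
  have i: "integrable (lebesgue_on {0..T}) (\<lambda>t. u2 t * e t)" "integrable (lebesgue_on {0..T}) (\<lambda>t. u1 t * e1 t)"
     "integrable (lebesgue_on {0..T}) (\<lambda>t. e2 t * u t)" "integrable (lebesgue_on {0..T}) (\<lambda>t. e1 t * u1 t)"
    by (intro L2_mult U E)+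
  show "lint 0 T (\<lambda>t. u1 t * e1 t) = - lint 0 T (\<lambda>t. u t * e2 t)"
    using 2 i by (simp add: mult.commute)
  then show "lint 0 T (\<lambda>t. u2 t * e t) = lint 0 T (\<lambda>t. u t * e2 t)"
    using 1 i by simp
qed

lemma H2_inner_rep:
  assumes T: "T > 0" and u: "H2rep T u u1 u2" and v: "H2rep T v v1 v2"
  shows "H2_inner T u v = lint 0 T (\<lambda>t. u t * v t) + lint 0 T (\<lambda>t. u1 t * v1 t) + lint 0 T (\<lambda>t. u2 t * v2 t)"
proof -
  note wu = H2rep_wderiv[OF T u] and wv = H2rep_wderiv[OF T v]
  have eq: "lint 0 T (\<lambda>t. f t * g t) = lint 0 T (\<lambda>t. f' t * g' t)"
    if "AE t in lebesgue_on {0..T}. f t = f' t" "AE t in lebesgue_on {0..T}. g t = g' t"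
      "f \<in> L2 T" "g \<in> L2 T" "f' \<in> L2 T" "g' \<in> L2 T" for f g f' g'
  proof (rule integral_cong_AE)
    show "AE t in lebesgue_on {0..T}. f t * g t = f' t * g' t"
      using that(1,2) by eventually_elim simp
  qed (rule borel_measurable_times; rule L2_measurable, rule that)+
  have "{..2::nat} = {0, 1, 2}" by auto
  then have "H2_inner T u v = lint 0 T (\<lambda>t. wderiv T 0 u t * wderiv T 0 v t) +
     lint 0 T (\<lambda>t. wderiv T 1 u t * wderiv T 1 v t) + lint 0 T (\<lambda>t. wderiv T 2 u t * wderiv T 2 v t)"
    unfolding H2_inner_def by simp
  also have "\<dots> = lint 0 T (\<lambda>t. u t * v t) + lint 0 T (\<lambda>t. u1 t * v1 t) + lint 0 T (\<lambda>t. u2 t * v2 t)"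
    using eq[OF wu(1) wv(1) wu(4) wv(4) H2repD(8)[OF u] H2repD(8)[OF v]]
      eq[OF wu(2) wv(2) wu(5) wv(5) H2repD(9)[OF u] H2repD(9)[OF v]]
      eq[OF wu(3) wv(3) wu(6) wv(6) H2repD(3)[OF u] H2repD(3)[OF v]] by (simp only:)
  finally show ?thesis .
qed

lemma H2_inner_self:
  assumes "T > 0" "H2rep T u u1 u2"
  shows "H2_inner T u u = lint 0 T (\<lambda>t. (u t)\<^sup>2) + lint 0 T (\<lambda>t. (u1 t)\<^sup>2) + lint 0 T (\<lambda>t. (u2 t)\<^sup>2)"
  using H2_inner_rep[OF assms(1,2,2)] by (simp add: power2_eq_square)

lemma H2_inner_nonneg:
  assumes "T > 0" "H2rep T u u1 u2" shows "0 \<le> H2_inner T u u"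
  unfolding H2_inner_self[OF assms] by (intro add_nonneg_nonneg Bochner_Integration.integral_nonneg) auto

lemma H2_inner_commute:
  assumes "T > 0" "H2rep T u u1 u2" "H2rep T v v1 v2"
  shows "H2_inner T u v = H2_inner T v u"
  using H2_inner_rep[OF assms] H2_inner_rep[OF assms(1,3,2)] by (simp add: mult.commute)

lemma H2_inner_lincomb:
  assumes T: "T > 0" and u: "H2rep T u u1 u2" and v: "H2rep T v v1 v2" and w: "H2rep T w w1 w2"
  shows "H2_inner T (\<lambda>t. c * u t + v t) w = c * H2_inner T u w + H2_inner T v w"
proof -
  have l: "lint 0 T (\<lambda>t. (c * f t + g t) * h t) = c * lint 0 T (\<lambda>t. f t * h t) + lint 0 T (\<lambda>t. g t * h t)"
    if "f \<in> L2 T" "g \<in> L2 T" "h \<in> L2 T" for f g h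
  proof -
    have "lint 0 T (\<lambda>t. (c * f t + g t) * h t) = lint 0 T (\<lambda>t. c * (f t * h t) + g t * h t)"
      by (rule lint_cong) (simp add: algebra_simps)
    then show ?thesis using L2_mult[OF that(1,3)] L2_mult[OF that(2,3)] by simp
  qed
  note U = H2repD[OF u] and V = H2repD[OF v] and W = H2repD[OF w]
  show ?thesis
    unfolding H2_inner_rep[OF T H2rep_add[OF H2rep_cmult[OF u] v] w] H2_inner_rep[OF T u w] H2_inner_rep[OF T v w]
      l[OF U(8) V(8) W(8)] l[OF U(9) V(9) W(9)] l[OF U(3) V(3) W(3)]
    by (simp add: algebra_simps)
qed

lemma H2_inner_square:
  assumes T: "T > 0" and u: "H2rep T u u1 u2" and v: "H2rep T v v1 v2"
  shows "H2_inner T (\<lambda>t. c * u t + v t) (\<lambda>t. c * u t + v t) =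
     H2_inner T u u * c\<^sup>2 + 2 * H2_inner T u v * c + H2_inner T v v"
proof -
  note r = H2rep_add[OF H2rep_cmult[OF u] v]
  show ?thesis
    unfolding H2_inner_lincomb[OF T u v r] H2_inner_commute[OF T u r] H2_inner_commute[OF T v r]
      H2_inner_lincomb[OF T u v u] H2_inner_lincomb[OF T u v v] H2_inner_commute[OF T v u]
    by (simp add: algebra_simps power2_eq_square)
qed

lemma H2_norm_rep: "T > 0 \<Longrightarrow> H2rep T u u1 u2 \<Longrightarrow> (H2_norm T u)\<^sup>2 = H2_inner T u u"
  by (simp add: H2_norm_def H2_inner_nonneg)

lemma H2_norm_triangle:
  assumes T: "T > 0" and u: "H2rep T u u1 u2" and v: "H2rep T v v1 v2"
  shows "H2_norm T (\<lambda>t. u t + v t) \<le> H2_norm T u + H2_norm T v"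
proof -
  have "(H2_inner T u v)\<^sup>2 \<le> H2_inner T u u * H2_inner T v v"
  proof (rule quadratic_nonneg_discriminant)
    fix c
    show "0 \<le> H2_inner T u u * c\<^sup>2 + 2 * H2_inner T u v * c + H2_inner T v v"
      using H2_inner_nonneg[OF T H2rep_add[OF H2rep_cmult[OF u] v]] H2_inner_square[OF T u v] by simp
  qed (rule H2_inner_nonneg[OF T u])
  then have "\<bar>H2_inner T u v\<bar> \<le> sqrt (H2_inner T u u * H2_inner T v v)"
    using real_le_rsqrt by (metis real_sqrt_abs real_sqrt_le_iff)
  then have "H2_inner T u v \<le> H2_norm T u * H2_norm T v" by (simp add: H2_norm_def real_sqrt_mult)
  then have "(H2_norm T (\<lambda>t. 1 * u t + v t))\<^sup>2 \<le> (H2_norm T u + H2_norm T v)\<^sup>2"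
    unfolding H2_norm_rep[OF T H2rep_add[OF H2rep_cmult[OF u] v]] H2_inner_square[OF T u v] power2_sum
      H2_norm_rep[OF T u] H2_norm_rep[OF T v] by simp
  moreover have "0 \<le> H2_norm T u + H2_norm T v" by (simp add: H2_norm_def H2_inner_nonneg[OF T u] H2_inner_nonneg[OF T v])
  ultimately have "H2_norm T (\<lambda>t. 1 * u t + v t) \<le> H2_norm T u + H2_norm T v" by (rule power2_le_imp_le)
  then show ?thesis by simp
qed

lemma H2_norm_cmult:
  assumes T: "T > 0" and u: "H2rep T u u1 u2"
  shows "H2_norm T (\<lambda>t. c * u t) = \<bar>c\<bar> * H2_norm T u"
proof -
  have "H2_inner T (\<lambda>t. c * u t) (\<lambda>t. c * u t) = c\<^sup>2 * H2_inner T u u"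
    unfolding H2_inner_self[OF T u] H2_inner_self[OF T H2rep_cmult[OF u]] power_mult_distrib
    by (simp add: algebra_simps)
  then show ?thesis by (simp add: H2_norm_def real_sqrt_mult)
qed

text \<open>Converts pointwise bounds on a triple, which is what series majorants deliver, into the
  norm; the factor 3 T comes from three integrals over an interval of length T.\<close>

lemma H2_norm_le_sup:
  assumes T: "T > 0" and u: "H2rep T u u1 u2" and "0 \<le> b"
    and b: "\<And>t. t \<in> {0..T} \<Longrightarrow> \<bar>u t\<bar> \<le> b" "\<And>t. t \<in> {0..T} \<Longrightarrow> \<bar>u1 t\<bar> \<le> b" "\<And>t. t \<in> {0..T} \<Longrightarrow> \<bar>u2 t\<bar> \<le> b"
  shows "H2_norm T u \<le> sqrt (3 * T) * b"
proof -
  have l: "lint 0 T (\<lambda>t. (f t)\<^sup>2) \<le> T * b\<^sup>2" if f: "f \<in> L2 T" and "\<And>t. t \<in> {0..T} \<Longrightarrow> \<bar>f t\<bar> \<le> b" for f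
  proof -
    have "\<bar>lint 0 T (\<lambda>t. (f t)\<^sup>2)\<bar> \<le> (T - 0) * b\<^sup>2"
    proof (rule lint_abs_le)
      show "(\<lambda>t. (f t)\<^sup>2) \<in> borel_measurable (lebesgue_on {0..T})" using L2_measurable[OF f] by measurable
      show "\<bar>(f t)\<^sup>2\<bar> \<le> b\<^sup>2" if "t \<in> {0..T}" for t
        using power_mono[of "\<bar>f t\<bar>" b 2] \<open>t \<in> {0..T} \<Longrightarrow> \<bar>f t\<bar> \<le> b\<close> that by simp
    qed (use T in simp)
    then show ?thesis by simp
  qed
  have "H2_inner T u u \<le> 3 * T * b\<^sup>2"
    unfolding H2_inner_self[OF T u]
    using l[OF H2repD(8)[OF u] b(1)] l[OF H2repD(9)[OF u] b(2)] l[OF H2repD(3)[OF u] b(3)] by simp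
  then have "H2_norm T u \<le> sqrt (3 * T * b\<^sup>2)" by (simp add: H2_norm_def)
  then show ?thesis using \<open>0 \<le> b\<close> by (simp add: real_sqrt_mult)
qed

text \<open>The one-dimensional Sobolev embedding with an explicit constant: |u(t)| is compared with
  |u(s)| up to the integral of |v|, the inequality is averaged over s, and both integrals are
  estimated by Cauchy-Schwarz.\<close>

lemma acd_sup_bound:
  assumes T: "T > 0" and a: "acd T u v" and v: "v \<in> L2 T" and "0 \<le> N"
    and N: "lint 0 T (\<lambda>t. (u t)\<^sup>2) \<le> N\<^sup>2" "lint 0 T (\<lambda>t. (v t)\<^sup>2) \<le> N\<^sup>2" and t: "t \<in> {0..T}"
  shows "\<bar>u t\<bar> \<le> (sqrt T / T + sqrt T) * N"
proof -
  have cu: "continuous_on {0..T} u" by (rule acd_continuous[OF a])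
  have l: "lint 0 T (\<lambda>t. \<bar>f t\<bar>) \<le> sqrt T * N" if f: "f \<in> L2 T" "lint 0 T (\<lambda>t. (f t)\<^sup>2) \<le> N\<^sup>2" for f
  proof -
    have f': "(\<lambda>t. \<bar>f t\<bar>) \<in> L2 T" using f(1) by (auto simp: L2_def)
    have "(lint 0 T (\<lambda>t. \<bar>f t\<bar> * 1))\<^sup>2 \<le> lint 0 T (\<lambda>t. \<bar>f t\<bar>\<^sup>2) * lint 0 T (\<lambda>t. 1\<^sup>2)"
      by (rule L2_Cauchy_Schwarz[OF f' L2_cont]) auto
    also have "\<dots> \<le> N\<^sup>2 * T" using f(2) T measure_interval[of 0 T] by simp
    finally have "(lint 0 T (\<lambda>t. \<bar>f t\<bar>))\<^sup>2 \<le> (sqrt T * N)\<^sup>2" using T by (simp add: power_mult_distrib mult.commute)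
    then show ?thesis by (rule power2_le_imp_le) (use T \<open>0 \<le> N\<close> in simp)
  qed
  have iv: "integrable (lebesgue_on {0..T}) (\<lambda>t. \<bar>v t\<bar>)" using L2_integrable[OF v] by simp
  have incr: "\<bar>u t - u s\<bar> \<le> lint 0 T (\<lambda>t. \<bar>v t\<bar>)" if s: "s \<in> {0..T}" for s
  proof -
    have main: "\<bar>u q - u p\<bar> \<le> lint 0 T (\<lambda>t. \<bar>v t\<bar>)" if pq: "0 \<le> p" "p \<le> q" "q \<le> T" for p q
    proof -
      have "\<bar>u q - u p\<bar> = \<bar>lint p q v\<bar>" using acd_increment[OF a pq] by simp
      also have "\<dots> \<le> lint p q (\<lambda>t. \<bar>v t\<bar>)" by (rule integral_abs_bound)
      also have "\<dots> \<le> lint 0 T (\<lambda>t. \<bar>v t\<bar>)"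
      proof -
        have "0 \<le> lint 0 p (\<lambda>t. \<bar>v t\<bar>)" "0 \<le> lint q T (\<lambda>t. \<bar>v t\<bar>)"
          by (rule Bochner_Integration.integral_nonneg, simp)+
        moreover have "lint 0 T (\<lambda>t. \<bar>v t\<bar>) = lint 0 p (\<lambda>t. \<bar>v t\<bar>) + lint p T (\<lambda>t. \<bar>v t\<bar>)"
          by (rule lint_combine[OF iv]) (use pq in auto)
        moreover have "lint p T (\<lambda>t. \<bar>v t\<bar>) = lint p q (\<lambda>t. \<bar>v t\<bar>) + lint q T (\<lambda>t. \<bar>v t\<bar>)"
          by (rule lint_combine[OF integrable_sub[OF iv]]) (use pq in auto)
        ultimately show ?thesis by linarith
      qed
      finally show ?thesis .
    qed
    show ?thesis using main[of s t] main[of t s] s t by (cases "s \<le> t") (auto simp: abs_minus_commute)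
  qed
  have "lint 0 T (\<lambda>s. \<bar>u t\<bar>) \<le> lint 0 T (\<lambda>s. \<bar>u s\<bar> + lint 0 T (\<lambda>t. \<bar>v t\<bar>))"
  proof (rule integral_mono)
    show "integrable (lebesgue_on {0..T}) (\<lambda>s. \<bar>u t\<bar>)"
      "integrable (lebesgue_on {0..T}) (\<lambda>s. \<bar>u s\<bar> + lint 0 T (\<lambda>t. \<bar>v t\<bar>))"
      by (auto intro!: integrable_cont continuous_intros cu)
    fix s assume "s \<in> space (lebesgue_on {0..T})"
    then show "\<bar>u t\<bar> \<le> \<bar>u s\<bar> + lint 0 T (\<lambda>t. \<bar>v t\<bar>)" using incr[of s] by auto
  qed
  also have "\<dots> = lint 0 T (\<lambda>s. \<bar>u s\<bar>) + T * lint 0 T (\<lambda>t. \<bar>v t\<bar>)"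
  proof -
    have "integrable (lebesgue_on {0..T}) (\<lambda>s. \<bar>u s\<bar>)" "integrable (lebesgue_on {0..T}) (\<lambda>s. lint 0 T (\<lambda>t. \<bar>v t\<bar>))"
      by (auto intro!: integrable_cont continuous_intros cu)
    then show ?thesis using measure_interval[of 0 T] T by simp
  qed
  also have "\<dots> \<le> sqrt T * N + T * (sqrt T * N)"
    using l[OF L2_cont[OF cu] N(1)] l[OF v N(2)] T by (intro add_mono mult_left_mono) auto
  finally have "T * \<bar>u t\<bar> \<le> sqrt T * N + T * (sqrt T * N)" using measure_interval[of 0 T] T by simp
  then show ?thesis using T by (simp add: field_simps)
qed

lemma H2_sup_bound:
  assumes T: "T > 0" and u: "H2rep T u u1 u2" and t: "t \<in> {0..T}"
  shows "\<bar>u t\<bar> \<le> (sqrt T / T + sqrt T) * H2_norm T u" "\<bar>u1 t\<bar> \<le> (sqrt T / T + sqrt T) * H2_norm T u"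
proof -
  note U = H2repD[OF u]
  have n: "0 \<le> H2_norm T u" by (simp add: H2_norm_def H2_inner_nonneg[OF T u])
  have p: "0 \<le> lint 0 T (\<lambda>t. (f t)\<^sup>2)" for f by (rule Bochner_Integration.integral_nonneg) simp
  have *: "lint 0 T (\<lambda>t. (u t)\<^sup>2) \<le> (H2_norm T u)\<^sup>2" "lint 0 T (\<lambda>t. (u1 t)\<^sup>2) \<le> (H2_norm T u)\<^sup>2"
     "lint 0 T (\<lambda>t. (u2 t)\<^sup>2) \<le> (H2_norm T u)\<^sup>2"
    unfolding H2_norm_rep[OF T u] H2_inner_self[OF T u] using p[of u] p[of u1] p[of u2] by auto
  show "\<bar>u t\<bar> \<le> (sqrt T / T + sqrt T) * H2_norm T u" "\<bar>u1 t\<bar> \<le> (sqrt T / T + sqrt T) * H2_norm T u"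
    by (rule acd_sup_bound[OF T U(1) U(9) n *(1,2) t] acd_sup_bound[OF T U(2) U(3) n *(2,3) t])+
qed

lemma H2_diff:
  assumes "T > 0" "u \<in> H2 T" "v \<in> H2 T" shows "(\<lambda>t. u t - v t) \<in> H2 T"
  using assms H2rep_diff unfolding H2_iff[OF assms(1)] by fastforce

text \<open>This holds also for functions without weak derivatives, for which \<open>wderiv\<close> is the same
  arbitrary function for \<open>u\<close> and \<open>- u\<close>.\<close>

lemma H2_inner_uminus:
  assumes T: "T > 0"
  shows "H2_inner T (\<lambda>t. - u t) (\<lambda>t. - u t) = H2_inner T u u"
proof -
  have neg: "has_weak_deriv T n (\<lambda>t. - w t) (\<lambda>t. - v t)" if "has_weak_deriv T n w v" for n w v
    using that L2_cmult[of w T "-1"] L2_cmult[of v T "-1"] by (simp add: has_weak_deriv_def)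
  have "lint 0 T (\<lambda>t. wderiv T n (\<lambda>t. - u t) t * wderiv T n (\<lambda>t. - u t) t) =
     lint 0 T (\<lambda>t. wderiv T n u t * wderiv T n u t)" for n
  proof (cases "\<exists>v. has_weak_deriv T n u v")
    case True
    then obtain v where v: "has_weak_deriv T n u v" by blast
    note w1 = wderiv_weak_deriv[OF v] and w2 = wderiv_weak_deriv[OF neg[OF v]]
    have "AE t in lebesgue_on {0..T}. wderiv T n (\<lambda>t. - u t) t = - wderiv T n u t"
      by (rule weak_deriv_unique[OF T w2 neg[OF w1]])
    then have ae: "AE t in lebesgue_on {0..T}. wderiv T n (\<lambda>t. - u t) t * wderiv T n (\<lambda>t. - u t) t =
        wderiv T n u t * wderiv T n u t" by (rule eventually_mono) simp
    have "wderiv T n (\<lambda>t. - u t) \<in> L2 T" "wderiv T n u \<in> L2 T"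
      using w1 w2 by (auto simp: has_weak_deriv_def)
    then show ?thesis
      by (intro integral_cong_AE[OF _ _ ae] borel_measurable_times) (auto dest: L2_measurable)
  next
    case False
    then have "has_weak_deriv T n u = (\<lambda>_. False)" by blast
    moreover have "has_weak_deriv T n (\<lambda>t. - u t) = (\<lambda>_. False)"
      using False neg[of n "\<lambda>t. - u t"] by fastforce
    ultimately have "wderiv T n (\<lambda>t. - u t) = wderiv T n u" by (simp add: wderiv_def)
    then show ?thesis by simp
  qed
  then show ?thesis by (simp add: H2_inner_def)
qed

lemma H2_Metric_space:
  assumes T: "T > 0" shows "Metric_space (H2 T) (H2_dist T)"
proof
  have rep: "\<exists>u1 u2. H2rep T u u1 u2" if "u \<in> H2 T" for u using that H2_iff[OF T] by blast
  \<comment> \<open>The locale demands nonnegativity and symmetry for arbitrary functions, not only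
    for members of \<open>H2 T\<close>; hence the general form of
    \<open>H2_inner_uminus\<close>.\<close>
  have "0 \<le> H2_inner T u u" for u
    unfolding H2_inner_def by (intro sum_nonneg Bochner_Integration.integral_nonneg) simp
  then show "0 \<le> H2_dist T u v" for u v by (simp add: H2_dist_def H2_norm_def)
  show "H2_dist T u v = H2_dist T v u" for u v
    using H2_inner_uminus[OF T, of "\<lambda>t. u t - v t"] by (simp add: H2_dist_def H2_norm_def)
  show "H2_dist T u v = 0 \<longleftrightarrow> u = v" if uv: "u \<in> H2 T" "v \<in> H2 T" for u v
  proof
    obtain w1 w2 where w: "H2rep T (\<lambda>t. u t - v t) w1 w2" using rep[OF H2_diff[OF T uv]] by blast
    {
      assume "H2_dist T u v = 0"
      then have "u t - v t = 0" if "t \<in> {0..T}" for t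
        using H2_sup_bound(1)[OF T w that] by (simp add: H2_dist_def)
      moreover have "u t = 0" "v t = 0" if "t \<notin> {0..T}" for t using uv that by (auto simp: H2_def)
      ultimately show "u = v" by (metis eq_iff_diff_eq_0 ext)
    }
    assume "u = v"
    then have "H2_dist T u v = H2_norm T (\<lambda>t. 0 * (u t - v t))" by (simp add: H2_dist_def)
    then show "H2_dist T u v = 0" using H2_norm_cmult[OF T w, of 0] by simp
  qed
  show "H2_dist T u w \<le> H2_dist T u v + H2_dist T v w" if uv: "u \<in> H2 T" "v \<in> H2 T" "w \<in> H2 T" for u v w
  proof -
    obtain p1 p2 q1 q2 where "H2rep T (\<lambda>t. u t - v t) p1 p2" "H2rep T (\<lambda>t. v t - w t) q1 q2"
      using rep[OF H2_diff[OF T uv(1,2)]] rep[OF H2_diff[OF T uv(2,3)]] by blast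
    from H2_norm_triangle[OF T this] show ?thesis by (simp add: H2_dist_def)
  qed
qed

section \<open>Series of functions\<close>

lemma lint_suminf:
  assumes ab: "a \<le> b" and m: "\<And>n. f n \<in> borel_measurable (lebesgue_on {a..b})"
    and c: "\<And>n t. t \<in> {a..b} \<Longrightarrow> \<bar>f n t\<bar> \<le> c n" and s: "summable c"
  shows "integrable (lebesgue_on {a..b}) (\<lambda>t. \<Sum>n. f n t)"
    "(\<lambda>n. lint a b (f n)) sums lint a b (\<lambda>t. \<Sum>n. f n t)"
proof -
  have i: "integrable (lebesgue_on {a..b}) (f n)" for n by (rule integrable_bdd[OF m c])
  have ae: "AE t in lebesgue_on {a..b}. summable (\<lambda>n. norm (f n t))"
    by (rule AE_I2) (auto intro!: summable_comparison_test'[OF s, of 0] c)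
  have si: "summable (\<lambda>n. lint a b (\<lambda>t. norm (f n t)))"
  proof (rule summable_comparison_test'[OF summable_mult[OF s, of "b - a"], of 0])
    fix n
    have mn: "(\<lambda>t. norm (f n t)) \<in> borel_measurable (lebesgue_on {a..b})" using m[of n] by measurable
    show "norm (lint a b (\<lambda>t. norm (f n t))) \<le> (b - a) * c n"
      using lint_abs_le[OF ab mn, of "c n"] c by simp
  qed
  show "integrable (lebesgue_on {a..b}) (\<lambda>t. \<Sum>n. f n t)" by (rule integrable_suminf[OF i ae si])
  show "(\<lambda>n. lint a b (f n)) sums lint a b (\<lambda>t. \<Sum>n. f n t)" by (rule sums_integral[OF i ae si])
qed

text \<open>A common summable bound for functions and derivatives permits termwise integration;
  differentiation of the series is thereby reduced to integration.\<close>

lemma acd_suminf: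
  assumes T: "T > 0" and a: "\<And>n. acd T (v n) (w n)"
    and c: "\<And>n t. t \<in> {0..T} \<Longrightarrow> \<bar>v n t\<bar> \<le> c n" "\<And>n t. t \<in> {0..T} \<Longrightarrow> \<bar>w n t\<bar> \<le> c n" and s: "summable c"
  shows "acd T (\<lambda>t. \<Sum>n. v n t) (\<lambda>t. \<Sum>n. w n t)"
proof (rule acdI)
  have m: "w n \<in> borel_measurable (lebesgue_on {0..T})" for n using acd_integrable[OF a[of n]] by auto
  show "integrable (lebesgue_on {0..T}) (\<lambda>t. \<Sum>n. w n t)"
    by (rule lint_suminf(1)[OF _ m c(2) s]) (use T in auto)
  fix t assume t: "0 \<le> t" "t \<le> T"
  have mt: "w n \<in> borel_measurable (lebesgue_on {0..t})" for n
    by (rule measurable_restrict_mono[OF m]) (use t in auto)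
  have "(\<lambda>n. lint 0 t (w n)) sums lint 0 t (\<lambda>t. \<Sum>n. w n t)"
    by (rule lint_suminf(2)[OF t(1) mt _ s]) (use c(2) t in auto)
  moreover have "(\<lambda>n. v n 0) sums (\<Sum>n. v n 0)"
    by (rule summable_sums, rule summable_comparison_test'[OF s, of 0]) (use c(1) T in auto)
  ultimately have "(\<lambda>n. v n 0 + lint 0 t (w n)) sums ((\<Sum>n. v n 0) + lint 0 t (\<lambda>t. \<Sum>n. w n t))"
    by (intro sums_add)
  moreover have "(\<lambda>n. v n 0 + lint 0 t (w n)) = (\<lambda>n. v n t)"
    by (rule ext) (rule acdD[OF a t, symmetric])
  ultimately have "(\<lambda>n. v n t) sums ((\<Sum>n. v n 0) + lint 0 t (\<lambda>t. \<Sum>n. w n t))" by (simp only:)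
  then show "(\<Sum>n. v n t) = (\<Sum>n. v n 0) + lint 0 t (\<lambda>t. \<Sum>n. w n t)" by (rule sums_unique[symmetric])
qed

lemma abs_suminf_le:
  fixes f :: "nat \<Rightarrow> real"
  assumes "\<And>n. \<bar>f n\<bar> \<le> c n" "summable c"
  shows "\<bar>\<Sum>n. f n\<bar> \<le> (\<Sum>n. c n)" "summable f"
proof -
  have s: "summable (\<lambda>n. \<bar>f n\<bar>)"
    by (rule summable_comparison_test'[OF assms(2), of 0]) (use assms(1) in auto)
  then show "summable f" by (rule summable_rabs_cancel)
  show "\<bar>\<Sum>n. f n\<bar> \<le> (\<Sum>n. c n)"
    using summable_rabs[OF s] suminf_le[OF assms(1) s assms(2)] by linarith
qed

lemma H2rep_suminf:
  assumes T: "T > 0" and r: "\<And>n. H2rep T (v n) (v1 n) (v2 n)"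
    and c: "\<And>n t. t \<in> {0..T} \<Longrightarrow> \<bar>v n t\<bar> \<le> c n" "\<And>n t. t \<in> {0..T} \<Longrightarrow> \<bar>v1 n t\<bar> \<le> c n"
      "\<And>n t. t \<in> {0..T} \<Longrightarrow> \<bar>v2 n t\<bar> \<le> c n" and s: "summable c"
  shows "H2rep T (\<lambda>t. \<Sum>n. v n t) (\<lambda>t. \<Sum>n. v1 n t) (\<lambda>t. \<Sum>n. v2 n t)"
proof -
  note R = H2repD[OF r]
  have a: "acd T (\<lambda>t. \<Sum>n. v n t) (\<lambda>t. \<Sum>n. v1 n t)" "acd T (\<lambda>t. \<Sum>n. v1 n t) (\<lambda>t. \<Sum>n. v2 n t)"
    by (rule acd_suminf[OF T R(1) c(1,2) s] acd_suminf[OF T R(2) c(2,3) s]; assumption)+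
  have "(\<lambda>t. \<Sum>n. v2 n t) \<in> L2 T"
  proof (rule L2_bdd)
    show "(\<lambda>t. \<Sum>n. v2 n t) \<in> borel_measurable (lebesgue_on {0..T})" using acd_integrable[OF a(2)] by auto
    show "\<bar>\<Sum>n. v2 n t\<bar> \<le> (\<Sum>n. c n)" if "t \<in> {0..T}" for t by (rule abs_suminf_le(1)[OF c(3)[OF that] s])
  qed
  with a show ?thesis by (simp add: H2rep_def R(4,5))
qed

section \<open>Power series\<close>

definition ps :: "(nat \<Rightarrow> real) \<Rightarrow> real \<Rightarrow> real" where
  "ps c r = (\<Sum>n. c n * r ^ n)"

definition cv :: "(nat \<Rightarrow> real) \<Rightarrow> (nat \<Rightarrow> real) \<Rightarrow> nat \<Rightarrow> real" where
  "cv x y n = (\<Sum>i\<le>n. x i * y (n - i))"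

lemma cv_scale: "cv (\<lambda>n. x n * r ^ n) (\<lambda>n. y n * r ^ n) n = cv x y n * r ^ n"
proof -
  have "x i * r ^ i * (y (n - i) * r ^ (n - i)) = x i * y (n - i) * r ^ n" if "i \<le> n" for i
  proof -
    have "r ^ i * r ^ (n - i) = r ^ n" using that by (simp add: power_add[symmetric])
    moreover have "x i * r ^ i * (y (n - i) * r ^ (n - i)) = x i * y (n - i) * (r ^ i * r ^ (n - i))"
      by (simp add: mult_ac)
    ultimately show ?thesis by simp
  qed
  then show ?thesis unfolding cv_def sum_distrib_right by (intro sum.cong) auto
qed

lemma cv_nonneg: "(\<And>n. 0 \<le> x n) \<Longrightarrow> (\<And>n. 0 \<le> y n) \<Longrightarrow> 0 \<le> cv x y n"
  unfolding cv_def by (intro sum_nonneg mult_nonneg_nonneg) auto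

lemma cv_cong: "(\<And>i. i \<le> n \<Longrightarrow> x i = x' i) \<Longrightarrow> (\<And>i. i \<le> n \<Longrightarrow> y i = y' i) \<Longrightarrow> cv x y n = cv x' y' n"
  unfolding cv_def by (intro sum.cong) auto

lemma abs_cv_le:
  assumes "\<And>i. i \<le> n \<Longrightarrow> \<bar>x i\<bar> \<le> x' i" "\<And>i. i \<le> n \<Longrightarrow> \<bar>y i\<bar> \<le> y' i"
  shows "\<bar>cv x y n\<bar> \<le> cv x' y' n"
proof -
  have "\<bar>cv x y n\<bar> \<le> (\<Sum>i\<le>n. \<bar>x i * y (n - i)\<bar>)" unfolding cv_def by (rule sum_abs)
  also have "\<dots> \<le> cv x' y' n" unfolding cv_def abs_mult
  proof (rule sum_mono)
    fix i assume "i \<in> {..n}"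
    then show "\<bar>x i\<bar> * \<bar>y (n - i)\<bar> \<le> x' i * y' (n - i)"
      using assms(1)[of i] assms(2)[of "n - i"] by (intro mult_mono) auto
  qed
  finally show ?thesis .
qed

text \<open>A triangular family of products is injected by \<open>h\<close> into the square of index
  pairs; nonnegativity allows the missing pairs to be added.\<close>

lemma sum_triangle_le:
  fixes x y :: "nat \<Rightarrow> real"
  assumes x: "\<And>n. 0 \<le> x n" and y: "\<And>n. 0 \<le> y n"
    and inj: "inj_on h (SIGMA n:{..N}. I n)" and fin: "\<And>n. finite (I n)"
    and im: "h ` (SIGMA n:{..N}. I n) \<subseteq> {..N} \<times> {..N}"
  shows "(\<Sum>n\<le>N. \<Sum>i\<in>I n. x (fst (h (n, i))) * y (snd (h (n, i)))) \<le> (\<Sum>n\<le>N. x n) * (\<Sum>n\<le>N. y n)"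
proof -
  have "(\<Sum>n\<le>N. \<Sum>i\<in>I n. x (fst (h (n, i))) * y (snd (h (n, i)))) =
      (\<Sum>p\<in>(SIGMA n:{..N}. I n). x (fst (h p)) * y (snd (h p)))"
    by (subst sum.Sigma) (auto simp: fin split_def)
  also have "\<dots> = (\<Sum>p\<in>h ` (SIGMA n:{..N}. I n). x (fst p) * y (snd p))"
    by (subst sum.reindex[OF inj]) simp
  also have "\<dots> \<le> (\<Sum>p\<in>{..N} \<times> {..N}. x (fst p) * y (snd p))"
    by (rule sum_mono2[OF _ im]) (auto simp: x y)
  also have "\<dots> = (\<Sum>n\<le>N. x n) * (\<Sum>n\<le>N. y n)"
    unfolding sum_product sum.cartesian_product by (simp add: split_def)
  finally show ?thesis .
qed

lemma sum_cv_le: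
  assumes "\<And>n. 0 \<le> x n" "\<And>n. 0 \<le> y n"
  shows "(\<Sum>n\<le>N. cv x y n) \<le> (\<Sum>n\<le>N. x n) * (\<Sum>n\<le>N. y n)"
proof -
  let ?h = "\<lambda>(n, i). (i, n - i)"
  have "inj_on ?h (SIGMA n:{..N}. {..n})" by (rule inj_onI) force
  moreover have "?h ` (SIGMA n:{..N}. {..n}) \<subseteq> {..N} \<times> {..N}" by force
  ultimately have "(\<Sum>n\<le>N. \<Sum>i\<le>n. x (fst (?h (n, i))) * y (snd (?h (n, i)))) \<le> (\<Sum>n\<le>N. x n) * (\<Sum>n\<le>N. y n)"
    by (intro sum_triangle_le[OF assms]) simp_all
  then show ?thesis unfolding cv_def by (simp only: split_conv fst_conv snd_conv)
qed

text \<open>These are the terms of order n + 1 of a product with both extreme terms removed.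
  Starting at i = 1 keeps the second index at most n, hence inside the square.\<close>

lemma sum_shifted_cv_le:
  fixes x y :: "nat \<Rightarrow> real"
  assumes "\<And>n. 0 \<le> x n" "\<And>n. 0 \<le> y n"
  shows "(\<Sum>n\<le>N. \<Sum>i = 1..n. x i * y (Suc n - i)) \<le> (\<Sum>n\<le>N. x n) * (\<Sum>n\<le>N. y n)"
proof -
  let ?h = "\<lambda>(n, i). (i, Suc n - i)"
  have "inj_on ?h (SIGMA n:{..N}. {1..n})" by (rule inj_onI) force
  moreover have "?h ` (SIGMA n:{..N}. {1..n}) \<subseteq> {..N} \<times> {..N}" by force
  ultimately have "(\<Sum>n\<le>N. \<Sum>i = 1..n. x (fst (?h (n, i))) * y (snd (?h (n, i)))) \<le> (\<Sum>n\<le>N. x n) * (\<Sum>n\<le>N. y n)"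
    by (intro sum_triangle_le[OF assms]) simp_all
  then show ?thesis by (simp only: split_conv fst_conv snd_conv)
qed

text \<open>Partial sums of a weighted Cauchy product are bounded by the product of the partial sums, so
  for a small weight \<open>\<rho>\<close> the recursion keeps all partial sums bounded.\<close>

lemma cubic_recursion_summable:
  fixes b m :: "nat \<Rightarrow> real"
  assumes b: "\<And>n. 0 \<le> b n" and m: "\<And>n. 0 \<le> m n" and m0: "m 0 = 0" and q: "0 \<le> q1" "0 \<le> q2"
    and mS: "\<And>n. m (Suc n) \<le> q1 * cv b (cv b b) n"
    and bS: "\<And>n. b (Suc n) \<le> q2 * ((\<Sum>i = 1..n. m i * b (Suc n - i)) + cv b (cv b b) n)"
  obtains \<rho> where "\<rho> > 0" "summable (\<lambda>n. b n * \<rho> ^ n)" "summable (\<lambda>n. m n * \<rho> ^ n)"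
proof -
  \<comment> \<open>The excess 1 over \<open>b 0\<close> is the room for the terms of positive
    order, which add up to at most \<rho> Q \<le> 1.\<close>
  define A where "A = b 0 + 1"
  have A: "A \<ge> 1" using b[of 0] by (simp add: A_def)
  \<comment> \<open>Obtained by inserting the bounds X \<le> A and M \<le> q1 \<rho> A^3 into the
    recursion and taking out one factor \<rho>.\<close>
  define Q where "Q = q2 * (q1 * A ^ 4 + A ^ 3)"
  have Q: "Q \<ge> 0" unfolding Q_def using q A by (intro mult_nonneg_nonneg add_nonneg_nonneg) auto
  define \<rho> where "\<rho> = 1 / (1 + Q)"
  have \<rho>: "\<rho> > 0" "\<rho> * Q \<le> 1" using Q by (auto simp: \<rho>_def field_simps)
  define X where "X N = (\<Sum>n\<le>N. b n * \<rho> ^ n)" for N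
  define M where "M N = (\<Sum>n\<le>N. m n * \<rho> ^ n)" for N
  have bp: "0 \<le> b n * \<rho> ^ n" "0 \<le> m n * \<rho> ^ n" for n using b m \<rho> by simp_all
  have X0: "0 \<le> X N" "0 \<le> M N" for N unfolding X_def M_def by (intro sum_nonneg bp)+
  have cub: "(\<Sum>n\<le>N. cv b (cv b b) n * \<rho> ^ n) \<le> X N ^ 3" for N
  proof -
    have "(\<Sum>n\<le>N. cv b (cv b b) n * \<rho> ^ n) =
        (\<Sum>n\<le>N. cv (\<lambda>n. b n * \<rho> ^ n) (cv (\<lambda>n. b n * \<rho> ^ n) (\<lambda>n. b n * \<rho> ^ n)) n)"
    proof -
      have "cv (\<lambda>n. b n * \<rho> ^ n) (\<lambda>n. b n * \<rho> ^ n) = (\<lambda>n. cv b b n * \<rho> ^ n)"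
        by (rule ext) (rule cv_scale)
      then show ?thesis by (simp only: cv_scale)
    qed
    also have "\<dots> \<le> X N * (\<Sum>n\<le>N. cv (\<lambda>n. b n * \<rho> ^ n) (\<lambda>n. b n * \<rho> ^ n) n)"
      unfolding X_def by (rule sum_cv_le) (auto intro: bp cv_nonneg)
    also have "\<dots> \<le> X N * (X N * X N)"
      unfolding X_def by (intro mult_left_mono sum_cv_le sum_nonneg bp)
    finally show ?thesis by (simp add: power3_eq_cube mult.assoc)
  qed
  have MS: "M (Suc N) \<le> q1 * \<rho> * X N ^ 3" for N
  proof -
    have "M (Suc N) = (\<Sum>n\<le>N. m (Suc n) * \<rho> ^ Suc n)"
      unfolding M_def by (subst sum.atMost_Suc_shift) (simp add: m0)
    also have "\<dots> \<le> (\<Sum>n\<le>N. q1 * cv b (cv b b) n * \<rho> ^ Suc n)"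
      by (intro sum_mono mult_right_mono mS) (use \<rho> in auto)
    also have "\<dots> = q1 * \<rho> * (\<Sum>n\<le>N. cv b (cv b b) n * \<rho> ^ n)"
      by (simp add: sum_distrib_left algebra_simps)
    also have "\<dots> \<le> q1 * \<rho> * X N ^ 3" using cub q \<rho> by (intro mult_left_mono) auto
    finally show ?thesis .
  qed
  have XS: "X (Suc N) \<le> b 0 + q2 * (M N * X N + \<rho> * X N ^ 3)" for N
  proof -
    have "X (Suc N) = b 0 + (\<Sum>n\<le>N. b (Suc n) * \<rho> ^ Suc n)"
      unfolding X_def by (subst sum.atMost_Suc_shift) simp
    also have "(\<Sum>n\<le>N. b (Suc n) * \<rho> ^ Suc n) \<le>
        (\<Sum>n\<le>N. q2 * ((\<Sum>i = 1..n. m i * b (Suc n - i)) + cv b (cv b b) n) * \<rho> ^ Suc n)"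
      by (intro sum_mono mult_right_mono bS) (use \<rho> in auto)
    also have "\<dots> = q2 * ((\<Sum>n\<le>N. \<Sum>i = 1..n. (m i * \<rho> ^ i) * (b (Suc n - i) * \<rho> ^ (Suc n - i)))
        + \<rho> * (\<Sum>n\<le>N. cv b (cv b b) n * \<rho> ^ n))"
    proof -
      have *: "(\<Sum>i = 1..n. (m i * \<rho> ^ i) * (b (Suc n - i) * \<rho> ^ (Suc n - i))) =
          (\<Sum>i = 1..n. m i * b (Suc n - i)) * \<rho> ^ Suc n" for n
        unfolding sum_distrib_right
      proof (rule sum.cong)
        fix i assume "i \<in> {1..n}"
        then have "\<rho> ^ i * \<rho> ^ (Suc n - i) = \<rho> ^ Suc n" by (simp add: power_add[symmetric] del: power_Suc)
        then show "(m i * \<rho> ^ i) * (b (Suc n - i) * \<rho> ^ (Suc n - i)) = m i * b (Suc n - i) * \<rho> ^ Suc n"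
          by (metis mult.assoc mult.left_commute)
      qed simp
      show ?thesis unfolding * sum_distrib_left sum.distrib[symmetric] by (rule sum.cong) (simp_all add: algebra_simps)
    qed
    also have "\<dots> \<le> q2 * (M N * X N + \<rho> * X N ^ 3)"
      unfolding M_def X_def
      by (intro mult_left_mono add_mono sum_shifted_cv_le cub[unfolded X_def] bp) (use \<rho> q in auto)
    finally show ?thesis by simp
  qed
  have bnd: "X N \<le> A \<and> M N \<le> q1 * \<rho> * A ^ 3" for N
  proof (induction N)
    case 0
    show ?case using q \<rho> A by (simp add: X_def M_def A_def m0)
  next
    case (Suc N)
    have c: "X N ^ 3 \<le> A ^ 3" using Suc X0 by (intro power_mono) auto
    have "M (Suc N) \<le> q1 * \<rho> * A ^ 3"
      using MS[of N] mult_left_mono[OF c, of "q1 * \<rho>"] q \<rho> by simp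
    moreover have "X (Suc N) \<le> A"
    proof -
      have "0 \<le> q1 * \<rho> * A ^ 3" using q \<rho> A by simp
      then have "M N * X N \<le> (q1 * \<rho> * A ^ 3) * A" using Suc X0 A by (intro mult_mono) auto
      then have "q2 * (M N * X N + \<rho> * X N ^ 3) \<le> q2 * ((q1 * \<rho> * A ^ 3) * A + \<rho> * A ^ 3)"
        using c q \<rho> by (intro mult_left_mono add_mono) auto
      also have "\<dots> = \<rho> * Q" by (simp add: Q_def algebra_simps power4_eq_xxxx power3_eq_cube)
      finally show ?thesis using XS[of N] \<rho> by (simp add: A_def)
    qed
    ultimately show ?case by simp
  qed
  have sm: "summable f" if "\<And>n. 0 \<le> f n" "\<And>N. (\<Sum>n\<le>N. f n) \<le> B" for f :: "nat \<Rightarrow> real" and B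
    by (rule bounded_imp_summable[OF that])
  show ?thesis
    by (rule that[OF \<rho>(1)]; rule sm[OF bp(1)] sm[OF bp(2)]) (use bnd in \<open>auto simp: X_def M_def\<close>)
qed

text \<open>Course-of-values recursion. Masking the values from index n on makes termination
  evident; a functional that looks only below n cannot notice the mask. As a rewrite rule the
  defining equation would unfold without end.\<close>

fun course_rec :: "(nat \<Rightarrow> (nat \<Rightarrow> 'a) \<Rightarrow> 'a) \<Rightarrow> nat \<Rightarrow> 'a" where
  "course_rec F n = F n (\<lambda>i. if i < n then course_rec F i else undefined)"

declare course_rec.simps [simp del]

lemma course_rec_exists:
  fixes F :: "nat \<Rightarrow> (nat \<Rightarrow> 'a) \<Rightarrow> 'a"
  assumes "\<And>n x y. (\<And>i. i < n \<Longrightarrow> x i = y i) \<Longrightarrow> F n x = F n y"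
  obtains x where "\<And>n. x n = F n x"
proof (rule that)
  show "course_rec F n = F n (course_rec F)" for n
    by (subst course_rec.simps, rule assms) simp
qed

section \<open>Power series estimates that depend only on a majorant\<close>

lemma ps_summable:
  fixes s R :: real
  assumes "\<And>n. \<bar>v n\<bar> \<le> b n" "\<And>x. \<bar>x\<bar> < R \<Longrightarrow> summable (\<lambda>n. b n * x ^ n)" "\<bar>s\<bar> < R"
  shows "summable (\<lambda>n. \<bar>v n * s ^ n\<bar>)" "summable (\<lambda>n. v n * s ^ n)"
proof -
  show "summable (\<lambda>n. \<bar>v n * s ^ n\<bar>)"
  proof (rule summable_comparison_test'[where N = 0])
    show "summable (\<lambda>n. b n * \<bar>s\<bar> ^ n)" by (rule assms(2)) (use assms(3) in simp)
    show "norm \<bar>v n * s ^ n\<bar> \<le> b n * \<bar>s\<bar> ^ n" for n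
      using mult_right_mono[OF assms(1)[of n], of "\<bar>s\<bar> ^ n"] by (simp add: abs_mult power_abs)
  qed
  then show "summable (\<lambda>n. v n * s ^ n)" by (rule summable_rabs_cancel)
qed

lemma abs_power_diff_le:
  fixes r s :: real
  assumes "\<bar>r\<bar> \<le> K" "\<bar>s\<bar> \<le> K"
  shows "\<bar>r ^ n - s ^ n\<bar> \<le> real n * K ^ (n - 1) * \<bar>r - s\<bar>"
proof (induction n)
  case (Suc n)
  have K: "0 \<le> K" using assms by linarith
  have "\<bar>r ^ Suc n - s ^ Suc n\<bar> = \<bar>r * (r ^ n - s ^ n) + (r - s) * s ^ n\<bar>" by (simp add: algebra_simps)
  also have "\<dots> \<le> \<bar>r\<bar> * \<bar>r ^ n - s ^ n\<bar> + \<bar>r - s\<bar> * \<bar>s\<bar> ^ n"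
    by (metis abs_mult abs_triangle_ineq power_abs)
  also have "\<dots> \<le> K * (real n * K ^ (n - 1) * \<bar>r - s\<bar>) + \<bar>r - s\<bar> * K ^ n"
    using assms K Suc by (intro add_mono mult_mono power_mono) auto
  also have "\<dots> = real (Suc n) * K ^ (Suc n - 1) * \<bar>r - s\<bar>"
    by (cases n) (auto simp: algebra_simps)
  finally show ?case .
qed simp

lemma summable_diffs:
  assumes "\<And>x::real. \<bar>x\<bar> < R \<Longrightarrow> summable (\<lambda>n. b n * x ^ n)" "\<bar>x\<bar> < R"
  shows "summable (\<lambda>n. diffs b n * x ^ n)"
  by (rule termdiff_converges[of x R]) (use assms in auto)

text \<open>The constant comes from the differentiated majorant and not from the coefficients, so it
  is uniform in t when the coefficients are values of functions at t.\<close>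

lemma ps_Lipschitz:
  assumes b: "\<And>x::real. \<bar>x\<bar> < R \<Longrightarrow> summable (\<lambda>n. b n * x ^ n)" and b0: "\<And>n. 0 \<le> b n" and "0 \<le> K" "K < R"
  obtains L where "L \<ge> 0" "\<And>v r s. (\<And>n. \<bar>v n\<bar> \<le> b n) \<Longrightarrow> \<bar>r\<bar> \<le> K \<Longrightarrow> \<bar>s\<bar> \<le> K \<Longrightarrow> \<bar>ps v r - ps v s\<bar> \<le> L * \<bar>r - s\<bar>"
proof -
  have "summable (\<lambda>n. diffs b n * K ^ n)" by (rule summable_diffs[OF b]) (use assms in auto)
  then have "summable (\<lambda>n. b (Suc n) * (real (Suc n) * K ^ (Suc n - 1)))" by (simp add: diffs_def mult.commute mult.left_commute)
  then have s: "summable (\<lambda>n. b n * (real n * K ^ (n - 1)))"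
    using summable_Suc_iff[of "\<lambda>n. b n * (real n * K ^ (n - 1))"] by blast
  define L where "L = (\<Sum>n. b n * (real n * K ^ (n - 1)))"
  show ?thesis
  proof (rule that)
    show "L \<ge> 0" unfolding L_def by (rule suminf_nonneg[OF s]) (use assms in auto)
    fix v r q assume v: "\<And>n. \<bar>v n\<bar> \<le> b n" and rq: "\<bar>r\<bar> \<le> K" "\<bar>q\<bar> \<le> K"
    have sr: "summable (\<lambda>n. v n * r ^ n)" by (rule ps_summable(2)[OF v b]) (use rq assms in auto)
    have sq: "summable (\<lambda>n. v n * q ^ n)" by (rule ps_summable(2)[OF v b]) (use rq assms in auto)
    have "ps v r - ps v q = (\<Sum>n. v n * r ^ n - v n * q ^ n)"
      unfolding ps_def by (rule suminf_diff[OF sr sq])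
    also have "\<bar>\<dots>\<bar> \<le> (\<Sum>n. b n * (real n * K ^ (n - 1)) * \<bar>r - q\<bar>)"
    proof (rule abs_suminf_le(1)[OF _ summable_mult2[OF s]])
      fix n
      have "\<bar>v n * r ^ n - v n * q ^ n\<bar> = \<bar>v n\<bar> * \<bar>r ^ n - q ^ n\<bar>" by (metis abs_mult right_diff_distrib)
      also have "\<dots> \<le> b n * (real n * K ^ (n - 1) * \<bar>r - q\<bar>)"
        by (intro mult_mono v abs_power_diff_le rq b0) auto
      finally show "\<bar>v n * r ^ n - v n * q ^ n\<bar> \<le> b n * (real n * K ^ (n - 1)) * \<bar>r - q\<bar>" by (simp add: mult.assoc)
    qed
    also have "\<dots> = L * \<bar>r - q\<bar>" unfolding L_def by (rule suminf_mult2[OF s, symmetric])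
    finally show "\<bar>ps v r - ps v q\<bar> \<le> L * \<bar>r - q\<bar>" .
  qed
qed

text \<open>A second-order Taylor estimate in which \<delta> and L depend only on the majorant;
  uniformity over the coefficient sequences is what later gives convergence of difference quotients
  in the norm.\<close>

lemma ps_difference_quotient:
  assumes b: "\<And>x::real. \<bar>x\<bar> < R \<Longrightarrow> summable (\<lambda>n. b n * x ^ n)" and b0: "\<And>n. 0 \<le> b n" and s: "\<bar>s\<bar> < R"
  obtains L \<delta> where "\<delta> > 0" "L \<ge> 0" "\<And>v h. (\<And>n. \<bar>v n\<bar> \<le> b n) \<Longrightarrow> h \<noteq> 0 \<Longrightarrow> \<bar>h\<bar> < \<delta> \<Longrightarrow>
      \<bar>s + h\<bar> < R \<and> \<bar>(ps v (s + h) - ps v s) / h - ps (diffs v) s\<bar> \<le> L * \<bar>h\<bar>"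
proof -
  \<comment> \<open>Strictly between |s| and R: for small h the point s + h stays within K, while
    the twice differentiated majorant still converges at K.\<close>
  define K where "K = (\<bar>s\<bar> + R) / 2"
  have K: "\<bar>s\<bar> < K" "K < R" "0 \<le> K" using s by (auto simp: K_def)
  have "summable (\<lambda>n. diffs (diffs b) n * K ^ n)" by (intro summable_diffs[OF summable_diffs[OF b]]) (use K in auto)
  then have "summable (\<lambda>n. b (Suc (Suc n)) * (real (Suc (Suc n)) * real (Suc (Suc n) - 1) * K ^ (Suc (Suc n) - 2)))"
    by (simp add: diffs_def algebra_simps)
  then have sm: "summable (\<lambda>n. b n * (real n * real (n - 1) * K ^ (n - 2)))"
    using summable_Suc_iff[of "\<lambda>n. b n * (real n * real (n - 1) * K ^ (n - 2))"]
      summable_Suc_iff[of "\<lambda>n. b (Suc n) * (real (Suc n) * real (Suc n - 1) * K ^ (Suc n - 2))"] by blast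
  define L where "L = (\<Sum>n. b n * (real n * real (n - 1) * K ^ (n - 2)))"
  show ?thesis
  proof (rule that)
    show "K - \<bar>s\<bar> > 0" using K by simp
    show "L \<ge> 0" unfolding L_def by (rule suminf_nonneg[OF sm]) (use b0 K in auto)
    fix v h assume v: "\<And>n. \<bar>v n\<bar> \<le> b n" and h: "h \<noteq> 0" "\<bar>h\<bar> < K - \<bar>s\<bar>"
    have sh: "\<bar>s + h\<bar> \<le> K" "\<bar>s\<bar> \<le> K" using h K by auto
    then have shR: "\<bar>s + h\<bar> < R" using K by linarith
    have s1: "summable (\<lambda>n. v n * (s + h) ^ n)" and s2: "summable (\<lambda>n. v n * s ^ n)"
      by (rule ps_summable(2)[OF v b shR] ps_summable(2)[OF v b s]; assumption)+
    have s3: "summable (\<lambda>n. diffs v n * s ^ n)"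
      by (rule summable_diffs[OF ps_summable(2)[OF v b] s]; assumption)
    have d: "(\<lambda>n. real n * v n * s ^ (n - Suc 0)) sums ps (diffs v) s"
      using diffs_equiv[OF s3] by (simp add: ps_def)
    have "(\<lambda>n. (v n * (s + h) ^ n - v n * s ^ n) / h - real n * v n * s ^ (n - Suc 0)) sums
        ((ps v (s + h) - ps v s) / h - ps (diffs v) s)"
      unfolding ps_def[of v] by (intro sums_diff sums_divide summable_sums s1 s2 d)
    then have eq: "(ps v (s + h) - ps v s) / h - ps (diffs v) s =
       (\<Sum>n. (v n * (s + h) ^ n - v n * s ^ n) / h - real n * v n * s ^ (n - Suc 0))"
      by (rule sums_unique)
    have "\<bar>(ps v (s + h) - ps v s) / h - ps (diffs v) s\<bar> \<le> (\<Sum>n. b n * (real n * real (n - 1) * K ^ (n - 2)) * \<bar>h\<bar>)"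
      unfolding eq
    proof (rule abs_suminf_le(1)[OF _ summable_mult2[OF sm]])
      fix n
      have "(v n * (s + h) ^ n - v n * s ^ n) / h - real n * v n * s ^ (n - Suc 0) =
         v n * (((s + h) ^ n - s ^ n) / h - real n * s ^ (n - Suc 0))"
        using h by (simp add: field_simps)
      also have "\<bar>\<dots>\<bar> = \<bar>v n\<bar> * \<bar>((s + h) ^ n - s ^ n) / h - real n * s ^ (n - Suc 0)\<bar>" by (rule abs_mult)
      also have "\<dots> \<le> b n * (real n * real (n - 1) * K ^ (n - 2) * \<bar>h\<bar>)"
        using lemma_termdiff3[of h s K n] h sh by (intro mult_mono v b0) auto
      finally show "\<bar>(v n * (s + h) ^ n - v n * s ^ n) / h - real n * v n * s ^ (n - Suc 0)\<bar> \<le>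
          b n * (real n * real (n - 1) * K ^ (n - 2)) * \<bar>h\<bar>" by (simp add: mult.assoc)
    qed
    also have "\<dots> = L * \<bar>h\<bar>" unfolding L_def by (rule suminf_mult2[OF sm, symmetric])
    finally show "\<bar>s + h\<bar> < R \<and> \<bar>(ps v (s + h) - ps v s) / h - ps (diffs v) s\<bar> \<le> L * \<bar>h\<bar>" using shR by simp
  qed
qed

lemma ps_smooth_on:
  assumes b: "\<And>x::real. \<bar>x\<bar> < R \<Longrightarrow> summable (\<lambda>n. b n * x ^ n)"
    and f: "\<And>s. \<bar>s\<bar> < R \<Longrightarrow> f s = ps b s"
  shows "smooth_on {-R<..<R} f"
proof -
  have sm: "summable (\<lambda>n. (diffs ^^ p) b n * x ^ n)" if "\<bar>x\<bar> < R" for p x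
    using that by (induction p arbitrary: x) (auto intro!: b summable_diffs[where R = R])
  have d: "(ps ((diffs ^^ p) b) has_real_derivative ps ((diffs ^^ Suc p) b) s) (at s)" if "\<bar>s\<bar> < R" for p s
    using termdiffs_strong'[of R "(diffs ^^ p) b" s] sm that by (simp add: ps_def[abs_def])
  have tr: "((deriv ^^ p) f has_real_derivative ps ((diffs ^^ Suc p) b) s) (at s)"
    if "\<And>s. \<bar>s\<bar> < R \<Longrightarrow> (deriv ^^ p) f s = ps ((diffs ^^ p) b) s" "\<bar>s\<bar> < R" for p s
    by (rule has_field_derivative_transform_within_open[OF d[OF that(2)], of "{-R<..<R}"])
       (use that in \<open>auto simp: abs_less_iff\<close>)
  have eq: "(deriv ^^ p) f s = ps ((diffs ^^ p) b) s" if "\<bar>s\<bar> < R" for p s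
    using that
  proof (induction p arbitrary: s)
    case 0 then show ?case by (simp add: f)
  next
    case (Suc p)
    from tr[OF Suc.IH Suc.prems] show ?case by (auto dest: DERIV_imp_deriv)
  qed
  show ?thesis
    unfolding smooth_on_def field_differentiable_def
  proof (intro allI ballI exI)
    fix p s assume "s \<in> {-R<..<R}"
    then have "\<bar>s\<bar> < R" by auto
    from tr[OF eq this] show "((deriv ^^ p) f has_real_derivative ps ((diffs ^^ Suc p) b) s) (at s)" by simp
  qed
qed

text \<open>The weight \<open>(diffs ^^ p) (\<lambda>_. 1) n\<close> is (n + p)! / n!. Separating it
  makes the p-th derivative a fixed linear combination of shifted coefficients, so bounds and linear
  constraints on the coefficients carry over.\<close>

lemma funpow_diffs: "(diffs ^^ p) f n = (diffs ^^ p) (\<lambda>_. 1::real) n * f (n + p)"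
proof (induction p arbitrary: n)
  case (Suc p)
  show ?case
    unfolding funpow.simps o_apply diffs_def[of "(diffs ^^ p) f"] diffs_def[of "(diffs ^^ p) (\<lambda>_. 1)"] Suc[of "Suc n"]
    by simp
qed simp

lemma funpow_diffs_1_nonneg: "0 \<le> (diffs ^^ p) (\<lambda>_. 1::real) n"
  by (induction p arbitrary: n) (auto simp: diffs_def)

text \<open>Derivatives of all orders are series in the shifted coefficients, so membership in Y is
  demanded for precisely such series. Error bounds for the function and its two derivatives, uniform
  in t, give convergence of the difference quotients in the norm.\<close>

lemma smooth_map_H2_ps:
  assumes T: "T > 0" and r: "\<And>n. H2rep T (v n) (v1 n) (v2 n)"
    and c: "\<And>n t. t \<in> {0..T} \<Longrightarrow> \<bar>v n t\<bar> \<le> b n" "\<And>n t. t \<in> {0..T} \<Longrightarrow> \<bar>v1 n t\<bar> \<le> b n"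
      "\<And>n t. t \<in> {0..T} \<Longrightarrow> \<bar>v2 n t\<bar> \<le> b n"
    and b0: "\<And>n. 0 \<le> b n" and b: "\<And>x::real. \<bar>x\<bar> < R \<Longrightarrow> summable (\<lambda>n. b n * x ^ n)"
    and \<epsilon>: "\<epsilon> \<le> R" and \<Gamma>: "\<And>s. \<bar>s\<bar> < R \<Longrightarrow> \<Gamma> s = (\<lambda>t. ps (\<lambda>n. v n t) s)"
    and Y: "\<And>k p. summable (\<lambda>n. \<bar>k n\<bar> * b (n + p)) \<Longrightarrow> (\<lambda>t. \<Sum>n. k n * v (n + p) t) \<in> Y"
  shows "smooth_map_H2 T Y \<epsilon> \<Gamma>"
proof -
  let ?d = "\<lambda>p n. (diffs ^^ p) (\<lambda>_. 1::real) n"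
  \<comment> \<open>The candidate for the derivative of order p, available for each of the three
    coefficient families.\<close>
  define D where "D f p s t = ps ((diffs ^^ p) (\<lambda>n. f n t)) s" for f :: "nat \<Rightarrow> real \<Rightarrow> real" and p s t
  have D_alt: "D f p s t = (\<Sum>n. (?d p n * s ^ n) * f (n + p) t)" for f p s t
    unfolding D_def ps_def by (subst funpow_diffs) (simp add: mult_ac)
  have sb: "summable (\<lambda>n. (diffs ^^ p) b n * x ^ n)" if "\<bar>x\<bar> < R" for p x
    using that by (induction p arbitrary: x) (auto intro!: b summable_diffs[where R = R])
  have sb': "summable (\<lambda>n. \<bar>?d p n * s ^ n\<bar> * b (n + p))" if "\<bar>s\<bar> < R" for p s
  proof -
    have "summable (\<lambda>n. (diffs ^^ p) b n * \<bar>s\<bar> ^ n)" by (rule sb) (use that in simp)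
    then show ?thesis
      by (subst (asm) funpow_diffs) (simp add: abs_mult power_abs funpow_diffs_1_nonneg mult_ac)
  qed
  have D_rep: "H2rep T (D v p s) (D v1 p s) (D v2 p s)" if s: "\<bar>s\<bar> < R" for p s
  proof -
    have "\<bar>?d p n * s ^ n * f (n + p) t\<bar> \<le> \<bar>?d p n * s ^ n\<bar> * b (n + p)"
      if "\<And>n t. t \<in> {0..T} \<Longrightarrow> \<bar>f n t\<bar> \<le> b n" "t \<in> {0..T}" for f n t
      unfolding abs_mult[of "?d p n * s ^ n"] by (intro mult_left_mono that) auto
    then have "H2rep T (\<lambda>t. \<Sum>n. (?d p n * s ^ n) * v (n + p) t) (\<lambda>t. \<Sum>n. (?d p n * s ^ n) * v1 (n + p) t)
        (\<lambda>t. \<Sum>n. (?d p n * s ^ n) * v2 (n + p) t)"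
      by (intro H2rep_suminf[OF T H2rep_cmult[OF r] _ _ _ sb'[OF s]]) (use c in blast)+
    then show ?thesis unfolding D_alt[abs_def] .
  qed
  have bnd: "\<bar>(diffs ^^ p) f n\<bar> \<le> (diffs ^^ p) b n" if "\<And>n. \<bar>f n\<bar> \<le> b n" for f p n
    unfolding funpow_diffs[of p f] funpow_diffs[of p b] abs_mult
    using funpow_diffs_1_nonneg that by (intro mult_mono) auto
  have bnd0: "0 \<le> (diffs ^^ p) b n" for p n
    unfolding funpow_diffs[of p b] using funpow_diffs_1_nonneg b0 by (intro mult_nonneg_nonneg)
  show ?thesis unfolding smooth_map_H2_def
  proof (intro exI conjI allI ballI)
    fix s assume "s \<in> {-\<epsilon><..<\<epsilon>}"
    then have s: "\<bar>s\<bar> < R" using \<epsilon> by auto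
    show "D v 0 s = \<Gamma> s" using \<Gamma>[OF s] by (simp add: D_def[abs_def])
    fix p
    show "D v p s \<in> Y" using Y[OF sb'[OF s]] unfolding D_alt[abs_def] .
    obtain L \<delta> where L: "\<delta> > 0" "L \<ge> 0" "\<And>f h. (\<And>n. \<bar>f n\<bar> \<le> (diffs ^^ p) b n) \<Longrightarrow> h \<noteq> 0 \<Longrightarrow> \<bar>h\<bar> < \<delta> \<Longrightarrow>
      \<bar>s + h\<bar> < R \<and> \<bar>(ps f (s + h) - ps f s) / h - ps (diffs f) s\<bar> \<le> L * \<bar>h\<bar>"
    proof (rule ps_difference_quotient[where b = "(diffs ^^ p) b" and R = R and s = s, OF sb bnd0 s])
      fix \<delta> L :: real
      assume 1: "\<delta> > 0" and 2: "L \<ge> 0" and 3: "\<And>f h. (\<And>n. \<bar>f n\<bar> \<le> (diffs ^^ p) b n) \<Longrightarrow> h \<noteq> 0 \<Longrightarrow> \<bar>h\<bar> < \<delta> \<Longrightarrow>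
        \<bar>s + h\<bar> < R \<and> \<bar>(ps f (s + h) - ps f s) / h - ps (diffs f) s\<bar> \<le> L * \<bar>h\<bar>"
      show thesis by (rule that[OF 1 2 3])
    qed
    have quot: "\<bar>s + h\<bar> < R \<and> \<bar>(D f p (s + h) t - D f p s t) / h - D f (Suc p) s t\<bar> \<le> L * \<bar>h\<bar>"
      if "h \<noteq> 0" "\<bar>h\<bar> < \<delta>" "\<And>n t. t \<in> {0..T} \<Longrightarrow> \<bar>f n t\<bar> \<le> b n" "t \<in> {0..T}" for f h t
      using L(3)[OF bnd[of "\<lambda>n. f n t"] that(1,2)] that(3,4) by (simp add: D_def)
    show "((\<lambda>h. H2_norm T (\<lambda>t. (D v p (s + h) t - D v p s t) / h - D v (Suc p) s t)) \<longlongrightarrow> 0) (at 0)"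
    proof (rule Lim_null_comparison)
      show "((\<lambda>h. sqrt (3 * T) * (L * \<bar>h\<bar>)) \<longlongrightarrow> 0) (at 0)"
        by (auto intro!: tendsto_eq_intros)
      have "\<forall>\<^sub>F h in at 0. h \<noteq> 0 \<and> \<bar>h\<bar> < \<delta>"
        using L(1) by (auto simp: eventually_at dist_real_def)
      then show "\<forall>\<^sub>F h in at 0. norm (H2_norm T (\<lambda>t. (D v p (s + h) t - D v p s t) / h - D v (Suc p) s t)) \<le> sqrt (3 * T) * (L * \<bar>h\<bar>)"
      proof eventually_elim
        case (elim h)
        then have sh: "\<bar>s + h\<bar> < R" using L(3)[of "\<lambda>_. 0" h] bnd0 by simp
        have rep: "H2rep T (\<lambda>t. (1 / h) * (D v p (s + h) t - D v p s t) - D v (Suc p) s t)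
            (\<lambda>t. (1 / h) * (D v1 p (s + h) t - D v1 p s t) - D v1 (Suc p) s t)
            (\<lambda>t. (1 / h) * (D v2 p (s + h) t - D v2 p s t) - D v2 (Suc p) s t)"
          by (intro H2rep_diff H2rep_cmult D_rep s sh)
        have "H2_norm T (\<lambda>t. (1 / h) * (D v p (s + h) t - D v p s t) - D v (Suc p) s t) \<le> sqrt (3 * T) * (L * \<bar>h\<bar>)"
          by (rule H2_norm_le_sup[OF T rep])
             (use L(2) quot[OF conjunct1[OF elim] conjunct2[OF elim] c(1)]
               quot[OF conjunct1[OF elim] conjunct2[OF elim] c(2)]
               quot[OF conjunct1[OF elim] conjunct2[OF elim] c(3)] in \<open>simp_all add: divide_inverse mult.commute\<close>)
        moreover have "0 \<le> H2_norm T (\<lambda>t. (1 / h) * (D v p (s + h) t - D v p s t) - D v (Suc p) s t)"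
          unfolding H2_norm_def using H2_inner_nonneg[OF T rep] by simp
        ultimately show ?case by simp
      qed
    qed
  qed
qed

text \<open>Coefficients of the series c in s^2 when it is read as a series in s.\<close>

definition interleave :: "(nat \<Rightarrow> real) \<Rightarrow> nat \<Rightarrow> real" where
  "interleave c n = (if even n then c (n div 2) else 0)"

lemma interleave_sums: "(\<lambda>n. c n * (s\<^sup>2) ^ n) sums l \<longleftrightarrow> (\<lambda>n. interleave c n * s ^ n) sums l"
proof -
  have "strict_mono ((*) (2::nat))" by (rule strict_monoI) simp
  moreover have "interleave c n * s ^ n = 0" if "n \<notin> range ((*) 2)" for n
    using that by (auto simp: interleave_def elim!: evenE)
  ultimately have "(\<lambda>n. interleave c (2 * n) * s ^ (2 * n)) sums l \<longleftrightarrow> (\<lambda>n. interleave c n * s ^ n) sums l"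
    by (rule sums_mono_reindex)
  then show ?thesis by (simp add: interleave_def power_mult)
qed

lemma interleave_summable: "summable (\<lambda>n. c n * (s\<^sup>2) ^ n) \<Longrightarrow> summable (\<lambda>n. interleave c n * s ^ n)"
  unfolding summable_def interleave_sums .

lemma ps_interleave: "ps (interleave c) s = ps c (s\<^sup>2)"
  unfolding ps_def suminf_def interleave_sums ..

section \<open>Symmetry classes\<close>

text \<open>A pointwise condition, in contrast to \<open>even_fun\<close> and
  \<open>odd_fun\<close>; for continuous functions the two agree. A set of signs, rather than one
  sign, makes room for the class without symmetry.\<close>

definition symE :: "real \<Rightarrow> real set \<Rightarrow> (real \<Rightarrow> real) \<Rightarrow> bool" where
  "symE T E f \<longleftrightarrow> (\<forall>\<epsilon>\<in>E. \<forall>t\<in>{0..T}. f (T - t) = \<epsilon> * f t)"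

lemma symED: "symE T E f \<Longrightarrow> \<epsilon> \<in> E \<Longrightarrow> t \<in> {0..T} \<Longrightarrow> f (T - t) = \<epsilon> * f t"
  by (auto simp: symE_def)

lemma symE_lincomb: "symE T E f \<Longrightarrow> symE T E g \<Longrightarrow> symE T E (\<lambda>t. c * f t + d * g t)"
  by (auto simp: symE_def algebra_simps)

lemma symE_diff: "symE T E f \<Longrightarrow> symE T E g \<Longrightarrow> symE T E (\<lambda>t. f t - g t)"
  by (auto simp: symE_def algebra_simps)

lemma symE_cmult: "symE T E f \<Longrightarrow> symE T E (\<lambda>t. c * f t)"
  by (auto simp: symE_def algebra_simps)

lemma symE_add: "symE T E f \<Longrightarrow> symE T E g \<Longrightarrow> symE T E (\<lambda>t. f t + g t)"
  by (auto simp: symE_def algebra_simps)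

lemma symE_sum: "(\<And>i. i \<in> I \<Longrightarrow> symE T E (f i)) \<Longrightarrow> symE T E (\<lambda>t. \<Sum>i\<in>I. f i t)"
  by (auto simp: symE_def sum_distrib_left intro!: sum.cong)

lemma symE_cong: "symE T E f \<Longrightarrow> (\<And>t. t \<in> {0..T} \<Longrightarrow> g t = f t) \<Longrightarrow> symE T E g"
  unfolding symE_def by (metis atLeastAtMost_iff diff_ge_0_iff_ge diff_left_mono diff_zero)

text \<open>A cubic term with even coefficient respects every class because a sign satisfies
  \<epsilon>^3 = \<epsilon>.\<close>

lemma symE_mult3:
  assumes "E \<subseteq> {-1, 1}" "\<And>t. t \<in> {0..T} \<Longrightarrow> a (T - t) = a t" "symE T E f" "symE T E g" "symE T E h"
  shows "symE T E (\<lambda>t. a t * (f t * (g t * h t)))"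
  unfolding symE_def
proof (intro ballI)
  fix \<epsilon> t assume \<epsilon>: "\<epsilon> \<in> E" and t: "t \<in> {0..T}"
  have "a (T - t) * (f (T - t) * (g (T - t) * h (T - t))) = a t * (\<epsilon> * f t * (\<epsilon> * g t * (\<epsilon> * h t)))"
    using assms(2)[OF t] symED[OF assms(3) \<epsilon> t] symED[OF assms(4) \<epsilon> t] symED[OF assms(5) \<epsilon> t] by simp
  also have "\<dots> = (\<epsilon> * \<epsilon>) * \<epsilon> * (a t * (f t * (g t * h t)))" by (simp add: mult_ac)
  also have "\<epsilon> * \<epsilon> = 1" using assms(1) \<epsilon> by auto
  finally show "a (T - t) * (f (T - t) * (g (T - t) * h (T - t))) = \<epsilon> * (a t * (f t * (g t * h t)))" by simp
qed

lemma symE_suminf: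
  assumes "\<And>n. symE T E (f n)" "\<And>n t. t \<in> {0..T} \<Longrightarrow> \<bar>f n t\<bar> \<le> c n" "summable c"
  shows "symE T E (\<lambda>t. \<Sum>n. f n t)"
  unfolding symE_def
proof (intro ballI)
  fix \<epsilon> t assume \<epsilon>: "\<epsilon> \<in> E" and t: "t \<in> {0..T}"
  have "summable (\<lambda>n. f n t)" by (rule abs_suminf_le(2)[OF assms(2)[OF t] assms(3)])
  then have "\<epsilon> * (\<Sum>n. f n t) = (\<Sum>n. \<epsilon> * f n t)" by (rule suminf_mult[symmetric])
  then show "(\<Sum>n. f n (T - t)) = \<epsilon> * (\<Sum>n. f n t)" using symED[OF assms(1) \<epsilon> t] by simp
qed

lemma lint_lincomb3:
  assumes "integrable (lebesgue_on {a..b}) f" "integrable (lebesgue_on {a..b}) g" "integrable (lebesgue_on {a..b}) h"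
  shows "lint a b (\<lambda>t. p * f t + q * g t + r * h t) = p * lint a b f + q * lint a b g + r * lint a b h"
  using assms by simp

section \<open>Local bifurcation from a one-dimensional kernel\<close>

text \<open>\<open>E\<close> encodes the symmetry class: \<open>{}\<close>, \<open>{1}\<close> and \<open>{-1}\<close> stand for all, even and odd functions;
  \<open>e\<close> spans the kernel of \<open>u'' + \<sigma> u\<close> in that class.\<close>

locale simple_bifurcation =
  fixes T \<sigma> A C :: real and E :: "real set" and a e e1 :: "real \<Rightarrow> real"
  assumes T: "T > 0" and E: "E \<subseteq> {-1, 1}" and \<sigma>0: "0 \<le> \<sigma>" and C0: "0 \<le> C"
    and a_meas: "a \<in> borel_measurable (lebesgue_on {0..T})"
    and a_bdd: "\<And>t. t \<in> {0..T} \<Longrightarrow> \<bar>a t\<bar> \<le> A"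
    and a_even: "\<And>t. t \<in> {0..T} \<Longrightarrow> a (T - t) = a t"
    and e_rep: "H2rep T e e1 (\<lambda>t. - \<sigma> * e t)" and e_sym: "symE T E e"
    and e_zero: "\<And>t. t \<notin> {0..T} \<Longrightarrow> e t = 0"
    and N_pos: "lint 0 T (\<lambda>t. e t * e t) > 0"
    and solve: "\<And>f B. f \<in> borel_measurable (lebesgue_on {0..T}) \<Longrightarrow> (\<And>t. t \<in> {0..T} \<Longrightarrow> \<bar>f t\<bar> \<le> B) \<Longrightarrow>
       symE T E f \<Longrightarrow> lint 0 T (\<lambda>t. f t * e t) = 0 \<Longrightarrow>
       \<exists>p p1. H2rep T p p1 (\<lambda>t. f t - \<sigma> * p t) \<and> symE T E p \<and> (\<forall>t\<in>{0..T}. \<bar>p t\<bar> \<le> C * B \<and> \<bar>p1 t\<bar> \<le> C * B)"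
    and kernel: "\<And>u u1. H2rep T u u1 (\<lambda>t. - \<sigma> * u t) \<Longrightarrow> symE T E u \<Longrightarrow> \<exists>c. \<forall>t\<in>{0..T}. u t = c * e t"
begin

abbreviation "N \<equiv> lint 0 T (\<lambda>t. e t * e t)"

definition "c0 = (SOME c. c > 0 \<and> (\<forall>t\<in>{0..T}. \<bar>e t\<bar> \<le> c \<and> \<bar>e1 t\<bar> \<le> c))"

lemma c0: "c0 > 0" "\<And>t. t \<in> {0..T} \<Longrightarrow> \<bar>e t\<bar> \<le> c0" "\<And>t. t \<in> {0..T} \<Longrightarrow> \<bar>e1 t\<bar> \<le> c0"
proof -
  obtain B1 where B1: "B1 > 0" "\<And>t. t \<in> {0..T} \<Longrightarrow> \<bar>e t\<bar> \<le> B1" using continuous_bounded[OF H2repD(6)[OF e_rep]] by blast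
  obtain B2 where B2: "B2 > 0" "\<And>t. t \<in> {0..T} \<Longrightarrow> \<bar>e1 t\<bar> \<le> B2" using continuous_bounded[OF H2repD(7)[OF e_rep]] by blast
  have "\<exists>c. c > 0 \<and> (\<forall>t\<in>{0..T}. \<bar>e t\<bar> \<le> c \<and> \<bar>e1 t\<bar> \<le> c)"
    using B1 B2 by (intro exI[of _ "max B1 B2"]) (auto simp: le_max_iff_disj)
  from someI_ex[OF this] show "c0 > 0" "\<And>t. t \<in> {0..T} \<Longrightarrow> \<bar>e t\<bar> \<le> c0" "\<And>t. t \<in> {0..T} \<Longrightarrow> \<bar>e1 t\<bar> \<le> c0"
    unfolding c0_def by auto
qed

lemma A0: "0 \<le> A" using a_bdd[of 0] T by auto

lemma cont_e: "continuous_on {0..T} e" by (rule H2repD(6)[OF e_rep])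

text \<open>The bound C of \<open>solve\<close> plus the cost of subtracting the component along
  e.\<close>

definition "D = C + T * C * c0\<^sup>2 / N"

lemma D0: "0 \<le> D" unfolding D_def using C0 T N_pos by (intro add_nonneg_nonneg divide_nonneg_pos) auto

text \<open>Adding a multiple of e does not change the equation, so the solution can be normalised
  to be orthogonal to e; by \<open>kernel\<close> this singles out one solution.\<close>

lemma solve_perp:
  assumes f: "f \<in> borel_measurable (lebesgue_on {0..T})" "\<And>t. t \<in> {0..T} \<Longrightarrow> \<bar>f t\<bar> \<le> B" "symE T E f"
    "lint 0 T (\<lambda>t. f t * e t) = 0"
  shows "\<exists>y y1. H2rep T y y1 (\<lambda>t. f t - \<sigma> * y t) \<and> symE T E y \<and> lint 0 T (\<lambda>t. y t * e t) = 0 \<and>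
    (\<forall>t\<in>{0..T}. \<bar>y t\<bar> \<le> D * B \<and> \<bar>y1 t\<bar> \<le> D * B)"
proof -
  obtain p p1 where p: "H2rep T p p1 (\<lambda>t. f t - \<sigma> * p t)" "symE T E p"
    "\<And>t. t \<in> {0..T} \<Longrightarrow> \<bar>p t\<bar> \<le> C * B" "\<And>t. t \<in> {0..T} \<Longrightarrow> \<bar>p1 t\<bar> \<le> C * B" using solve[OF f] by blast
  define k where "k = lint 0 T (\<lambda>t. p t * e t) / N"
  have cp: "continuous_on {0..T} p" by (rule H2repD(6)[OF p(1)])
  have B: "0 \<le> C * B" using p(3)[of 0] T by auto
  have "\<bar>lint 0 T (\<lambda>t. p t * e t)\<bar> \<le> (T - 0) * ((C * B) * c0)"
  proof (rule lint_abs_le)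
    show "(\<lambda>t. p t * e t) \<in> borel_measurable (lebesgue_on {0..T})"
      by (intro continuous_measurable continuous_intros cp cont_e)
    show "\<bar>p t * e t\<bar> \<le> C * B * c0" if "t \<in> {0..T}" for t
      unfolding abs_mult using p(3) c0 B that by (intro mult_mono) auto
  qed (use T in simp)
  then have k: "\<bar>k\<bar> \<le> T * (C * B * c0) / N" unfolding k_def abs_divide using N_pos by (simp add: divide_right_mono)
  let ?y = "\<lambda>t. p t - k * e t" and ?y1 = "\<lambda>t. p1 t - k * e1 t"
  have "H2rep T ?y ?y1 (\<lambda>t. (f t - \<sigma> * p t) - k * (- \<sigma> * e t))"
    by (intro H2rep_diff H2rep_cmult p(1) e_rep)
  then have r: "H2rep T ?y ?y1 (\<lambda>t. f t - \<sigma> * ?y t)" by (simp add: algebra_simps)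
  have s: "symE T E ?y" by (intro symE_diff symE_cmult p(2) e_sym)
  have i: "integrable (lebesgue_on {0..T}) (\<lambda>t. p t * e t)" "integrable (lebesgue_on {0..T}) (\<lambda>t. e t * e t)"
    by (intro integrable_cont continuous_intros cp cont_e)+
  have "lint 0 T (\<lambda>t. ?y t * e t) = lint 0 T (\<lambda>t. p t * e t - k * (e t * e t))"
    by (rule lint_cong) (simp add: algebra_simps)
  also have "\<dots> = 0" using i N_pos by (simp add: k_def)
  finally have o: "lint 0 T (\<lambda>t. ?y t * e t) = 0" .
  have bd: "\<bar>x - k * z\<bar> \<le> D * B" if "\<bar>x\<bar> \<le> C * B" "\<bar>z\<bar> \<le> c0" for x z
  proof -
    have "\<bar>x - k * z\<bar> \<le> \<bar>x\<bar> + \<bar>k\<bar> * \<bar>z\<bar>" by (metis abs_mult abs_triangle_ineq4)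
    also have "\<dots> \<le> C * B + T * (C * B * c0) / N * c0" using that k by (intro add_mono mult_mono) auto
    also have "\<dots> = D * B" by (simp add: D_def algebra_simps power2_eq_square)
    finally show ?thesis .
  qed
  show ?thesis
    by (intro exI[of _ ?y] exI[of _ ?y1] conjI r s o ballI bd p(3,4) c0(2,3))
qed

text \<open>The necessary half of the Fredholm alternative: Green's formula moves the operator from
  u onto e, which it annihilates.\<close>

lemma perp_of_solution:
  assumes "H2rep T u u1 (\<lambda>t. f t - \<sigma> * u t)"
  shows "lint 0 T (\<lambda>t. f t * e t) = 0"
proof -
  have Lu: "u \<in> L2 T" by (rule H2repD(8)[OF assms])
  have Lf: "f \<in> L2 T" using L2_add[OF H2repD(3)[OF assms] L2_cmult[OF Lu, of \<sigma>]] by simp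
  note i = L2_mult[OF Lf H2repD(8)[OF e_rep]] L2_mult[OF Lu H2repD(8)[OF e_rep]]
  have "lint 0 T (\<lambda>t. (f t - \<sigma> * u t) * e t) = lint 0 T (\<lambda>t. u t * (- \<sigma> * e t))"
    by (rule H2rep_Green(2)[OF T assms e_rep])
  moreover have "lint 0 T (\<lambda>t. (f t - \<sigma> * u t) * e t) = lint 0 T (\<lambda>t. f t * e t - \<sigma> * (u t * e t))"
    by (rule lint_cong) (simp add: algebra_simps)
  moreover have "lint 0 T (\<lambda>t. u t * (- \<sigma> * e t)) = lint 0 T (\<lambda>t. (- \<sigma>) * (u t * e t))"
    by (rule lint_cong) (simp add: algebra_simps)
  ultimately show ?thesis using i by simp
qed

text \<open>The solution coincides with the one from \<open>solve_perp\<close> and inherits its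
  bound: the difference lies in the kernel and is orthogonal to e.\<close>

lemma apriori:
  assumes u: "H2rep T u u1 (\<lambda>t. f t - \<sigma> * u t)" and f: "\<And>t. t \<in> {0..T} \<Longrightarrow> \<bar>f t\<bar> \<le> B" "symE T E f"
    and s: "symE T E u" and o: "lint 0 T (\<lambda>t. u t * e t) = 0" and t: "t \<in> {0..T}"
  shows "\<bar>u t\<bar> \<le> D * B"
proof -
  have Lu: "u \<in> L2 T" by (rule H2repD(8)[OF u])
  have fm: "f \<in> borel_measurable (lebesgue_on {0..T})"
    using L2_measurable[OF L2_add[OF H2repD(3)[OF u] L2_cmult[OF Lu, of \<sigma>]]] by simp
  obtain y y1 where y: "H2rep T y y1 (\<lambda>t. f t - \<sigma> * y t)" "symE T E y" "lint 0 T (\<lambda>t. y t * e t) = 0"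
    "\<And>t. t \<in> {0..T} \<Longrightarrow> \<bar>y t\<bar> \<le> D * B" using solve_perp[OF fm f perp_of_solution[OF u]] by blast
  have "H2rep T (\<lambda>t. u t - y t) (\<lambda>t. u1 t - y1 t) (\<lambda>t. (f t - \<sigma> * u t) - (f t - \<sigma> * y t))"
    by (rule H2rep_diff[OF u y(1)])
  then have "H2rep T (\<lambda>t. u t - y t) (\<lambda>t. u1 t - y1 t) (\<lambda>t. - \<sigma> * (u t - y t))" by (simp add: algebra_simps)
  from kernel[OF this symE_diff[OF s y(2)]] obtain c where c: "\<And>t. t \<in> {0..T} \<Longrightarrow> u t - y t = c * e t" by blast
  have i: "integrable (lebesgue_on {0..T}) (\<lambda>t. u t * e t)" "integrable (lebesgue_on {0..T}) (\<lambda>t. y t * e t)"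
    by (intro integrable_cont continuous_intros H2repD(6)[OF u] H2repD(6)[OF y(1)] cont_e)+
  have "c * N = lint 0 T (\<lambda>t. c * (e t * e t))" by simp
  also have "\<dots> = lint 0 T (\<lambda>t. u t * e t - y t * e t)"
  proof (rule lint_cong)
    fix t assume "t \<in> {0..T}"
    from c[OF this] have "(u t - y t) * e t = c * e t * e t" by simp
    then show "c * (e t * e t) = u t * e t - y t * e t" by (simp add: algebra_simps)
  qed
  also have "\<dots> = 0" using i o y(3) by simp
  finally have "c = 0" using N_pos by simp
  then show ?thesis using c[OF t] y(4)[OF t] by simp
qed

text \<open>After the blow-up \<open>u = s (e + \<gamma>)\<close>, \<open>\<lambda> = \<sigma> + \<mu>\<close>, the equation reads as follows, with \<open>r = s\<^sup>2\<close>.\<close>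

definition nonl :: "real \<Rightarrow> real \<Rightarrow> (real \<Rightarrow> real) \<Rightarrow> real \<Rightarrow> real" where
  "nonl r \<mu> \<gamma> t = - (\<mu> * (e t + \<gamma> t) + r * (a t * ((e t + \<gamma> t) * ((e t + \<gamma> t) * (e t + \<gamma> t)))))"

definition blowup :: "real \<Rightarrow> real \<Rightarrow> (real \<Rightarrow> real) \<Rightarrow> bool" where
  "blowup r \<mu> \<gamma> \<longleftrightarrow> (\<exists>\<gamma>1. H2rep T \<gamma> \<gamma>1 (\<lambda>t. nonl r \<mu> \<gamma> t - \<sigma> * \<gamma> t)) \<and> symE T E \<gamma> \<and> lint 0 T (\<lambda>t. \<gamma> t * e t) = 0"

lemma symE_nonl: "symE T E \<gamma> \<Longrightarrow> symE T E (nonl r \<mu> \<gamma>)"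
proof -
  assume g: "symE T E \<gamma>"
  have w: "symE T E (\<lambda>t. e t + \<gamma> t)" by (rule symE_add[OF e_sym g])
  have "symE T E (\<lambda>t. (- \<mu>) * (e t + \<gamma> t) + (- r) * (a t * ((e t + \<gamma> t) * ((e t + \<gamma> t) * (e t + \<gamma> t)))))"
    by (intro symE_lincomb symE_mult3[where T = T and a = a, OF E a_even] w)
  then show ?thesis by (simp add: nonl_def[abs_def])
qed

lemma cube_diff_bound:
  fixes x y c d :: real
  assumes "\<bar>x\<bar> \<le> c" "\<bar>y\<bar> \<le> c" "\<bar>x - y\<bar> \<le> d"
  shows "\<bar>x * (x * x) - y * (y * y)\<bar> \<le> 3 * c\<^sup>2 * d"
proof -
  have "x * (x * x) - y * (y * y) = (x - y) * (x * x + x * y + y * y)" by (simp add: algebra_simps)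
  also have "\<bar>\<dots>\<bar> \<le> d * (c * c + c * c + c * c)"
  proof -
    have "\<bar>x * x + x * y + y * y\<bar> \<le> \<bar>x\<bar> * \<bar>x\<bar> + \<bar>x\<bar> * \<bar>y\<bar> + \<bar>y\<bar> * \<bar>y\<bar>"
      unfolding abs_mult[symmetric] by linarith
    also have "\<dots> \<le> c * c + c * c + c * c" using assms by (intro add_mono mult_mono) auto
    finally show ?thesis unfolding abs_mult using assms by (intro mult_mono) auto
  qed
  finally show ?thesis by (simp add: power2_eq_square mult_ac)
qed

text \<open>A contraction estimate. Pairing with e bounds the difference of the two \<mu> by a
  multiple of r times the distance d of the two \<gamma>; inserted into \<open>apriori\<close> this
  gives d \<le> 2 \<eta> D q d with a factor below 1, so d = 0. Smallness is demanded of one of the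
  two \<mu> only.\<close>

lemma blowup_unique:
  obtains \<eta> where "\<eta> > 0" "\<And>r \<mu> \<gamma> \<mu>' \<gamma>'. blowup r \<mu> \<gamma> \<Longrightarrow> blowup r \<mu>' \<gamma>' \<Longrightarrow> \<bar>r\<bar> \<le> \<eta> \<Longrightarrow> \<bar>\<mu>'\<bar> \<le> \<eta> \<Longrightarrow>
     (\<And>t. t \<in> {0..T} \<Longrightarrow> \<bar>\<gamma> t\<bar> \<le> 1) \<Longrightarrow> (\<And>t. t \<in> {0..T} \<Longrightarrow> \<bar>\<gamma>' t\<bar> \<le> 1) \<Longrightarrow>
     \<mu> = \<mu>' \<and> (\<forall>t\<in>{0..T}. \<gamma> t = \<gamma>' t)"
proof -
  \<comment> \<open>Bounds |e + \<gamma>| when |\<gamma>| \<le> 1.\<close>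
  define c where "c = c0 + 1"
  have c: "c > 1" using c0 by (simp add: c_def)
  define q1 where "q1 = T * (A * (3 * c\<^sup>2) * c0) / N"
  define q where "q = q1 * c + 1 + A * (3 * c\<^sup>2)"
  have q1: "0 \<le> q1" unfolding q1_def using T A0 c0 N_pos c by simp
  have q: "q \<ge> 1" unfolding q_def using q1 c A0 by simp
  define \<eta> where "\<eta> = 1 / (4 * (D * q + 1))"
  have Dq: "0 \<le> D * q" using D0 q by simp
  have \<eta>: "\<eta> > 0" "2 * \<eta> * (D * q) < 1" using Dq by (auto simp: \<eta>_def field_simps)
  show ?thesis
  proof (rule that[OF \<eta>(1)])
    fix r \<mu> \<gamma> \<mu>' \<gamma>'
    assume s: "blowup r \<mu> \<gamma>" and s': "blowup r \<mu>' \<gamma>'" and r: "\<bar>r\<bar> \<le> \<eta>" and mu': "\<bar>\<mu>'\<bar> \<le> \<eta>"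
      and g: "\<And>t. t \<in> {0..T} \<Longrightarrow> \<bar>\<gamma> t\<bar> \<le> 1" and g': "\<And>t. t \<in> {0..T} \<Longrightarrow> \<bar>\<gamma>' t\<bar> \<le> 1"
    obtain \<gamma>1 \<gamma>1' where rep: "H2rep T \<gamma> \<gamma>1 (\<lambda>t. nonl r \<mu> \<gamma> t - \<sigma> * \<gamma> t)" "H2rep T \<gamma>' \<gamma>1' (\<lambda>t. nonl r \<mu>' \<gamma>' t - \<sigma> * \<gamma>' t)"
      and sym: "symE T E \<gamma>" "symE T E \<gamma>'" and o: "lint 0 T (\<lambda>t. \<gamma> t * e t) = 0" "lint 0 T (\<lambda>t. \<gamma>' t * e t) = 0"
      using s s' unfolding blowup_def by blast
    have cg: "continuous_on {0..T} \<gamma>" "continuous_on {0..T} \<gamma>'" using H2repD(6)[OF rep(1)] H2repD(6)[OF rep(2)] by auto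
    let ?w = "\<lambda>t. e t + \<gamma> t" and ?w' = "\<lambda>t. e t + \<gamma>' t"
    let ?cu = "\<lambda>w t. w t * (w t * w t)"
    have cw: "continuous_on {0..T} ?w" "continuous_on {0..T} ?w'" by (intro continuous_intros cont_e cg)+
    have wb: "\<bar>?w t\<bar> \<le> c" "\<bar>?w' t\<bar> \<le> c" if "t \<in> {0..T}" for t
      using c0(2)[OF that] g[OF that] g'[OF that] unfolding c_def by linarith+
    have "continuous_on {0..T} (\<lambda>t. \<bar>\<gamma> t - \<gamma>' t\<bar>)" by (intro continuous_intros cg)
    then obtain t0 where t0: "t0 \<in> {0..T}" "\<And>t. t \<in> {0..T} \<Longrightarrow> \<bar>\<gamma> t - \<gamma>' t\<bar> \<le> \<bar>\<gamma> t0 - \<gamma>' t0\<bar>"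
      using continuous_attains_sup[of "{0..T}" "\<lambda>t. \<bar>\<gamma> t - \<gamma>' t\<bar>"] T by auto
    define d where "d = \<bar>\<gamma> t0 - \<gamma>' t0\<bar>"
    have d: "0 \<le> d" "\<And>t. t \<in> {0..T} \<Longrightarrow> \<bar>\<gamma> t - \<gamma>' t\<bar> \<le> d" using t0 by (auto simp: d_def)
    have cub: "\<bar>?cu ?w t - ?cu ?w' t\<bar> \<le> 3 * c\<^sup>2 * d" if "t \<in> {0..T}" for t
      by (rule cube_diff_bound) (use wb[OF that] d(2)[OF that] in auto)
    have acub: "\<bar>a t * (?cu ?w t - ?cu ?w' t)\<bar> \<le> A * (3 * c\<^sup>2 * d)" if "t \<in> {0..T}" for t
      unfolding abs_mult by (intro mult_mono a_bdd cub that A0) auto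
    have ie: "lint 0 T (\<lambda>t. nonl r m h t * e t) = - (m * N) - r * lint 0 T (\<lambda>t. (a t * ?cu (\<lambda>t. e t + h t) t) * e t)"
      "integrable (lebesgue_on {0..T}) (\<lambda>t. (a t * ?cu (\<lambda>t. e t + h t) t) * e t)"
      if h: "continuous_on {0..T} h" "lint 0 T (\<lambda>t. h t * e t) = 0" for m h
    proof -
      have ia: "integrable (lebesgue_on {0..T}) a" by (rule integrable_bdd[OF a_meas a_bdd])
      have "integrable (lebesgue_on {0..T}) (\<lambda>t. a t * (?cu (\<lambda>t. e t + h t) t * e t))"
        by (intro integrable_mult_cont ia continuous_intros cont_e h)
      then show i1: "integrable (lebesgue_on {0..T}) (\<lambda>t. (a t * ?cu (\<lambda>t. e t + h t) t) * e t)" by (simp add: mult_ac)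
      have i2: "integrable (lebesgue_on {0..T}) (\<lambda>t. e t * e t)" "integrable (lebesgue_on {0..T}) (\<lambda>t. h t * e t)"
        by (intro integrable_cont continuous_intros cont_e h)+
      have "lint 0 T (\<lambda>t. nonl r m h t * e t) = lint 0 T (\<lambda>t. (- m) * (e t * e t) + (- m) * (h t * e t)
          + (- r) * ((a t * ?cu (\<lambda>t. e t + h t) t) * e t))"
        by (rule lint_cong) (simp add: nonl_def algebra_simps)
      also have "\<dots> = (- m) * N + (- m) * lint 0 T (\<lambda>t. h t * e t) + (- r) * lint 0 T (\<lambda>t. (a t * ?cu (\<lambda>t. e t + h t) t) * e t)"
        by (rule lint_lincomb3[OF i2 i1])
      finally show "lint 0 T (\<lambda>t. nonl r m h t * e t) = - (m * N) - r * lint 0 T (\<lambda>t. (a t * ?cu (\<lambda>t. e t + h t) t) * e t)"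
        using h(2) by simp
    qed
    have alg: "(x - y) * n = - (r * (p - q))" if "- (x * n) - r * p = 0" "- (y * n) - r * q = 0" for x y n p q :: real
      using that by (simp add: algebra_simps)
    \<comment> \<open>Both right-hand sides are orthogonal to e; since the two \<gamma> are
      orthogonal to e as well, the pairing isolates \<mu> N.\<close>
    have "(\<mu> - \<mu>') * N = - (r * (lint 0 T (\<lambda>t. (a t * ?cu ?w t) * e t) - lint 0 T (\<lambda>t. (a t * ?cu ?w' t) * e t)))"
      by (rule alg) (rule trans[OF ie(1)[OF cg(1) o(1), symmetric] perp_of_solution[OF rep(1)]]
        trans[OF ie(1)[OF cg(2) o(2), symmetric] perp_of_solution[OF rep(2)]])+
    also have "lint 0 T (\<lambda>t. (a t * ?cu ?w t) * e t) - lint 0 T (\<lambda>t. (a t * ?cu ?w' t) * e t) =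
        lint 0 T (\<lambda>t. (a t * ?cu ?w t) * e t - (a t * ?cu ?w' t) * e t)"
      by (rule Bochner_Integration.integral_diff[symmetric]) (rule ie(2)[OF cg(1) o(1)] ie(2)[OF cg(2) o(2)])+
    finally have eq: "(\<mu> - \<mu>') * N = - (r * lint 0 T (\<lambda>t. (a t * ?cu ?w t) * e t - (a t * ?cu ?w' t) * e t))" .
    have "\<bar>lint 0 T (\<lambda>t. (a t * ?cu ?w t) * e t - (a t * ?cu ?w' t) * e t)\<bar> \<le> (T - 0) * (A * (3 * c\<^sup>2 * d) * c0)"
    proof (rule lint_abs_le)
      show "(\<lambda>t. (a t * ?cu ?w t) * e t - (a t * ?cu ?w' t) * e t) \<in> borel_measurable (lebesgue_on {0..T})"
        using ie(2)[OF cg(1) o(1)] ie(2)[OF cg(2) o(2)] by (intro borel_measurable_diff) auto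
      fix t assume t: "t \<in> {0..T}"
      have gen: "\<bar>x * y * z - x * y' * z\<bar> = \<bar>x * (y - y')\<bar> * \<bar>z\<bar>" for x y y' z :: real
        by (simp add: abs_mult[symmetric] algebra_simps)
      have "\<bar>(a t * ?cu ?w t) * e t - (a t * ?cu ?w' t) * e t\<bar> = \<bar>a t * (?cu ?w t - ?cu ?w' t)\<bar> * \<bar>e t\<bar>"
        by (rule gen)
      also have "\<dots> \<le> A * (3 * c\<^sup>2 * d) * c0"
        using acub[OF t] c0(2)[OF t] A0 d(1) by (intro mult_mono) auto
      finally show "\<bar>(a t * ?cu ?w t) * e t - (a t * ?cu ?w' t) * e t\<bar> \<le> A * (3 * c\<^sup>2 * d) * c0" .
    qed (use T in simp)
    then have "\<bar>(\<mu> - \<mu>') * N\<bar> \<le> \<bar>r\<bar> * (T * (A * (3 * c\<^sup>2 * d) * c0))"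
      unfolding eq abs_minus_cancel abs_mult[of r] by (intro mult_left_mono) auto
    then have "\<bar>\<mu> - \<mu>'\<bar> * N \<le> (\<bar>r\<bar> * q1 * d) * N"
      using N_pos by (simp add: abs_mult q1_def mult_ac)
    then have dmu: "\<bar>\<mu> - \<mu>'\<bar> \<le> \<bar>r\<bar> * q1 * d" using N_pos by (simp add: mult_le_cancel_right)
    let ?f = "\<lambda>t. nonl r \<mu> \<gamma> t - nonl r \<mu>' \<gamma>' t"
    have "H2rep T (\<lambda>t. \<gamma> t - \<gamma>' t) (\<lambda>t. \<gamma>1 t - \<gamma>1' t) (\<lambda>t. (nonl r \<mu> \<gamma> t - \<sigma> * \<gamma> t) - (nonl r \<mu>' \<gamma>' t - \<sigma> * \<gamma>' t))"
      by (rule H2rep_diff[OF rep])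
    then have repd: "H2rep T (\<lambda>t. \<gamma> t - \<gamma>' t) (\<lambda>t. \<gamma>1 t - \<gamma>1' t) (\<lambda>t. ?f t - \<sigma> * (\<gamma> t - \<gamma>' t))" by (simp add: algebra_simps)
    have fb: "\<bar>?f t\<bar> \<le> 2 * \<eta> * q * d" if t: "t \<in> {0..T}" for t
    proof -
      \<comment> \<open>The splitting puts \<mu>' in front of \<gamma> - \<gamma>' and leaves \<mu>
        only in the difference \<mu> - \<mu>', already bounded in terms of d.\<close>
      have "?f t = - ((\<mu> - \<mu>') * ?w t + \<mu>' * (\<gamma> t - \<gamma>' t) + r * (a t * (?cu ?w t - ?cu ?w' t)))"
        by (simp add: nonl_def algebra_simps)
      then have "\<bar>?f t\<bar> \<le> \<bar>(\<mu> - \<mu>') * ?w t\<bar> + \<bar>\<mu>' * (\<gamma> t - \<gamma>' t)\<bar> + \<bar>r * (a t * (?cu ?w t - ?cu ?w' t))\<bar>"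
        by linarith
      also have "\<dots> \<le> (\<bar>r\<bar> * q1 * d) * c + \<bar>\<mu>'\<bar> * d + \<bar>r\<bar> * (A * (3 * c\<^sup>2 * d))"
        unfolding abs_mult[of "\<mu> - \<mu>'"] abs_mult[of \<mu>'] abs_mult[of r]
        using dmu wb[OF t] d acub[OF t] t q1 by (intro add_mono mult_mono) auto
      also have "\<dots> \<le> (\<eta> * q1 * d) * c + \<eta> * d + \<eta> * (A * (3 * c\<^sup>2 * d))"
        using r mu' d(1) c q1 A0 by (intro add_mono mult_right_mono mult_nonneg_nonneg) auto
      also have "\<dots> = \<eta> * (q * d)" by (simp add: q_def algebra_simps)
      also have "\<dots> \<le> 2 * (\<eta> * (q * d))" using \<eta> q d(1) by simp
      finally show ?thesis by (simp add: mult_ac)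
    qed
    have "lint 0 T (\<lambda>t. (\<gamma> t - \<gamma>' t) * e t) = lint 0 T (\<lambda>t. \<gamma> t * e t - \<gamma>' t * e t)"
      by (rule lint_cong) (simp add: algebra_simps)
    also have "\<dots> = lint 0 T (\<lambda>t. \<gamma> t * e t) - lint 0 T (\<lambda>t. \<gamma>' t * e t)"
      by (intro Bochner_Integration.integral_diff integrable_cont continuous_intros cg cont_e)
    finally have od: "lint 0 T (\<lambda>t. (\<gamma> t - \<gamma>' t) * e t) = 0" using o by simp
    have "d \<le> D * (2 * \<eta> * q * d)" unfolding d_def
      by (rule apriori[OF repd fb[unfolded d_def] symE_diff[OF symE_nonl[OF sym(1)] symE_nonl[OF sym(2)]] symE_diff[OF sym] od t0(1)])
    then have "d \<le> (2 * \<eta> * (D * q)) * d" by (simp add: mult_ac)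
    then have "(1 - 2 * \<eta> * (D * q)) * d \<le> 0" by (simp add: algebra_simps)
    then have d0: "d = 0" using \<eta>(2) d(1) by (simp add: mult_le_0_iff)
    then have "\<mu> = \<mu>'" using dmu by simp
    moreover have "\<gamma> t = \<gamma>' t" if "t \<in> {0..T}" for t using d(2)[OF that] d0 by simp
    ultimately show "\<mu> = \<mu>' \<and> (\<forall>t\<in>{0..T}. \<gamma> t = \<gamma>' t)" by simp
  qed
qed

end

lemma continuous_on_cv:
  "(\<And>i. i \<le> n \<Longrightarrow> continuous_on S (x i)) \<Longrightarrow> (\<And>i. i \<le> n \<Longrightarrow> continuous_on S (y i)) \<Longrightarrow>
    continuous_on S (\<lambda>t. cv (\<lambda>i. x i t) (\<lambda>i. y i t) n)"
  unfolding cv_def by (auto intro!: continuous_intros)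

text \<open>The second claim keeps absolute convergence, so the product can be iterated to form the
  cube.\<close>

lemma cv_sums:
  fixes r :: real
  assumes "summable (\<lambda>n. \<bar>x n * r ^ n\<bar>)" "summable (\<lambda>n. \<bar>y n * r ^ n\<bar>)"
  shows "(\<lambda>n. cv x y n * r ^ n) sums (ps x r * ps y r)" "summable (\<lambda>n. \<bar>cv x y n * r ^ n\<bar>)"
proof -
  have "(\<lambda>k. \<Sum>i\<le>k. x i * r ^ i * (y (k - i) * r ^ (k - i))) sums (ps x r * ps y r)"
    unfolding ps_def by (rule Cauchy_product_sums) (use assms in auto)
  then show "(\<lambda>n. cv x y n * r ^ n) sums (ps x r * ps y r)"
    unfolding cv_scale[symmetric] by (simp only: cv_def)
  have "(\<lambda>k. \<Sum>i\<le>k. \<bar>x i * r ^ i\<bar> * \<bar>y (k - i) * r ^ (k - i)\<bar>) sums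
      ((\<Sum>k. \<bar>x k * r ^ k\<bar>) * (\<Sum>k. \<bar>y k * r ^ k\<bar>))"
    by (rule Cauchy_product_sums) (use assms in auto)
  then have s: "summable (\<lambda>k. \<Sum>i\<le>k. \<bar>x i * r ^ i\<bar> * \<bar>y (k - i) * r ^ (k - i)\<bar>)" by (rule sums_summable)
  show "summable (\<lambda>n. \<bar>cv x y n * r ^ n\<bar>)"
  proof (rule summable_comparison_test'[OF s, of 0])
    fix n
    have "\<bar>cv x y n * r ^ n\<bar> \<le> cv (\<lambda>n. \<bar>x n * r ^ n\<bar>) (\<lambda>n. \<bar>y n * r ^ n\<bar>) n"
      unfolding cv_scale[symmetric] by (rule abs_cv_le) auto
    then show "norm \<bar>cv x y n * r ^ n\<bar> \<le> (\<Sum>i\<le>n. \<bar>x i * r ^ i\<bar> * \<bar>y (n - i) * r ^ (n - i)\<bar>)"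
      by (simp only: cv_def real_norm_def abs_idempotent)
  qed
qed

section \<open>Blow-up of small solutions and the power series branch\<close>

context simple_bifurcation
begin

text \<open>Here s is the coordinate of u along e and y the remainder. The a priori bound makes |y|
  at most |s| when everything is small, so s = 0 would force u = 0, and \<gamma> = y / s is bounded
  by 1.\<close>

lemma blowdown:
  assumes "\<eta> > 0"
  obtains \<delta> where "\<delta> > 0" "\<And>l u u1. H2rep T u u1 (\<lambda>t. - l * u t - a t * (u t * (u t * u t))) \<Longrightarrow> symE T E u \<Longrightarrow>
    \<bar>l - \<sigma>\<bar> \<le> \<delta> \<Longrightarrow> (\<And>t. t \<in> {0..T} \<Longrightarrow> \<bar>u t\<bar> \<le> \<delta>) \<Longrightarrow> (\<exists>t\<in>{0..T}. u t \<noteq> 0) \<Longrightarrow>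
    \<exists>s \<gamma>. s \<noteq> 0 \<and> \<bar>s\<bar> \<le> \<eta> \<and> blowup (s\<^sup>2) (l - \<sigma>) \<gamma> \<and> (\<forall>t\<in>{0..T}. \<bar>\<gamma> t\<bar> \<le> 1) \<and> (\<forall>t\<in>{0..T}. u t = s * (e t + \<gamma> t))"
proof -
  \<comment> \<open>Besides \<delta> \<le> 1, the first bound absorbs the remainder in the a priori
    estimate and the second keeps the coordinate s below \<eta>.\<close>
  define \<delta> where "\<delta> = min 1 (min (1 / (2 * (1 + A) * (D + 1) * (1 + c0))) (\<eta> * N / (T * c0)))"
  define P where "P = 2 * (1 + A) * (D + 1) * (1 + c0)"
  have P: "P > 0" unfolding P_def using A0 D0 c0 by (intro mult_pos_pos) auto
  have Tc: "T * c0 > 0" using T c0 by simp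
  have \<delta>: "\<delta> > 0" "\<delta> \<le> 1" "\<delta> * P \<le> 1" "T * c0 * \<delta> / N \<le> \<eta>"
  proof -
    show "\<delta> > 0" unfolding \<delta>_def P_def[symmetric] using P Tc assms N_pos by simp
    show "\<delta> \<le> 1" by (simp add: \<delta>_def)
    have "\<delta> \<le> 1 / P" by (simp add: \<delta>_def P_def)
    then show "\<delta> * P \<le> 1" using P by (simp add: field_simps)
    have "\<delta> \<le> \<eta> * N / (T * c0)" by (simp add: \<delta>_def)
    then show "T * c0 * \<delta> / N \<le> \<eta>" using Tc N_pos by (simp add: field_simps)
  qed
  show ?thesis
  proof (rule that[OF \<delta>(1)])
    fix l u u1
    assume u: "H2rep T u u1 (\<lambda>t. - l * u t - a t * (u t * (u t * u t)))" and sym: "symE T E u" and l: "\<bar>l - \<sigma>\<bar> \<le> \<delta>"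
      and ub: "\<And>t. t \<in> {0..T} \<Longrightarrow> \<bar>u t\<bar> \<le> \<delta>" and nz: "\<exists>t\<in>{0..T}. u t \<noteq> 0"
    have cu: "continuous_on {0..T} u" by (rule H2repD(6)[OF u])
    define s where "s = lint 0 T (\<lambda>t. u t * e t) / N"
    define y where "y t = u t - s * e t" for t
    have cy: "continuous_on {0..T} y" unfolding y_def by (intro continuous_intros cu cont_e)
    define f where "f t = - ((l - \<sigma>) * u t + a t * (u t * (u t * u t)))" for t
    have "H2rep T (\<lambda>t. u t - s * e t) (\<lambda>t. u1 t - s * e1 t) (\<lambda>t. (- l * u t - a t * (u t * (u t * u t))) - s * (- \<sigma> * e t))"
      by (intro H2rep_diff H2rep_cmult u e_rep)
    then have yrep: "H2rep T y (\<lambda>t. u1 t - s * e1 t) (\<lambda>t. f t - \<sigma> * y t)"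
      by (simp add: y_def[abs_def] f_def algebra_simps)
    have "symE T E (\<lambda>t. (- (l - \<sigma>)) * u t + (- 1) * (a t * (u t * (u t * u t))))"
      by (intro symE_lincomb symE_mult3[where T = T and a = a, OF E a_even] sym)
    then have fsym: "symE T E f" by (simp add: f_def[abs_def] algebra_simps)
    have ysym: "symE T E y" unfolding y_def by (intro symE_diff symE_cmult sym e_sym)
    have "lint 0 T (\<lambda>t. y t * e t) = lint 0 T (\<lambda>t. u t * e t - s * (e t * e t))"
      by (rule lint_cong) (simp add: y_def algebra_simps)
    also have "\<dots> = lint 0 T (\<lambda>t. u t * e t) - s * N"
    proof -
      have "integrable (lebesgue_on {0..T}) (\<lambda>t. u t * e t)" "integrable (lebesgue_on {0..T}) (\<lambda>t. e t * e t)"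
        by (intro integrable_cont continuous_intros cu cont_e)+
      then show ?thesis by simp
    qed
    finally have yo: "lint 0 T (\<lambda>t. y t * e t) = 0" using N_pos by (simp add: s_def)
    have "continuous_on {0..T} (\<lambda>t. \<bar>y t\<bar>)" by (intro continuous_intros cy)
    then obtain t0 where t0: "t0 \<in> {0..T}" "\<And>t. t \<in> {0..T} \<Longrightarrow> \<bar>y t\<bar> \<le> \<bar>y t0\<bar>"
      using continuous_attains_sup[of "{0..T}" "\<lambda>t. \<bar>y t\<bar>"] T by auto
    define d where "d = \<bar>y t0\<bar>"
    have d: "0 \<le> d" "\<And>t. t \<in> {0..T} \<Longrightarrow> \<bar>y t\<bar> \<le> d" using t0 by (auto simp: d_def)
    have fb: "\<bar>f t\<bar> \<le> \<delta> * (1 + A) * (\<bar>s\<bar> * c0 + d)" if t: "t \<in> {0..T}" for t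
    proof -
      have "f t = - ((l - \<sigma>) + a t * (u t * u t)) * u t" by (simp add: f_def algebra_simps)
      then have "\<bar>f t\<bar> = \<bar>(l - \<sigma>) + a t * (u t * u t)\<bar> * \<bar>u t\<bar>" by (simp only: abs_mult abs_minus_cancel)
      also have "\<dots> \<le> (\<delta> * (1 + A)) * (\<bar>s\<bar> * c0 + d)"
      proof (intro mult_mono)
        have "\<bar>a t * (u t * u t)\<bar> \<le> A * (\<delta> * 1)"
          unfolding abs_mult using a_bdd[OF t] ub[OF t] \<delta> A0 by (intro mult_mono) auto
        then show "\<bar>(l - \<sigma>) + a t * (u t * u t)\<bar> \<le> \<delta> * (1 + A)" using l by (simp add: algebra_simps)
        have "\<bar>u t\<bar> \<le> \<bar>s * e t\<bar> + \<bar>y t\<bar>" by (simp add: y_def)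
        also have "\<dots> \<le> \<bar>s\<bar> * c0 + d" unfolding abs_mult by (intro add_mono mult_left_mono c0 d t) auto
        finally show "\<bar>u t\<bar> \<le> \<bar>s\<bar> * c0 + d" .
      qed (use \<delta> A0 in auto)
      finally show ?thesis .
    qed
    have "d \<le> D * (\<delta> * (1 + A) * (\<bar>s\<bar> * c0 + d))" unfolding d_def
      by (rule apriori[OF yrep fb[unfolded d_def] fsym ysym yo t0(1)])
    also have "\<dots> \<le> (D + 1) * (\<delta> * (1 + A) * (\<bar>s\<bar> * c0 + d))"
      using \<delta> A0 c0 d by (intro mult_right_mono mult_nonneg_nonneg add_nonneg_nonneg) auto
    \<comment> \<open>With the factor 2 (1 + c0) the left side absorbs the d on the right and still
      leaves d c0 \<le> |s| c0.\<close>
    finally have "2 * d * (1 + c0) \<le> 2 * ((D + 1) * (\<delta> * (1 + A) * (\<bar>s\<bar> * c0 + d))) * (1 + c0)"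
      using c0 by (intro mult_right_mono) auto
    also have "\<dots> = (\<delta> * P) * (\<bar>s\<bar> * c0 + d)" by (simp add: P_def algebra_simps)
    also have "\<dots> \<le> 1 * (\<bar>s\<bar> * c0 + d)" using \<delta>(3) c0 d by (intro mult_right_mono) auto
    finally have "2 * d * (1 + c0) \<le> \<bar>s\<bar> * c0 + d" by simp
    moreover have "2 * d * (1 + c0) = d + d * (1 + 2 * c0)" by (simp add: algebra_simps)
    moreover have "d * c0 \<le> d * (1 + 2 * c0)" using d(1) c0 by (intro mult_left_mono) auto
    ultimately have "d * c0 \<le> \<bar>s\<bar> * c0" by linarith
    then have ds: "d \<le> \<bar>s\<bar>" using c0 by simp
    have s0: "s \<noteq> 0"
    proof
      assume "s = 0"
      then have "u t = 0" if "t \<in> {0..T}" for t using d(2)[OF that] ds by (simp add: y_def)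
      with nz show False by auto
    qed
    have "\<bar>lint 0 T (\<lambda>t. u t * e t)\<bar> \<le> (T - 0) * (\<delta> * c0)"
    proof (rule lint_abs_le)
      show "(\<lambda>t. u t * e t) \<in> borel_measurable (lebesgue_on {0..T})"
        by (intro continuous_measurable continuous_intros cu cont_e)
      show "\<bar>u t * e t\<bar> \<le> \<delta> * c0" if "t \<in> {0..T}" for t
        unfolding abs_mult using ub c0 that \<delta> by (intro mult_mono) auto
    qed (use T in simp)
    then have "\<bar>s\<bar> \<le> T * c0 * \<delta> / N" unfolding s_def abs_divide using N_pos by (simp add: divide_right_mono mult_ac)
    then have s\<eta>: "\<bar>s\<bar> \<le> \<eta>" using \<delta>(4) by linarith
    let ?\<gamma> = "\<lambda>t. (1 / s) * y t"
    have gb: "\<bar>?\<gamma> t\<bar> \<le> 1" if "t \<in> {0..T}" for t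
      using d(2)[OF that] ds s0 by (simp add: abs_mult field_simps)
    have us: "u t = s * (e t + ?\<gamma> t)" for t using s0 by (simp add: y_def algebra_simps)
    have "blowup (s\<^sup>2) (l - \<sigma>) ?\<gamma>" unfolding blowup_def
    proof (intro conjI exI)
      have "H2rep T ?\<gamma> (\<lambda>t. (1 / s) * (u1 t - s * e1 t)) (\<lambda>t. (1 / s) * (f t - \<sigma> * y t))"
        by (rule H2rep_cmult[OF yrep])
      moreover have "(1 / s) * (f t - \<sigma> * y t) = nonl (s\<^sup>2) (l - \<sigma>) ?\<gamma> t - \<sigma> * ?\<gamma> t" for t
      proof -
        define g where "g = ?\<gamma> t"
        have y: "y t = s * g" using s0 by (simp add: g_def)
        have ug: "u t = s * (e t + g)" using us[of t] by (simp add: g_def)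
        have "(1 / s) * (f t - \<sigma> * y t) = - ((l - \<sigma>) * (e t + g) + s\<^sup>2 * (a t * ((e t + g) * ((e t + g) * (e t + g))))) - \<sigma> * g"
          unfolding f_def y ug using s0 by (simp add: field_simps power2_eq_square)
        then show ?thesis by (simp add: nonl_def g_def)
      qed
      ultimately show "H2rep T ?\<gamma> (\<lambda>t. (1 / s) * (u1 t - s * e1 t)) (\<lambda>t. nonl (s\<^sup>2) (l - \<sigma>) ?\<gamma> t - \<sigma> * ?\<gamma> t)" by (simp only:)
      show "symE T E ?\<gamma>" by (rule symE_cmult[OF ysym])
      have "lint 0 T (\<lambda>t. ?\<gamma> t * e t) = lint 0 T (\<lambda>t. (1 / s) * (y t * e t))" by (simp only: mult.assoc)
      then show "lint 0 T (\<lambda>t. ?\<gamma> t * e t) = 0" using yo by simp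
    qed
    then show "\<exists>s \<gamma>. s \<noteq> 0 \<and> \<bar>s\<bar> \<le> \<eta> \<and> blowup (s\<^sup>2) (l - \<sigma>) \<gamma> \<and> (\<forall>t\<in>{0..T}. \<bar>\<gamma> t\<bar> \<le> 1) \<and> (\<forall>t\<in>{0..T}. u t = s * (e t + \<gamma> t))"
      using s0 s\<eta> gb us by blast
  qed
qed

text \<open>The coefficient of r^(n+1) satisfies a linear equation whose right-hand side is
  determined by earlier coefficients: solvability fixes \<mu>(n+1), and \<open>solve_perp\<close>
  then provides the function. The numerical sequences \<open>b\<close> and \<open>m\<close> run a
  recursion that dominates these estimates, so \<open>cubic_recursion_summable\<close> gives a
  positive radius.\<close>

lemma power_series_solution:
  obtains \<rho> b \<mu> v v1 v2 where "\<rho> > 0" "\<And>n. 0 \<le> b n" "\<And>x::real. \<bar>x\<bar> < \<rho> \<Longrightarrow> summable (\<lambda>n. b n * x ^ n)"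
    "\<And>n. H2rep T (v n) (v1 n) (v2 n)"
    "\<And>n t. t \<in> {0..T} \<Longrightarrow> \<bar>v n t\<bar> \<le> b n" "\<And>n t. t \<in> {0..T} \<Longrightarrow> \<bar>v1 n t\<bar> \<le> b n" "\<And>n t. t \<in> {0..T} \<Longrightarrow> \<bar>v2 n t\<bar> \<le> b n"
    "\<And>n. \<bar>\<mu> n\<bar> \<le> b n" "\<And>n. symE T E (v n)" "\<And>n. lint 0 T (\<lambda>t. v n t * e t) = 0"
    "\<And>n t. t \<notin> {0..T} \<Longrightarrow> v n t = 0" "\<And>t. v 0 t = 0 \<and> v1 0 t = 0 \<and> v2 0 t = 0" "\<mu> 0 = 0"
    "\<And>r t. \<bar>r\<bar> < \<rho> \<Longrightarrow> t \<in> {0..T} \<Longrightarrow>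
       ps (\<lambda>n. v2 n t) r = nonl r (ps \<mu> r) (\<lambda>t. ps (\<lambda>n. v n t) r) t - \<sigma> * ps (\<lambda>n. v n t) r"
proof -
  \<comment> \<open>\<open>q1\<close> bounds the next \<mu> by the cubic term, \<open>q3\<close> the
    right-hand side, and \<open>q2\<close> dominates simultaneously the function and its first two
    derivatives.\<close>
  define q1 where "q1 = T * A * c0 / N"
  define q3 where "q3 = 1 + q1 * c0 + A"
  define q2 where "q2 = (1 + D + \<sigma> * D) * q3"
  have q1: "0 \<le> q1" unfolding q1_def using T A0 c0 N_pos by simp
  have q3: "1 \<le> q3" unfolding q3_def using q1 c0 A0 by simp
  have q2: "0 \<le> q2" unfolding q2_def using q3 D0 \<sigma>0 by simp
  \<comment> \<open>The majorants are generated as pairs (b n, m n). The initial value c0 (1 +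
    \<sigma>) dominates e, its derivative and \<sigma> e.\<close>
  define Fn :: "nat \<Rightarrow> (nat \<Rightarrow> real \<times> real) \<Rightarrow> real \<times> real" where
    "Fn n x = (case n of 0 \<Rightarrow> (c0 * (1 + \<sigma>), 0) | Suc k \<Rightarrow>
      (q2 * ((\<Sum>i = 1..k. snd (x i) * fst (x (Suc k - i))) + cv (\<lambda>i. fst (x i)) (cv (\<lambda>i. fst (x i)) (\<lambda>i. fst (x i))) k),
       q1 * cv (\<lambda>i. fst (x i)) (cv (\<lambda>i. fst (x i)) (\<lambda>i. fst (x i))) k))" for n x
  have "\<exists>x. \<forall>n. x n = Fn n x"
  proof (rule course_rec_exists[of Fn])
    fix n and x y :: "nat \<Rightarrow> real \<times> real" assume eq: "\<And>i. i < n \<Longrightarrow> x i = y i"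
    show "Fn n x = Fn n y"
    proof (cases n)
      case (Suc k)
      have "cv (\<lambda>i. fst (x i)) (cv (\<lambda>i. fst (x i)) (\<lambda>i. fst (x i))) k = cv (\<lambda>i. fst (y i)) (cv (\<lambda>i. fst (y i)) (\<lambda>i. fst (y i))) k"
        using eq Suc by (intro cv_cong) auto
      moreover have "(\<Sum>i = 1..k. snd (x i) * fst (x (Suc k - i))) = (\<Sum>i = 1..k. snd (y i) * fst (y (Suc k - i)))"
        using eq Suc by (intro sum.cong) auto
      ultimately show ?thesis unfolding Fn_def Suc by simp
    qed (simp add: Fn_def)
  qed blast
  then obtain bm where bm: "\<And>n. bm n = Fn n bm" by blast
  define b where "b n = fst (bm n)" for n
  define m where "m n = snd (bm n)" for n
  let ?cub = "\<lambda>n. cv b (cv b b) n"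
  have b_eq: "b 0 = c0 * (1 + \<sigma>)" "b (Suc n) = q2 * ((\<Sum>i = 1..n. m i * b (Suc n - i)) + ?cub n)" for n
    unfolding b_def m_def using bm[of 0] bm[of "Suc n"] by (simp_all add: Fn_def b_def[abs_def])
  have m_eq: "m 0 = 0" "m (Suc n) = q1 * ?cub n" for n
    unfolding m_def using bm[of 0] bm[of "Suc n"] by (simp_all add: Fn_def b_def[abs_def])
  have nonneg: "0 \<le> b n \<and> 0 \<le> m n" for n
  proof (induction n rule: less_induct)
    case (less n)
    show ?case
    proof (cases n)
      case 0 then show ?thesis using c0 \<sigma>0 by (simp add: b_eq m_eq)
    next
      case (Suc k)
      have cb: "0 \<le> cv b b j" if "j \<le> k" for j unfolding cv_def by (intro sum_nonneg mult_nonneg_nonneg) (use less Suc that in auto)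
      have c: "0 \<le> ?cub k" unfolding cv_def[of b "cv b b"] by (intro sum_nonneg mult_nonneg_nonneg cb) (use less Suc in auto)
      have "0 \<le> (\<Sum>i = 1..k. m i * b (Suc k - i))" by (intro sum_nonneg mult_nonneg_nonneg) (use less Suc in auto)
      then show ?thesis unfolding Suc b_eq m_eq using c q1 q2 by simp
    qed
  qed
  then have b0: "0 \<le> b n" and m0: "0 \<le> m n" for n by auto
  obtain \<rho> where \<rho>: "\<rho> > 0" "summable (\<lambda>n. b n * \<rho> ^ n)" "summable (\<lambda>n. m n * \<rho> ^ n)"
    by (rule cubic_recursion_summable[of b m q1 q2]) (use b0 m0 m_eq b_eq q1 q2 in auto)
  \<comment> \<open>A coefficient is a triple of function, derivative and \<mu>; \<open>cubf\<close>
    is the coefficient of the cubic term, \<open>mu\<close> the value enforced by orthogonality to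
    e.\<close>
  define cubf :: "(nat \<Rightarrow> (real \<Rightarrow> real) \<times> (real \<Rightarrow> real) \<times> real) \<Rightarrow> nat \<Rightarrow> real \<Rightarrow> real" where
    "cubf x n t = a t * cv (\<lambda>i. fst (x i) t) (cv (\<lambda>i. fst (x i) t) (\<lambda>i. fst (x i) t)) n" for x n t
  define mu where "mu x n = - (lint 0 T (\<lambda>t. cubf x n t * e t) / N)" for x n
  define f where "f x n t = - ((\<Sum>i = 1..n. snd (snd (x i)) * fst (x (Suc n - i)) t) + mu x n * e t + cubf x n t)" for x n t
  define good where "good g q \<beta> \<longleftrightarrow> H2rep T (fst q) (snd q) (\<lambda>t. g t - \<sigma> * fst q t) \<and> symE T E (fst q) \<and>
    lint 0 T (\<lambda>t. fst q t * e t) = 0 \<and> (\<forall>t\<in>{0..T}. \<bar>fst q t\<bar> \<le> D * \<beta> \<and> \<bar>snd q t\<bar> \<le> D * \<beta>)"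
    for g :: "real \<Rightarrow> real" and q :: "(real \<Rightarrow> real) \<times> (real \<Rightarrow> real)" and \<beta>
  define BB where "BB n = q3 * ((\<Sum>i = 1..n. m i * b (Suc n - i)) + ?cub n)" for n
  \<comment> \<open>Order 0 is e itself, so the recursion produces w = e + \<gamma> rather than
    \<gamma>; this keeps the cubic term a plain triple Cauchy product.\<close>
  define F where "F n x = (case n of 0 \<Rightarrow> (e, e1, 0) | Suc k \<Rightarrow>
     (let q = SOME q. good (f x k) q (BB k) in (fst q, snd q, mu x k)))" for n x
  have "\<exists>x. \<forall>n. x n = F n x"
  proof (rule course_rec_exists[of F])
    fix n and x y :: "nat \<Rightarrow> (real \<Rightarrow> real) \<times> (real \<Rightarrow> real) \<times> real" assume eq: "\<And>i. i < n \<Longrightarrow> x i = y i"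
    show "F n x = F n y"
    proof (cases n)
      case (Suc k)
      have c: "cubf x k = cubf y k" unfolding cubf_def
        using eq Suc by (intro ext arg_cong2[where f = "(*)"] cv_cong) auto
      then have mm: "mu x k = mu y k" by (simp add: mu_def)
      have "f x k = f y k" unfolding f_def c mm using eq Suc
        by (intro ext arg_cong[where f = uminus] arg_cong2[where f = "(+)"] sum.cong) auto
      then show ?thesis unfolding F_def Suc by (simp add: mm)
    qed (simp add: F_def)
  qed blast
  then obtain x where x: "\<And>n. x n = F n x" by blast
  define w where "w n = fst (x n)" for n
  define w1 where "w1 n = fst (snd (x n))" for n
  define \<mu> where "\<mu> n = snd (snd (x n))" for n
  define cu where "cu n t = a t * cv (\<lambda>i. w i t) (cv (\<lambda>i. w i t) (\<lambda>i. w i t)) n" for n t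
  define g where "g n t = - ((\<Sum>i = 1..n. \<mu> i * w (Suc n - i) t) + \<mu> (Suc n) * e t + cu n t)" for n t
  have cubf_x: "cubf x n = cu n" for n by (simp add: cubf_def cu_def w_def fun_eq_iff)
  have x0: "w 0 = e" "w1 0 = e1" "\<mu> 0 = 0" unfolding w_def w1_def \<mu>_def using x[of 0] by (simp_all add: F_def)
  have \<mu>S: "\<mu> (Suc n) = - (lint 0 T (\<lambda>t. cu n t * e t) / N)" for n
    unfolding \<mu>_def using x[of "Suc n"] by (simp add: F_def Let_def mu_def cubf_x)
  have f_x: "f x n = g n" for n
    using x[of "Suc n"] by (simp add: fun_eq_iff f_def g_def cubf_x \<mu>_def[symmetric] w_def[symmetric] \<mu>S mu_def)
  have wS: "good (g n) (w (Suc n), w1 (Suc n)) (BB n)" if "\<exists>q. good (g n) q (BB n)" for n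
  proof -
    have "good (g n) (SOME q. good (g n) q (BB n)) (BB n)" using that by (rule someI_ex)
    moreover have "(w (Suc n), w1 (Suc n)) = (SOME q. good (g n) q (BB n))"
      unfolding w_def w1_def using x[of "Suc n"] by (simp add: F_def Let_def f_x)
    ultimately show ?thesis by simp
  qed
  \<comment> \<open>The second derivative of order n involves the right-hand side of index n - 1; at
    order 0 it is given by the eigenvalue equation of e.\<close>
  define w2 where "w2 n t = (if n = 0 then - \<sigma> * e t else g (n - 1) t - \<sigma> * w n t)" for n t
  \<comment> \<open>Orthogonality to e fails at order 0, where the coefficient is e.\<close>
  define P where "P n \<longleftrightarrow> H2rep T (w n) (w1 n) (w2 n) \<and> symE T E (w n) \<and> (n \<noteq> 0 \<longrightarrow> lint 0 T (\<lambda>t. w n t * e t) = 0) \<and>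
     (\<forall>t\<in>{0..T}. \<bar>w n t\<bar> \<le> b n \<and> \<bar>w1 n t\<bar> \<le> b n \<and> \<bar>w2 n t\<bar> \<le> b n) \<and> \<bar>\<mu> n\<bar> \<le> m n" for n
  have P: "P n" for n
  proof (induction n rule: less_induct)
    case (less n)
    show ?case
    proof (cases n)
      case 0
      have le: "c0 \<le> c0 * (1 + \<sigma>)" "\<sigma> * c0 \<le> c0 * (1 + \<sigma>)" using c0(1) \<sigma>0 by (auto simp: algebra_simps)
      have "\<bar>- \<sigma> * e t\<bar> \<le> \<sigma> * c0" if "t \<in> {0..T}" for t
        using c0(2)[OF that] \<sigma>0 by (simp add: abs_mult mult_left_mono)
      then have bd: "\<bar>e t\<bar> \<le> c0 * (1 + \<sigma>) \<and> \<bar>e1 t\<bar> \<le> c0 * (1 + \<sigma>) \<and> \<bar>- \<sigma> * e t\<bar> \<le> c0 * (1 + \<sigma>)"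
        if "t \<in> {0..T}" for t
        using le c0(2)[OF that] c0(3)[OF that] that by (meson order_trans)
      have "w2 0 = (\<lambda>t. - \<sigma> * e t)" by (simp add: w2_def fun_eq_iff)
      then show ?thesis unfolding P_def 0 x0 b_eq m_eq
        using e_rep e_sym bd by (simp only: simp_thms ball_simps) auto
    next
      case (Suc k)
      have IH: "P i" if "i \<le> k" for i using less Suc that by simp
      have rep: "H2rep T (w i) (w1 i) (w2 i)" and sy: "symE T E (w i)" and wb: "\<And>t. t \<in> {0..T} \<Longrightarrow> \<bar>w i t\<bar> \<le> b i"
        and mb: "\<bar>\<mu> i\<bar> \<le> m i" and wo: "i \<noteq> 0 \<Longrightarrow> lint 0 T (\<lambda>t. w i t * e t) = 0" if "i \<le> k" for i
        using IH[OF that] unfolding P_def by auto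
      have cw: "continuous_on {0..T} (w i)" if "i \<le> k" for i by (rule H2repD(6)[OF rep[OF that]])
      have ccv: "continuous_on {0..T} (\<lambda>t. cv (\<lambda>i. w i t) (cv (\<lambda>i. w i t) (\<lambda>i. w i t)) k)"
        by (intro continuous_on_cv cw) auto
      have cum: "cu k \<in> borel_measurable (lebesgue_on {0..T})"
        unfolding cu_def[abs_def] by (intro borel_measurable_times a_meas continuous_measurable ccv)
      have cub: "\<bar>cu k t\<bar> \<le> A * ?cub k" if "t \<in> {0..T}" for t
        unfolding cu_def abs_mult using a_bdd[OF that] A0 wb that by (intro mult_mono abs_cv_le) auto
      have cusym: "symE T E (cu k)"
      proof -
        have "symE T E (\<lambda>t. \<Sum>i\<le>k. \<Sum>j\<le>k - i. a t * (w i t * (w j t * w (k - i - j) t)))"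
          by (intro symE_sum symE_mult3[where T = T and a = a, OF E a_even] sy) auto
        then show ?thesis unfolding cu_def[abs_def] cv_def sum_distrib_left .
      qed
      have cb0: "0 \<le> ?cub k" by (intro cv_nonneg b0)
      have icu: "integrable (lebesgue_on {0..T}) (cu k)" by (rule integrable_bdd[OF cum cub])
      have icue: "integrable (lebesgue_on {0..T}) (\<lambda>t. cu k t * e t)" by (rule integrable_mult_cont[OF icu cont_e])
      have "\<bar>lint 0 T (\<lambda>t. cu k t * e t)\<bar> \<le> (T - 0) * ((A * ?cub k) * c0)"
      proof (rule lint_abs_le)
        show "(\<lambda>t. cu k t * e t) \<in> borel_measurable (lebesgue_on {0..T})" using icue by auto
        show "\<bar>cu k t * e t\<bar> \<le> A * ?cub k * c0" if "t \<in> {0..T}" for t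
          unfolding abs_mult using cub c0 A0 cb0 that by (intro mult_mono) auto
      qed (use T in simp)
      then have "\<bar>\<mu> (Suc k)\<bar> \<le> T * (A * ?cub k * c0) / N"
        unfolding \<mu>S abs_minus_cancel abs_divide using N_pos by (simp add: divide_right_mono)
      then have mS: "\<bar>\<mu> (Suc k)\<bar> \<le> m (Suc k)" by (simp add: m_eq q1_def mult_ac)
      have csum: "continuous_on {0..T} (\<lambda>t. \<Sum>i = 1..k. \<mu> i * w (Suc k - i) t)"
        by (intro continuous_intros cw) auto
      have gm: "g k \<in> borel_measurable (lebesgue_on {0..T})"
        unfolding g_def[abs_def]
        by (intro borel_measurable_uminus borel_measurable_add cum continuous_measurable csum continuous_intros cont_e)
      have gb: "\<bar>g k t\<bar> \<le> BB k" if t: "t \<in> {0..T}" for t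
      proof -
        have "\<bar>\<Sum>i = 1..k. \<mu> i * w (Suc k - i) t\<bar> \<le> (\<Sum>i = 1..k. m i * b (Suc k - i))"
        proof (rule order_trans[OF sum_abs sum_mono])
          fix i assume "i \<in> {1..k}"
          then show "\<bar>\<mu> i * w (Suc k - i) t\<bar> \<le> m i * b (Suc k - i)"
            unfolding abs_mult using mb[of i] wb[of "Suc k - i" t] t m0 by (intro mult_mono) auto
        qed
        moreover have "\<bar>\<mu> (Suc k) * e t\<bar> \<le> (q1 * ?cub k) * c0"
          unfolding abs_mult using mS c0 t m0[of "Suc k"] by (intro mult_mono) (auto simp: m_eq)
        ultimately have "\<bar>g k t\<bar> \<le> (\<Sum>i = 1..k. m i * b (Suc k - i)) + (q1 * ?cub k) * c0 + A * ?cub k"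
          unfolding g_def using cub[OF t] by linarith
        also have "\<dots> \<le> q3 * (\<Sum>i = 1..k. m i * b (Suc k - i)) + q3 * ?cub k"
        proof -
          have "0 \<le> (\<Sum>i = 1..k. m i * b (Suc k - i))" by (intro sum_nonneg mult_nonneg_nonneg b0 m0)
          then have "1 * (\<Sum>i = 1..k. m i * b (Suc k - i)) \<le> q3 * (\<Sum>i = 1..k. m i * b (Suc k - i))"
            using q3 by (intro mult_right_mono)
          moreover have "(q1 * ?cub k) * c0 + A * ?cub k \<le> q3 * ?cub k" using cb0 by (simp add: q3_def algebra_simps)
          ultimately show ?thesis by linarith
        qed
        finally show ?thesis by (simp add: BB_def algebra_simps)
      qed
      have gsym: "symE T E (g k)"
      proof -
        have "symE T E (\<lambda>t. (- 1) * ((\<Sum>i = 1..k. \<mu> i * w (Suc k - i) t) + \<mu> (Suc k) * e t + cu k t))"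
          by (intro symE_cmult symE_add symE_sum e_sym cusym sy) auto
        then show ?thesis by (simp add: g_def[abs_def])
      qed
      \<comment> \<open>The sum runs from i = 1 to k, so only coefficients w of positive order
        occur, all orthogonal to e; what is left is cancelled by the choice of \<mu>.\<close>
      have "lint 0 T (\<lambda>t. g k t * e t) = lint 0 T (\<lambda>t. (- 1) * (\<Sum>i = 1..k. \<mu> i * (w (Suc k - i) t * e t))
          + (- \<mu> (Suc k)) * (e t * e t) + (- 1) * (cu k t * e t))"
        by (rule lint_cong) (simp add: g_def algebra_simps sum_distrib_left sum_negf)
      also have "\<dots> = (- 1) * lint 0 T (\<lambda>t. \<Sum>i = 1..k. \<mu> i * (w (Suc k - i) t * e t))
          + (- \<mu> (Suc k)) * N + (- 1) * lint 0 T (\<lambda>t. cu k t * e t)"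
        by (rule lint_lincomb3) (auto intro!: icue integrable_cont continuous_intros cw cont_e)
      also have "lint 0 T (\<lambda>t. \<Sum>i = 1..k. \<mu> i * (w (Suc k - i) t * e t)) =
          (\<Sum>i = 1..k. lint 0 T (\<lambda>t. \<mu> i * (w (Suc k - i) t * e t)))"
        by (rule Bochner_Integration.integral_sum) (auto intro!: integrable_cont continuous_intros cw cont_e)
      also have "\<dots> = 0" by (rule sum.neutral) (auto simp: wo)
      also have "(- 1) * 0 + (- \<mu> (Suc k)) * N + (- 1) * lint 0 T (\<lambda>t. cu k t * e t) = 0"
        using N_pos by (simp add: \<mu>S)
      finally have go: "lint 0 T (\<lambda>t. g k t * e t) = 0" .
      have "\<exists>q. good (g k) q (BB k)"
        using solve_perp[OF gm gb gsym go] unfolding good_def by fastforce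
      from wS[OF this] have G: "H2rep T (w (Suc k)) (w1 (Suc k)) (\<lambda>t. g k t - \<sigma> * w (Suc k) t)" "symE T E (w (Suc k))"
        "lint 0 T (\<lambda>t. w (Suc k) t * e t) = 0" "\<And>t. t \<in> {0..T} \<Longrightarrow> \<bar>w (Suc k) t\<bar> \<le> D * BB k"
        "\<And>t. t \<in> {0..T} \<Longrightarrow> \<bar>w1 (Suc k) t\<bar> \<le> D * BB k"
        unfolding good_def by auto
      have BB0: "0 \<le> BB k" using gb[of 0] T by auto
      have bS: "b (Suc k) = (1 + D + \<sigma> * D) * BB k" by (simp add: b_eq q2_def BB_def)
      have le: "D * BB k \<le> b (Suc k)" "BB k + \<sigma> * (D * BB k) \<le> b (Suc k)"
        unfolding bS using BB0 D0 \<sigma>0 by (auto simp: algebra_simps)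
      have "\<bar>g k t - \<sigma> * w (Suc k) t\<bar> \<le> b (Suc k)" if t: "t \<in> {0..T}" for t
      proof -
        have "\<bar>g k t - \<sigma> * w (Suc k) t\<bar> \<le> \<bar>g k t\<bar> + \<sigma> * \<bar>w (Suc k) t\<bar>" using abs_triangle_ineq4[of "g k t" "\<sigma> * w (Suc k) t"] \<sigma>0 by (simp add: abs_mult)
        also have "\<dots> \<le> BB k + \<sigma> * (D * BB k)" using gb[OF t] G(4)[OF t] \<sigma>0 by (intro add_mono mult_left_mono) auto
        finally show ?thesis using le by linarith
      qed
      then have "\<bar>w (Suc k) t\<bar> \<le> b (Suc k) \<and> \<bar>w1 (Suc k) t\<bar> \<le> b (Suc k) \<and> \<bar>w2 (Suc k) t\<bar> \<le> b (Suc k)"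
        if "t \<in> {0..T}" for t
        using order_trans[OF G(4)[OF that] le(1)] order_trans[OF G(5)[OF that] le(1)] that by (simp add: w2_def)
      moreover have "w2 (Suc k) = (\<lambda>t. g k t - \<sigma> * w (Suc k) t)" by (simp add: w2_def fun_eq_iff)
      ultimately show ?thesis unfolding P_def Suc using G(1,2,3) mS by simp
    qed
  qed
  \<comment> \<open>Removing order 0 turns w = e + \<gamma> into \<gamma>, and vanishing off [0,T]
    meets the normal form of \<open>H2 T\<close>.\<close>
  define v where "v n t = (if n = 0 \<or> t \<notin> {0..T} then 0 else w n t)" for n t
  define v1 where "v1 n t = (if n = 0 then 0 else w1 n t)" for n t
  define v2 where "v2 n t = (if n = 0 then 0 else w2 n t)" for n t
  \<comment> \<open>One majorant for the functions and for \<mu>.\<close>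
  define bb where "bb n = b n + m n" for n
  have sums: "summable (\<lambda>n. \<bar>b n * r ^ n\<bar>)" "summable (\<lambda>n. \<bar>m n * r ^ n\<bar>)" if "\<bar>r\<bar> < \<rho>" for r
    using powser_insidea[OF \<rho>(2), of r] powser_insidea[OF \<rho>(3), of r] that by auto
  show ?thesis
  proof (rule that[of \<rho> bb v v1 v2 \<mu>])
    show "\<rho> > 0" by fact
    show "0 \<le> bb n" for n using b0 m0 by (simp add: bb_def)
    show "summable (\<lambda>n. bb n * r ^ n)" if "\<bar>r\<bar> < \<rho>" for r
      using summable_add[OF summable_rabs_cancel[OF sums(1)[OF that]] summable_rabs_cancel[OF sums(2)[OF that]]]
      by (simp add: bb_def algebra_simps)
    show "H2rep T (v n) (v1 n) (v2 n)" for n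
    proof (cases "n = 0")
      case True
      have "H2rep T (\<lambda>t. 0 * e t) (\<lambda>t. 0 * e1 t) (\<lambda>t. 0 * (- \<sigma> * e t))" by (rule H2rep_cmult[OF e_rep])
      then show ?thesis using True by (simp add: v_def[abs_def] v1_def[abs_def] v2_def[abs_def])
    next
      case False
      have "H2rep T (w n) (w1 n) (w2 n)" using P[of n] by (simp add: P_def)
      then have "H2rep T (v n) (w1 n) (w2 n)" by (rule H2rep_cong[OF _ T]) (use False in \<open>auto simp: v_def\<close>)
      then show ?thesis using False by (simp add: v1_def[abs_def] v2_def[abs_def])
    qed
    show "\<bar>v n t\<bar> \<le> bb n" "\<bar>v1 n t\<bar> \<le> bb n" "\<bar>v2 n t\<bar> \<le> bb n" if "t \<in> {0..T}" for n t
      using P[of n] b0[of n] m0[of n] that unfolding P_def v_def v1_def v2_def bb_def by (auto intro: add_increasing2)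
    show "\<bar>\<mu> n\<bar> \<le> bb n" for n using P[of n] b0[of n] unfolding P_def bb_def by auto
    show "symE T E (v n)" for n
    proof (cases "n = 0")
      case False
      have "symE T E (w n)" using P[of n] by (simp add: P_def)
      then show ?thesis by (rule symE_cong) (use False in \<open>auto simp: v_def\<close>)
    qed (simp add: symE_def v_def)
    show "lint 0 T (\<lambda>t. v n t * e t) = 0" for n
    proof (cases "n = 0")
      case False
      have "lint 0 T (\<lambda>t. v n t * e t) = lint 0 T (\<lambda>t. w n t * e t)" by (rule lint_cong) (use False in \<open>auto simp: v_def\<close>)
      then show ?thesis using P[of n] False by (simp add: P_def)
    qed (simp add: v_def)
    show "v n t = 0" if "t \<notin> {0..T}" for n t using that by (simp add: v_def)
    show "v 0 t = 0 \<and> v1 0 t = 0 \<and> v2 0 t = 0" for t by (simp add: v_def v1_def v2_def)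
    show "\<mu> 0 = 0" by (rule x0)
    fix r t assume r: "\<bar>r\<bar> < \<rho>" and t: "t \<in> {0..T}"
    let ?w = "\<lambda>n. w n t"
    have sw: "summable (\<lambda>n. \<bar>w n t * r ^ n\<bar>)"
    proof (rule summable_comparison_test'[OF sums(1)[OF r], of 0])
      have "\<bar>w n t\<bar> \<le> b n" for n using P[of n] t by (simp add: P_def)
      then show "norm \<bar>w n t * r ^ n\<bar> \<le> \<bar>b n * r ^ n\<bar>" for n
        using b0[of n] by (simp add: abs_mult mult_right_mono)
    qed
    have s\<mu>: "summable (\<lambda>n. \<bar>\<mu> n * r ^ n\<bar>)"
    proof (rule summable_comparison_test'[OF sums(2)[OF r], of 0])
      have "\<bar>\<mu> n\<bar> \<le> m n" for n using P[of n] by (simp add: P_def)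
      then show "norm \<bar>\<mu> n * r ^ n\<bar> \<le> \<bar>m n * r ^ n\<bar>" for n
        using m0[of n] by (simp add: abs_mult mult_right_mono)
    qed
    note c2 = cv_sums[OF sw sw]
    note c3 = cv_sums[OF sw c2(2)]
    have ps2: "ps (cv ?w ?w) r = ps ?w r * ps ?w r" unfolding ps_def[of "cv ?w ?w"] by (rule sums_unique[OF c2(1), symmetric])
    define W where "W = ps ?w r"
    define M where "M = ps \<mu> r"
    have e0: "(\<lambda>n. (if n = 0 then c else 0) * r ^ n) sums c" for c :: real
      using sums_If_finite_set[of "{0::nat}" "\<lambda>n. c * r ^ n"] by (simp add: if_distrib[of "\<lambda>x. x * _"] cong: if_cong)
    have sc: "(\<lambda>n. (if n = 0 then 0 else cu (n - 1) t) * r ^ n) sums (r * (a t * (W * (W * W))))"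
    proof -
      have "(\<lambda>n. (r * a t) * (cv ?w (cv ?w ?w) n * r ^ n)) sums ((r * a t) * (W * (W * W)))"
        unfolding W_def ps2[symmetric] by (rule sums_mult[OF c3(1)])
      then have "(\<lambda>n. (if Suc n = 0 then 0 else cu (Suc n - 1) t) * r ^ Suc n) sums (r * (a t * (W * (W * W))))"
        by (simp add: cu_def mult_ac)
      from sums_Suc[OF this] show ?thesis by simp
    qed
    have cv\<mu>: "(\<lambda>n. cv \<mu> ?w n * r ^ n) sums (M * W)" unfolding M_def W_def by (rule cv_sums(1)[OF s\<mu> sw])
    have sW: "(\<lambda>n. w n t * r ^ n) sums W" unfolding W_def ps_def by (rule summable_sums[OF summable_rabs_cancel[OF sw]])
    \<comment> \<open>The Cauchy product of \<mu> and w differs from the sum in the recursion by its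
      end terms: \<mu> 0 = 0 removes one, the other is \<mu> n e.\<close>
    have w2_eq: "w2 n t = - \<sigma> * w n t - cv \<mu> ?w n - (if n = 0 then 0 else cu (n - 1) t)" for n
    proof (cases n)
      case 0 then show ?thesis by (simp add: w2_def x0 cv_def)
    next
      case (Suc k)
      have "cv \<mu> ?w (Suc k) = (\<Sum>i\<in>insert 0 (insert (Suc k) {1..k}). \<mu> i * w (Suc k - i) t)"
        unfolding cv_def by (rule sum.cong) auto
      also have "\<dots> = (\<Sum>i = 1..k. \<mu> i * w (Suc k - i) t) + \<mu> (Suc k) * e t"
        by (simp add: x0)
      finally show ?thesis by (simp add: w2_def Suc g_def)
    qed
    have "(\<lambda>n. - \<sigma> * (w n t * r ^ n) - cv \<mu> ?w n * r ^ n - (if n = 0 then 0 else cu (n - 1) t) * r ^ n) sums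
       (- \<sigma> * W - M * W - r * (a t * (W * (W * W))))"
      by (intro sums_diff sums_mult sW cv\<mu> sc)
    then have s2: "(\<lambda>n. w2 n t * r ^ n) sums (- \<sigma> * W - M * W - r * (a t * (W * (W * W))))"
      by (simp add: w2_eq left_diff_distrib mult.assoc)
    have "(\<lambda>n. w n t * r ^ n - (if n = 0 then e t else 0) * r ^ n) sums (W - e t)" by (rule sums_diff[OF sW e0])
    moreover have "w n t * r ^ n - (if n = 0 then e t else 0) * r ^ n = v n t * r ^ n" for n
      using t by (simp add: v_def x0)
    ultimately have G: "ps (\<lambda>n. v n t) r = W - e t" unfolding ps_def by (simp add: sums_unique[symmetric])
    have "(\<lambda>n. w2 n t * r ^ n - (if n = 0 then - \<sigma> * e t else 0) * r ^ n) sums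
        ((- \<sigma> * W - M * W - r * (a t * (W * (W * W)))) - (- \<sigma> * e t))" by (rule sums_diff[OF s2 e0])
    moreover have "w2 n t * r ^ n - (if n = 0 then - \<sigma> * e t else 0) * r ^ n = v2 n t * r ^ n" for n
      by (simp add: v2_def w2_def)
    ultimately have "ps (\<lambda>n. v2 n t) r = (- \<sigma> * W - M * W - r * (a t * (W * (W * W)))) - (- \<sigma> * e t)"
      unfolding ps_def by (simp add: sums_unique[symmetric])
    then show "ps (\<lambda>n. v2 n t) r = nonl r (ps \<mu> r) (\<lambda>t. ps (\<lambda>n. v n t) r) t - \<sigma> * ps (\<lambda>n. v n t) r"
      unfolding nonl_def G M_def[symmetric] by (simp add: algebra_simps)
  qed
qed

end

section \<open>Solutions and the metric of \<open>\<real> \<times> H\<^sup>2\<close>\<close>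

lemma RH2_Metric_space:
  assumes "T > 0" shows "Metric_space ((UNIV :: real set) \<times> H2 T) (prod_dist dist (H2_dist T))"
proof -
  interpret H: Metric_space "H2 T" "H2_dist T" by (rule H2_Metric_space[OF assms])
  interpret Metric_space12 "UNIV :: real set" dist "H2 T" "H2_dist T" by unfold_locales
  show ?thesis by (rule prod_metric)
qed

lemma H2_norm_minus:
  assumes "T > 0" "H2rep T u u1 u2" shows "H2_norm T (\<lambda>t. - u t) = H2_norm T u"
  using H2_norm_cmult[OF assms, of "-1"] by simp

lemma H2_norm_nonneg: "T > 0 \<Longrightarrow> H2rep T u u1 u2 \<Longrightarrow> 0 \<le> H2_norm T u"
  by (simp add: H2_norm_def H2_inner_nonneg)

lemma zero_fun_H2:
  assumes "T > 0" shows "zero_fun \<in> H2 T"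
proof -
  have "acd T (\<lambda>_. 0) (\<lambda>_. 0)" by (rule acd_C1) auto
  then have "H2rep T (\<lambda>_. 0) (\<lambda>_. 0) (\<lambda>_. 0)" by (simp add: H2rep_def L2_cont)
  then show ?thesis unfolding H2_iff[OF assms] zero_fun_def by auto
qed

lemma in_RH2_ball:
  assumes T: "T > 0"
  shows "(l, u) \<in> RH2_ball T (l0, zero_fun) \<rho> \<longleftrightarrow> u \<in> H2 T \<and> sqrt ((l - l0)\<^sup>2 + (H2_norm T u)\<^sup>2) < \<rho>"
proof -
  have d: "prod_dist dist (H2_dist T) (l0, zero_fun) (l, u) = sqrt ((l - l0)\<^sup>2 + (H2_norm T u)\<^sup>2)" if uH: "u \<in> H2 T"
  proof -
    obtain u1 u2 where r: "H2rep T u u1 u2" using uH H2_iff[OF T, of u] by blast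
    show ?thesis
      using H2_norm_minus[OF T r] by (simp add: prod_dist_def H2_dist_def zero_fun_def dist_real_def power2_commute[of l0 l])
  qed
  show ?thesis
    unfolding RH2_ball_def Metric_space.in_mball[OF RH2_Metric_space[OF T]]
    using d zero_fun_H2[OF T] by auto
qed

text \<open>The representative u'' in the triple may be altered on a null set, so an equation valid
  almost everywhere can be built into the triple and used pointwise.\<close>

lemma zeros_FF_iff:
  assumes T: "T > 0" and a: "a \<in> borel_measurable (lebesgue_on {0..T})" "\<And>t. t \<in> {0..T} \<Longrightarrow> \<bar>a t\<bar> \<le> A"
  shows "(l, u) \<in> zeros_FF T a \<longleftrightarrow>
    (\<forall>t. t \<notin> {0..T} \<longrightarrow> u t = 0) \<and> (\<exists>u1. H2rep T u u1 (\<lambda>t. - l * u t - a t * (u t * (u t * u t))))"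
proof
  assume "(l, u) \<in> zeros_FF T a"
  then have u: "u \<in> H2 T" and z: "AE t in lebesgue_on {0..T}. wderiv T 2 u t + l * u t + a t * (u t) ^ 3 = 0"
    by (auto simp: zeros_FF_def FF_def)
  obtain u1 u2 where r: "H2rep T u u1 u2" and off: "\<forall>t. t \<notin> {0..T} \<longrightarrow> u t = 0" using u H2_iff[OF T, of u] by blast
  have cu: "continuous_on {0..T} u" by (rule H2repD(6)[OF r])
  have c3: "continuous_on {0..T} (\<lambda>t. u t * (u t * u t))" by (intro continuous_intros cu)
  obtain B where B: "B > 0" "\<And>t. t \<in> {0..T} \<Longrightarrow> \<bar>u t * (u t * u t)\<bar> \<le> B"
    using continuous_bounded[OF c3] by blast
  have L: "(\<lambda>t. a t * (u t * (u t * u t))) \<in> L2 T"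
  proof (rule L2_bdd)
    show "(\<lambda>t. a t * (u t * (u t * u t))) \<in> borel_measurable (lebesgue_on {0..T})"
      by (intro borel_measurable_times a(1) continuous_measurable cu)
    show "\<bar>a t * (u t * (u t * u t))\<bar> \<le> A * B" if "t \<in> {0..T}" for t
      unfolding abs_mult[of "a t"] using a(2)[OF that] B that by (intro mult_mono) (auto intro: order_trans[OF abs_ge_zero])
  qed
  have "AE t in lebesgue_on {0..T}. - l * u t - a t * (u t * (u t * u t)) = u2 t"
    using z H2rep_wderiv(3)[OF T r] by eventually_elim (simp add: power3_eq_cube)
  then have "H2rep T u u1 (\<lambda>t. - l * u t - a t * (u t * (u t * u t)))"
    by (rule H2rep_cong_AE[OF r T]) (intro L2_diff L2_cmult L2_cont[OF cu] L)
  then show "(\<forall>t. t \<notin> {0..T} \<longrightarrow> u t = 0) \<and> (\<exists>u1. H2rep T u u1 (\<lambda>t. - l * u t - a t * (u t * (u t * u t))))"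
    using off by blast
next
  assume as: "(\<forall>t. t \<notin> {0..T} \<longrightarrow> u t = 0) \<and> (\<exists>u1. H2rep T u u1 (\<lambda>t. - l * u t - a t * (u t * (u t * u t))))"
  then obtain u1 where r: "H2rep T u u1 (\<lambda>t. - l * u t - a t * (u t * (u t * u t)))" by blast
  have "u \<in> H2 T" unfolding H2_iff[OF T] using as by blast
  moreover have "AE t in lebesgue_on {0..T}. wderiv T 2 u t + l * u t + a t * (u t) ^ 3 = 0"
    using H2rep_wderiv(3)[OF T r] by eventually_elim (simp add: power3_eq_cube)
  ultimately show "(l, u) \<in> zeros_FF T a" by (simp add: zeros_FF_def FF_def)
qed

text \<open>Green's formula moves the derivatives onto the eigenfunction. Hence orthogonality to e
  in H^2 and in L^2 agree, and the proof can work with the latter.\<close>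

lemma H2_inner_eigen:
  assumes T: "T > 0" and u: "H2rep T u u1 u2" and e: "H2rep T e e1 (\<lambda>t. - \<sigma> * e t)"
  shows "H2_inner T u e = (1 + \<sigma> + \<sigma>\<^sup>2) * lint 0 T (\<lambda>t. u t * e t)"
proof -
  have 1: "lint 0 T (\<lambda>t. u t * (- \<sigma> * e t)) = - \<sigma> * lint 0 T (\<lambda>t. u t * e t)"
  proof -
    have "lint 0 T (\<lambda>t. u t * (- \<sigma> * e t)) = lint 0 T (\<lambda>t. (- \<sigma>) * (u t * e t))" by (rule lint_cong) simp
    then show ?thesis by simp
  qed
  have 2: "lint 0 T (\<lambda>t. u2 t * (- \<sigma> * e t)) = - \<sigma> * lint 0 T (\<lambda>t. u2 t * e t)"
  proof -
    have "lint 0 T (\<lambda>t. u2 t * (- \<sigma> * e t)) = lint 0 T (\<lambda>t. (- \<sigma>) * (u2 t * e t))" by (rule lint_cong) simp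
    then show ?thesis by simp
  qed
  show ?thesis
    unfolding H2_inner_rep[OF T u e] H2rep_Green(1)[OF T u e] 2 H2rep_Green(2)[OF T u e] 1
    by (simp add: algebra_simps power2_eq_square)
qed

context simple_bifurcation
begin

text \<open>The formula is the squared distance from (\<sigma>, 0) of the branch point with r = s^2.
  Its linear part r E0 increases, and for small \<open>r1\<close> it dominates the variation of M^2
  and of r g(r).\<close>

lemma quadratic_increment:
  fixes M g :: "real \<Rightarrow> real"
  assumes L: "\<And>r r'. \<lbrakk>0 \<le> r; r \<le> r1; 0 \<le> r'; r' \<le> r1\<rbrakk> \<Longrightarrow> \<bar>M r - M r'\<bar> \<le> L * \<bar>r - r'\<bar>" "M 0 = 0" "0 \<le> L"
    and g: "\<And>r r'. \<lbrakk>0 \<le> r; r \<le> r1; 0 \<le> r'; r' \<le> r1\<rbrakk> \<Longrightarrow> \<bar>g r - g r'\<bar> \<le> L' * \<bar>r - r'\<bar>" "\<And>r. 0 \<le> g r"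
    and small: "r1 * (2 * L\<^sup>2 + L') < E0" and r: "0 \<le> r" "r < r'" "r' \<le> r1"
  shows "(M r)\<^sup>2 + r * (E0 + g r) < (M r')\<^sup>2 + r' * (E0 + g r')"
proof -
  have "\<bar>M r\<bar> \<le> L * r1" "\<bar>M r'\<bar> \<le> L * r1"
    using L(1)[of r 0] L(1)[of r' 0] L(2,3) r mult_left_mono[of r r1 L] mult_left_mono[of r' r1 L] by auto
  then have "\<bar>M r - M r'\<bar> * \<bar>M r + M r'\<bar> \<le> (L * (r' - r)) * (2 * (L * r1))"
    using L(1)[of r r'] r L(3) by (intro mult_mono) auto
  moreover have "\<bar>(M r)\<^sup>2 - (M r')\<^sup>2\<bar> = \<bar>M r - M r'\<bar> * \<bar>M r + M r'\<bar>"
    unfolding abs_mult[symmetric] by (simp add: power2_eq_square algebra_simps)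
  moreover have "(L * (r' - r)) * (2 * (L * r1)) = (r' - r) * (r1 * (2 * L\<^sup>2))"
    by (simp add: power2_eq_square mult_ac)
  ultimately have d: "(M r)\<^sup>2 - (M r')\<^sup>2 \<le> (r' - r) * (r1 * (2 * L\<^sup>2))" by linarith
  have "r * (g r - g r') \<le> r1 * (L' * (r' - r))"
  proof -
    have "r * (g r - g r') \<le> r * (L' * (r' - r))" using g(1)[of r r'] r by (intro mult_left_mono) auto
    also have "\<dots> \<le> r1 * (L' * (r' - r))"
      using g(1)[of r r'] r by (intro mult_right_mono) auto
    finally show ?thesis .
  qed
  moreover have "0 \<le> (r' - r) * g r'" using g(2) r by simp
  moreover have "(r' - r) * (r1 * (2 * L\<^sup>2 + L')) < (r' - r) * E0" using small r by (intro mult_strict_left_mono) auto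
  moreover have "(r' - r) * (r1 * (2 * L\<^sup>2 + L')) = (r' - r) * (r1 * (2 * L\<^sup>2)) + r1 * (L' * (r' - r))"
    by (simp add: algebra_simps)
  moreover have "((M r')\<^sup>2 + r' * (E0 + g r')) - ((M r)\<^sup>2 + r * (E0 + g r)) =
      - ((M r)\<^sup>2 - (M r')\<^sup>2) + (r' - r) * E0 + (r' - r) * g r' - r * (g r - g r')"
    by (simp add: algebra_simps)
  ultimately show ?thesis using d by linarith
qed

end

section \<open>Construction of the local branch\<close>

context simple_bifurcation
begin

lemma sol_iff:
  "(l, u) \<in> zeros_FF T a \<longleftrightarrow>
    (\<forall>t. t \<notin> {0..T} \<longrightarrow> u t = 0) \<and> (\<exists>u1. H2rep T u u1 (\<lambda>t. - l * u t - a t * (u t * (u t * u t))))"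
  by (rule zeros_FF_iff[OF T a_meas a_bdd])

text \<open>Regularity, symmetry and orthogonality pass to weighted sums of coefficients; this
  covers the branch itself as well as all its derivatives in s.\<close>

lemma series_closed:
  assumes rep: "\<And>n. H2rep T (f n) (f1 n) (f2 n)"
    and bd: "\<And>n t. t \<in> {0..T} \<Longrightarrow> \<bar>f n t\<bar> \<le> c n" "\<And>n t. t \<in> {0..T} \<Longrightarrow> \<bar>f1 n t\<bar> \<le> c n"
      "\<And>n t. t \<in> {0..T} \<Longrightarrow> \<bar>f2 n t\<bar> \<le> c n"
    and sym: "\<And>n. symE T E (f n)" and orth: "\<And>n. lint 0 T (\<lambda>t. f n t * e t) = 0"
    and s: "summable (\<lambda>n. \<bar>k n\<bar> * c n)"
  shows "H2rep T (\<lambda>t. \<Sum>n. k n * f n t) (\<lambda>t. \<Sum>n. k n * f1 n t) (\<lambda>t. \<Sum>n. k n * f2 n t)"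
    "symE T E (\<lambda>t. \<Sum>n. k n * f n t)" "lint 0 T (\<lambda>t. (\<Sum>n. k n * f n t) * e t) = 0"
proof -
  have bd': "\<bar>k n * f n t\<bar> \<le> \<bar>k n\<bar> * c n" "\<bar>k n * f1 n t\<bar> \<le> \<bar>k n\<bar> * c n"
    "\<bar>k n * f2 n t\<bar> \<le> \<bar>k n\<bar> * c n" if "t \<in> {0..T}" for n t
    unfolding abs_mult using bd that by (intro mult_left_mono; simp)+
  show "H2rep T (\<lambda>t. \<Sum>n. k n * f n t) (\<lambda>t. \<Sum>n. k n * f1 n t) (\<lambda>t. \<Sum>n. k n * f2 n t)"
    by (rule H2rep_suminf[OF T H2rep_cmult[OF rep] bd' s])
  show "symE T E (\<lambda>t. \<Sum>n. k n * f n t)"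
    by (rule symE_suminf[OF symE_cmult[OF sym] bd'(1) s])
  have ct: "continuous_on {0..T} (\<lambda>t. k n * f n t * e t)" for n
    by (intro continuous_intros cont_e H2repD(6)[OF rep])
  have c0': "0 \<le> c n" for n using bd(1)[of 0 n] T by auto
  have "(\<lambda>n. lint 0 T (\<lambda>t. k n * f n t * e t)) sums lint 0 T (\<lambda>t. \<Sum>n. k n * f n t * e t)"
  proof (rule lint_suminf(2)[OF _ continuous_measurable[OF ct] _ summable_mult2[OF s, of c0]])
    show "\<bar>k n * f n t * e t\<bar> \<le> \<bar>k n\<bar> * c n * c0" if "t \<in> {0..T}" for n t
      unfolding abs_mult[of _ "e t"] using bd'(1)[OF that, of n] c0(2)[OF that] c0'[of n] by (intro mult_mono) auto
  qed (use T in simp)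
  moreover have "lint 0 T (\<lambda>t. k n * f n t * e t) = 0" for n
    using orth[of n] by (simp add: mult.assoc)
  ultimately have z: "lint 0 T (\<lambda>t. \<Sum>n. k n * f n t * e t) = 0" by (simp add: sums_iff)
  have "lint 0 T (\<lambda>t. (\<Sum>n. k n * f n t) * e t) = lint 0 T (\<lambda>t. \<Sum>n. k n * f n t * e t)"
    by (rule lint_cong, rule suminf_mult2, rule abs_suminf_le(2)[OF bd'(1) s])
  with z show "lint 0 T (\<lambda>t. (\<Sum>n. k n * f n t) * e t) = 0" by simp
qed

text \<open>Besides the curve this records that it fills the ball of radius \<rho> exactly, that the
  remainder is at most \<open>\<delta>0\<close> in C^1 (for signs and zero counts), and that the
  curve is Lipschitz (for connectedness).\<close>

definition "is_branch \<rho> \<delta>0 \<epsilon> \<Lambda> \<Gamma> \<longleftrightarrow> \<epsilon> > 0 \<and> smooth_on {-\<epsilon><..<\<epsilon>} \<Lambda> \<and>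
    smooth_map_H2 T (ortho_in T {u \<in> H2 T. symE T E u} e) \<epsilon> \<Gamma> \<and> \<Lambda> 0 = \<sigma> \<and> \<Gamma> 0 = zero_fun \<and>
    (\<forall>s. \<Lambda> (- s) = \<Lambda> s) \<and> (\<forall>s. \<Gamma> (- s) = \<Gamma> s) \<and>
    (\<forall>s. \<bar>s\<bar> < \<epsilon> \<longrightarrow> (\<Lambda> s, \<lambda>t. s * (e t + \<Gamma> s t)) \<in> zeros_FF T a \<and> symE T E (\<lambda>t. s * (e t + \<Gamma> s t))) \<and>
    (\<forall>s. \<bar>s\<bar> < \<epsilon> \<longrightarrow> blowup (s\<^sup>2) (\<Lambda> s - \<sigma>) (\<Gamma> s)) \<and>
    (\<forall>s. \<bar>s\<bar> < \<epsilon> \<longrightarrow> (\<exists>\<gamma>1 \<gamma>2. H2rep T (\<Gamma> s) \<gamma>1 \<gamma>2 \<and> (\<forall>t\<in>{0..T}. \<bar>\<Gamma> s t\<bar> \<le> \<delta>0 \<and> \<bar>\<gamma>1 t\<bar> \<le> \<delta>0))) \<and>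
    {(l, u) \<in> zeros_FF T a. symE T E u \<and> u \<noteq> zero_fun} \<inter> RH2_ball T (\<sigma>, zero_fun) \<rho> =
      {(\<Lambda> s, \<lambda>t. s * (e t + \<Gamma> s t)) | s. s \<noteq> 0 \<and> \<bar>s\<bar> < \<epsilon>} \<and>
    (\<exists>L. \<forall>s s'. \<bar>s\<bar> < \<epsilon> \<longrightarrow> \<bar>s'\<bar> < \<epsilon> \<longrightarrow> prod_dist dist (H2_dist T) (\<Lambda> s, \<lambda>t. s * (e t + \<Gamma> s t))
        (\<Lambda> s', \<lambda>t. s' * (e t + \<Gamma> s' t)) \<le> L * \<bar>s - s'\<bar>)"
  for \<rho> \<delta>0 \<epsilon> :: real and \<Lambda> :: "real \<Rightarrow> real" and \<Gamma> :: "real \<Rightarrow> real \<Rightarrow> real"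

lemma is_branchI:
  assumes "\<epsilon> > 0" "smooth_on {-\<epsilon><..<\<epsilon>} \<Lambda>"
    "smooth_map_H2 T (ortho_in T {u \<in> H2 T. symE T E u} e) \<epsilon> \<Gamma>" "\<Lambda> 0 = \<sigma>" "\<Gamma> 0 = zero_fun"
    "\<And>s. \<Lambda> (- s) = \<Lambda> s" "\<And>s. \<Gamma> (- s) = \<Gamma> s"
    "\<And>s. \<bar>s\<bar> < \<epsilon> \<Longrightarrow> (\<Lambda> s, \<lambda>t. s * (e t + \<Gamma> s t)) \<in> zeros_FF T a \<and> symE T E (\<lambda>t. s * (e t + \<Gamma> s t))"
    "\<And>s. \<bar>s\<bar> < \<epsilon> \<Longrightarrow> blowup (s\<^sup>2) (\<Lambda> s - \<sigma>) (\<Gamma> s)"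
    "\<And>s. \<bar>s\<bar> < \<epsilon> \<Longrightarrow> \<exists>\<gamma>1 \<gamma>2. H2rep T (\<Gamma> s) \<gamma>1 \<gamma>2 \<and> (\<forall>t\<in>{0..T}. \<bar>\<Gamma> s t\<bar> \<le> \<delta>0 \<and> \<bar>\<gamma>1 t\<bar> \<le> \<delta>0)"
    "{(l, u) \<in> zeros_FF T a. symE T E u \<and> u \<noteq> zero_fun} \<inter> RH2_ball T (\<sigma>, zero_fun) \<rho> =
      {(\<Lambda> s, \<lambda>t. s * (e t + \<Gamma> s t)) | s. s \<noteq> 0 \<and> \<bar>s\<bar> < \<epsilon>}"
    "\<exists>L. \<forall>s s'. \<bar>s\<bar> < \<epsilon> \<longrightarrow> \<bar>s'\<bar> < \<epsilon> \<longrightarrow> prod_dist dist (H2_dist T) (\<Lambda> s, \<lambda>t. s * (e t + \<Gamma> s t))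
        (\<Lambda> s', \<lambda>t. s' * (e t + \<Gamma> s' t)) \<le> L * \<bar>s - s'\<bar>"
  shows "is_branch \<rho> \<delta>0 \<epsilon> \<Lambda> \<Gamma>"
  unfolding is_branch_def
  by (intro conjI; (rule assms | (intro allI impI; erule assms) | (intro allI; rule assms)))

text \<open>The parameter range is adapted to the ball: the squared distance Q(s^2) to the
  bifurcation point is continuous and strictly increasing in s^2, so each small \<rho> has an
  \<epsilon> such that |s| < \<epsilon> holds exactly inside the ball. That no solution is missed
  comes from \<open>blowdown\<close> followed by \<open>blowup_unique\<close>.\<close>

theorem local_branch:
  assumes "\<delta>0 > 0"
  obtains \<rho>m where "\<rho>m > 0" "\<rho>m \<le> \<delta>0" "\<And>\<rho>. 0 < \<rho> \<Longrightarrow> \<rho> \<le> \<rho>m \<Longrightarrow> \<exists>\<epsilon> \<Lambda> \<Gamma>. is_branch \<rho> \<delta>0 \<epsilon> \<Lambda> \<Gamma>"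
proof -
  obtain \<rho>0 b \<mu> v v1 v2 where \<rho>0: "\<rho>0 > 0" and b0: "\<And>n. 0 \<le> b n" and bs: "\<And>x::real. \<bar>x\<bar> < \<rho>0 \<Longrightarrow> summable (\<lambda>n. b n * x ^ n)"
    and rep: "\<And>n. H2rep T (v n) (v1 n) (v2 n)"
    and vb: "\<And>n t. t \<in> {0..T} \<Longrightarrow> \<bar>v n t\<bar> \<le> b n" "\<And>n t. t \<in> {0..T} \<Longrightarrow> \<bar>v1 n t\<bar> \<le> b n" "\<And>n t. t \<in> {0..T} \<Longrightarrow> \<bar>v2 n t\<bar> \<le> b n"
    and \<mu>b: "\<And>n. \<bar>\<mu> n\<bar> \<le> b n" and sym: "\<And>n. symE T E (v n)" and orth: "\<And>n. lint 0 T (\<lambda>t. v n t * e t) = 0"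
    and off: "\<And>n t. t \<notin> {0..T} \<Longrightarrow> v n t = 0" and v0: "\<And>t. v 0 t = 0 \<and> v1 0 t = 0 \<and> v2 0 t = 0" and \<mu>0: "\<mu> 0 = 0"
    and eq: "\<And>r t. \<bar>r\<bar> < \<rho>0 \<Longrightarrow> t \<in> {0..T} \<Longrightarrow>
       ps (\<lambda>n. v2 n t) r = nonl r (ps \<mu> r) (\<lambda>t. ps (\<lambda>n. v n t) r) t - \<sigma> * ps (\<lambda>n. v n t) r"
  proof (rule power_series_solution, goal_cases)
    case (1 \<rho> b \<mu> v v1 v2)
    from 1(2-) show ?case by (rule 1(1))
  qed
  define M where "M r = ps \<mu> r" for r
  define G where "G r = (\<lambda>t. ps (\<lambda>n. v n t) r)" for r
  define G1 where "G1 r = (\<lambda>t. ps (\<lambda>n. v1 n t) r)" for r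
  define G2 where "G2 r = (\<lambda>t. ps (\<lambda>n. v2 n t) r)" for r
  have G_props: "H2rep T (G r) (G1 r) (G2 r)" "symE T E (G r)" "lint 0 T (\<lambda>t. G r t * e t) = 0" if r: "\<bar>r\<bar> < \<rho>0" for r
  proof -
    have "summable (\<lambda>n. \<bar>r ^ n\<bar> * b n)" using bs[of "\<bar>r\<bar>"] r by (simp add: power_abs mult.commute)
    note * = series_closed[OF rep vb sym orth this]
    show "H2rep T (G r) (G1 r) (G2 r)" "symE T E (G r)" "lint 0 T (\<lambda>t. G r t * e t) = 0"
      using * by (simp_all add: G_def G1_def G2_def ps_def mult.commute)
  qed
  have Goff: "G r t = 0" if "t \<notin> {0..T}" for r t using off[OF that] by (simp add: G_def ps_def)
  have bu: "blowup r (M r) (G r)" if r: "\<bar>r\<bar> < \<rho>0" for r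
    unfolding blowup_def
  proof (intro conjI exI)
    show "H2rep T (G r) (G1 r) (\<lambda>t. nonl r (M r) (G r) t - \<sigma> * G r t)"
      by (rule H2rep_cong[OF G_props(1)[OF r] T]) (use eq[OF r] in \<open>simp_all add: G_def G2_def M_def\<close>)
  qed (rule G_props[OF r])+
  define K where "K = \<rho>0 / 2"
  have K: "0 < K" "K < \<rho>0" using \<rho>0 by (auto simp: K_def)
  obtain L where L: "L \<ge> 0" "\<And>f r s. (\<And>n. \<bar>f n\<bar> \<le> b n) \<Longrightarrow> \<bar>r\<bar> \<le> K \<Longrightarrow> \<bar>s\<bar> \<le> K \<Longrightarrow> \<bar>ps f r - ps f s\<bar> \<le> L * \<bar>r - s\<bar>"
  proof (rule ps_Lipschitz[of \<rho>0 b K])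
    fix L assume "0 \<le> L" "\<And>f r s. (\<And>n. \<bar>f n\<bar> \<le> b n) \<Longrightarrow> \<bar>r\<bar> \<le> K \<Longrightarrow> \<bar>s\<bar> \<le> K \<Longrightarrow> \<bar>ps f r - ps f s\<bar> \<le> L * \<bar>r - s\<bar>"
    then show thesis by (rule that)
  qed (use bs b0 K in auto)
  have ps0: "ps f 0 = f 0" for f
    unfolding ps_def using suminf_finite[of "{0}" "\<lambda>n. f n * 0 ^ n"] by simp
  have M0: "M 0 = 0" and G0: "G 0 t = 0" "G1 0 t = 0" "G2 0 t = 0" for t
    unfolding M_def G_def G1_def G2_def ps0 by (simp_all add: \<mu>0 v0)
  have MLip: "\<bar>M r - M s\<bar> \<le> L * \<bar>r - s\<bar>" if "\<bar>r\<bar> \<le> K" "\<bar>s\<bar> \<le> K" for r s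
    unfolding M_def by (rule L(2)[OF \<mu>b that])
  have GLip: "\<bar>G r t - G s t\<bar> \<le> L * \<bar>r - s\<bar>" "\<bar>G1 r t - G1 s t\<bar> \<le> L * \<bar>r - s\<bar>" "\<bar>G2 r t - G2 s t\<bar> \<le> L * \<bar>r - s\<bar>"
    if "\<bar>r\<bar> \<le> K" "\<bar>s\<bar> \<le> K" "t \<in> {0..T}" for r s t
    unfolding G_def G1_def G2_def by (rule L(2)[OF _ that(1,2)], rule vb[OF that(3)])+
  define S where "S = sqrt (3 * T)"
  have S0: "S \<ge> 0" using T by (simp add: S_def)
  have GH: "H2_norm T (\<lambda>t. G r t - G s t) \<le> S * (L * \<bar>r - s\<bar>)" if rs: "\<bar>r\<bar> \<le> K" "\<bar>s\<bar> \<le> K" for r s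
    unfolding S_def
    by (rule H2_norm_le_sup[OF T H2rep_diff[OF G_props(1) G_props(1)]]) (use rs K L(1) GLip[OF rs] in auto)
  have Gnorm: "H2_norm T (G r) \<le> S * (L * \<bar>r\<bar>)" if "\<bar>r\<bar> \<le> K" for r
    using GH[of r 0] that K by (simp add: G0)
  define E0 where "E0 = H2_inner T e e"
  have E0: "E0 > 0"
    unfolding E0_def H2_inner_eigen[OF T e_rep e_rep] using N_pos \<sigma>0 by (intro mult_pos_pos) (auto intro: add_pos_nonneg)
  define g where "g r = H2_inner T (G r) (G r)" for r
  have g_norm: "g r = (H2_norm T (G r))\<^sup>2" if "\<bar>r\<bar> \<le> K" for r
    unfolding g_def using H2_norm_rep[OF T G_props(1)] that K by simp
  have g0: "0 \<le> g r" if "\<bar>r\<bar> \<le> K" for r using g_norm[OF that] by simp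
  obtain \<eta> where \<eta>: "\<eta> > 0" "\<And>r m \<gamma> m' \<gamma>'. blowup r m \<gamma> \<Longrightarrow> blowup r m' \<gamma>' \<Longrightarrow> \<bar>r\<bar> \<le> \<eta> \<Longrightarrow> \<bar>m'\<bar> \<le> \<eta> \<Longrightarrow>
     (\<And>t. t \<in> {0..T} \<Longrightarrow> \<bar>\<gamma> t\<bar> \<le> 1) \<Longrightarrow> (\<And>t. t \<in> {0..T} \<Longrightarrow> \<bar>\<gamma>' t\<bar> \<le> 1) \<Longrightarrow> m = m' \<and> (\<forall>t\<in>{0..T}. \<gamma> t = \<gamma>' t)"
  proof (rule blowup_unique)
    fix \<eta> assume "\<eta> > 0" "\<And>r m \<gamma> m' \<gamma>'. blowup r m \<gamma> \<Longrightarrow> blowup r m' \<gamma>' \<Longrightarrow> \<bar>r\<bar> \<le> \<eta> \<Longrightarrow> \<bar>m'\<bar> \<le> \<eta> \<Longrightarrow>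
     (\<And>t. t \<in> {0..T} \<Longrightarrow> \<bar>\<gamma> t\<bar> \<le> 1) \<Longrightarrow> (\<And>t. t \<in> {0..T} \<Longrightarrow> \<bar>\<gamma>' t\<bar> \<le> 1) \<Longrightarrow> m = m' \<and> (\<forall>t\<in>{0..T}. \<gamma> t = \<gamma>' t)"
    then show thesis by (rule that)
  qed
  define L' where "L' = S * L * (2 * (S * L))"
  have L'0: "0 \<le> L'" unfolding L'_def using S0 L by simp
  define q where "q = 2 * L\<^sup>2 + L' + 1"
  have q: "q > 0" unfolding q_def using L'0 by (intro add_nonneg_pos add_nonneg_nonneg) auto
  \<comment> \<open>Collects what is required of r = s^2: Lipschitz bounds, uniqueness after
    blow-up, a remainder of at most 1 and at most \<open>\<delta>0\<close> in C^1, and monotonicity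
    of the distance.\<close>
  define r1 where "r1 = min (min 1 K) (min (min \<eta> (E0 / (2 * q))) (min 1 \<delta>0 / (L + 1)))"
  have r1: "0 < r1" "r1 \<le> 1" "r1 \<le> K" "r1 \<le> \<eta>" "L * r1 \<le> 1" "L * r1 \<le> \<delta>0" "r1 * (2 * L\<^sup>2 + L') < E0"
  proof -
    show "0 < r1" unfolding r1_def using K \<eta> E0 q assms L(1) by simp
    then have p: "0 < r1" .
    show "r1 \<le> 1" "r1 \<le> K" "r1 \<le> \<eta>" by (auto simp: r1_def)
    have "r1 \<le> min 1 \<delta>0 / (L + 1)" by (auto simp: r1_def)
    then have "r1 * (L + 1) \<le> min 1 \<delta>0" using L(1) by (simp add: pos_le_divide_eq)
    then show "L * r1 \<le> 1" "L * r1 \<le> \<delta>0" using p by (auto simp: algebra_simps)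
    have "r1 \<le> E0 / (2 * q)" by (auto simp: r1_def)
    then have "r1 * q * 2 \<le> E0" using q by (simp add: pos_le_divide_eq mult_ac)
    moreover have "r1 * (2 * L\<^sup>2 + L') \<le> r1 * q" using p by (intro mult_left_mono) (auto simp: q_def)
    ultimately show "r1 * (2 * L\<^sup>2 + L') < E0" using p q mult_pos_pos[of r1 q] by linarith
  qed
  have Gsmall: "\<bar>G r t\<bar> \<le> L * r1" "\<bar>G1 r t\<bar> \<le> L * r1" if "\<bar>r\<bar> \<le> r1" "t \<in> {0..T}" for r t
  proof -
    have "L * \<bar>r\<bar> \<le> L * r1" using that L(1) by (intro mult_left_mono)
    then show "\<bar>G r t\<bar> \<le> L * r1" "\<bar>G1 r t\<bar> \<le> L * r1"
      using GLip(1)[of r 0 t] GLip(2)[of r 0 t] that r1 K by (auto simp: G0)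
  qed
  have gL: "\<bar>g r - g s\<bar> \<le> L' * \<bar>r - s\<bar>" if "0 \<le> r" "r \<le> r1" "0 \<le> s" "s \<le> r1" for r s
  proof -
    have rs: "\<bar>r\<bar> \<le> K" "\<bar>s\<bar> \<le> K" "\<bar>r\<bar> \<le> 1" "\<bar>s\<bar> \<le> 1" using that r1 by auto
    then have rep': "H2rep T (G r) (G1 r) (G2 r)" "H2rep T (G s) (G1 s) (G2 s)" using K by (auto intro: G_props)
    define x where "x = H2_norm T (G r)" define y where "y = H2_norm T (G s)"
    have tri: "x \<le> H2_norm T (\<lambda>t. G r t - G s t) + y" "y \<le> H2_norm T (\<lambda>t. G s t - G r t) + x"
      using H2_norm_triangle[OF T H2rep_diff[OF rep'(1,2)] rep'(2)] H2_norm_triangle[OF T H2rep_diff[OF rep'(2,1)] rep'(1)]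
      by (simp_all add: x_def y_def)
    have d: "\<bar>x - y\<bar> \<le> S * (L * \<bar>r - s\<bar>)"
      using tri GH[OF rs(1,2)] GH[OF rs(2,1)] by (simp add: abs_minus_commute)
    have "S * (L * \<bar>r\<bar>) \<le> S * (L * 1)" "S * (L * \<bar>s\<bar>) \<le> S * (L * 1)"
      using rs S0 L(1) by (intro mult_left_mono; simp)+
    then have xy: "x \<le> S * L" "y \<le> S * L" using Gnorm[OF rs(1)] Gnorm[OF rs(2)] by (simp_all add: x_def y_def)
    have n: "0 \<le> x" "0 \<le> y" unfolding x_def y_def by (rule H2_norm_nonneg[OF T rep'(1)] H2_norm_nonneg[OF T rep'(2)])+
    have "\<bar>g r - g s\<bar> = \<bar>x - y\<bar> * \<bar>x + y\<bar>"
      unfolding g_norm[OF rs(1)] g_norm[OF rs(2)] x_def[symmetric] y_def[symmetric]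
      by (simp add: abs_mult[symmetric] power2_eq_square algebra_simps)
    also have "\<dots> \<le> (S * (L * \<bar>r - s\<bar>)) * (2 * (S * L))" using d xy n by (intro mult_mono) auto
    finally show ?thesis by (simp add: L'_def mult_ac)
  qed
  define Q where "Q r = (M r)\<^sup>2 + r * (E0 + g r)" for r
  have g0': "0 \<le> g r" for r unfolding g_def H2_inner_def by (intro sum_nonneg Bochner_Integration.integral_nonneg) simp
  have Qmono: "Q r < Q r'" if "0 \<le> r" "r < r'" "r' \<le> r1" for r r'
    unfolding Q_def
    by (rule quadratic_increment[where L = L and L' = L' and ?r1.0 = r1]) (use MLip gL M0 L(1) g0' r1 that in auto)
  have Qbound: "Q r \<le> r * (L\<^sup>2 + E0 + L')" if "0 \<le> r" "r \<le> r1" for r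
  proof -
    have "\<bar>M r\<bar> \<le> L * r" using MLip[of r 0] that r1 K by (simp add: M0)
    then have "(M r)\<^sup>2 \<le> (L * r)\<^sup>2" using that by (metis abs_le_square_iff abs_of_nonneg L(1) mult_nonneg_nonneg)
    also have "\<dots> = L\<^sup>2 * (r * r)" by (simp add: power_mult_distrib power2_eq_square)
    also have "\<dots> \<le> L\<^sup>2 * (r * 1)" using that r1 by (intro mult_left_mono) auto
    finally have 1: "(M r)\<^sup>2 \<le> L\<^sup>2 * r" by simp
    have "g r \<le> L' * r" using gL[of r 0] g_norm[of 0] Gnorm[of 0] H2_norm_nonneg[OF T G_props(1)[of 0]] that r1 K by simp
    also have "\<dots> \<le> L' * 1" using that r1 L'0 by (intro mult_left_mono) auto
    finally have "r * g r \<le> r * L'" using that by (intro mult_left_mono) auto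
    with 1 show ?thesis by (simp add: Q_def algebra_simps)
  qed
  define Cs where "Cs = sqrt T / T + sqrt T"
  have Cs: "Cs > 0" unfolding Cs_def using T by (intro add_pos_pos) auto
  \<comment> \<open>Chosen so that |s| \<le> \<eta>' forces s^2 < r1, where the series branch is
    under control.\<close>
  define \<eta>' where "\<eta>' = sqrt r1 / 2"
  have \<eta>': "\<eta>' > 0" using r1 by (simp add: \<eta>'_def)
  obtain \<delta> where \<delta>: "\<delta> > 0" "\<And>l u u1. H2rep T u u1 (\<lambda>t. - l * u t - a t * (u t * (u t * u t))) \<Longrightarrow> symE T E u \<Longrightarrow>
    \<bar>l - \<sigma>\<bar> \<le> \<delta> \<Longrightarrow> (\<And>t. t \<in> {0..T} \<Longrightarrow> \<bar>u t\<bar> \<le> \<delta>) \<Longrightarrow> (\<exists>t\<in>{0..T}. u t \<noteq> 0) \<Longrightarrow>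
    \<exists>s \<gamma>. s \<noteq> 0 \<and> \<bar>s\<bar> \<le> \<eta>' \<and> blowup (s\<^sup>2) (l - \<sigma>) \<gamma> \<and> (\<forall>t\<in>{0..T}. \<bar>\<gamma> t\<bar> \<le> 1) \<and> (\<forall>t\<in>{0..T}. u t = s * (e t + \<gamma> t))"
  proof (rule blowdown[OF \<eta>'], goal_cases)
    case (1 \<delta>)
    from 1(2-) show ?case by (rule 1(1))
  qed
  \<comment> \<open>In a ball of this radius the embedding constant \<open>Cs\<close> turns the norm
    bound into the pointwise bound \<delta> that \<open>blowdown\<close> asks for; \<eta> bounds |l
    - \<sigma>| for uniqueness.\<close>
  define \<rho>s where "\<rho>s = min (min \<delta>0 \<eta>) (min \<delta> (\<delta> / Cs))"
  have \<rho>s: "0 < \<rho>s" "\<rho>s \<le> \<delta>0" "\<rho>s \<le> \<eta>" "\<rho>s \<le> \<delta>" "Cs * \<rho>s \<le> \<delta>"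
  proof -
    show "0 < \<rho>s" using assms \<eta> \<delta> Cs by (simp add: \<rho>s_def)
    show "\<rho>s \<le> \<delta>0" "\<rho>s \<le> \<eta>" "\<rho>s \<le> \<delta>" by (auto simp: \<rho>s_def)
    have "\<rho>s \<le> \<delta> / Cs" by (auto simp: \<rho>s_def)
    then show "Cs * \<rho>s \<le> \<delta>" using Cs by (simp add: pos_le_divide_eq mult.commute)
  qed
  define H where "H = L\<^sup>2 + E0 + L'"
  have H: "H > 0" unfolding H_def using E0 L'0 by (simp add: add_nonneg_pos add_pos_nonneg)
  \<comment> \<open>The factor 2 gives the strict inequality Q(rm) < \<rho>s^2.\<close>
  define rm where "rm = min (r1 / 2) (\<rho>s\<^sup>2 / (2 * H))"
  have rm: "0 < rm" "rm < r1" "rm * H < \<rho>s\<^sup>2"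
  proof -
    show "0 < rm" "rm < r1" using r1 \<rho>s H by (auto simp: rm_def min_def)
    have "rm \<le> \<rho>s\<^sup>2 / (2 * H)" by (simp add: rm_def)
    then have "rm * H * 2 \<le> \<rho>s\<^sup>2" using H by (simp add: pos_le_divide_eq mult_ac)
    then show "rm * H < \<rho>s\<^sup>2" using \<open>0 < rm\<close> H mult_pos_pos[of rm H] by linarith
  qed
  have Q0: "Q 0 = 0" by (simp add: Q_def M0)
  have Qrm: "0 < Q rm" "Q rm < \<rho>s\<^sup>2"
    using Qmono[of 0 rm] Qbound[of rm] rm by (auto simp: Q0 H_def[symmetric])
  have cQ: "continuous_on {0..rm} Q"
  proof -
    have lip: "continuous_on {0..rm} f" if "\<And>r s. r \<in> {0..rm} \<Longrightarrow> s \<in> {0..rm} \<Longrightarrow> \<bar>f r - f s\<bar> \<le> B * \<bar>r - s\<bar>" "0 \<le> B"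
      for f :: "real \<Rightarrow> real" and B
      by (rule lipschitz_on_continuous_on[of B], rule lipschitz_onI) (use that in \<open>auto simp: dist_real_def\<close>)
    have "continuous_on {0..rm} M" by (rule lip[OF _ L(1)], rule MLip) (use rm r1 in auto)
    moreover have "continuous_on {0..rm} g" by (rule lip[OF _ L'0], rule gL) (use rm in auto)
    ultimately show ?thesis unfolding Q_def by (intro continuous_intros)
  qed
  define \<rho>m where "\<rho>m = sqrt (Q rm)"
  have \<rho>m: "0 < \<rho>m" "\<rho>m \<le> \<rho>s"
  proof -
    show "0 < \<rho>m" using Qrm by (simp add: \<rho>m_def)
    have "sqrt (Q rm) \<le> sqrt (\<rho>s\<^sup>2)" using Qrm by (intro real_sqrt_le_mono) simp
    then show "\<rho>m \<le> \<rho>s" using \<rho>s(1) by (simp add: \<rho>m_def)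
  qed
  have main: "\<exists>\<epsilon> \<Lambda> \<Gamma>. is_branch \<rho> \<delta>0 \<epsilon> \<Lambda> \<Gamma>" if \<rho>: "0 < \<rho>" "\<rho> \<le> \<rho>m" for \<rho>
  proof -
  have "\<rho>\<^sup>2 \<le> Q rm"
  proof -
    have "\<rho>\<^sup>2 \<le> \<rho>m\<^sup>2" using \<rho> by (intro power_mono) auto
    then show ?thesis using Qrm by (simp add: \<rho>m_def)
  qed
  \<comment> \<open>The intermediate value theorem selects the r at which the curve leaves the
    ball.\<close>
  then obtain r2 where r2': "0 \<le> r2" "r2 \<le> rm" "Q r2 = \<rho>\<^sup>2"
    using IVT'[of Q 0 "\<rho>\<^sup>2" rm] cQ rm \<rho> by (auto simp: Q0)
  have r2: "0 < r2" "r2 < r1"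
    using r2' rm \<rho> Q0 by (cases "r2 = 0"; auto)+
  have \<rho>_Q: "\<rho> = sqrt (Q r2)" using r2'(3) \<rho> by simp
  have \<rho>\<rho>s: "\<rho> \<le> \<rho>s" using \<rho> \<rho>m by linarith
  define \<epsilon> where "\<epsilon> = sqrt r2"
  have \<epsilon>: "0 < \<epsilon>" "\<epsilon>\<^sup>2 = r2" using r2 by (auto simp: \<epsilon>_def)
  have sq: "s\<^sup>2 < r2 \<longleftrightarrow> \<bar>s\<bar> < \<epsilon>" for s
    unfolding \<epsilon>(2)[symmetric] using \<epsilon>(1) by (metis abs_le_square_iff abs_of_pos not_le)
  define \<Lambda> where "\<Lambda> s = \<sigma> + M (s\<^sup>2)" for s
  define \<Gamma> where "\<Gamma> s = G (s\<^sup>2)" for s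
  have sK: "\<bar>s\<^sup>2\<bar> < \<rho>0" "\<bar>s\<^sup>2\<bar> \<le> K" "\<bar>s\<^sup>2\<bar> \<le> r1" if "s\<^sup>2 \<le> r1" for s :: real
    using that r1 K by auto
  have e_H2: "e \<in> H2 T" unfolding H2_iff[OF T] using e_rep e_zero by blast
  have crep: "H2rep T (\<lambda>t. s * (e t + \<Gamma> s t)) (\<lambda>t. s * (e1 t + G1 (s\<^sup>2) t)) (\<lambda>t. s * (- \<sigma> * e t + G2 (s\<^sup>2) t))"
    if "s\<^sup>2 \<le> r1" for s
    unfolding \<Gamma>_def by (intro H2rep_cmult H2rep_add e_rep G_props sK that)
  have cnorm: "(H2_norm T (\<lambda>t. s * (e t + \<Gamma> s t)))\<^sup>2 = s\<^sup>2 * (E0 + g (s\<^sup>2))" if s: "s\<^sup>2 \<le> r1" for s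
  proof -
    note Gr = G_props[OF sK(1)[OF s]]
    \<comment> \<open>Pythagoras: the remainder is orthogonal to e in H^2, so the squared norm of
      the sum splits.\<close>
    have "H2_inner T (\<lambda>t. 1 * G (s\<^sup>2) t + e t) (\<lambda>t. 1 * G (s\<^sup>2) t + e t) =
        H2_inner T (G (s\<^sup>2)) (G (s\<^sup>2)) * 1\<^sup>2 + 2 * H2_inner T (G (s\<^sup>2)) e * 1 + H2_inner T e e"
      by (rule H2_inner_square[OF T Gr(1) e_rep])
    moreover have "H2_inner T (G (s\<^sup>2)) e = 0" using H2_inner_eigen[OF T Gr(1) e_rep] Gr(3) by simp
    ultimately have i: "H2_inner T (\<lambda>t. e t + \<Gamma> s t) (\<lambda>t. e t + \<Gamma> s t) = E0 + g (s\<^sup>2)"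
      by (simp add: \<Gamma>_def E0_def g_def add.commute)
    have r: "H2rep T (\<lambda>t. e t + \<Gamma> s t) (\<lambda>t. e1 t + G1 (s\<^sup>2) t) (\<lambda>t. - \<sigma> * e t + G2 (s\<^sup>2) t)"
      unfolding \<Gamma>_def by (intro H2rep_add e_rep Gr)
    show ?thesis
      unfolding H2_norm_cmult[OF T r] power_mult_distrib H2_norm_rep[OF T r] i by simp
  qed
  have csol: "(\<Lambda> s, \<lambda>t. s * (e t + \<Gamma> s t)) \<in> zeros_FF T a \<and> symE T E (\<lambda>t. s * (e t + \<Gamma> s t))" if s: "s\<^sup>2 \<le> r1" for s
  proof
    have "H2rep T (\<lambda>t. s * (e t + \<Gamma> s t)) (\<lambda>t. s * (e1 t + G1 (s\<^sup>2) t))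
       (\<lambda>t. - \<Lambda> s * (s * (e t + \<Gamma> s t)) - a t * ((s * (e t + \<Gamma> s t)) * ((s * (e t + \<Gamma> s t)) * (s * (e t + \<Gamma> s t)))))"
    proof (rule H2rep_cong[OF crep[OF s] T])
      fix t assume t: "t \<in> {0..T}"
      have G2: "G2 (s\<^sup>2) t = nonl (s\<^sup>2) (M (s\<^sup>2)) (G (s\<^sup>2)) t - \<sigma> * G (s\<^sup>2) t"
        using eq[OF sK(1)[OF s] t] by (simp add: G2_def G_def M_def)
      show "- \<Lambda> s * (s * (e t + \<Gamma> s t)) - a t * ((s * (e t + \<Gamma> s t)) * ((s * (e t + \<Gamma> s t)) * (s * (e t + \<Gamma> s t))))
          = s * (- \<sigma> * e t + G2 (s\<^sup>2) t)"
        unfolding G2 nonl_def \<Lambda>_def \<Gamma>_def by (simp add: algebra_simps power2_eq_square)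
    qed simp
    then show "(\<Lambda> s, \<lambda>t. s * (e t + \<Gamma> s t)) \<in> zeros_FF T a"
      unfolding sol_iff using e_zero Goff by (auto simp: \<Gamma>_def)
    show "symE T E (\<lambda>t. s * (e t + \<Gamma> s t))"
      unfolding \<Gamma>_def by (intro symE_cmult symE_add e_sym G_props sK s)
  qed
  have cdist: "sqrt ((\<Lambda> s - \<sigma>)\<^sup>2 + (H2_norm T (\<lambda>t. s * (e t + \<Gamma> s t)))\<^sup>2) < \<rho> \<longleftrightarrow> \<bar>s\<bar> < \<epsilon>" if s: "s\<^sup>2 \<le> r1" for s
  proof -
    have "(\<Lambda> s - \<sigma>)\<^sup>2 + (H2_norm T (\<lambda>t. s * (e t + \<Gamma> s t)))\<^sup>2 = Q (s\<^sup>2)"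
      unfolding cnorm[OF s] by (simp add: Q_def \<Lambda>_def)
    moreover have "Q (s\<^sup>2) < Q r2 \<longleftrightarrow> s\<^sup>2 < r2"
      using Qmono[of "s\<^sup>2" r2] Qmono[of r2 "s\<^sup>2"] s r2 by (cases "s\<^sup>2" r2 rule: linorder_cases) auto
    ultimately show ?thesis by (simp add: \<rho>_Q sq)
  qed
  have "is_branch \<rho> \<delta>0 \<epsilon> \<Lambda> \<Gamma>"
  proof (rule is_branchI)
    show "\<epsilon> > 0" using \<epsilon> by auto
    have \<epsilon>R: "\<epsilon> \<le> sqrt \<rho>0" unfolding \<epsilon>_def using r2 r1 K by (intro real_sqrt_le_mono) simp
    have R: "s\<^sup>2 < \<rho>0" if "\<bar>s\<bar> < sqrt \<rho>0" for s
      using that \<rho>0 by (metis abs_ge_zero power2_abs power_strict_mono real_sqrt_pow2 less_imp_le zero_less_numeral)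
    have sumI: "summable (\<lambda>n. interleave c n * x ^ n)" if "\<bar>x\<bar> < sqrt \<rho>0" "\<And>n. \<bar>c n\<bar> \<le> b n" for c x
    proof -
      have "summable (\<lambda>n. c n * (x\<^sup>2) ^ n)" by (rule ps_summable(2)[OF that(2) bs]) (use R[OF that(1)] in auto)
      then show ?thesis by (rule interleave_summable)
    qed
    show "smooth_on {-\<epsilon><..<\<epsilon>} \<Lambda>"
    proof -
      have "smooth_on {-sqrt \<rho>0<..<sqrt \<rho>0} \<Lambda>"
      proof (rule ps_smooth_on)
        fix x assume x: "\<bar>x\<bar> < sqrt \<rho>0"
        \<comment> \<open>The constant \<sigma> enters as the coefficient of order 0, which is free
          because \<mu> 0 = 0.\<close>
        have "summable (\<lambda>n. interleave \<mu> n * x ^ n + (if n = 0 then \<sigma> else 0))"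
          by (intro summable_add sumI x \<mu>b) (rule summable_finite[of "{0}"], auto)
        moreover have "interleave \<mu> n * x ^ n + (if n = 0 then \<sigma> else 0) = interleave (\<mu>(0 := \<sigma>)) n * x ^ n" for n
          by (cases "even n"; cases "n = 0") (auto simp: interleave_def \<mu>0 elim!: evenE)
        ultimately show "summable (\<lambda>n. interleave (\<mu>(0 := \<sigma>)) n * x ^ n)" by simp
      next
        fix s assume s: "\<bar>s\<bar> < sqrt \<rho>0"
        have "(\<lambda>n. \<mu> n * (s\<^sup>2) ^ n) sums M (s\<^sup>2)"
          unfolding M_def ps_def by (rule summable_sums, rule ps_summable(2)[OF \<mu>b bs]) (use R[OF s] in auto)
        moreover have "(\<lambda>n. if n = 0 then \<sigma> else 0) sums \<sigma>" using sums_single[of 0 "\<lambda>_. \<sigma>"] by simp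
        ultimately have "(\<lambda>n. (if n = 0 then \<sigma> else 0) + \<mu> n * (s\<^sup>2) ^ n) sums \<Lambda> s"
          unfolding \<Lambda>_def by (intro sums_add)
        moreover have "(if n = 0 then \<sigma> else 0) + \<mu> n * (s\<^sup>2) ^ n = (\<mu>(0 := \<sigma>)) n * (s\<^sup>2) ^ n" for n
          by (simp add: \<mu>0)
        ultimately have "(\<lambda>n. (\<mu>(0 := \<sigma>)) n * (s\<^sup>2) ^ n) sums \<Lambda> s" by (simp only:)
        then show "\<Lambda> s = ps (interleave (\<mu>(0 := \<sigma>))) s" unfolding ps_interleave unfolding ps_def by (rule sums_unique)
      qed
      then show ?thesis using \<epsilon>R unfolding smooth_on_def by auto
    qed
    show "smooth_map_H2 T (ortho_in T {u \<in> H2 T. symE T E u} e) \<epsilon> \<Gamma>"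
    proof (rule smooth_map_H2_ps[where v = "\<lambda>n t. interleave (\<lambda>n. v n t) n" and ?v1.0 = "\<lambda>n t. interleave (\<lambda>n. v1 n t) n"
          and ?v2.0 = "\<lambda>n t. interleave (\<lambda>n. v2 n t) n" and b = "interleave b" and R = "sqrt \<rho>0", OF T])
      have z: "H2rep T (\<lambda>_. 0) (\<lambda>_. 0) (\<lambda>_. 0)" using H2rep_cmult[OF e_rep, of 0] by simp
      show "H2rep T (\<lambda>t. interleave (\<lambda>n. v n t) n) (\<lambda>t. interleave (\<lambda>n. v1 n t) n) (\<lambda>t. interleave (\<lambda>n. v2 n t) n)" for n
        by (cases "even n") (simp_all add: interleave_def rep z)
      show "\<bar>interleave (\<lambda>n. v n t) n\<bar> \<le> interleave b n" "\<bar>interleave (\<lambda>n. v1 n t) n\<bar> \<le> interleave b n"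
        "\<bar>interleave (\<lambda>n. v2 n t) n\<bar> \<le> interleave b n" if "t \<in> {0..T}" for n t
        using vb[OF that] by (simp_all add: interleave_def)
      show "0 \<le> interleave b n" for n using b0 by (simp add: interleave_def)
      show "summable (\<lambda>n. interleave b n * x ^ n)" if "\<bar>x\<bar> < sqrt \<rho>0" for x
        by (rule sumI[OF that]) (use b0 in auto)
      show "\<epsilon> \<le> sqrt \<rho>0" by fact
      show "\<Gamma> s = (\<lambda>t. ps (interleave (\<lambda>n. v n t)) s)" for s by (simp add: \<Gamma>_def G_def ps_interleave)
      fix k :: "nat \<Rightarrow> real" and p assume s: "summable (\<lambda>n. \<bar>k n\<bar> * interleave b (n + p))"
      let ?f = "\<lambda>v n t. interleave (\<lambda>n. v n t) (n + p)"
      have z: "H2rep T (\<lambda>_. 0) (\<lambda>_. 0) (\<lambda>_. 0)" using H2rep_cmult[OF e_rep, of 0] by simp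
      have 1: "H2rep T (?f v n) (?f v1 n) (?f v2 n)" for n
        by (cases "even (n + p)") (simp_all add: interleave_def rep z)
      have 2: "\<bar>?f v n t\<bar> \<le> interleave b (n + p)" "\<bar>?f v1 n t\<bar> \<le> interleave b (n + p)"
        "\<bar>?f v2 n t\<bar> \<le> interleave b (n + p)" if "t \<in> {0..T}" for n t
        using vb[OF that] by (simp_all add: interleave_def)
      have 3: "symE T E (?f v n)" for n
        using sym by (cases "even (n + p)") (simp_all add: interleave_def symE_def)
      have 4: "lint 0 T (\<lambda>t. ?f v n t * e t) = 0" for n
        using orth by (cases "even (n + p)") (simp_all add: interleave_def)
      note c = series_closed[OF 1 2 3 4 s]
      have "(\<Sum>n. k n * ?f v n t) = 0" if "t \<notin> {0..T}" for t
        using off[OF that] by (simp add: interleave_def)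
      then have "(\<lambda>t. \<Sum>n. k n * ?f v n t) \<in> H2 T" unfolding H2_iff[OF T] using c(1) by blast
      moreover have "H2_inner T (\<lambda>t. \<Sum>n. k n * ?f v n t) e = 0"
        using H2_inner_eigen[OF T c(1) e_rep] c(3) by simp
      ultimately show "(\<lambda>t. \<Sum>n. k n * ?f v n t) \<in> ortho_in T {u \<in> H2 T. symE T E u} e"
        using c(2) by (simp add: ortho_in_def)
    qed
    show "\<Lambda> 0 = \<sigma>" by (simp add: \<Lambda>_def M0)
    show "\<Gamma> 0 = zero_fun" by (simp add: \<Gamma>_def G0 zero_fun_def fun_eq_iff)
    show "\<Lambda> (- s) = \<Lambda> s" "\<Gamma> (- s) = \<Gamma> s" for s by (simp_all add: \<Lambda>_def \<Gamma>_def)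
    have le: "s\<^sup>2 \<le> r1" if "\<bar>s\<bar> < \<epsilon>" for s using that sq[of s] r2 by simp
    show "(\<Lambda> s, \<lambda>t. s * (e t + \<Gamma> s t)) \<in> zeros_FF T a \<and> symE T E (\<lambda>t. s * (e t + \<Gamma> s t))" if "\<bar>s\<bar> < \<epsilon>" for s
      by (rule csol[OF le[OF that]])
    show "blowup (s\<^sup>2) (\<Lambda> s - \<sigma>) (\<Gamma> s)" if "\<bar>s\<bar> < \<epsilon>" for s
      using bu[OF sK(1)[OF le[OF that]]] by (simp add: \<Lambda>_def \<Gamma>_def)
    show "\<exists>\<gamma>1 \<gamma>2. H2rep T (\<Gamma> s) \<gamma>1 \<gamma>2 \<and> (\<forall>t\<in>{0..T}. \<bar>\<Gamma> s t\<bar> \<le> \<delta>0 \<and> \<bar>\<gamma>1 t\<bar> \<le> \<delta>0)" if "\<bar>s\<bar> < \<epsilon>" for s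
      unfolding \<Gamma>_def using G_props(1)[OF sK(1)[OF le[OF that]]] Gsmall[OF sK(3)[OF le[OF that]]] r1(6)
      by (meson order_trans)
    show "{(l, u) \<in> zeros_FF T a. symE T E u \<and> u \<noteq> zero_fun} \<inter> RH2_ball T (\<sigma>, zero_fun) \<rho> =
      {(\<Lambda> s, \<lambda>t. s * (e t + \<Gamma> s t)) | s. s \<noteq> 0 \<and> \<bar>s\<bar> < \<epsilon>}"
    proof (intro set_eqI iffI)
      fix p assume p: "p \<in> {(l, u) \<in> zeros_FF T a. symE T E u \<and> u \<noteq> zero_fun} \<inter> RH2_ball T (\<sigma>, zero_fun) \<rho>"
      obtain l u where lu: "p = (l, u)" by force
      have z: "(l, u) \<in> zeros_FF T a" and sy: "symE T E u" and nz: "u \<noteq> zero_fun" and uH: "u \<in> H2 T"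
        and d: "sqrt ((l - \<sigma>)\<^sup>2 + (H2_norm T u)\<^sup>2) < \<rho>" using p unfolding lu by (auto simp: in_RH2_ball[OF T])
      obtain u1 where off_u: "\<And>t. t \<notin> {0..T} \<Longrightarrow> u t = 0" and r: "H2rep T u u1 (\<lambda>t. - l * u t - a t * (u t * (u t * u t)))"
        using z unfolding sol_iff by blast
      have "\<bar>l - \<sigma>\<bar> \<le> sqrt ((l - \<sigma>)\<^sup>2 + (H2_norm T u)\<^sup>2)" 
        using real_sqrt_le_mono[of "(l - \<sigma>)\<^sup>2" "(l - \<sigma>)\<^sup>2 + (H2_norm T u)\<^sup>2"] by simp
      then have l1: "\<bar>l - \<sigma>\<bar> \<le> \<rho>s" using d \<rho>\<rho>s by linarith
      have "H2_norm T u \<le> sqrt ((l - \<sigma>)\<^sup>2 + (H2_norm T u)\<^sup>2)" by (rule real_sqrt_sum_squares_ge2)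
      then have n1: "H2_norm T u \<le> \<rho>s" using d \<rho>\<rho>s by linarith
      have ub: "\<bar>u t\<bar> \<le> \<delta>" if "t \<in> {0..T}" for t
      proof -
        have "\<bar>u t\<bar> \<le> Cs * H2_norm T u" unfolding Cs_def by (rule H2_sup_bound(1)[OF T r that])
        also have "\<dots> \<le> Cs * \<rho>s" using n1 Cs by (intro mult_left_mono) auto
        finally show ?thesis using \<rho>s by linarith
      qed
      have nz': "\<exists>t\<in>{0..T}. u t \<noteq> 0" using nz off_u unfolding zero_fun_def by blast
      have l\<delta>: "\<bar>l - \<sigma>\<bar> \<le> \<delta>" using l1 \<rho>s by linarith
      obtain s \<gamma> where s: "s \<noteq> 0" "\<bar>s\<bar> \<le> \<eta>'" "blowup (s\<^sup>2) (l - \<sigma>) \<gamma>" "\<forall>t\<in>{0..T}. \<bar>\<gamma> t\<bar> \<le> 1"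
        "\<forall>t\<in>{0..T}. u t = s * (e t + \<gamma> t)" using \<delta>(2)[OF r sy l\<delta> ub nz'] by blast
      have "s\<^sup>2 \<le> \<eta>'\<^sup>2" using s(2) \<eta>' by (simp add: abs_le_square_iff[symmetric])
      also have "\<dots> \<le> r1" using r1 by (simp add: \<eta>'_def power_divide)
      finally have sr: "s\<^sup>2 \<le> r1" .
      \<comment> \<open>Uniqueness identifies the blown-up solution with the series at the same r =
        s^2; the sign of u along e is kept by s.\<close>
      have un: "M (s\<^sup>2) = l - \<sigma> \<and> (\<forall>t\<in>{0..T}. G (s\<^sup>2) t = \<gamma> t)"
      proof (rule \<eta>(2)[OF bu[OF sK(1)[OF sr]] s(3)])
        show "\<bar>s\<^sup>2\<bar> \<le> \<eta>" "\<bar>l - \<sigma>\<bar> \<le> \<eta>" using sr r1 l1 \<rho>s by auto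
        show "\<bar>G (s\<^sup>2) t\<bar> \<le> 1" if "t \<in> {0..T}" for t using Gsmall(1)[OF sK(3)[OF sr] that] r1 by linarith
        show "\<bar>\<gamma> t\<bar> \<le> 1" if "t \<in> {0..T}" for t using s(4) that by blast
      qed
      have leq: "l = \<Lambda> s" using un by (simp add: \<Lambda>_def)
      have ueq: "u = (\<lambda>t. s * (e t + \<Gamma> s t))"
      proof
        fix t show "u t = s * (e t + \<Gamma> s t)"
          using s(5) un off_u[of t] e_zero[of t] Goff[of t] by (cases "t \<in> {0..T}") (auto simp: \<Gamma>_def)
      qed
      have "\<bar>s\<bar> < \<epsilon>" using d cdist[OF sr] unfolding leq ueq by simp
      then show "p \<in> {(\<Lambda> s, \<lambda>t. s * (e t + \<Gamma> s t)) | s. s \<noteq> 0 \<and> \<bar>s\<bar> < \<epsilon>}"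
        unfolding lu leq using ueq s(1) by blast
    next
      fix p assume "p \<in> {(\<Lambda> s, \<lambda>t. s * (e t + \<Gamma> s t)) | s. s \<noteq> 0 \<and> \<bar>s\<bar> < \<epsilon>}"
      then obtain s where p: "p = (\<Lambda> s, \<lambda>t. s * (e t + \<Gamma> s t))" and s: "s \<noteq> 0" "\<bar>s\<bar> < \<epsilon>" by blast
      note sr = le[OF s(2)]
      have "(\<lambda>t. s * (e t + \<Gamma> s t)) \<noteq> zero_fun"
      proof
        assume "(\<lambda>t. s * (e t + \<Gamma> s t)) = zero_fun"
        then have "s * (e t + \<Gamma> s t) = 0" for t unfolding zero_fun_def by metis
        then have "e t = - \<Gamma> s t" for t using s(1) by (simp add: eq_neg_iff_add_eq_0)
        \<comment> \<open>Pairing with e gives N = 0, since the remainder is orthogonal to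
          e.\<close>
        then have "N = lint 0 T (\<lambda>t. - (G (s\<^sup>2) t * e t))" by (intro lint_cong) (simp add: \<Gamma>_def)
        then show False using N_pos G_props(3)[OF sK(1)[OF sr]] by simp
      qed
      moreover have "(\<lambda>t. s * (e t + \<Gamma> s t)) \<in> H2 T" using csol[OF sr] by (simp add: zeros_FF_def)
      ultimately show "p \<in> {(l, u) \<in> zeros_FF T a. symE T E u \<and> u \<noteq> zero_fun} \<inter> RH2_ball T (\<sigma>, zero_fun) \<rho>"
        using csol[OF sr] cdist[OF sr] s(2) by (simp add: p in_RH2_ball[OF T])
    qed
    show "\<exists>L. \<forall>s s'. \<bar>s\<bar> < \<epsilon> \<longrightarrow> \<bar>s'\<bar> < \<epsilon> \<longrightarrow> prod_dist dist (H2_dist T) (\<Lambda> s, \<lambda>t. s * (e t + \<Gamma> s t))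
        (\<Lambda> s', \<lambda>t. s' * (e t + \<Gamma> s' t)) \<le> L * \<bar>s - s'\<bar>"
    proof (rule exI, intro allI impI)
      fix s s' assume s: "\<bar>s\<bar> < \<epsilon>" and s': "\<bar>s'\<bar> < \<epsilon>"
      note sr = le[OF s] and sr' = le[OF s']
      have "\<epsilon>\<^sup>2 \<le> 1\<^sup>2" using \<epsilon>(2) r2 r1 by simp
      then have \<epsilon>1: "\<epsilon> \<le> 1" by (rule power2_le_imp_le) simp
      have sq': "\<bar>s\<^sup>2 - s'\<^sup>2\<bar> \<le> 2 * \<bar>s - s'\<bar>"
      proof -
        have "\<bar>s\<^sup>2 - s'\<^sup>2\<bar> = \<bar>s + s'\<bar> * \<bar>s - s'\<bar>" unfolding abs_mult[symmetric]
          by (simp add: power2_eq_square algebra_simps)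
        also have "\<dots> \<le> 2 * \<bar>s - s'\<bar>" using s s' \<epsilon>1 by (intro mult_right_mono) auto
        finally show ?thesis .
      qed
      have lam: "\<bar>\<Lambda> s - \<Lambda> s'\<bar> \<le> 2 * L * \<bar>s - s'\<bar>"
      proof -
        have "\<bar>\<Lambda> s - \<Lambda> s'\<bar> \<le> L * \<bar>s\<^sup>2 - s'\<^sup>2\<bar>" using MLip[OF sK(2)[OF sr] sK(2)[OF sr']] by (simp add: \<Lambda>_def)
        also have "\<dots> \<le> L * (2 * \<bar>s - s'\<bar>)" using sq' L(1) by (rule mult_left_mono)
        finally show ?thesis by simp
      qed
      note Gs = G_props(1)[OF sK(1)[OF sr]] and Gs' = G_props(1)[OF sK(1)[OF sr']]
      have eG: "H2_norm T (\<lambda>t. e t + G (s\<^sup>2) t) \<le> H2_norm T e + S * L"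
      proof -
        have "H2_norm T (\<lambda>t. e t + G (s\<^sup>2) t) \<le> H2_norm T e + H2_norm T (G (s\<^sup>2))"
          by (rule H2_norm_triangle[OF T e_rep Gs])
        moreover have "S * (L * \<bar>s\<^sup>2\<bar>) \<le> S * (L * 1)" using S0 L(1) sr r1 by (intro mult_left_mono) auto
        ultimately show ?thesis using Gnorm[OF sK(2)[OF sr]] by simp
      qed
      \<comment> \<open>The change of the amplitude is separated from the change of the
        remainder.\<close>
      have "H2_dist T (\<lambda>t. s * (e t + \<Gamma> s t)) (\<lambda>t. s' * (e t + \<Gamma> s' t)) =
          H2_norm T (\<lambda>t. (s - s') * (e t + G (s\<^sup>2) t) + s' * (G (s\<^sup>2) t - G (s'\<^sup>2) t))"
        unfolding H2_dist_def \<Gamma>_def by (rule arg_cong[where f = "H2_norm T"]) (simp add: fun_eq_iff algebra_simps)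
      also have "\<dots> \<le> H2_norm T (\<lambda>t. (s - s') * (e t + G (s\<^sup>2) t)) + H2_norm T (\<lambda>t. s' * (G (s\<^sup>2) t - G (s'\<^sup>2) t))"
        by (rule H2_norm_triangle[OF T H2rep_cmult[OF H2rep_add[OF e_rep Gs]] H2rep_cmult[OF H2rep_diff[OF Gs Gs']]])
      also have "\<dots> = \<bar>s - s'\<bar> * H2_norm T (\<lambda>t. e t + G (s\<^sup>2) t) + \<bar>s'\<bar> * H2_norm T (\<lambda>t. G (s\<^sup>2) t - G (s'\<^sup>2) t)"
        unfolding H2_norm_cmult[OF T H2rep_add[OF e_rep Gs]] H2_norm_cmult[OF T H2rep_diff[OF Gs Gs']] ..
      also have "\<dots> \<le> \<bar>s - s'\<bar> * (H2_norm T e + S * L) + 1 * (S * (L * (2 * \<bar>s - s'\<bar>)))"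
      proof (intro add_mono mult_mono eG)
        have "S * (L * \<bar>s\<^sup>2 - s'\<^sup>2\<bar>) \<le> S * (L * (2 * \<bar>s - s'\<bar>))" using sq' S0 L(1) by (intro mult_left_mono)
        then show "H2_norm T (\<lambda>t. G (s\<^sup>2) t - G (s'\<^sup>2) t) \<le> S * (L * (2 * \<bar>s - s'\<bar>))"
          using GH[OF sK(2)[OF sr] sK(2)[OF sr']] by linarith
      qed (use s' \<epsilon>1 H2_norm_nonneg[OF T H2rep_add[OF e_rep Gs]] H2_norm_nonneg[OF T H2rep_diff[OF Gs Gs']] in auto)
      finally have hd: "H2_dist T (\<lambda>t. s * (e t + \<Gamma> s t)) (\<lambda>t. s' * (e t + \<Gamma> s' t)) \<le>
          \<bar>s - s'\<bar> * (H2_norm T e + S * L) + 1 * (S * (L * (2 * \<bar>s - s'\<bar>)))" .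
      interpret Hm: Metric_space "H2 T" "H2_dist T" by (rule H2_Metric_space[OF T])
      have "prod_dist dist (H2_dist T) (\<Lambda> s, \<lambda>t. s * (e t + \<Gamma> s t)) (\<Lambda> s', \<lambda>t. s' * (e t + \<Gamma> s' t)) \<le>
          \<bar>\<Lambda> s - \<Lambda> s'\<bar> + H2_dist T (\<lambda>t. s * (e t + \<Gamma> s t)) (\<lambda>t. s' * (e t + \<Gamma> s' t))"
        using sqrt_sum_squares_le_sum[of "\<bar>\<Lambda> s - \<Lambda> s'\<bar>" "H2_dist T (\<lambda>t. s * (e t + \<Gamma> s t)) (\<lambda>t. s' * (e t + \<Gamma> s' t))"]
          Hm.nonneg by (simp add: prod_dist_def dist_real_def)
      also have "\<dots> \<le> (2 * L + (H2_norm T e + S * L) + S * (L * 2)) * \<bar>s - s'\<bar>"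
        using lam hd by (simp add: algebra_simps)
      finally show "prod_dist dist (H2_dist T) (\<Lambda> s, \<lambda>t. s * (e t + \<Gamma> s t)) (\<Lambda> s', \<lambda>t. s' * (e t + \<Gamma> s' t)) \<le>
        (2 * L + (H2_norm T e + S * L) + S * (L * 2)) * \<bar>s - s'\<bar>" .
    qed
  qed
  then show ?thesis by blast
  qed
  show ?thesis by (rule that[OF \<rho>m(1) order_trans[OF \<rho>m(2) \<rho>s(2)] main])
qed

end

section \<open>The linear equation\<close>

lemma acd_mult_trig:
  assumes "acd T u v"
  shows "acd T (\<lambda>t. u t * cos (\<omega> * t)) (\<lambda>t. v t * cos (\<omega> * t) + u t * (- (\<omega> * sin (\<omega> * t))))"
    "acd T (\<lambda>t. u t * sin (\<omega> * t)) (\<lambda>t. v t * sin (\<omega> * t) + u t * (\<omega> * cos (\<omega> * t)))"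
  by (rule acd_mult[OF assms]; auto intro!: derivative_eq_intros continuous_intros)+

text \<open>In coordinates rotating with frequency \<open>\<omega>\<close> the equation \<open>u'' + \<omega>\<^sup>2 u = f\<close> is a mere integration;
  this is the cosine coordinate.\<close>

lemma rotating_frame:
  assumes u: "H2rep T u u1 (\<lambda>t. f t - \<omega>\<^sup>2 * u t)" and \<omega>: "\<omega> \<noteq> 0"
  shows "acd T (\<lambda>t. u t * cos (\<omega> * t) - u1 t / \<omega> * sin (\<omega> * t)) (\<lambda>t. - (1 / \<omega>) * (f t * sin (\<omega> * t)))"
    "acd T (\<lambda>t. u t * sin (\<omega> * t) + u1 t / \<omega> * cos (\<omega> * t)) (\<lambda>t. (1 / \<omega>) * (f t * cos (\<omega> * t)))"
proof -
  note U = H2repD[OF u]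
  have v: "acd T (\<lambda>t. (1 / \<omega>) * u1 t) (\<lambda>t. (1 / \<omega>) * (f t - \<omega>\<^sup>2 * u t))" by (rule acd_cmult[OF U(2)])
  show "acd T (\<lambda>t. u t * cos (\<omega> * t) - u1 t / \<omega> * sin (\<omega> * t)) (\<lambda>t. - (1 / \<omega>) * (f t * sin (\<omega> * t)))"
    by (rule acd_cong[OF acd_diff[OF acd_mult_trig(1)[OF U(1)] acd_mult_trig(2)[OF v]]])
       (use \<omega> in \<open>auto simp: field_simps power2_eq_square\<close>)
  show "acd T (\<lambda>t. u t * sin (\<omega> * t) + u1 t / \<omega> * cos (\<omega> * t)) (\<lambda>t. (1 / \<omega>) * (f t * cos (\<omega> * t)))"
    by (rule acd_cong[OF acd_add[OF acd_mult_trig(2)[OF U(1)] acd_mult_trig(1)[OF v]]])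
       (use \<omega> in \<open>auto simp: field_simps power2_eq_square\<close>)
qed

lemma frame_inverse:
  fixes u w c s :: real
  assumes "c * c + s * s = 1"
  shows "u = (u * c - w * s) * c + (u * s + w * c) * s"
proof -
  have "(u * c - w * s) * c + (u * s + w * c) * s = u * (c * c + s * s)" by (simp add: algebra_simps)
  then show ?thesis using assms by simp
qed

lemma cos_sin_one: "cos x * cos x + sin x * sin x = (1::real)"
  using sin_cos_squared_add2[of x] by (simp add: power2_eq_square)

text \<open>Without a right-hand side both rotating coordinates are constant.\<close>

lemma homogeneous_solution:
  assumes u: "H2rep T u u1 (\<lambda>t. - \<omega>\<^sup>2 * u t)" and \<omega>: "\<omega> \<noteq> 0" and t: "t \<in> {0..T}"
  shows "u t = u 0 * cos (\<omega> * t) + u1 0 / \<omega> * sin (\<omega> * t)"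
proof -
  have u': "H2rep T u u1 (\<lambda>t. (\<lambda>_. 0) t - \<omega>\<^sup>2 * u t)" using u by simp
  note r = rotating_frame[OF u' \<omega>]
  have "u t * cos (\<omega> * t) - u1 t / \<omega> * sin (\<omega> * t) = u 0"
    using acd_increment[OF r(1), of 0 t] t by simp
  moreover have "u t * sin (\<omega> * t) + u1 t / \<omega> * cos (\<omega> * t) = u1 0 / \<omega>"
    using acd_increment[OF r(2), of 0 t] t by simp
  ultimately show ?thesis using frame_inverse[OF cos_sin_one, of "u t" "\<omega> * t" "u1 t / \<omega>"] by simp
qed

text \<open>The rotating coordinates start at 0; orthogonality of f to cosine and sine is exactly
  what brings them back to 0 at T and hence makes the solution periodic. For the symmetry, the
  solution and its signed reflection solve the same problem with zero data at 0.\<close>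

lemma solve_trig:
  assumes T: "T > 0" and \<omega>: "\<omega> > 0" and \<epsilon>: "\<epsilon> \<in> {-1, 1}"
    and fm: "f \<in> borel_measurable (lebesgue_on {0..T})" and fb: "\<And>t. t \<in> {0..T} \<Longrightarrow> \<bar>f t\<bar> \<le> B"
    and sym: "symE T {\<epsilon>} f" and o: "lint 0 T (\<lambda>t. f t * cos (\<omega> * t)) = 0" "lint 0 T (\<lambda>t. f t * sin (\<omega> * t)) = 0"
  shows "\<exists>p p1. H2rep T p p1 (\<lambda>t. f t - \<omega>\<^sup>2 * p t) \<and> symE T {\<epsilon>} p \<and>
    (\<forall>t\<in>{0..T}. \<bar>p t\<bar> \<le> (2 * T / \<omega> + 2 * T) * B \<and> \<bar>p1 t\<bar> \<le> (2 * T / \<omega> + 2 * T) * B)"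
proof -
  have fi: "integrable (lebesgue_on {0..T}) f" by (rule integrable_bdd[OF fm fb])
  have ii: "integrable (lebesgue_on {0..T}) (\<lambda>t. f t * sin (\<omega> * t))" "integrable (lebesgue_on {0..T}) (\<lambda>t. f t * cos (\<omega> * t))"
    by (rule integrable_mult_cont[OF fi]; intro continuous_intros)+
  define \<alpha> where "\<alpha> t = 0 + lint 0 t (\<lambda>t. - (1 / \<omega>) * (f t * sin (\<omega> * t)))" for t
  define \<beta> where "\<beta> t = 0 + lint 0 t (\<lambda>t. (1 / \<omega>) * (f t * cos (\<omega> * t)))" for t
  have a\<alpha>: "acd T \<alpha> (\<lambda>t. - (1 / \<omega>) * (f t * sin (\<omega> * t)))" unfolding \<alpha>_def
    by (rule acd_lint, rule integrable_mult_right, rule ii(1))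
  have a\<beta>: "acd T \<beta> (\<lambda>t. (1 / \<omega>) * (f t * cos (\<omega> * t)))" unfolding \<beta>_def
    by (rule acd_lint, rule integrable_mult_right, rule ii(2))
  have z: "\<alpha> 0 = 0" "\<beta> 0 = 0" "\<alpha> T = 0" "\<beta> T = 0" using o by (simp_all add: \<alpha>_def \<beta>_def)
  have bnd: "\<bar>lint 0 t (\<lambda>t. c * (f t * h t))\<bar> \<le> T / \<omega> * B"
    if t: "t \<in> {0..T}" and c: "\<bar>c\<bar> = 1 / \<omega>" and h: "continuous_on {0..T} h" "\<And>t. \<bar>h t\<bar> \<le> 1" for t c h
  proof -
    have B: "0 \<le> B" using fb[of 0] T by auto
    have "\<bar>lint 0 t (\<lambda>t. c * (f t * h t))\<bar> \<le> (t - 0) * (1 / \<omega> * B)"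
    proof (rule lint_abs_le)
      have "(\<lambda>t. c * (f t * h t)) \<in> borel_measurable (lebesgue_on {0..T})"
        by (intro borel_measurable_times fm continuous_measurable h continuous_intros)
      then show "(\<lambda>t. c * (f t * h t)) \<in> borel_measurable (lebesgue_on {0..t})"
        by (rule measurable_restrict_mono) (use t in auto)
      fix s assume s: "s \<in> {0..t}"
      have "\<bar>f s\<bar> * \<bar>h s\<bar> \<le> B * 1" using fb[of s] h(2) s t B by (intro mult_mono) auto
      then show "\<bar>c * (f s * h s)\<bar> \<le> 1 / \<omega> * B"
        unfolding abs_mult c using \<omega> by (intro mult_left_mono) auto
    qed (use t in auto)
    also have "\<dots> \<le> T * (1 / \<omega> * B)" using t B \<omega> by (intro mult_right_mono) auto
    finally show ?thesis by simp
  qed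
  have b\<alpha>: "\<bar>\<alpha> t\<bar> \<le> T / \<omega> * B" and b\<beta>: "\<bar>\<beta> t\<bar> \<le> T / \<omega> * B" if "t \<in> {0..T}" for t
    unfolding \<alpha>_def \<beta>_def add_0 using \<omega> by (intro bnd that; auto intro!: continuous_intros)+
  define p where "p t = \<alpha> t * cos (\<omega> * t) + \<beta> t * sin (\<omega> * t)" for t
  define p1 where "p1 t = \<omega> * (\<beta> t * cos (\<omega> * t) - \<alpha> t * sin (\<omega> * t))" for t
  have "acd T p p1"
    by (rule acd_cong[OF acd_add[OF acd_mult_trig(1)[OF a\<alpha>] acd_mult_trig(2)[OF a\<beta>]]])
       (auto simp: p_def p1_def algebra_simps)
  moreover have "acd T p1 (\<lambda>t. f t - \<omega>\<^sup>2 * p t)"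
  proof (rule acd_cong[OF acd_cmult[OF acd_diff[OF acd_mult_trig(1)[OF a\<beta>] acd_mult_trig(2)[OF a\<alpha>]]]])
    fix t
    show "p1 t = \<omega> * (\<beta> t * cos (\<omega> * t) - \<alpha> t * sin (\<omega> * t))" by (simp add: p1_def)
    define C S where "C = cos (\<omega> * t)" and "S = sin (\<omega> * t)"
    have "f t = f t * (C * C + S * S)" using cos_sin_one[of "\<omega> * t"] by (simp add: C_def S_def)
    moreover have "\<omega> * ((1 / \<omega> * (f t * C) * C + \<beta> t * - (\<omega> * S)) - (- (1 / \<omega>) * (f t * S) * S + \<alpha> t * (\<omega> * C))) =
       f t * (C * C + S * S) - \<omega>\<^sup>2 * (\<alpha> t * C + \<beta> t * S)"
      using \<omega> by (simp add: field_simps power2_eq_square)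
    ultimately show "f t - \<omega>\<^sup>2 * p t = \<omega> * (1 / \<omega> * (f t * cos (\<omega> * t)) * cos (\<omega> * t) + \<beta> t * - (\<omega> * sin (\<omega> * t)) -
           (- (1 / \<omega>) * (f t * sin (\<omega> * t)) * sin (\<omega> * t) + \<alpha> t * (\<omega> * cos (\<omega> * t))))"
      unfolding p_def C_def[symmetric] S_def[symmetric] by linarith
  qed
  moreover have "(\<lambda>t. f t - \<omega>\<^sup>2 * p t) \<in> L2 T"
    by (intro L2_diff L2_bdd[OF fm fb] L2_cmult L2_cont acd_continuous[OF \<open>acd T p p1\<close>])
  moreover have per: "p T = 0" "p 0 = 0" "p1 T = 0" "p1 0 = 0" by (simp_all add: p_def p1_def z)
  ultimately have rep: "H2rep T p p1 (\<lambda>t. f t - \<omega>\<^sup>2 * p t)" by (simp add: H2rep_def)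
  have \<epsilon>2: "\<epsilon> * \<epsilon> = 1" using \<epsilon> by auto
  have "symE T {\<epsilon>} p" unfolding symE_def
  proof (intro ballI)
    fix e' t assume e': "e' \<in> {\<epsilon>}" and t: "t \<in> {0..T}"
    have "H2rep T (\<lambda>t. \<epsilon> * p (T - t) - p t) (\<lambda>t. \<epsilon> * - p1 (T - t) - p1 t)
        (\<lambda>t. \<epsilon> * (f (T - t) - \<omega>\<^sup>2 * p (T - t)) - (f t - \<omega>\<^sup>2 * p t))"
      by (intro H2rep_diff H2rep_cmult rep H2rep_reflect[OF rep])
    then have "H2rep T (\<lambda>t. \<epsilon> * p (T - t) - p t) (\<lambda>t. \<epsilon> * - p1 (T - t) - p1 t) (\<lambda>t. - \<omega>\<^sup>2 * (\<epsilon> * p (T - t) - p t))"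
    proof (rule H2rep_cong[OF _ T])
      fix t assume t: "t \<in> {0..T}"
      have "\<epsilon> * f (T - t) = \<epsilon> * \<epsilon> * f t" using symED[OF sym _ t] by simp
      then have "\<epsilon> * f (T - t) = f t" by (simp add: \<epsilon>2)
      then show "- \<omega>\<^sup>2 * (\<epsilon> * p (T - t) - p t) = \<epsilon> * (f (T - t) - \<omega>\<^sup>2 * p (T - t)) - (f t - \<omega>\<^sup>2 * p t)"
        by (simp add: algebra_simps)
    qed simp
    from homogeneous_solution[OF this _ t] have "\<epsilon> * p (T - t) = p t" using \<omega> per by simp
    then have "\<epsilon> * (\<epsilon> * p (T - t)) = \<epsilon> * p t" by simp
    then show "p (T - t) = e' * p t" using e' by (simp add: mult.assoc[symmetric] \<epsilon>2)
  qed
  moreover have "\<bar>p t\<bar> \<le> (2 * T / \<omega> + 2 * T) * B \<and> \<bar>p1 t\<bar> \<le> (2 * T / \<omega> + 2 * T) * B" if t: "t \<in> {0..T}" for t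
  proof -
    have B: "0 \<le> B" using fb[of 0] T by auto
    have TB: "0 \<le> T / \<omega> * B" "0 \<le> T * B" using T \<omega> B by auto
    have tr: "\<bar>x * c\<bar> \<le> T / \<omega> * B" if "\<bar>x\<bar> \<le> T / \<omega> * B" "\<bar>c\<bar> \<le> 1" for x c
      using mult_mono[OF that] TB by (simp add: abs_mult)
    have p: "\<bar>\<alpha> t * cos (\<omega> * t)\<bar> \<le> T / \<omega> * B" "\<bar>\<beta> t * sin (\<omega> * t)\<bar> \<le> T / \<omega> * B"
      "\<bar>\<beta> t * cos (\<omega> * t)\<bar> \<le> T / \<omega> * B" "\<bar>\<alpha> t * sin (\<omega> * t)\<bar> \<le> T / \<omega> * B"
      by (intro tr b\<alpha> b\<beta> t; simp)+
    have "\<bar>p t\<bar> \<le> 2 * (T / \<omega> * B)" unfolding p_def using p(1,2) by linarith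
    moreover have "\<bar>p1 t\<bar> \<le> \<omega> * (2 * (T / \<omega> * B))"
      unfolding p1_def abs_mult using \<omega> p(3,4) by (intro mult_mono) auto
    moreover have "\<omega> * (2 * (T / \<omega> * B)) = 2 * (T * B)" using \<omega> by simp
    moreover have "(2 * T / \<omega> + 2 * T) * B = 2 * (T / \<omega> * B) + 2 * (T * B)" by (simp add: algebra_simps)
    ultimately show ?thesis using TB by linarith
  qed
  ultimately show ?thesis using rep by blast
qed

lemma lint_square_pos:
  assumes T: "T > 0" and c: "continuous_on {0..T} f" and t: "t \<in> {0..T}" "f t \<noteq> 0"
  shows "lint 0 T (\<lambda>t. f t * f t) > 0"
proof (rule ccontr)
  assume "\<not> ?thesis"
  moreover have "0 \<le> lint 0 T (\<lambda>t. f t * f t)" by (rule Bochner_Integration.integral_nonneg) simp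
  ultimately have z: "lint 0 T (\<lambda>t. f t * f t) = 0" by linarith
  have cc: "continuous_on {0..T} (\<lambda>t. f t * f t)" by (intro continuous_intros c)
  have "integral {0..T} (\<lambda>t. f t * f t) = 0" using z lint_eq_HK[OF integrable_cont[OF cc]] by simp
  then have "f t * f t = 0" using integral_eq_0_iff[OF cc] T t by auto
  then show False using t by simp
qed

lemma trig_reflect:
  assumes T: "T > 0" and \<omega>: "\<omega> = 2 * pi * real k / T"
  shows "cos (\<omega> * (T - t)) = cos (\<omega> * t)" "sin (\<omega> * (T - t)) = - sin (\<omega> * t)"
proof -
  have e: "\<omega> * (T - t) = 2 * real k * pi - \<omega> * t"
    using T by (simp add: \<omega> field_simps)
  have "sin (2 * real k * pi) = 0" "cos (2 * real k * pi) = 1"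
    using sin_2npi[of k] cos_2npi[of k] by (simp_all add: mult_ac)
  then show "cos (\<omega> * (T - t)) = cos (\<omega> * t)" "sin (\<omega> * (T - t)) = - sin (\<omega> * t)"
    unfolding e by (simp_all add: cos_diff sin_diff)
qed

lemma chi_rep:
  assumes T: "T > 0" and \<omega>: "\<omega> = 2 * pi * real k / T"
  shows "H2rep T (chi_cos T k) (\<lambda>t. sqrt (2 / T) * (- (\<omega> * sin (\<omega> * t)))) (\<lambda>t. - sigma T k * chi_cos T k t)"
    "H2rep T (chi_sin T k) (\<lambda>t. sqrt (2 / T) * (\<omega> * cos (\<omega> * t))) (\<lambda>t. - sigma T k * chi_sin T k t)"
    "H2rep T (chi_const T) (\<lambda>_. 0) (\<lambda>t. - sigma T 0 * chi_const T t)"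
proof -
  have \<sigma>: "sigma T k = \<omega>\<^sup>2" by (simp add: sigma_def \<omega>)
  have w: "2 * pi * real k * t / T = \<omega> * t" for t by (simp add: \<omega>)
  have "H2rep T (\<lambda>t. sqrt (2 / T) * cos (\<omega> * t)) (\<lambda>t. sqrt (2 / T) * (- (\<omega> * sin (\<omega> * t)))) (\<lambda>t. sqrt (2 / T) * (- (\<omega> * (\<omega> * cos (\<omega> * t)))))"
    unfolding H2rep_def
  proof (intro conjI)
    show "sqrt (2 / T) * cos (\<omega> * T) = sqrt (2 / T) * cos (\<omega> * 0)"
      "sqrt (2 / T) * (- (\<omega> * sin (\<omega> * T))) = sqrt (2 / T) * (- (\<omega> * sin (\<omega> * 0)))"
      using trig_reflect[OF T \<omega>, of 0] by simp_all
  qed (auto intro!: acd_C1 L2_cont derivative_eq_intros continuous_intros)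
  then show "H2rep T (chi_cos T k) (\<lambda>t. sqrt (2 / T) * (- (\<omega> * sin (\<omega> * t)))) (\<lambda>t. - sigma T k * chi_cos T k t)"
    by (rule H2rep_cong[OF _ T]) (auto simp: chi_cos_def w \<sigma> power2_eq_square)
  have "H2rep T (\<lambda>t. sqrt (2 / T) * sin (\<omega> * t)) (\<lambda>t. sqrt (2 / T) * (\<omega> * cos (\<omega> * t))) (\<lambda>t. sqrt (2 / T) * (\<omega> * (- (\<omega> * sin (\<omega> * t)))))"
    unfolding H2rep_def
  proof (intro conjI)
    show "sqrt (2 / T) * sin (\<omega> * T) = sqrt (2 / T) * sin (\<omega> * 0)"
      "sqrt (2 / T) * (\<omega> * cos (\<omega> * T)) = sqrt (2 / T) * (\<omega> * cos (\<omega> * 0))"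
      using trig_reflect[OF T \<omega>, of 0] by simp_all
  qed (auto intro!: acd_C1 L2_cont derivative_eq_intros continuous_intros)
  then show "H2rep T (chi_sin T k) (\<lambda>t. sqrt (2 / T) * (\<omega> * cos (\<omega> * t))) (\<lambda>t. - sigma T k * chi_sin T k t)"
    by (rule H2rep_cong[OF _ T]) (auto simp: chi_sin_def w \<sigma> power2_eq_square)
  have "H2rep T (\<lambda>t. 1) (\<lambda>_. 0) (\<lambda>t. 0)"
    unfolding H2rep_def by (auto intro!: acd_C1 L2_cont derivative_eq_intros)
  then show "H2rep T (chi_const T) (\<lambda>_. 0) (\<lambda>t. - sigma T 0 * chi_const T t)"
    by (rule H2rep_cong[OF _ T]) (auto simp: chi_const_def sigma_def)
qed

context
  fixes T A :: real and a :: "real \<Rightarrow> real"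
  assumes T: "T > 0" and a_meas: "a \<in> borel_measurable (lebesgue_on {0..T})"
    and a_bdd: "\<And>t. t \<in> {0..T} \<Longrightarrow> \<bar>a t\<bar> \<le> A" and a_even: "\<And>t. t \<in> {0..T} \<Longrightarrow> a (T - t) = a t"
begin

lemma bifurcation_cos:
  assumes k: "k \<ge> (1::nat)" and \<omega>: "\<omega> = 2 * pi * real k / T"
  shows "simple_bifurcation T (sigma T k) A (2 * T / \<omega> + 2 * T) {1} a (chi_cos T k) (\<lambda>t. sqrt (2 / T) * (- (\<omega> * sin (\<omega> * t))))"
proof
  have \<omega>0: "\<omega> > 0" using k T by (simp add: \<omega>)
  have \<sigma>: "sigma T k = \<omega>\<^sup>2" by (simp add: sigma_def \<omega>)
  have \<kappa>: "sqrt (2 / T) > 0" using T by simp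
  have chi: "chi_cos T k t = sqrt (2 / T) * cos (\<omega> * t)" if "t \<in> {0..T}" for t
    using that by (simp add: chi_cos_def \<omega>)
  show "0 < T" "{1} \<subseteq> {- 1, 1::real}" "0 \<le> sigma T k" "0 \<le> 2 * T / \<omega> + 2 * T"
    "a \<in> borel_measurable (lebesgue_on {0..T})" using T \<omega>0 a_meas by (auto simp: sigma_def)
  show "\<bar>a t\<bar> \<le> A" "a (T - t) = a t" if "t \<in> {0..T}" for t using a_bdd[OF that] a_even[OF that] by auto
  show rep: "H2rep T (chi_cos T k) (\<lambda>t. sqrt (2 / T) * - (\<omega> * sin (\<omega> * t))) (\<lambda>t. - sigma T k * chi_cos T k t)"
    by (rule chi_rep(1)[OF T \<omega>])
  show "symE T {1} (chi_cos T k)" using trig_reflect(1)[OF T \<omega>] by (auto simp: symE_def chi)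
  show "chi_cos T k t = 0" if "t \<notin> {0..T}" for t using that by (simp add: chi_cos_def)
  show "0 < lint 0 T (\<lambda>t. chi_cos T k t * chi_cos T k t)"
    by (rule lint_square_pos[OF T H2repD(6)[OF rep], of 0]) (use T \<kappa> chi[of 0] in auto)
  show "\<exists>p p1. H2rep T p p1 (\<lambda>t. f t - sigma T k * p t) \<and> symE T {1} p \<and>
      (\<forall>t\<in>{0..T}. \<bar>p t\<bar> \<le> (2 * T / \<omega> + 2 * T) * B \<and> \<bar>p1 t\<bar> \<le> (2 * T / \<omega> + 2 * T) * B)"
    if f: "f \<in> borel_measurable (lebesgue_on {0..T})" "\<And>t. t \<in> {0..T} \<Longrightarrow> \<bar>f t\<bar> \<le> B" "symE T {1} f"
      "lint 0 T (\<lambda>t. f t * chi_cos T k t) = 0" for f B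
    unfolding \<sigma>
  proof (rule solve_trig[OF T \<omega>0 _ f(1,2,3)])
    have "lint 0 T (\<lambda>t. f t * chi_cos T k t) = lint 0 T (\<lambda>t. sqrt (2 / T) * (f t * cos (\<omega> * t)))"
      by (rule lint_cong) (simp add: chi)
    then show "lint 0 T (\<lambda>t. f t * cos (\<omega> * t)) = 0" using f(4) \<kappa> by simp
    \<comment> \<open>Orthogonality to the other mode comes from symmetry: reflection changes the
      sign of the integral.\<close>
    have "lint 0 T (\<lambda>t. f t * sin (\<omega> * t)) = lint 0 T (\<lambda>t. f (T - t) * sin (\<omega> * (T - t)))"
      using lint_reflect[of 0 T "\<lambda>t. f t * sin (\<omega> * t)" T] by simp
    also have "\<dots> = lint 0 T (\<lambda>t. - (f t * sin (\<omega> * t)))"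
      by (rule lint_cong) (use symED[OF f(3)] in \<open>simp add: trig_reflect[OF T \<omega>]\<close>)
    finally show "lint 0 T (\<lambda>t. f t * sin (\<omega> * t)) = 0" by simp
  qed simp
  show "\<exists>c. \<forall>t\<in>{0..T}. u t = c * chi_cos T k t"
    if u: "H2rep T u u1 (\<lambda>t. - sigma T k * u t)" "symE T {1} u" for u u1
  proof -
    have \<omega>n: "\<omega> \<noteq> 0" using \<omega>0 by simp
    note h = homogeneous_solution[OF u(1)[unfolded \<sigma>] \<omega>n]
    \<comment> \<open>A quarter wavelength, where the sine equals 1; evenness compared at t0 and T -
      t0 removes the sine component.\<close>
    define t0 where "t0 = T / (4 * real k)"
    have t0: "t0 \<in> {0..T}" "T - t0 \<in> {0..T}" using T k by (auto simp: t0_def field_simps)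
    have "\<omega> * t0 = pi / 2" using T k by (simp add: \<omega> t0_def)
    then have "sin (\<omega> * t0) = 1" by (simp only: sin_pi_half)
    then have "u1 0 / \<omega> = 0"
      using h[OF t0(1)] h[OF t0(2)] symED[OF u(2) _ t0(1)] by (simp add: trig_reflect[OF T \<omega>])
    then have "u t = (u 0 / sqrt (2 / T)) * chi_cos T k t" if "t \<in> {0..T}" for t
      using h[OF that] chi[OF that] \<kappa> \<omega>n by auto
    then show ?thesis by blast
  qed
qed

lemma bifurcation_sin:
  assumes k: "k \<ge> (1::nat)" and \<omega>: "\<omega> = 2 * pi * real k / T"
  shows "simple_bifurcation T (sigma T k) A (2 * T / \<omega> + 2 * T) {-1} a (chi_sin T k) (\<lambda>t. sqrt (2 / T) * (\<omega> * cos (\<omega> * t)))"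
proof
  have \<omega>0: "\<omega> > 0" using k T by (simp add: \<omega>)
  have \<sigma>: "sigma T k = \<omega>\<^sup>2" by (simp add: sigma_def \<omega>)
  have \<kappa>: "sqrt (2 / T) > 0" using T by simp
  have chi: "chi_sin T k t = sqrt (2 / T) * sin (\<omega> * t)" if "t \<in> {0..T}" for t
    using that by (simp add: chi_sin_def \<omega>)
  show "0 < T" "{-1} \<subseteq> {- 1, 1::real}" "0 \<le> sigma T k" "0 \<le> 2 * T / \<omega> + 2 * T"
    "a \<in> borel_measurable (lebesgue_on {0..T})" using T \<omega>0 a_meas by (auto simp: sigma_def)
  show "\<bar>a t\<bar> \<le> A" "a (T - t) = a t" if "t \<in> {0..T}" for t using a_bdd[OF that] a_even[OF that] by auto
  show rep: "H2rep T (chi_sin T k) (\<lambda>t. sqrt (2 / T) * (\<omega> * cos (\<omega> * t))) (\<lambda>t. - sigma T k * chi_sin T k t)"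
    by (rule chi_rep(2)[OF T \<omega>])
  show "symE T {-1} (chi_sin T k)" using trig_reflect(2)[OF T \<omega>] by (auto simp: symE_def chi)
  show "chi_sin T k t = 0" if "t \<notin> {0..T}" for t using that by (simp add: chi_sin_def)
  define t0 where "t0 = T / (4 * real k)"
  have t0: "t0 \<in> {0..T}" using T k by (auto simp: t0_def field_simps)
  have "\<omega> * t0 = pi / 2" using T k by (simp add: \<omega> t0_def)
  then have "sin (\<omega> * t0) = 1" by (simp only: sin_pi_half)
  then have "chi_sin T k t0 \<noteq> 0" using chi[OF t0] \<kappa> by simp
  then show "0 < lint 0 T (\<lambda>t. chi_sin T k t * chi_sin T k t)"
    by (rule lint_square_pos[OF T H2repD(6)[OF rep] t0])
  show "\<exists>p p1. H2rep T p p1 (\<lambda>t. f t - sigma T k * p t) \<and> symE T {-1} p \<and>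
      (\<forall>t\<in>{0..T}. \<bar>p t\<bar> \<le> (2 * T / \<omega> + 2 * T) * B \<and> \<bar>p1 t\<bar> \<le> (2 * T / \<omega> + 2 * T) * B)"
    if f: "f \<in> borel_measurable (lebesgue_on {0..T})" "\<And>t. t \<in> {0..T} \<Longrightarrow> \<bar>f t\<bar> \<le> B" "symE T {-1} f"
      "lint 0 T (\<lambda>t. f t * chi_sin T k t) = 0" for f B
    unfolding \<sigma>
  proof (rule solve_trig[OF T \<omega>0 _ f(1,2,3)])
    have "lint 0 T (\<lambda>t. f t * chi_sin T k t) = lint 0 T (\<lambda>t. sqrt (2 / T) * (f t * sin (\<omega> * t)))"
      by (rule lint_cong) (simp add: chi)
    then show "lint 0 T (\<lambda>t. f t * sin (\<omega> * t)) = 0" using f(4) \<kappa> by simp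
    have "lint 0 T (\<lambda>t. f t * cos (\<omega> * t)) = lint 0 T (\<lambda>t. f (T - t) * cos (\<omega> * (T - t)))"
      using lint_reflect[of 0 T "\<lambda>t. f t * cos (\<omega> * t)" T] by simp
    also have "\<dots> = lint 0 T (\<lambda>t. - (f t * cos (\<omega> * t)))"
      by (rule lint_cong) (use symED[OF f(3)] in \<open>simp add: trig_reflect[OF T \<omega>]\<close>)
    finally show "lint 0 T (\<lambda>t. f t * cos (\<omega> * t)) = 0" by simp
  qed simp
  show "\<exists>c. \<forall>t\<in>{0..T}. u t = c * chi_sin T k t"
    if u: "H2rep T u u1 (\<lambda>t. - sigma T k * u t)" "symE T {-1} u" for u u1
  proof -
    have \<omega>n: "\<omega> \<noteq> 0" using \<omega>0 by simp
    note h = homogeneous_solution[OF u(1)[unfolded \<sigma>] \<omega>n]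
    \<comment> \<open>Oddness and periodicity at the endpoints give u 0 = 0, which removes the
      cosine component.\<close>
    have "u (T - 0) = - 1 * u 0" by (rule symED[OF u(2)]) (use T in auto)
    then have "u 0 = 0" using H2repD(4)[OF u(1)] by simp
    then have "u t = (u1 0 / \<omega> / sqrt (2 / T)) * chi_sin T k t" if "t \<in> {0..T}" for t
      using h[OF that] chi[OF that] \<kappa> by simp
    then show ?thesis by blast
  qed
qed

text \<open>At the eigenvalue 0 the equation is solved by integrating twice: mean value zero makes
  the first primitive periodic, and subtracting a linear function does so for the second.\<close>

lemma bifurcation_const:
  "simple_bifurcation T (sigma T 0) A (2 * T + 2 * T * T) {} a (chi_const T) (\<lambda>_. 0)"
proof
  have \<sigma>: "sigma T 0 = 0" by (simp add: sigma_def)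
  have chi: "chi_const T t = 1" if "t \<in> {0..T}" for t
    using that by (simp add: chi_const_def)
  show "0 < T" "{} \<subseteq> {- 1, 1::real}" "0 \<le> sigma T 0" "0 \<le> 2 * T + 2 * T * T"
    "a \<in> borel_measurable (lebesgue_on {0..T})" using T a_meas by (auto simp: sigma_def)
  show "\<bar>a t\<bar> \<le> A" "a (T - t) = a t" if "t \<in> {0..T}" for t using a_bdd[OF that] a_even[OF that] by auto
  show rep: "H2rep T (chi_const T) (\<lambda>_. 0) (\<lambda>t. - sigma T 0 * chi_const T t)"
    by (rule chi_rep(3)[OF T refl])
  show "symE T {} (chi_const T)" by (simp add: symE_def)
  show "chi_const T t = 0" if "t \<notin> {0..T}" for t using that by (simp add: chi_const_def)
  show "0 < lint 0 T (\<lambda>t. chi_const T t * chi_const T t)"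
    by (rule lint_square_pos[OF T H2repD(6)[OF rep], of 0]) (use T chi[of 0] in auto)
  show "\<exists>p p1. H2rep T p p1 (\<lambda>t. f t - sigma T 0 * p t) \<and> symE T {} p \<and>
      (\<forall>t\<in>{0..T}. \<bar>p t\<bar> \<le> (2 * T + 2 * T * T) * B \<and> \<bar>p1 t\<bar> \<le> (2 * T + 2 * T * T) * B)"
    if f: "f \<in> borel_measurable (lebesgue_on {0..T})" "\<And>t. t \<in> {0..T} \<Longrightarrow> \<bar>f t\<bar> \<le> B" "symE T {} f"
      "lint 0 T (\<lambda>t. f t * chi_const T t) = 0" for f B
  proof -
    have B: "0 \<le> B" using f(2)[of 0] T by auto
    have f0: "lint 0 T f = 0"
    proof -
      have "lint 0 T f = lint 0 T (\<lambda>t. f t * chi_const T t)" by (rule lint_cong) (simp add: chi)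
      then show ?thesis using f(4) by simp
    qed
    define F where "F t = 0 + lint 0 t f" for t
    have aF: "acd T F f" unfolding F_def by (rule acd_lint, rule integrable_bdd[OF f(1,2)])
    have cF: "continuous_on {0..T} F" by (rule acd_continuous[OF aF])
    have Fb: "\<bar>F t\<bar> \<le> T * B" if t: "t \<in> {0..T}" for t
    proof -
      have "\<bar>lint 0 t f\<bar> \<le> (t - 0) * B"
        by (rule lint_abs_le[OF _ measurable_restrict_mono[OF f(1)]]) (use f(2) t in auto)
      also have "\<dots> \<le> T * B" using t B by (intro mult_right_mono) auto
      finally show ?thesis by (simp add: F_def)
    qed
    define P where "P t = 0 + lint 0 t F" for t
    have aP: "acd T P F" unfolding P_def by (rule acd_lint, rule integrable_cont[OF cF])
    have Pb: "\<bar>P t\<bar> \<le> T * (T * B)" if t: "t \<in> {0..T}" for t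
    proof -
      have "\<bar>lint 0 t F\<bar> \<le> (t - 0) * (T * B)"
        by (rule lint_abs_le[OF _ measurable_restrict_mono[OF continuous_measurable[OF cF]]]) (use Fb t in auto)
      also have "\<dots> \<le> T * (T * B)" using t B T by (intro mult_right_mono) auto
      finally show ?thesis by (simp add: P_def)
    qed
    define c where "c = P T / T"
    have c: "\<bar>c\<bar> \<le> T * B" using Pb[of T] T by (simp add: c_def field_simps)
    have al: "acd T (\<lambda>t. c * t) (\<lambda>_. c)" by (rule acd_C1) (auto intro!: derivative_eq_intros)
    have ac: "acd T (\<lambda>_. c) (\<lambda>_. 0)" by (rule acd_C1) auto
    have "H2rep T (\<lambda>t. P t - c * t) (\<lambda>t. F t - c) (\<lambda>t. f t - 0)"
      unfolding H2rep_def
      using acd_diff[OF aP al] acd_diff[OF aF ac] L2_bdd[OF f(1,2)] f0 T by (simp add: c_def P_def F_def)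
    moreover have "\<bar>P t - c * t\<bar> \<le> (2 * T + 2 * T * T) * B \<and> \<bar>F t - c\<bar> \<le> (2 * T + 2 * T * T) * B" if t: "t \<in> {0..T}" for t
    proof -
      have "\<bar>c * t\<bar> \<le> (T * B) * T" unfolding abs_mult using c t T B by (intro mult_mono) auto
      then have "\<bar>P t - c * t\<bar> \<le> T * (T * B) + (T * B) * T" using Pb[OF t] by linarith
      moreover have "\<bar>F t - c\<bar> \<le> T * B + T * B" using Fb[OF t] c by linarith
      moreover have "0 \<le> T * B" "0 \<le> T * (T * B)" using T B by auto
      moreover have "(2 * T + 2 * T * T) * B = (T * B + T * B) + (T * (T * B) + (T * B) * T)" by (simp add: algebra_simps)
      ultimately show ?thesis by linarith
    qed
    ultimately show ?thesis unfolding \<sigma> by (intro exI[of _ "\<lambda>t. P t - c * t"] exI[of _ "\<lambda>t. F t - c"]) (simp add: symE_def)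
  qed
  show "\<exists>c. \<forall>t\<in>{0..T}. u t = c * chi_const T t"
    if u: "H2rep T u u1 (\<lambda>t. - sigma T 0 * u t)" "symE T {} u" for u u1
  proof -
    note U = H2repD[OF u(1)[unfolded \<sigma>]]
    have u1: "u1 t = u1 0" if "t \<in> {0..T}" for t using acd_increment[OF U(2), of 0 t] that by simp
    have inc: "u t - u 0 = t * u1 0" if t: "t \<in> {0..T}" for t
    proof -
      have "lint 0 t u1 = lint 0 t (\<lambda>_. u1 0)" by (rule lint_cong, rule u1) (use t in auto)
      then show ?thesis using acd_increment[OF U(1), of 0 t] t measure_interval[of 0 t] by simp
    qed
    have "T * u1 0 = 0" using inc[of T] U(4) T by simp
    then have "u t = u 0 * chi_const T t" if "t \<in> {0..T}" for t using inc[OF that] chi[OF that] T by simp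
    then show ?thesis by blast
  qed
qed

end

section \<open>Absence of bifurcation off the spectrum\<close>

lemma cos_omega_ne_1:
  assumes T: "T > 0" and \<omega>: "\<omega> > 0" "\<And>k. \<omega>\<^sup>2 \<noteq> sigma T k"
  shows "cos (\<omega> * T) \<noteq> 1"
proof
  assume "cos (\<omega> * T) = 1"
  then obtain n :: int where n: "\<omega> * T = real_of_int n * 2 * pi" using cos_one_2pi_int by auto
  then have "n > 0" using T \<omega> by (smt (verit) mult_pos_pos of_int_0_less_iff pi_gt_zero zero_less_mult_iff)
  then have "real (nat n) = real_of_int n" by simp
  then have "\<omega> = 2 * pi * real (nat n) / T" using n T by (simp add: field_simps)
  then show False using \<omega>(2)[of "nat n"] by (simp add: sigma_def)
qed

text \<open>Off the spectrum the linear equation has a quantitative bound, which absorbs a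
  right-hand side dominated by a small multiple of |u|. For negative l0 this is an energy estimate;
  for positive l0 it is the invertibility of rotation by one period minus the identity.\<close>

lemma nonresonance:
  assumes T: "T > 0" and l0: "\<And>k. l0 \<noteq> sigma T k"
  obtains \<theta> where "\<theta> > 0" "\<And>u u1 f t. H2rep T u u1 (\<lambda>t. f t - l0 * u t) \<Longrightarrow>
    (\<And>t. t \<in> {0..T} \<Longrightarrow> \<bar>f t\<bar> \<le> \<theta> * \<bar>u t\<bar>) \<Longrightarrow> t \<in> {0..T} \<Longrightarrow> u t = 0"
proof -
  have "l0 \<noteq> 0" using l0[of 0] by (simp add: sigma_def)
  then consider "l0 < 0" | "l0 > 0" by linarith
  then show ?thesis
  proof cases
    case 1
    show ?thesis
    proof (rule that[of "- l0 / 2"])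
      show "- l0 / 2 > 0" using 1 by simp
      fix u u1 f t
      assume u: "H2rep T u u1 (\<lambda>t. f t - l0 * u t)" and fb: "\<And>t. t \<in> {0..T} \<Longrightarrow> \<bar>f t\<bar> \<le> - l0 / 2 * \<bar>u t\<bar>"
        and t: "t \<in> {0..T}"
      note U = H2repD[OF u]
      have Lf: "f \<in> L2 T" using L2_add[OF U(3) L2_cmult[OF U(8), of l0]] by simp
      note i = L2_mult[OF U(8) Lf] L2_mult[OF U(8,8)]
      have "0 \<le> lint 0 T (\<lambda>t. u1 t * u1 t)" by (rule Bochner_Integration.integral_nonneg) simp
      also have "\<dots> = - lint 0 T (\<lambda>t. u t * (f t - l0 * u t))" by (rule H2rep_Green(1)[OF T u u])
      also have "lint 0 T (\<lambda>t. u t * (f t - l0 * u t)) = lint 0 T (\<lambda>t. u t * f t - l0 * (u t * u t))"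
        by (rule lint_cong) (simp add: algebra_simps)
      also have "\<dots> = lint 0 T (\<lambda>t. u t * f t) - l0 * lint 0 T (\<lambda>t. u t * u t)" using i by simp
      finally have 2: "- l0 * lint 0 T (\<lambda>t. u t * u t) \<le> - lint 0 T (\<lambda>t. u t * f t)" by simp
      have "- lint 0 T (\<lambda>t. u t * f t) = lint 0 T (\<lambda>t. - (u t * f t))" by simp
      also have "\<dots> \<le> lint 0 T (\<lambda>t. - l0 / 2 * (u t * u t))"
      proof (rule integral_mono)
        fix t assume "t \<in> space (lebesgue_on {0..T})"
        then have "\<bar>u t\<bar> * \<bar>f t\<bar> \<le> \<bar>u t\<bar> * (- l0 / 2 * \<bar>u t\<bar>)" using fb[of t] by (intro mult_left_mono) auto
        also have "\<dots> = - l0 / 2 * (u t * u t)" by (simp add: abs_mult[symmetric])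
        finally show "- (u t * f t) \<le> - l0 / 2 * (u t * u t)" unfolding abs_mult[symmetric] by linarith
      qed (use i in simp_all)
      also have "\<dots> = - l0 / 2 * lint 0 T (\<lambda>t. u t * u t)" by simp
      finally have "- l0 / 2 * lint 0 T (\<lambda>t. u t * u t) \<le> 0" using 2 by simp
      then have "lint 0 T (\<lambda>t. u t * u t) \<le> 0" using 1 by (simp add: mult_le_0_iff zero_le_mult_iff)
      then show "u t = 0" using lint_square_pos[OF T U(6) t] by force
    qed
  next
    case 2
    define \<omega> where "\<omega> = sqrt l0"
    have \<omega>: "\<omega> > 0" "\<omega>\<^sup>2 = l0" using 2 by (auto simp: \<omega>_def)
    \<comment> \<open>The determinant of the rotation by \<omega> T minus the identity; it vanishes
      exactly at resonance.\<close>
    define \<Delta> where "\<Delta> = 2 - 2 * cos (\<omega> * T)"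
    have "cos (\<omega> * T) \<noteq> 1" by (rule cos_omega_ne_1[OF T \<omega>(1)]) (use \<omega> l0 in auto)
    then have \<Delta>: "\<Delta> > 0" unfolding \<Delta>_def using cos_le_one[of "\<omega> * T"] by linarith
    \<comment> \<open>The initial coordinates cost 3 / \<Delta>, the drift over one period 1, and
      the two coordinates together give the factor 2.\<close>
    define Cn where "Cn = 2 * (3 / \<Delta> + 1) * (T / \<omega>)"
    have Cn: "Cn > 0" unfolding Cn_def using \<Delta> T \<omega> by (intro mult_pos_pos add_pos_pos) auto
    show ?thesis
    proof (rule that[of "1 / (2 * Cn)"])
      show "1 / (2 * Cn) > 0" using Cn by simp
      fix u u1 f t
      assume u: "H2rep T u u1 (\<lambda>t. f t - l0 * u t)" and fb: "\<And>t. t \<in> {0..T} \<Longrightarrow> \<bar>f t\<bar> \<le> 1 / (2 * Cn) * \<bar>u t\<bar>"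
        and t: "t \<in> {0..T}"
      note U = H2repD[OF u]
      have fm: "f \<in> borel_measurable (lebesgue_on {0..T})"
        using L2_measurable[OF L2_add[OF U(3) L2_cmult[OF U(8), of l0]]] by simp
      have "continuous_on {0..T} (\<lambda>t. \<bar>u t\<bar>)" by (intro continuous_intros U)
      then obtain t0 where t0: "t0 \<in> {0..T}" "\<And>t. t \<in> {0..T} \<Longrightarrow> \<bar>u t\<bar> \<le> \<bar>u t0\<bar>"
        using continuous_attains_sup[of "{0..T}" "\<lambda>t. \<bar>u t\<bar>"] T by auto
      define d where "d = \<bar>u t0\<bar>"
      define B where "B = 1 / (2 * Cn) * d"
      have B0: "0 \<le> B" using Cn by (simp add: B_def d_def)
      have fB: "\<bar>f t\<bar> \<le> B" if "t \<in> {0..T}" for t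
      proof -
        have "1 / (2 * Cn) * \<bar>u t\<bar> \<le> B" unfolding B_def d_def using t0(2)[OF that] Cn by (intro mult_left_mono) auto
        then show ?thesis using fb[OF that] by linarith
      qed
      have \<omega>n: "\<omega> \<noteq> 0" using \<omega> by simp
      define \<alpha> where "\<alpha> t = u t * cos (\<omega> * t) - u1 t / \<omega> * sin (\<omega> * t)" for t
      define \<beta> where "\<beta> t = u t * sin (\<omega> * t) + u1 t / \<omega> * cos (\<omega> * t)" for t
      have a: "acd T \<alpha> (\<lambda>t. - (1 / \<omega>) * (f t * sin (\<omega> * t)))" "acd T \<beta> (\<lambda>t. (1 / \<omega>) * (f t * cos (\<omega> * t)))"
        unfolding \<alpha>_def[abs_def] \<beta>_def[abs_def] using rotating_frame[OF _ \<omega>n, of T u u1 f] u \<omega>(2) by auto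
      have bnd: "\<bar>lint 0 t (\<lambda>t. c * (f t * h t))\<bar> \<le> T / \<omega> * B"
        if t: "t \<in> {0..T}" and c: "\<bar>c\<bar> = 1 / \<omega>" and h: "continuous_on {0..T} h" "\<And>t. \<bar>h t\<bar> \<le> 1" for t c h
      proof -
        have "\<bar>lint 0 t (\<lambda>t. c * (f t * h t))\<bar> \<le> (t - 0) * (1 / \<omega> * B)"
        proof (rule lint_abs_le)
          have "(\<lambda>t. c * (f t * h t)) \<in> borel_measurable (lebesgue_on {0..T})"
            by (intro borel_measurable_times fm continuous_measurable h continuous_intros)
          then show "(\<lambda>t. c * (f t * h t)) \<in> borel_measurable (lebesgue_on {0..t})"
            by (rule measurable_restrict_mono) (use t in auto)
          fix s assume s: "s \<in> {0..t}"
          have "\<bar>f s\<bar> * \<bar>h s\<bar> \<le> B * 1" using fB[of s] h(2) s t B0 by (intro mult_mono) auto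
          then show "\<bar>c * (f s * h s)\<bar> \<le> 1 / \<omega> * B"
            unfolding abs_mult c using \<omega> by (intro mult_left_mono) auto
        qed (use t in auto)
        also have "\<dots> \<le> T * (1 / \<omega> * B)" using t B0 \<omega> by (intro mult_right_mono) auto
        finally show ?thesis by simp
      qed
      define R where "R = T / \<omega> * B"
      have R0: "0 \<le> R" using T \<omega> B0 by (simp add: R_def)
      have inc: "\<bar>\<alpha> t - \<alpha> 0\<bar> \<le> R" "\<bar>\<beta> t - \<beta> 0\<bar> \<le> R" if t: "t \<in> {0..T}" for t
      proof -
        have "\<alpha> t - \<alpha> 0 = lint 0 t (\<lambda>t. - (1 / \<omega>) * (f t * sin (\<omega> * t)))"
          "\<beta> t - \<beta> 0 = lint 0 t (\<lambda>t. (1 / \<omega>) * (f t * cos (\<omega> * t)))"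
          using acd_increment[OF a(1), of 0 t] acd_increment[OF a(2), of 0 t] t by auto
        moreover have "\<bar>lint 0 t (\<lambda>t. - (1 / \<omega>) * (f t * sin (\<omega> * t)))\<bar> \<le> R" unfolding R_def
          by (rule bnd[OF t]) (use \<omega> in \<open>auto intro!: continuous_intros\<close>)
        moreover have "\<bar>lint 0 t (\<lambda>t. (1 / \<omega>) * (f t * cos (\<omega> * t)))\<bar> \<le> R" unfolding R_def
          by (rule bnd[OF t]) (use \<omega> in \<open>auto intro!: continuous_intros\<close>)
        ultimately show "\<bar>\<alpha> t - \<alpha> 0\<bar> \<le> R" "\<bar>\<beta> t - \<beta> 0\<bar> \<le> R" by (simp_all only:)
      qed
      define x y c s where "x = u 0" and "y = u1 0 / \<omega>" and "c = cos (\<omega> * T)" and "s = sin (\<omega> * T)"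
      define P where "P = \<alpha> T - \<alpha> 0"
      define Q where "Q = \<beta> T - \<beta> 0"
      have PQ: "P = x * (c - 1) - y * s" "Q = x * s + y * (c - 1)"
        using U(4,5) by (simp_all add: P_def Q_def \<alpha>_def \<beta>_def x_def y_def c_def s_def algebra_simps)
      have PQb: "\<bar>P\<bar> \<le> R" "\<bar>Q\<bar> \<le> R" unfolding P_def Q_def using inc[of T] T by auto
      have cs: "c * c + s * s = 1" unfolding c_def s_def by (rule cos_sin_one)
      have \<Delta>cs: "(c - 1) * (c - 1) + s * s = \<Delta>" using cs by (simp add: \<Delta>_def c_def algebra_simps)
      \<comment> \<open>Cramer's rule for the initial coordinates x and y.\<close>
      have "P * (c - 1) + Q * s = x * ((c - 1) * (c - 1) + s * s)" "Q * (c - 1) - P * s = y * ((c - 1) * (c - 1) + s * s)"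
        unfolding PQ by (simp_all add: algebra_simps)
      then have xy: "x * \<Delta> = P * (c - 1) + Q * s" "y * \<Delta> = Q * (c - 1) - P * s" unfolding \<Delta>cs by simp_all
      have c1: "\<bar>c - 1\<bar> \<le> 2" "\<bar>s\<bar> \<le> 1" unfolding c_def s_def using cos_ge_minus_one[of "\<omega> * T"] cos_le_one[of "\<omega> * T"] by auto
      have pr: "\<bar>X * (c - 1)\<bar> \<le> R * 2" "\<bar>X * s\<bar> \<le> R * 1" if "\<bar>X\<bar> \<le> R" for X
        unfolding abs_mult using that c1 R0 by (intro mult_mono; simp)+
      have "\<bar>x * \<Delta>\<bar> \<le> 3 * R" "\<bar>y * \<Delta>\<bar> \<le> 3 * R"
        unfolding xy using pr[OF PQb(1)] pr[OF PQb(2)] by linarith+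
      then have xb: "\<bar>x\<bar> \<le> 3 / \<Delta> * R" "\<bar>y\<bar> \<le> 3 / \<Delta> * R" using \<Delta> by (simp_all add: abs_mult field_simps)
      have ab: "\<bar>\<alpha> t\<bar> \<le> 3 / \<Delta> * R + R" "\<bar>\<beta> t\<bar> \<le> 3 / \<Delta> * R + R" if t: "t \<in> {0..T}" for t
      proof -
        have "\<alpha> 0 = x" "\<beta> 0 = y" by (simp_all add: \<alpha>_def \<beta>_def x_def y_def)
        then show "\<bar>\<alpha> t\<bar> \<le> 3 / \<Delta> * R + R" "\<bar>\<beta> t\<bar> \<le> 3 / \<Delta> * R + R"
          using inc[OF t] xb by linarith+
      qed
      have ub: "\<bar>u t\<bar> \<le> Cn * B" if t: "t \<in> {0..T}" for t
      proof -
        have "u t = \<alpha> t * cos (\<omega> * t) + \<beta> t * sin (\<omega> * t)"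
          unfolding \<alpha>_def \<beta>_def by (rule frame_inverse[OF cos_sin_one])
        then have "\<bar>u t\<bar> \<le> \<bar>\<alpha> t\<bar> * \<bar>cos (\<omega> * t)\<bar> + \<bar>\<beta> t\<bar> * \<bar>sin (\<omega> * t)\<bar>"
          unfolding abs_mult[symmetric] by linarith
        also have "\<dots> \<le> (3 / \<Delta> * R + R) * 1 + (3 / \<Delta> * R + R) * 1"
          using ab[OF t] by (intro add_mono mult_mono) auto
        also have "\<dots> = Cn * B" by (simp add: Cn_def R_def algebra_simps)
        finally show ?thesis .
      qed
      have "d \<le> Cn * B" unfolding d_def by (rule ub[OF t0(1)])
      also have "\<dots> = d / 2" using Cn by (simp add: B_def)
      finally have "d = 0" by (simp add: d_def)
      then show "u t = 0" using t0(2)[OF t] by (simp add: d_def)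
    qed
  qed
qed

section \<open>Counting zeros\<close>

lemma card_zeros_in_cells:
  fixes L :: real
  assumes L: "L > 0" and uniq: "\<And>j. j < n \<Longrightarrow> \<exists>!t. t \<in> {c + real j * L..<c + (real j + 1) * L} \<and> P t"
  shows "finite {t \<in> {c..<c + real n * L}. P t} \<and> card {t \<in> {c..<c + real n * L}. P t} = n"
  using uniq
proof (induction n)
  case 0 then show ?case by simp
next
  case (Suc n)
  obtain t0 where t0: "t0 \<in> {c + real n * L..<c + (real n + 1) * L}" "P t0"
    and un: "\<And>t. t \<in> {c + real n * L..<c + (real n + 1) * L} \<Longrightarrow> P t \<Longrightarrow> t = t0"
    using Suc.prems[of n] by blast
  have nL: "0 \<le> real n * L" and e: "real (Suc n) * L = real n * L + L" "(real n + 1) * L = real n * L + L"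
    using L by (simp_all add: algebra_simps)
  have "{t \<in> {c..<c + real (Suc n) * L}. P t} = insert t0 {t \<in> {c..<c + real n * L}. P t}"
    (is "?A = ?B")
  proof (intro set_eqI iffI)
    fix t assume "t \<in> ?A"
    then show "t \<in> ?B" using un[of t] unfolding e by (cases "t < c + real n * L") auto
  next
    fix t assume "t \<in> ?B"
    moreover have "c \<le> t0" using t0(1) nL unfolding atLeastLessThan_iff by linarith
    ultimately show "t \<in> ?A" using t0 L unfolding e by auto
  qed
  moreover have "t0 \<notin> {t \<in> {c..<c + real n * L}. P t}" using t0 by auto
  moreover have "finite {t \<in> {c..<c + real n * L}. P t} \<and> card {t \<in> {c..<c + real n * L}. P t} = n"
    by (rule Suc.IH) (use Suc.prems in auto)
  ultimately show ?case by simp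
qed

lemma sin_ge_half_of_cos:
  assumes "0 \<le> x" "x \<le> pi" "\<bar>cos x\<bar> \<le> 1 / 2" shows "1 / 2 \<le> sin x"
proof -
  have "(cos x)\<^sup>2 \<le> (1 / 2)\<^sup>2" using power_mono[OF assms(3), of 2] by simp
  then have "(1 / 2)\<^sup>2 \<le> (sin x)\<^sup>2" using sin_cos_squared_add[of x] by (simp add: power2_eq_square)
  then show ?thesis by (rule power2_le_imp_le) (use assms sin_ge_zero in auto)
qed

lemma cos_ge_half_of_sin:
  assumes "0 \<le> x" "x \<le> pi / 2" "sin x \<le> 1 / 2" shows "1 / 2 \<le> cos x"
proof -
  have "0 \<le> sin x" using assms pi_gt_zero by (intro sin_ge_zero) auto
  then have "(sin x)\<^sup>2 \<le> (1 / 2)\<^sup>2" using assms(3) by (intro power_mono)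
  then have "(1 / 2)\<^sup>2 \<le> (cos x)\<^sup>2" using sin_cos_squared_add[of x] by (simp add: power2_eq_square)
  then show ?thesis by (rule power2_le_imp_le) (use assms cos_ge_zero pi_gt_zero in auto)
qed

lemma mvt_within:
  fixes G :: "real \<Rightarrow> real"
  assumes "a < b" "\<And>x. x \<in> {a..b} \<Longrightarrow> (G has_real_derivative G' x) (at x within {a..b})" "G a = 0" "G b = 0"
  obtains x where "a < x" "x < b" "G' x = 0"
proof -
  have "\<exists>x\<in>{a<..<b}. G b - G a = G' x * (b - a)"
    by (rule mvt_simple[OF assms(1)]) (use assms(2) in \<open>auto simp: has_field_derivative_def\<close>)
  then show ?thesis using that assms by auto
qed

text \<open>On half a wavelength the end values have opposite signs, which gives a zero. At a zero
  the cosine is at most 1/2 in modulus, and monotonicity keeps it so between two zeros; there the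
  sine is at least 1/2, so the derivative cannot vanish and Rolle's theorem excludes a second
  zero.\<close>

lemma cos_perturbation_unique_zero:
  assumes \<omega>: "\<omega> > 0" and L: "\<omega> * L = pi" and \<kappa>: "\<bar>\<kappa>\<bar> > 2 * \<delta>" "\<bar>\<kappa>\<bar> * \<omega> > 2 * \<delta>"
    and h: "\<And>t. t \<in> {c..c + L} \<Longrightarrow> (h has_real_derivative h1 t) (at t within {c..c + L})"
    and hb: "\<And>t. t \<in> {c..c + L} \<Longrightarrow> \<bar>h t\<bar> \<le> \<delta>" "\<And>t. t \<in> {c..c + L} \<Longrightarrow> \<bar>h1 t\<bar> \<le> \<delta>"
  shows "\<exists>!t. t \<in> {c..<c + L} \<and> \<kappa> * cos (\<omega> * (t - c)) + h t = 0"
proof -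
  have Lp: "L > 0" using L \<omega> pi_gt_zero by (metis zero_less_mult_pos)
  \<comment> \<open>The sign of \<kappa> is moved to h, whose bounds do not depend on it.\<close>
  define s where "s = sgn \<kappa>"
  have \<delta>0: "0 \<le> \<delta>" using hb(1)[of c] Lp by auto
  have s: "s * \<kappa> = \<bar>\<kappa>\<bar>" "\<bar>s\<bar> = 1" "s \<noteq> 0" using \<kappa> \<delta>0 by (auto simp: s_def sgn_if)
  define G where "G t = \<bar>\<kappa>\<bar> * cos (\<omega> * (t - c)) + s * h t" for t
  have Giff: "\<kappa> * cos (\<omega> * (t - c)) + h t = 0 \<longleftrightarrow> G t = 0" for t
  proof -
    have "G t = s * (\<kappa> * cos (\<omega> * (t - c)) + h t)" by (simp add: G_def s(1)[symmetric] algebra_simps)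
    then show ?thesis using s by simp
  qed
  have sh: "\<bar>s * h t\<bar> \<le> \<delta>" "\<bar>s * h1 t\<bar> \<le> \<delta>" if "t \<in> {c..c + L}" for t
    using hb(1)[OF that] hb(2)[OF that] s by (simp_all add: abs_mult)
  have dG: "(G has_real_derivative (- \<bar>\<kappa>\<bar> * \<omega> * sin (\<omega> * (t - c)) + s * h1 t)) (at t within {c..c + L})"
    if "t \<in> {c..c + L}" for t
    unfolding G_def using h[OF that] by (auto intro!: derivative_eq_intros)
  have cG: "continuous_on {c..c + L} G"
    by (rule DERIV_continuous_on[OF dG])
  have ends: "G c > 0" "G (c + L) < 0"
    using sh(1)[of c] sh(1)[of "c + L"] Lp \<kappa>(1) \<delta>0 by (auto simp: G_def L)
  obtain t0 where t0: "c \<le> t0" "t0 \<le> c + L" "G t0 = 0"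
    using IVT2'[of G "c + L" 0 c] ends cG Lp by auto
  have "t0 \<noteq> c + L" using ends(2) t0(3) by auto
  then have ex: "t0 \<in> {c..<c + L}" using t0 by auto
  have no2: False if t12: "t1 < t2" "t1 \<in> {c..<c + L}" "t2 \<in> {c..<c + L}" "G t1 = 0" "G t2 = 0" for t1 t2
  proof -
    have "\<exists>\<xi>. t1 < \<xi> \<and> \<xi> < t2 \<and> - \<bar>\<kappa>\<bar> * \<omega> * sin (\<omega> * (\<xi> - c)) + s * h1 \<xi> = 0"
    proof (rule mvt_within[of t1 t2 G])
      show "(G has_real_derivative (- \<bar>\<kappa>\<bar> * \<omega> * sin (\<omega> * (t - c)) + s * h1 t)) (at t within {t1..t2})"
        if "t \<in> {t1..t2}" for t
        by (rule has_field_derivative_subset[OF dG]) (use that t12 in auto)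
    qed (use t12 in auto)
    then obtain \<xi> where \<xi>: "t1 < \<xi>" "\<xi> < t2" "\<bar>\<kappa>\<bar> * \<omega> * sin (\<omega> * (\<xi> - c)) = s * h1 \<xi>" by auto
    have half: "\<bar>cos (\<omega> * (t - c))\<bar> \<le> 1 / 2" if t: "t \<in> {c..c + L}" "G t = 0" for t
    proof -
      have "\<bar>\<kappa>\<bar> * \<bar>cos (\<omega> * (t - c))\<bar> = \<bar>\<bar>\<kappa>\<bar> * cos (\<omega> * (t - c))\<bar>" by (simp add: abs_mult)
      also have "\<dots> \<le> \<delta>" using t(2) sh(1)[OF t(1)] unfolding G_def by linarith
      also have "\<dots> \<le> \<bar>\<kappa>\<bar> * (1 / 2)" using \<kappa> by simp
      finally show ?thesis by (rule mult_left_le_imp_le) (use \<kappa>(1) \<delta>0 in linarith)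
    qed
    have rng: "0 \<le> \<omega> * (t - c)" "\<omega> * (t - c) \<le> pi" if "t \<in> {c..c + L}" for t
      using that \<omega> mult_left_mono[of "t - c" L \<omega>] by (auto simp: L)
    have m: "\<omega> * (t1 - c) \<le> \<omega> * (\<xi> - c)" "\<omega> * (\<xi> - c) \<le> \<omega> * (t2 - c)"
      using \<xi> \<omega> by (auto intro!: mult_left_mono)
    have "cos (\<omega> * (\<xi> - c)) \<le> cos (\<omega> * (t1 - c))" "cos (\<omega> * (t2 - c)) \<le> cos (\<omega> * (\<xi> - c))"
      using m rng[of t1] rng[of t2] t12 by (auto intro!: cos_monotone_0_pi_le)
    then have "\<bar>cos (\<omega> * (\<xi> - c))\<bar> \<le> 1 / 2" using half[of t1] half[of t2] t12 by auto
    then have "1 / 2 \<le> sin (\<omega> * (\<xi> - c))" by (intro sin_ge_half_of_cos rng) (use \<xi> t12 in auto)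
    then have "\<bar>\<kappa>\<bar> * \<omega> * (1 / 2) \<le> \<bar>\<kappa>\<bar> * \<omega> * sin (\<omega> * (\<xi> - c))" using \<omega> by (intro mult_left_mono) auto
    moreover have "s * h1 \<xi> \<le> \<delta>" using sh(2)[of \<xi>] \<xi> t12 by auto
    ultimately show False using \<xi>(3) \<kappa>(2) by linarith
  qed
  show ?thesis unfolding Giff
  proof (rule ex1I[of _ t0])
    show "t0 \<in> {c..<c + L} \<and> G t0 = 0" using ex t0 by simp
    fix t assume "t \<in> {c..<c + L} \<and> G t = 0"
    then show "t = t0" using no2[of t t0] no2[of t0 t] ex t0 by (cases t t0 rule: linorder_cases) auto
  qed
qed

lemma cos_add_npi: "cos (x + real j * pi) = (- 1) ^ j * cos x"
  by (simp add: cos_add)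

text \<open>The zeros of the cosine lie in the interior of the 2 k half-wavelength cells that start
  at 0, and on each cell the main term is, up to sign, a cosine shifted to the start of the
  cell.\<close>

lemma count_cos:
  assumes T: "T > 0" and k: "k \<ge> (1::nat)" and \<omega>: "\<omega> = 2 * pi * real k / T" and \<kappa>: "\<kappa> > 2 * \<delta>" "\<kappa> * \<omega> > 2 * \<delta>" "\<kappa> > 0"
    and h: "H2rep T h h1 h2" and hb: "\<And>t. t \<in> {0..T} \<Longrightarrow> \<bar>h t\<bar> \<le> \<delta> \<and> \<bar>h1 t\<bar> \<le> \<delta>"
  shows "card {t \<in> {0..<T}. \<kappa> * cos (\<omega> * t) + h t = 0} = 2 * k"
proof -
  define L where "L = T / (2 * real k)"
  have L: "L > 0" "\<omega> * L = pi" "real (2 * k) * L = T" and \<omega>0: "\<omega> > 0" using T k by (auto simp: L_def \<omega>)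
  have "\<exists>!t. t \<in> {0 + real j * L..<0 + (real j + 1) * L} \<and> \<kappa> * cos (\<omega> * t) + h t = 0" if j: "j < 2 * k" for j
  proof -
    have jT: "(real j + 1) * L \<le> T" unfolding L(3)[symmetric] using j L(1) by (intro mult_right_mono) auto
    have sub: "{real j * L..real j * L + L} \<subseteq> {0..T}"
    proof (rule subsetI)
      have j0: "0 \<le> real j * L" and "(real j + 1) * L = real j * L + L" using L(1) by (simp_all add: algebra_simps)
      then show "t \<in> {0..T}" if "t \<in> {real j * L..real j * L + L}" for t
      proof -
        have "real j * L \<le> t" "t \<le> T" using that jT by (auto simp: distrib_right)
        then show ?thesis using order_trans[OF j0] by simp
      qed
    qed
    have "\<exists>!t. t \<in> {real j * L..<real j * L + L} \<and> ((- 1) ^ j * \<kappa>) * cos (\<omega> * (t - real j * L)) + h t = 0"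
    proof (rule cos_perturbation_unique_zero[OF \<omega>0 L(2)])
      show "2 * \<delta> < \<bar>(- 1) ^ j * \<kappa>\<bar>" "2 * \<delta> < \<bar>(- 1) ^ j * \<kappa>\<bar> * \<omega>" using \<kappa> by (simp_all add: abs_mult)
      show "(h has_real_derivative h1 t) (at t within {real j * L..real j * L + L})" if "t \<in> {real j * L..real j * L + L}" for t
        by (rule has_field_derivative_subset[OF acd_has_derivative[OF H2repD(1,7)[OF h]] sub]) (use subsetD[OF sub that] in simp)
    qed (use hb subsetD[OF sub] in blast)+
    moreover have "((- 1) ^ j * \<kappa>) * cos (\<omega> * (t - real j * L)) = \<kappa> * cos (\<omega> * t)" for t
    proof -
      have "\<omega> * t = \<omega> * (t - real j * L) + real j * pi" by (simp add: L(2)[symmetric] algebra_simps)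
      then have "cos (\<omega> * t) = (- 1) ^ j * cos (\<omega> * (t - real j * L))" using cos_add_npi by metis
      then show ?thesis by simp
    qed
    moreover have "0 + real j * L = real j * L" "0 + (real j + 1) * L = real j * L + L" by (simp_all add: algebra_simps)
    ultimately show ?thesis by (simp only:)
  qed
  from card_zeros_in_cells[where n = "2 * k", OF L(1) this] show ?thesis using L(3) by simp
qed

text \<open>Cells starting at 0 would have the zeros of the sine at their ends, where a perturbation
  may move them across. The cells are therefore shifted by a quarter wavelength, leaving 2 k - 1 of
  them; the remaining zero sits at 0, held there by oddness, and no other lies near the
  endpoints.\<close>

lemma count_sin:
  assumes T: "T > 0" and k: "k \<ge> (1::nat)" and \<omega>: "\<omega> = 2 * pi * real k / T" and \<kappa>: "\<kappa> > 2 * \<delta>" "\<kappa> * \<omega> > 2 * \<delta>" "\<kappa> > 0"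
    and h: "H2rep T h h1 h2" and hb: "\<And>t. t \<in> {0..T} \<Longrightarrow> \<bar>h t\<bar> \<le> \<delta> \<and> \<bar>h1 t\<bar> \<le> \<delta>"
    and odd: "\<And>t. t \<in> {0..T} \<Longrightarrow> h (T - t) = - h t"
  shows "card {t \<in> {0..<T}. \<kappa> * sin (\<omega> * t) + h t = 0} = 2 * k"
proof -
  let ?g = "\<lambda>t. \<kappa> * sin (\<omega> * t) + h t"
  define L where "L = T / (2 * real k)"
  define n where "n = 2 * k - 1"
  have n: "real n = 2 * real k - 1" "Suc n = 2 * k" using k by (auto simp: n_def of_nat_diff)
  have L: "L > 0" "\<omega> * L = pi" "2 * real k * L = T" and \<omega>0: "\<omega> > 0" using T k by (auto simp: L_def \<omega>)
  have nL: "L / 2 + real n * L = T - L / 2" unfolding n(1) by (simp add: L(3)[symmetric] algebra_simps)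
  have "\<exists>!t. t \<in> {L / 2 + real j * L..<L / 2 + (real j + 1) * L} \<and> ?g t = 0" if j: "j < n" for j
  proof -
    define c where "c = L / 2 + real j * L"
    have jT: "c + L \<le> T"
    proof -
      have "(real j + 1) * L \<le> real n * L" using j L(1) by (intro mult_right_mono) auto
      then show ?thesis using nL L(1) by (simp add: c_def algebra_simps)
    qed
    have c0: "0 \<le> c" using L(1) by (simp add: c_def)
    have sub: "{c..c + L} \<subseteq> {0..T}" using jT c0 by auto
    have "\<exists>!t. t \<in> {c..<c + L} \<and> ((- 1) ^ j * \<kappa>) * cos (\<omega> * (t - c)) + h t = 0"
    proof (rule cos_perturbation_unique_zero[OF \<omega>0 L(2)])
      show "2 * \<delta> < \<bar>(- 1) ^ j * \<kappa>\<bar>" "2 * \<delta> < \<bar>(- 1) ^ j * \<kappa>\<bar> * \<omega>" using \<kappa> by (simp_all add: abs_mult)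
      show "(h has_real_derivative h1 t) (at t within {c..c + L})" if "t \<in> {c..c + L}" for t
        by (rule has_field_derivative_subset[OF acd_has_derivative[OF H2repD(1,7)[OF h]] sub]) (use that sub in auto)
    qed (use hb sub in auto)
    moreover have "((- 1) ^ j * \<kappa>) * cos (\<omega> * (t - c)) = \<kappa> * sin (\<omega> * t)" for t
    proof -
      have "\<omega> * t - pi / 2 = \<omega> * (t - c) + real j * pi"
        by (simp add: c_def L(2)[symmetric] algebra_simps)
      then have "cos (\<omega> * t - pi / 2) = (- 1) ^ j * cos (\<omega> * (t - c))" using cos_add_npi by metis
      moreover have "cos (\<omega> * t - pi / 2) = sin (\<omega> * t)" by (simp add: cos_diff)
      ultimately show ?thesis by simp
    qed
    moreover have "L / 2 + (real j + 1) * L = c + L" by (simp add: c_def algebra_simps)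
    ultimately show ?thesis by (simp only: c_def[symmetric])
  qed
  from card_zeros_in_cells[where n = n, OF L(1) this]
  have mid: "finite {t \<in> {L / 2..<T - L / 2}. ?g t = 0} \<and> card {t \<in> {L / 2..<T - L / 2}. ?g t = 0} = n"
    using nL by simp
  have LT: "L / 2 \<le> T - L / 2" using nL L(1) by (metis le_add_same_cancel1 mult_nonneg_nonneg of_nat_0_le_iff less_imp_le)
  \<comment> \<open>Oddness at 0 and periodicity give h 0 = - h 0.\<close>
  have h0: "h 0 = 0" using odd[of 0] H2repD(4)[OF h] T by simp
  have dg: "(?g has_real_derivative (\<kappa> * (\<omega> * cos (\<omega> * t)) + h1 t)) (at t within {0..T})" if "t \<in> {0..T}" for t
    using acd_has_derivative[OF H2repD(1,7)[OF h] that] by (auto intro!: derivative_eq_intros)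
  \<comment> \<open>Together with the zero at 0, a zero in the first quarter wavelength would by
    Rolle's theorem produce a critical point where the cosine is at least 1/2.\<close>
  have no: "?g t \<noteq> 0" if t: "0 < t" "t \<le> L / 2" for t
  proof
    assume g: "?g t = 0"
    have tT: "t \<le> T" using t LT L(1) by linarith
    have "\<exists>\<xi>. 0 < \<xi> \<and> \<xi> < t \<and> \<kappa> * (\<omega> * cos (\<omega> * \<xi>)) + h1 \<xi> = 0"
    proof (rule mvt_within[of 0 t ?g])
      show "(?g has_real_derivative (\<kappa> * (\<omega> * cos (\<omega> * x)) + h1 x)) (at x within {0..t})" if "x \<in> {0..t}" for x
        by (rule has_field_derivative_subset[OF dg]) (use that tT in auto)
    qed (use t h0 g in auto)
    then obtain \<xi> where \<xi>: "0 < \<xi>" "\<xi> < t" "\<kappa> * (\<omega> * cos (\<omega> * \<xi>)) + h1 \<xi> = 0" by blast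
    have wt: "\<omega> * t \<le> pi / 2" using mult_left_mono[OF t(2), of \<omega>] \<omega>0 L(2) by simp
    have w: "0 \<le> \<omega> * \<xi>" "\<omega> * \<xi> \<le> \<omega> * t" using \<xi> \<omega>0 by auto
    have "\<kappa> * sin (\<omega> * t) \<le> \<kappa> * (1 / 2)" using g hb[of t] t tT \<kappa>(1) by auto
    then have "sin (\<omega> * t) \<le> 1 / 2" using \<kappa>(3) mult_le_cancel_left_pos by blast
    moreover have "sin (\<omega> * \<xi>) \<le> sin (\<omega> * t)"
      by (rule sin_monotone_2pi_le) (use w wt pi_gt_zero in linarith)+
    ultimately have "1 / 2 \<le> cos (\<omega> * \<xi>)" by (intro cos_ge_half_of_sin) (use w wt in auto)
    then have "\<kappa> * \<omega> * (1 / 2) \<le> \<kappa> * \<omega> * cos (\<omega> * \<xi>)" using \<kappa>(3) \<omega>0 by (intro mult_left_mono) auto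
    moreover have "- h1 \<xi> \<le> \<delta>" using hb[of \<xi>] \<xi> tT by auto
    ultimately show False using \<xi>(3) \<kappa>(2) by (simp add: mult.assoc)
  qed
  have gT: "?g (T - t) = - ?g t" if "t \<in> {0..T}" for t
    using odd[OF that] trig_reflect(2)[OF T \<omega>, of t] by simp
  have no': "?g t \<noteq> 0" if t: "T - L / 2 \<le> t" "t < T" for t
  proof
    assume "?g t = 0"
    then have "?g (T - t) = 0" using gT[of t] t LT L(1) by auto
    then show False using no[of "T - t"] t by auto
  qed
  \<comment> \<open>The half-open period excludes T, so the zero at the seam is counted
    once.\<close>
  have "{t \<in> {0..<T}. ?g t = 0} = insert 0 {t \<in> {L / 2..<T - L / 2}. ?g t = 0}" (is "?A = ?B")
  proof (intro set_eqI iffI)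
    fix t assume t: "t \<in> ?A"
    then show "t \<in> ?B" using no[of t] no'[of t] by (cases "t = 0"; cases "t \<le> L / 2"; cases "T - L / 2 \<le> t") auto
  next
    fix t assume "t \<in> ?B"
    then show "t \<in> ?A" using h0 T L(1) by auto
  qed
  moreover have "0 \<notin> {t \<in> {L / 2..<T - L / 2}. ?g t = 0}" using L(1) by auto
  ultimately show ?thesis using mid n(2) by simp
qed

section \<open>Components containing a curve\<close>

lemma topspace_RH2_top:
  assumes "T > 0" shows "topspace (RH2_top T) = UNIV \<times> H2 T"
  unfolding RH2_top_def by (rule Metric_space.topspace_mtopology[OF RH2_Metric_space[OF assms]])

text \<open>A Lipschitz curve is continuous, so its image is connected and lies in the component of
  its centre; the centre is also the limit of its other points.\<close>

lemma curve_in_component: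
  fixes c :: "real \<Rightarrow> real \<times> (real \<Rightarrow> real)"
  assumes T: "T > 0" and S: "S \<subseteq> UNIV \<times> H2 T" and cS: "\<And>s. \<bar>s\<bar> < \<epsilon> \<Longrightarrow> c s \<in> S"
    and L: "\<And>s s'. \<bar>s\<bar> < \<epsilon> \<Longrightarrow> \<bar>s'\<bar> < \<epsilon> \<Longrightarrow> prod_dist dist (H2_dist T) (c s) (c s') \<le> L * \<bar>s - s'\<bar>" and s: "\<bar>s\<bar> < \<epsilon>"
  shows "c s \<in> connected_component_of_set (subtopology (RH2_top T) S) (c 0)"
    "c 0 \<in> RH2_top T closure_of {c s | s. s \<noteq> 0 \<and> \<bar>s\<bar> < \<epsilon>}"
proof -
  interpret M: Metric_space "(UNIV :: real set) \<times> H2 T" "prod_dist dist (H2_dist T)" by (rule RH2_Metric_space[OF T])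
  have top: "RH2_top T = M.mtopology" by (simp add: RH2_top_def)
  have cM: "c s \<in> UNIV \<times> H2 T" if "\<bar>s\<bar> < \<epsilon>" for s using cS[OF that] S by blast
  have \<epsilon>0: "0 < \<epsilon>" using s by linarith
  have close: "\<exists>d>0. \<forall>s'. \<bar>s'\<bar> < \<epsilon> \<longrightarrow> \<bar>s - s'\<bar> < d \<longrightarrow> c s' \<in> M.mball (c s) r" if s: "\<bar>s\<bar> < \<epsilon>" and r: "r > 0" for s r
  proof (intro exI conjI allI impI)
    show "r / (\<bar>L\<bar> + 1) > 0" using r by simp
    fix s' assume s': "\<bar>s'\<bar> < \<epsilon>" and d: "\<bar>s - s'\<bar> < r / (\<bar>L\<bar> + 1)"
    have "prod_dist dist (H2_dist T) (c s) (c s') \<le> L * \<bar>s - s'\<bar>" by (rule L[OF s s'])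
    also have "\<dots> \<le> (\<bar>L\<bar> + 1) * \<bar>s - s'\<bar>" by (intro mult_right_mono) auto
    also have "\<dots> < r" using d by (simp add: pos_less_divide_eq mult.commute)
    finally show "c s' \<in> M.mball (c s) r" using cM[OF s] cM[OF s'] by simp
  qed
  have "continuous_map (top_of_set {-\<epsilon><..<\<epsilon>}) M.mtopology c"
    unfolding continuous_map_def
  proof (intro conjI allI impI)
    show "c \<in> topspace (top_of_set {-\<epsilon><..<\<epsilon>}) \<rightarrow> topspace M.mtopology" using cM by auto
    fix U assume U: "openin M.mtopology U"
    have "\<exists>d>0. \<forall>s'\<in>{-\<epsilon><..<\<epsilon>}. dist s' s < d \<longrightarrow> s' \<in> {x \<in> {-\<epsilon><..<\<epsilon>}. c x \<in> U}"
      if sU: "s \<in> {x \<in> {-\<epsilon><..<\<epsilon>}. c x \<in> U}" for s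
    proof -
      have s: "\<bar>s\<bar> < \<epsilon>" and "c s \<in> U" using sU by auto
      then obtain r where r: "r > 0" "M.mball (c s) r \<subseteq> U" using U unfolding M.openin_mtopology by blast
      from close[OF s r(1)] obtain d where d: "d > 0" "\<And>s'. \<bar>s'\<bar> < \<epsilon> \<Longrightarrow> \<bar>s - s'\<bar> < d \<Longrightarrow> c s' \<in> M.mball (c s) r" by blast
      have "s' \<in> {x \<in> {-\<epsilon><..<\<epsilon>}. c x \<in> U}" if "s' \<in> {-\<epsilon><..<\<epsilon>}" "dist s' s < d" for s'
      proof -
        have "\<bar>s'\<bar> < \<epsilon>" "\<bar>s - s'\<bar> < d" using that by (auto simp: dist_real_def)
        then show ?thesis using d(2)[of s'] r(2) that by blast
      qed
      then show ?thesis using d(1) by blast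
    qed
    then have "openin (top_of_set {-\<epsilon><..<\<epsilon>}) {x \<in> {-\<epsilon><..<\<epsilon>}. c x \<in> U}"
      unfolding openin_euclidean_subtopology_iff by blast
    then show "openin (top_of_set {-\<epsilon><..<\<epsilon>}) {x \<in> topspace (top_of_set {-\<epsilon><..<\<epsilon>}). c x \<in> U}" by simp
  qed
  moreover have "connectedin (top_of_set {-\<epsilon><..<\<epsilon>}) {-\<epsilon><..<\<epsilon>}"
    by (simp add: connectedin_subtopology)
  ultimately have "connectedin M.mtopology (c ` {-\<epsilon><..<\<epsilon>})" by (rule connectedin_continuous_map_image)
  then have "connectedin (subtopology (RH2_top T) S) (c ` {-\<epsilon><..<\<epsilon>})"
    unfolding top connectedin_subtopology using cS by (auto simp: abs_less_iff)
  moreover have "c 0 \<in> c ` {-\<epsilon><..<\<epsilon>}" using \<epsilon>0 by auto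
  ultimately have "c ` {-\<epsilon><..<\<epsilon>} \<subseteq> connected_component_of_set (subtopology (RH2_top T) S) (c 0)"
    by (rule connected_component_of_maximal)
  then show "c s \<in> connected_component_of_set (subtopology (RH2_top T) S) (c 0)"
    by (rule subsetD) (use s in \<open>simp add: abs_less_iff\<close>)
  show "c 0 \<in> RH2_top T closure_of {c s | s. s \<noteq> 0 \<and> \<bar>s\<bar> < \<epsilon>}"
    unfolding top M.metric_closure_of
  proof (intro CollectI conjI allI impI)
    have e0: "\<bar>0::real\<bar> < \<epsilon>" using \<epsilon>0 by simp
    show "c 0 \<in> UNIV \<times> H2 T" by (rule cM[OF e0])
    fix r :: real assume "r > 0"
    from close[OF e0 this] obtain d where d: "d > 0" "\<And>s'. \<bar>s'\<bar> < \<epsilon> \<Longrightarrow> \<bar>0 - s'\<bar> < d \<Longrightarrow> c s' \<in> M.mball (c 0) r" by blast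
    define s' where "s' = min d \<epsilon> / 2"
    have "s' \<noteq> 0" "\<bar>s'\<bar> < \<epsilon>" "\<bar>0 - s'\<bar> < d" using d(1) \<epsilon>0 by (auto simp: s'_def min_def)
    then show "\<exists>y\<in>{c s | s. s \<noteq> 0 \<and> \<bar>s\<bar> < \<epsilon>}. y \<in> M.mball (c 0) r" using d(2)[of s'] by blast
  qed
qed

section \<open>Branches inside a component\<close>

context simple_bifurcation
begin

text \<open>What survives of \<open>is_branch\<close> for a single point. The clause for empty
  \<open>E\<close> exports the evenness of the curve with constant kernel, which the symmetry class
  itself does not encode.\<close>

definition "on_branch \<delta>0 s l u \<longleftrightarrow> (l, u) \<in> zeros_FF T a \<and> symE T E u \<and>
    (E = {} \<longrightarrow> symE T {1} e \<longrightarrow> symE T {1} u) \<and>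
    (\<exists>\<gamma> \<gamma>1 \<gamma>2. H2rep T \<gamma> \<gamma>1 \<gamma>2 \<and> symE T E \<gamma> \<and> (\<forall>t\<in>{0..T}. \<bar>\<gamma> t\<bar> \<le> \<delta>0 \<and> \<bar>\<gamma>1 t\<bar> \<le> \<delta>0) \<and>
      u = (\<lambda>t. s * (e t + \<gamma> t)))"
  for \<delta>0 s l :: real and u :: "real \<Rightarrow> real"

lemma is_branchD:
  assumes "is_branch \<rho> \<delta>0 \<epsilon> \<Lambda> \<Gamma>"
  shows "\<epsilon> > 0" "smooth_on {-\<epsilon><..<\<epsilon>} \<Lambda>" "smooth_map_H2 T (ortho_in T {u \<in> H2 T. symE T E u} e) \<epsilon> \<Gamma>"
    "\<Lambda> 0 = \<sigma>" "\<Gamma> 0 = zero_fun" "\<And>s. \<Lambda> (- s) = \<Lambda> s" "\<And>s. \<Gamma> (- s) = \<Gamma> s"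
    "\<And>s. \<bar>s\<bar> < \<epsilon> \<Longrightarrow> (\<Lambda> s, \<lambda>t. s * (e t + \<Gamma> s t)) \<in> zeros_FF T a"
    "\<And>s. \<bar>s\<bar> < \<epsilon> \<Longrightarrow> symE T E (\<lambda>t. s * (e t + \<Gamma> s t))"
    "\<And>s. \<bar>s\<bar> < \<epsilon> \<Longrightarrow> blowup (s\<^sup>2) (\<Lambda> s - \<sigma>) (\<Gamma> s)"
    "\<And>s. \<bar>s\<bar> < \<epsilon> \<Longrightarrow> \<exists>\<gamma>1 \<gamma>2. H2rep T (\<Gamma> s) \<gamma>1 \<gamma>2 \<and> (\<forall>t\<in>{0..T}. \<bar>\<Gamma> s t\<bar> \<le> \<delta>0 \<and> \<bar>\<gamma>1 t\<bar> \<le> \<delta>0)"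
    "{(l, u) \<in> zeros_FF T a. symE T E u \<and> u \<noteq> zero_fun} \<inter> RH2_ball T (\<sigma>, zero_fun) \<rho> =
      {(\<Lambda> s, \<lambda>t. s * (e t + \<Gamma> s t)) | s. s \<noteq> 0 \<and> \<bar>s\<bar> < \<epsilon>}"
    "\<exists>L. \<forall>s s'. \<bar>s\<bar> < \<epsilon> \<longrightarrow> \<bar>s'\<bar> < \<epsilon> \<longrightarrow> prod_dist dist (H2_dist T) (\<Lambda> s, \<lambda>t. s * (e t + \<Gamma> s t))
        (\<Lambda> s', \<lambda>t. s' * (e t + \<Gamma> s' t)) \<le> L * \<bar>s - s'\<bar>"
  using assms[unfolded is_branch_def] by (elim conjE; (assumption | simp only:))+

text \<open>The parameter \<open>s\<close> is the coordinate of the solution along \<open>e\<close>, so the curve is injective.\<close>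

lemma branch_coordinate:
  assumes "is_branch \<rho> \<delta>0 \<epsilon> \<Lambda> \<Gamma>" "\<bar>s\<bar> < \<epsilon>"
  shows "lint 0 T (\<lambda>t. s * (e t + \<Gamma> s t) * e t) = s * N"
proof -
  obtain \<gamma>1 \<gamma>2 where r: "H2rep T (\<Gamma> s) \<gamma>1 \<gamma>2" and z: "lint 0 T (\<lambda>t. \<Gamma> s t * e t) = 0"
    using is_branchD(10)[OF assms] unfolding blowup_def by blast
  note i = L2_mult[OF H2repD(8)[OF e_rep] H2repD(8)[OF e_rep]] L2_mult[OF H2repD(8)[OF r] H2repD(8)[OF e_rep]]
  have "lint 0 T (\<lambda>t. s * (e t + \<Gamma> s t) * e t) = lint 0 T (\<lambda>t. s * (e t * e t) + s * (\<Gamma> s t * e t))"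
    by (rule lint_cong) (simp add: algebra_simps)
  also have "\<dots> = s * N" using i z by simp
  finally show ?thesis .
qed

lemma H2_norm_reflect:
  assumes "H2rep T u u1 u2" shows "H2_norm T (\<lambda>t. u (T - t)) = H2_norm T u"
proof -
  have "lint 0 T (\<lambda>t. (f (T - t))\<^sup>2) = lint 0 T (\<lambda>t. (f t)\<^sup>2)" for f :: "real \<Rightarrow> real"
    using lint_reflect[of 0 T "\<lambda>t. (f t)\<^sup>2" T] by simp
  then show ?thesis
    unfolding H2_norm_def H2_inner_self[OF T assms] H2_inner_self[OF T H2rep_reflect[OF assms]] by simp
qed

text \<open>The reflected solution has the same norm and the same \<lambda>, so it lies in the same
  ball and hence on the curve; its coordinate along the even function e is unchanged, so it is the
  same point.\<close>

lemma branch_even: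
  assumes br: "is_branch \<rho> \<delta>0 \<epsilon> \<Lambda> \<Gamma>" and s: "s \<noteq> 0" "\<bar>s\<bar> < \<epsilon>" and E0: "E = {}" and e_ev: "symE T {1} e"
  shows "symE T {1} (\<lambda>t. s * (e t + \<Gamma> s t))"
proof -
  define u where "u t = s * (e t + \<Gamma> s t)" for t
  define v where "v t = u (T - t)" for t
  let ?B = "{(l, u) \<in> zeros_FF T a. symE T E u \<and> u \<noteq> zero_fun} \<inter> RH2_ball T (\<sigma>, zero_fun) \<rho>"
  have "(\<Lambda> s, u) \<in> ?B" unfolding is_branchD(12)[OF br] u_def using s by blast
  then have uz: "(\<Lambda> s, u) \<in> zeros_FF T a" and u0: "u \<noteq> zero_fun" and ub: "(\<Lambda> s, u) \<in> RH2_ball T (\<sigma>, zero_fun) \<rho>" by auto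
  obtain u1 where off: "\<And>t. t \<notin> {0..T} \<Longrightarrow> u t = 0"
    and r: "H2rep T u u1 (\<lambda>t. - \<Lambda> s * u t - a t * (u t * (u t * u t)))" using uz unfolding sol_iff by blast
  have vr: "H2rep T v (\<lambda>t. - u1 (T - t)) (\<lambda>t. - \<Lambda> s * v t - a t * (v t * (v t * v t)))"
    by (rule H2rep_cong[OF H2rep_reflect[OF r] T]) (auto simp: v_def a_even)
  have off': "v t = 0" if "t \<notin> {0..T}" for t unfolding v_def by (rule off) (use that in auto)
  have "v \<noteq> zero_fun"
  proof
    assume v: "v = zero_fun"
    have "u t = v (T - t)" for t by (simp add: v_def)
    then show False using u0 by (auto simp: v zero_fun_def)
  qed
  moreover have "(\<Lambda> s, v) \<in> zeros_FF T a" unfolding sol_iff using vr off' by blast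
  moreover have "H2_norm T v = H2_norm T u" using H2_norm_reflect[OF r] by (simp add: v_def[abs_def])
  moreover have "v \<in> H2 T" unfolding H2_iff[OF T] using vr off' by blast
  ultimately have "(\<Lambda> s, v) \<in> ?B" using ub by (auto simp: in_RH2_ball[OF T] E0 symE_def)
  then obtain s' where s': "\<bar>s'\<bar> < \<epsilon>" "v = (\<lambda>t. s' * (e t + \<Gamma> s' t))" unfolding is_branchD(12)[OF br] by blast
  have "s' * N = lint 0 T (\<lambda>t. v t * e t)" using branch_coordinate[OF br s'(1)] s'(2) by simp
  also have "\<dots> = lint 0 T (\<lambda>t. u (T - t) * e (T - t))"
    using symED[OF e_ev, of 1] by (intro lint_cong) (simp add: v_def)
  also have "\<dots> = s * N"
    using lint_reflect[of 0 T "\<lambda>t. u t * e t" T] branch_coordinate[OF br s(2)] by (simp add: u_def)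
  finally have "s' = s" using N_pos by simp
  then have "v = u" using s'(2) by (simp add: u_def[abs_def])
  then have "symE T {1} u" unfolding symE_def by (simp add: v_def[abs_def] fun_eq_iff)
  then show ?thesis by (simp add: u_def[abs_def])
qed

text \<open>Stated for any S with the prescribed nontrivial points, so that it serves
  \<open>SS\<close>, \<open>SS_ev\<close> and \<open>SS_odd\<close> alike. The hypothesis
  \<open>gap\<close> keeps other trivial points of S out of the ball; connectedness of the curve
  puts it into the component.\<close>

theorem bifurcating_curves:
  assumes \<delta>0: "\<delta>0 > 0" and S: "S \<subseteq> UNIV \<times> H2 T" "(\<sigma>, zero_fun) \<in> S"
    and S_iff: "\<And>l u. u \<noteq> zero_fun \<Longrightarrow> (l, u) \<in> S \<longleftrightarrow> (l, u) \<in> zeros_FF T a \<and> symE T E u"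
    and gap: "\<And>l. (l, zero_fun) \<in> S \<Longrightarrow> \<bar>l - \<sigma>\<bar> < \<delta>0 \<Longrightarrow> l = \<sigma>"
  obtains \<rho>m where "\<rho>m > 0" "\<And>\<rho>. 0 < \<rho> \<Longrightarrow> \<rho> \<le> \<rho>m \<Longrightarrow>
    \<exists>Cp Cm. local_curves T {u \<in> H2 T. symE T E u} \<sigma> e Cp Cm \<and>
      RH2_ball T (\<sigma>, zero_fun) \<rho> \<inter>
        (connected_component_of_set (subtopology (RH2_top T) S) (\<sigma>, zero_fun) - {(\<sigma>, zero_fun)}) = Cp \<union> Cm \<and>
      Cp \<inter> Cm = {} \<and> neg_set Cp = Cm \<and>
      (\<forall>(l, u)\<in>Cp. \<exists>s>0. on_branch \<delta>0 s l u) \<and> (\<forall>(l, u)\<in>Cm. \<exists>s<0. on_branch \<delta>0 s l u) \<and>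
      (\<sigma>, zero_fun) \<in> RH2_top T closure_of
        (connected_component_of_set (subtopology (RH2_top T) S) (\<sigma>, zero_fun) - trivial_branch)"
proof -
  obtain \<rho>m where \<rho>m: "\<rho>m > 0" "\<rho>m \<le> \<delta>0" "\<And>\<rho>. 0 < \<rho> \<Longrightarrow> \<rho> \<le> \<rho>m \<Longrightarrow> \<exists>\<epsilon> \<Lambda> \<Gamma>. is_branch \<rho> \<delta>0 \<epsilon> \<Lambda> \<Gamma>"
    using local_branch[OF \<delta>0] by blast
  let ?p = "(\<sigma>, zero_fun)"
  define K where "K = connected_component_of_set (subtopology (RH2_top T) S) ?p"
  have KS: "K \<subseteq> S" unfolding K_def
    using connected_component_of_subset_topspace[of "subtopology (RH2_top T) S" ?p] by auto
  have main: "\<exists>Cp Cm. local_curves T {u \<in> H2 T. symE T E u} \<sigma> e Cp Cm \<and>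
      RH2_ball T ?p \<rho> \<inter> (K - {?p}) = Cp \<union> Cm \<and> Cp \<inter> Cm = {} \<and> neg_set Cp = Cm \<and>
      (\<forall>(l, u)\<in>Cp. \<exists>s>0. on_branch \<delta>0 s l u) \<and> (\<forall>(l, u)\<in>Cm. \<exists>s<0. on_branch \<delta>0 s l u) \<and>
      ?p \<in> RH2_top T closure_of (K - trivial_branch)" if \<rho>: "0 < \<rho>" "\<rho> \<le> \<rho>m" for \<rho>
  proof -
    obtain \<epsilon> \<Lambda> \<Gamma> where br: "is_branch \<rho> \<delta>0 \<epsilon> \<Lambda> \<Gamma>" using \<rho>m(3)[OF \<rho>] by blast
    note B = is_branchD[OF br]
    define c where "c s = (\<Lambda> s, \<lambda>t. s * (e t + \<Gamma> s t))" for s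
    have c0: "c 0 = ?p" by (simp add: c_def B(4) zero_fun_def)
    have ball: "{(l, u) \<in> zeros_FF T a. symE T E u \<and> u \<noteq> zero_fun} \<inter> RH2_ball T ?p \<rho> = {c s | s. s \<noteq> 0 \<and> \<bar>s\<bar> < \<epsilon>}"
      using B(12) by (simp add: c_def)
    have nz: "snd (c s) \<noteq> zero_fun \<and> c s \<in> RH2_ball T ?p \<rho>" if "s \<noteq> 0" "\<bar>s\<bar> < \<epsilon>" for s
    proof -
      have "c s \<in> {c s | s. s \<noteq> 0 \<and> \<bar>s\<bar> < \<epsilon>}" using that by blast
      then show ?thesis unfolding ball[symmetric] by auto
    qed
    have cS: "c s \<in> S" if s: "\<bar>s\<bar> < \<epsilon>" for s
    proof (cases "s = 0")
      case True
      then show ?thesis using c0 S by simp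
    next
      case False
      then show ?thesis using nz[OF False s] B(8,9)[OF s] by (simp add: c_def S_iff)
    qed
    obtain L where L: "\<And>s s'. \<bar>s\<bar> < \<epsilon> \<Longrightarrow> \<bar>s'\<bar> < \<epsilon> \<Longrightarrow> prod_dist dist (H2_dist T) (c s) (c s') \<le> L * \<bar>s - s'\<bar>"
      using B(13) unfolding c_def by blast
    have cK: "c s \<in> K" if "\<bar>s\<bar> < \<epsilon>" for s
      using curve_in_component(1)[where c = c and \<epsilon> = \<epsilon> and L = L, OF T S(1) cS L that] by (simp add: c0 K_def)
    have cl: "?p \<in> RH2_top T closure_of {c s | s. s \<noteq> 0 \<and> \<bar>s\<bar> < \<epsilon>}"
      unfolding c0[symmetric]
      by (rule curve_in_component(2)[where c = c and \<epsilon> = \<epsilon> and L = L and s = 0, OF T S(1) cS L]) (use B(1) in simp_all)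
    have coord: "lint 0 T (\<lambda>t. snd (c s) t * e t) = s * N" if "\<bar>s\<bar> < \<epsilon>" for s
      using branch_coordinate[OF br that] by (simp add: c_def)
    have inj: "s = s'" if "c s = c s'" "\<bar>s\<bar> < \<epsilon>" "\<bar>s'\<bar> < \<epsilon>" for s s'
    proof -
      have "s * N = s' * N" using coord[OF that(2)] coord[OF that(3)] unfolding that(1) by (rule trans[OF sym])
      then show ?thesis using N_pos by simp
    qed
    define Cp where "Cp = {c s | s. 0 < s \<and> s < \<epsilon>}"
    define Cm where "Cm = {c s | s. - \<epsilon> < s \<and> s < 0}"
    have U: "Cp \<union> Cm = {c s | s. s \<noteq> 0 \<and> \<bar>s\<bar> < \<epsilon>}" 
    proof
      show "Cp \<union> Cm \<subseteq> {c s | s. s \<noteq> 0 \<and> \<bar>s\<bar> < \<epsilon>}" unfolding Cp_def Cm_def by fastforce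
      show "{c s | s. s \<noteq> 0 \<and> \<bar>s\<bar> < \<epsilon>} \<subseteq> Cp \<union> Cm"
      proof
        fix p assume "p \<in> {c s | s. s \<noteq> 0 \<and> \<bar>s\<bar> < \<epsilon>}"
        then obtain s where "p = c s" "s \<noteq> 0" "\<bar>s\<bar> < \<epsilon>" by blast
        then show "p \<in> Cp \<union> Cm" unfolding Cp_def Cm_def by (cases "0 < s") auto
      qed
    qed
    have "local_curves T {u \<in> H2 T. symE T E u} \<sigma> e Cp Cm"
      unfolding local_curves_def
      by (rule exI[of _ \<epsilon>], intro conjI exI[of _ \<Lambda>] exI[of _ \<Gamma>]) (use B(1-5) in \<open>simp_all add: Cp_def Cm_def c_def\<close>)
    moreover have "RH2_ball T ?p \<rho> \<inter> (K - {?p}) = Cp \<union> Cm"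
    proof (intro set_eqI iffI)
      fix q assume q: "q \<in> RH2_ball T ?p \<rho> \<inter> (K - {?p})"
      obtain l u where lu: "q = (l, u)" by force
      have qS: "(l, u) \<in> S" and ne: "(l, u) \<noteq> ?p" and qb: "(l, u) \<in> RH2_ball T ?p \<rho>" using q KS lu by auto
      have "\<bar>l - \<sigma>\<bar> \<le> sqrt ((l - \<sigma>)\<^sup>2 + (H2_norm T u)\<^sup>2)"
        using real_sqrt_le_mono[of "(l - \<sigma>)\<^sup>2" "(l - \<sigma>)\<^sup>2 + (H2_norm T u)\<^sup>2"] by simp
      also have "\<dots> < \<rho>" using qb by (simp add: in_RH2_ball[OF T])
      finally have "\<bar>l - \<sigma>\<bar> < \<delta>0" using \<rho> \<rho>m(2) by linarith
      \<comment> \<open>A trivial point of S in the ball would be (\<sigma>, 0) by the gap, and that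
        point is removed.\<close>
      then have u0: "u \<noteq> zero_fun" using gap[of l] qS ne by auto
      then show "q \<in> Cp \<union> Cm" unfolding U ball[symmetric] using qS qb by (auto simp: lu S_iff)
    next
      fix q assume "q \<in> Cp \<union> Cm"
      then obtain s where s: "q = c s" "s \<noteq> 0" "\<bar>s\<bar> < \<epsilon>" unfolding U by blast
      then show "q \<in> RH2_ball T ?p \<rho> \<inter> (K - {?p})" using nz[OF s(2,3)] cK[OF s(3)] by auto
    qed
    moreover have "Cp \<inter> Cm = {}"
    proof -
      have False if p: "p \<in> Cp" "p \<in> Cm" for p
      proof -
        obtain s s' where "c s = c s'" "0 < s" "s < \<epsilon>" "- \<epsilon> < s'" "s' < 0" using p unfolding Cp_def Cm_def by auto
        then show False using inj[of s s'] by simp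
      qed
      then show ?thesis by blast
    qed
    moreover have "neg_set Cp = Cm"
    proof -
      have neg: "(\<lambda>(l, u). (l, \<lambda>t. - u t)) (c s) = c (- s)" for s by (simp add: c_def B(6,7))
      have "neg_set Cp = {c (- s) | s. 0 < s \<and> s < \<epsilon>}" unfolding neg_set_def Cp_def neg[symmetric] by blast
      also have "\<dots> = Cm" unfolding Cm_def
      proof (intro set_eqI iffI)
        fix p assume "p \<in> {c (- s) | s. 0 < s \<and> s < \<epsilon>}"
        then obtain s where "p = c (- s)" "0 < s" "s < \<epsilon>" by blast
        then show "p \<in> {c s | s. - \<epsilon> < s \<and> s < 0}" by (intro CollectI exI[of _ "- s"]) simp
      next
        fix p assume "p \<in> {c s | s. - \<epsilon> < s \<and> s < 0}"
        then obtain s where "p = c s" "- \<epsilon> < s" "s < 0" by blast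
        then show "p \<in> {c (- s) | s. 0 < s \<and> s < \<epsilon>}" by (intro CollectI exI[of _ "- s"]) simp
      qed
      finally show ?thesis .
    qed
    moreover have ob: "on_branch \<delta>0 s (\<Lambda> s) (\<lambda>t. s * (e t + \<Gamma> s t))" if s: "s \<noteq> 0" "\<bar>s\<bar> < \<epsilon>" for s
      unfolding on_branch_def
    proof (intro conjI impI)
      show "(\<Lambda> s, \<lambda>t. s * (e t + \<Gamma> s t)) \<in> zeros_FF T a" "symE T E (\<lambda>t. s * (e t + \<Gamma> s t))"
        by (rule B(8,9)[OF s(2)])+
      show "symE T {1} (\<lambda>t. s * (e t + \<Gamma> s t))" if "E = {}" "symE T {1} e" by (rule branch_even[OF br s that])
      have "symE T E (\<Gamma> s)" using B(10)[OF s(2)] by (simp add: blowup_def)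
      then show "\<exists>\<gamma> \<gamma>1 \<gamma>2. H2rep T \<gamma> \<gamma>1 \<gamma>2 \<and> symE T E \<gamma> \<and> (\<forall>t\<in>{0..T}. \<bar>\<gamma> t\<bar> \<le> \<delta>0 \<and> \<bar>\<gamma>1 t\<bar> \<le> \<delta>0) \<and>
          (\<lambda>t. s * (e t + \<Gamma> s t)) = (\<lambda>t. s * (e t + \<gamma> t))"
        using B(11)[OF s(2)] by blast
    qed
    have "\<forall>(l, u)\<in>Cp. \<exists>s>0. on_branch \<delta>0 s l u"
    proof safe
      fix l u assume "(l, u) \<in> Cp"
      then obtain s where "l = \<Lambda> s" "u = (\<lambda>t. s * (e t + \<Gamma> s t))" "0 < s" "s < \<epsilon>" unfolding Cp_def c_def by blast
      then show "\<exists>s>0. on_branch \<delta>0 s l u" using ob[of s] by auto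
    qed
    moreover have "\<forall>(l, u)\<in>Cm. \<exists>s<0. on_branch \<delta>0 s l u"
    proof safe
      fix l u assume "(l, u) \<in> Cm"
      then obtain s where "l = \<Lambda> s" "u = (\<lambda>t. s * (e t + \<Gamma> s t))" "s < 0" "- \<epsilon> < s" unfolding Cm_def c_def by blast
      then show "\<exists>s<0. on_branch \<delta>0 s l u" using ob[of s] by auto
    qed
    moreover have "?p \<in> RH2_top T closure_of (K - trivial_branch)"
    proof -
      have "{c s | s. s \<noteq> 0 \<and> \<bar>s\<bar> < \<epsilon>} \<subseteq> K - trivial_branch"
      proof
        fix p assume "p \<in> {c s | s. s \<noteq> 0 \<and> \<bar>s\<bar> < \<epsilon>}"
        then obtain s where s: "p = c s" "s \<noteq> 0" "\<bar>s\<bar> < \<epsilon>" by blast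
        then show "p \<in> K - trivial_branch" using nz[OF s(2,3)] cK[OF s(3)] by (auto simp: trivial_branch_def)
      qed
      from closure_of_mono[OF this] show ?thesis using cl by blast
    qed
    ultimately show ?thesis by blast
  qed
  show thesis by (rule that[OF \<rho>m(1) main[unfolded K_def]])
qed

end

section \<open>Bifurcation points and components\<close>

lemma AE_symmetric_iff:
  assumes T: "T > 0" and u: "continuous_on {0..T} u"
  shows "(AE t in lebesgue_on {0..T}. u (T - t) = c * u t) \<longleftrightarrow> symE T {c} u"
proof
  assume ae: "AE t in lebesgue_on {0..T}. u (T - t) = c * u t"
  have "continuous_on {0..T} (\<lambda>t. u (T - t))"
    by (rule continuous_on_compose2[OF u]) (auto intro!: continuous_intros)
  then have "continuous_on {0..T} (\<lambda>t. u (T - t) - c * u t)" using u by (intro continuous_intros)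
  moreover have "AE t in lebesgue_on {0..T}. u (T - t) - c * u t = 0" using ae by eventually_elim simp
  ultimately have "u (T - t) - c * u t = 0" if "t \<in> {0..T}" for t using continuous_AE_zero[of 0 T _ t] T that by blast
  then show "symE T {c} u" unfolding symE_def by simp
next
  assume "symE T {c} u"
  then have "u (T - t) = c * u t" if "t \<in> space (lebesgue_on {0..T})" for t using that by (simp add: symE_def)
  then show "AE t in lebesgue_on {0..T}. u (T - t) = c * u t" by (rule AE_I2)
qed

lemma even_fun_iff: "T > 0 \<Longrightarrow> u \<in> H2 T \<Longrightarrow> even_fun T u \<longleftrightarrow> symE T {1} u"
  using AE_symmetric_iff[of T u 1] by (simp add: even_fun_def H2_def)

lemma odd_fun_iff: "T > 0 \<Longrightarrow> u \<in> H2 T \<Longrightarrow> odd_fun T u \<longleftrightarrow> symE T {-1} u"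
  using AE_symmetric_iff[of T u "-1"] by (simp add: odd_fun_def H2_def)

lemma H2_symE:
  assumes "T > 0"
  shows "{u \<in> H2 T. symE T {} u} = H2 T" "{u \<in> H2 T. symE T {1} u} = H2_ev T" "{u \<in> H2 T. symE T {-1} u} = H2_odd T"
  using even_fun_iff[OF assms] odd_fun_iff[OF assms] by (auto simp: symE_def H2_ev_def H2_odd_def)

text \<open>Truncation at the essential bound makes the coefficient bounded everywhere, and
  averaging with the reflection makes it symmetric everywhere; both change it only on a null
  set.\<close>

lemma coefficient_representative:
  assumes T: "T > 0" and a: "a \<in> Linf T" "even_fun T a"
  obtains A b where "b \<in> borel_measurable (lebesgue_on {0..T})" "\<And>t. t \<in> {0..T} \<Longrightarrow> \<bar>b t\<bar> \<le> A"
    "\<And>t. t \<in> {0..T} \<Longrightarrow> b (T - t) = b t" "AE t in lebesgue_on {0..T}. a t = b t"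
proof -
  obtain A where am: "a \<in> borel_measurable (lebesgue_on {0..T})" and A: "AE t in lebesgue_on {0..T}. \<bar>a t\<bar> \<le> A"
    using a(1) unfolding Linf_def by blast
  \<comment> \<open>The modulus spares a proof that A is nonnegative.\<close>
  define M where "M = \<bar>A\<bar>"
  define c where "c t = max (- M) (min M (a t))" for t
  have cm: "c \<in> borel_measurable (lebesgue_on {0..T})" unfolding c_def[abs_def] using am by measurable
  have cb: "\<bar>c t\<bar> \<le> M" for t unfolding c_def M_def by auto
  have cr: "(\<lambda>t. c (T - t)) \<in> borel_measurable (lebesgue_on {0..T})"
    using L2_measurable[OF L2_reflect[OF L2_bdd[OF cm cb]]] .
  define b where "b t = (c t + c (T - t)) / 2" for t
  show thesis
  proof (rule that[of b M])
    show "b \<in> borel_measurable (lebesgue_on {0..T})" unfolding b_def[abs_def] using cm cr by measurable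
    show "\<bar>b t\<bar> \<le> M" for t
    proof -
      have "\<bar>c t + c (T - t)\<bar> \<le> 2 * M" using cb[of t] cb[of "T - t"] by linarith
      then show ?thesis by (simp add: b_def)
    qed
    show "b (T - t) = b t" for t unfolding b_def by (simp add: add.commute)
    show "AE t in lebesgue_on {0..T}. a t = b t"
      using A a(2)[unfolded even_fun_def]
    proof eventually_elim
      case (elim t)
      then have "c t = a t" "c (T - t) = a t" unfolding c_def M_def by auto
      then show ?case by (simp add: b_def)
    qed
  qed
qed

lemma zeros_FF_cong:
  assumes "AE t in lebesgue_on {0..T}. a t = b t" shows "zeros_FF T a = zeros_FF T b"
proof -
  have *: "AE t in lebesgue_on {0..T}. FF T g p t = 0"
    if "AE t in lebesgue_on {0..T}. f t = g t" "AE t in lebesgue_on {0..T}. FF T f p t = 0" for f g p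
    using that by eventually_elim (simp add: FF_def split: prod.splits)
  have "AE t in lebesgue_on {0..T}. b t = a t" using assms by eventually_elim simp
  then show ?thesis unfolding zeros_FF_def using *[OF assms] *[of b a] by blast
qed

text \<open>The eigenvalues are (2 pi / T)^2 times squares of integers, and distinct integers differ
  by at least 1.\<close>

lemma sigma_gap:
  assumes "T > 0" "\<bar>sigma T j - sigma T k\<bar> < (2 * pi / T)\<^sup>2"
  shows "sigma T j = sigma T k"
proof -
  have s: "sigma T n = (2 * pi / T)\<^sup>2 * (real n)\<^sup>2" for n
    by (simp add: sigma_def power_mult_distrib power_divide)
  have "\<bar>sigma T j - sigma T k\<bar> = (2 * pi / T)\<^sup>2 * \<bar>(real j)\<^sup>2 - (real k)\<^sup>2\<bar>"
    unfolding s right_diff_distrib[symmetric] by (simp add: abs_mult)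
  then have "(2 * pi / T)\<^sup>2 * \<bar>(real j)\<^sup>2 - (real k)\<^sup>2\<bar> < (2 * pi / T)\<^sup>2 * 1" using assms(2) by simp
  then have "\<bar>(real j)\<^sup>2 - (real k)\<^sup>2\<bar> < 1" by (rule mult_left_less_imp_less) simp
  moreover have "real_of_int \<bar>int (j\<^sup>2) - int (k\<^sup>2)\<bar> = \<bar>(real j)\<^sup>2 - (real k)\<^sup>2\<bar>" by simp
  ultimately have "\<bar>int (j\<^sup>2) - int (k\<^sup>2)\<bar> < 1" by linarith
  then have "j\<^sup>2 = k\<^sup>2" by linarith
  then show ?thesis by simp
qed

section \<open>The claims for a coefficient that is bounded and symmetric at every point\<close>

context
  fixes T A :: real and a :: "real \<Rightarrow> real"
  assumes T: "T > 0" and a_meas: "a \<in> borel_measurable (lebesgue_on {0..T})"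
    and a_bdd: "\<And>t. t \<in> {0..T} \<Longrightarrow> \<bar>a t\<bar> \<le> A" and a_even: "\<And>t. t \<in> {0..T} \<Longrightarrow> a (T - t) = a t"
begin

lemma zeros_iff:
  "(l, u) \<in> zeros_FF T a \<longleftrightarrow>
    (\<forall>t. t \<notin> {0..T} \<longrightarrow> u t = 0) \<and> (\<exists>u1. H2rep T u u1 (\<lambda>t. - l * u t - a t * (u t * (u t * u t))))"
  by (rule zeros_FF_iff[OF T a_meas a_bdd])

lemma zero_solution: "(l, zero_fun) \<in> zeros_FF T a"
proof -
  have "acd T (\<lambda>_. 0) (\<lambda>_. 0)" by (rule acd_C1) auto
  then have "H2rep T zero_fun (\<lambda>_. 0) (\<lambda>t. - l * zero_fun t - a t * (zero_fun t * (zero_fun t * zero_fun t)))"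
    by (simp add: H2rep_def L2_cont zero_fun_def)
  then show ?thesis unfolding zeros_iff by (auto simp: zero_fun_def)
qed

lemma zeros_H2: "(l, u) \<in> zeros_FF T a \<Longrightarrow> u \<in> H2 T"
  by (simp add: zeros_FF_def)

lemma zero_fun_H2_ev_odd: "zero_fun \<in> H2_ev T" "zero_fun \<in> H2_odd T"
  using zero_fun_H2[OF T] by (auto simp: H2_ev_def H2_odd_def even_fun_def odd_fun_def zero_fun_def)

lemma SS_subset: "SS T a \<subseteq> zeros_FF T a" "SS_ev T a \<subseteq> zeros_FF T a \<inter> (UNIV \<times> H2_ev T)"
  "SS_odd T a \<subseteq> zeros_FF T a \<inter> (UNIV \<times> H2_odd T)"
  using zero_solution zero_fun_H2_ev_odd by (auto simp: SS_def SS_ev_def SS_odd_def)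

lemma SS_sub: "SS_ev T a \<subseteq> SS T a" "SS_odd T a \<subseteq> SS T a"
  by (auto simp: SS_def SS_ev_def SS_odd_def)

lemma zeros_subset: "zeros_FF T a \<subseteq> UNIV \<times> H2 T"
  by (auto simp: zeros_FF_def)

lemma SS_nontrivial:
  assumes "u \<noteq> zero_fun"
  shows "(l, u) \<in> SS T a \<longleftrightarrow> (l, u) \<in> zeros_FF T a \<and> symE T {} u"
    "(l, u) \<in> SS_ev T a \<longleftrightarrow> (l, u) \<in> zeros_FF T a \<and> symE T {1} u"
    "(l, u) \<in> SS_odd T a \<longleftrightarrow> (l, u) \<in> zeros_FF T a \<and> symE T {-1} u"
  using assms even_fun_iff[OF T, of u] odd_fun_iff[OF T, of u] zeros_H2[of l u]
  by (auto simp: SS_def SS_ev_def SS_odd_def trivial_branch_def symE_def H2_ev_def H2_odd_def)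

lemma SS_trivial:
  "(l, zero_fun) \<in> SS T a \<Longrightarrow> \<exists>k. l = sigma T k" "(sigma T k, zero_fun) \<in> SS T a" "(sigma T k, zero_fun) \<in> SS_ev T a"
  "k \<ge> 1 \<Longrightarrow> (sigma T k, zero_fun) \<in> SS_odd T a"
  by (auto simp: SS_def SS_ev_def SS_odd_def trivial_branch_def)

lemma SS_gap:
  assumes "(l, zero_fun) \<in> S" "S \<subseteq> SS T a" "\<bar>l - sigma T k\<bar> < d" "d \<le> (2 * pi / T)\<^sup>2"
  shows "l = sigma T k"
  using SS_trivial(1)[of l] assms sigma_gap[OF T, of _ k] by force

lemma even_odd_bifurcation:
  assumes k: "k \<ge> (1::nat)"
  obtains \<rho> Ep Em Op Om where "\<rho> > 0"
    "local_curves T (H2_ev T) (sigma T k) (chi_cos T k) Ep Em"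
    "local_curves T (H2_odd T) (sigma T k) (chi_sin T k) Op Om"
    "RH2_ball T (sigma T k, zero_fun) \<rho> \<inter> (CC_ev T a k - {(sigma T k, zero_fun)}) = Ep \<union> Em" "Ep \<inter> Em = {}"
    "RH2_ball T (sigma T k, zero_fun) \<rho> \<inter> (CC_odd T a k - {(sigma T k, zero_fun)}) = Op \<union> Om" "Op \<inter> Om = {}"
    "\<And>l u. (l, u) \<in> Ep \<union> Em \<Longrightarrow> (l, u) \<in> zeros_FF T a \<and> even_fun T u \<and> card {t \<in> {0..<T}. u t = 0} = 2 * k"
    "\<And>l u. (l, u) \<in> Op \<union> Om \<Longrightarrow> (l, u) \<in> zeros_FF T a \<and> odd_fun T u \<and> card {t \<in> {0..<T}. u t = 0} = 2 * k"
    "neg_set Ep = Em" "neg_set Op = Om"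
    "(sigma T k, zero_fun) \<in> RH2_top T closure_of (CC_ev T a k - trivial_branch)"
proof -
  define \<omega> where "\<omega> = 2 * pi * real k / T"
  define \<kappa> where "\<kappa> = sqrt (2 / T)"
  have \<omega>0: "\<omega> > 0" and \<kappa>0: "\<kappa> > 0" using T k by (auto simp: \<omega>_def \<kappa>_def)
  interpret ev: simple_bifurcation T "sigma T k" A "2 * T / \<omega> + 2 * T" "{1}" a "chi_cos T k" "\<lambda>t. sqrt (2 / T) * (- (\<omega> * sin (\<omega> * t)))"
    by (rule bifurcation_cos[OF T a_meas a_bdd a_even k \<omega>_def])
  interpret od: simple_bifurcation T "sigma T k" A "2 * T / \<omega> + 2 * T" "{-1}" a "chi_sin T k" "\<lambda>t. sqrt (2 / T) * (\<omega> * cos (\<omega> * t))"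
    by (rule bifurcation_sin[OF T a_meas a_bdd a_even k \<omega>_def])
  \<comment> \<open>The first bound separates the eigenvalues; the others make the remainder small
    in C^1 against the amplitude \<kappa> of the kernel function and the amplitude \<kappa> \<omega>
    of its derivative.\<close>
  define \<delta> where "\<delta> = min ((2 * pi / T)\<^sup>2) (min (\<kappa> / 3) (\<kappa> * \<omega> / 3))"
  have \<delta>: "\<delta> > 0" "\<delta> \<le> (2 * pi / T)\<^sup>2" "\<kappa> > 2 * \<delta>" "\<kappa> * \<omega> > 2 * \<delta>"
  proof -
    have p: "\<kappa> * \<omega> > 0" using \<kappa>0 \<omega>0 by simp
    show "\<delta> > 0" "\<delta> \<le> (2 * pi / T)\<^sup>2" using T p \<kappa>0 by (auto simp: \<delta>_def)
    have "\<delta> \<le> \<kappa> / 3" "\<delta> \<le> \<kappa> * \<omega> / 3" by (auto simp: \<delta>_def)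
    then show "\<kappa> > 2 * \<delta>" "\<kappa> * \<omega> > 2 * \<delta>" using \<kappa>0 p by linarith+
  qed
  let ?p = "(sigma T k, zero_fun)"
  have count_ev: "(l, u) \<in> zeros_FF T a \<and> even_fun T u \<and> card {t \<in> {0..<T}. u t = 0} = 2 * k"
    if s: "s \<noteq> 0" and b: "ev.on_branch \<delta> s l u" for s l u
  proof -
    from b obtain \<gamma> \<gamma>1 \<gamma>2 where z: "(l, u) \<in> zeros_FF T a" "symE T {1} u" and g: "H2rep T \<gamma> \<gamma>1 \<gamma>2"
      "\<forall>t\<in>{0..T}. \<bar>\<gamma> t\<bar> \<le> \<delta> \<and> \<bar>\<gamma>1 t\<bar> \<le> \<delta>" and u: "u = (\<lambda>t. s * (chi_cos T k t + \<gamma> t))"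
      unfolding ev.on_branch_def by blast
    have "{t \<in> {0..<T}. u t = 0} = {t \<in> {0..<T}. \<kappa> * cos (\<omega> * t) + \<gamma> t = 0}"
      using s by (auto simp: u chi_cos_def \<kappa>_def \<omega>_def)
    moreover have "card {t \<in> {0..<T}. \<kappa> * cos (\<omega> * t) + \<gamma> t = 0} = 2 * k"
      by (rule count_cos[OF T k \<omega>_def \<delta>(3,4) \<kappa>0 g(1)]) (use g(2) in blast)
    ultimately show ?thesis using z even_fun_iff[OF T zeros_H2[OF z(1)]] by simp
  qed
  have count_odd: "(l, u) \<in> zeros_FF T a \<and> odd_fun T u \<and> card {t \<in> {0..<T}. u t = 0} = 2 * k"
    if s: "s \<noteq> 0" and b: "od.on_branch \<delta> s l u" for s l u
  proof -
    from b obtain \<gamma> \<gamma>1 \<gamma>2 where z: "(l, u) \<in> zeros_FF T a" "symE T {-1} u" and g: "H2rep T \<gamma> \<gamma>1 \<gamma>2" "symE T {-1} \<gamma>"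
      "\<forall>t\<in>{0..T}. \<bar>\<gamma> t\<bar> \<le> \<delta> \<and> \<bar>\<gamma>1 t\<bar> \<le> \<delta>" and u: "u = (\<lambda>t. s * (chi_sin T k t + \<gamma> t))"
      unfolding od.on_branch_def by blast
    have "{t \<in> {0..<T}. u t = 0} = {t \<in> {0..<T}. \<kappa> * sin (\<omega> * t) + \<gamma> t = 0}"
      using s by (auto simp: u chi_sin_def \<kappa>_def \<omega>_def)
    moreover have "card {t \<in> {0..<T}. \<kappa> * sin (\<omega> * t) + \<gamma> t = 0} = 2 * k"
      by (rule count_sin[OF T k \<omega>_def \<delta>(3,4) \<kappa>0 g(1)]) (use g(3) symED[OF g(2), of "-1"] in auto)
    ultimately show ?thesis using z odd_fun_iff[OF T zeros_H2[OF z(1)]] by simp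
  qed
  obtain \<rho>e where e: "\<rho>e > 0" "\<And>\<rho>. 0 < \<rho> \<Longrightarrow> \<rho> \<le> \<rho>e \<Longrightarrow>
    \<exists>Cp Cm. local_curves T {u \<in> H2 T. symE T {1} u} (sigma T k) (chi_cos T k) Cp Cm \<and>
      RH2_ball T ?p \<rho> \<inter> (connected_component_of_set (subtopology (RH2_top T) (SS_ev T a)) ?p - {?p}) = Cp \<union> Cm \<and>
      Cp \<inter> Cm = {} \<and> neg_set Cp = Cm \<and>
      (\<forall>(l, u)\<in>Cp. \<exists>s>0. ev.on_branch \<delta> s l u) \<and> (\<forall>(l, u)\<in>Cm. \<exists>s<0. ev.on_branch \<delta> s l u) \<and>
      ?p \<in> RH2_top T closure_of (connected_component_of_set (subtopology (RH2_top T) (SS_ev T a)) ?p - trivial_branch)"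
  proof (rule ev.bifurcating_curves[where S = "SS_ev T a", OF \<delta>(1)], goal_cases)
    case 1 show ?case using SS_subset(2) zeros_subset by blast
  next
    case 2 show ?case by (rule SS_trivial(3))
  next
    case (3 l u) show ?case by (rule SS_nontrivial(2)[OF 3(2)])
  next
    case (4 l) show ?case by (rule SS_gap[OF 4(2) SS_sub(1) 4(3) \<delta>(2)])
  next
    case (5 \<rho>m) show ?case by (rule 5(1)[OF 5(2,3)])
  qed
  obtain \<rho>o where o: "\<rho>o > 0" "\<And>\<rho>. 0 < \<rho> \<Longrightarrow> \<rho> \<le> \<rho>o \<Longrightarrow>
    \<exists>Cp Cm. local_curves T {u \<in> H2 T. symE T {-1} u} (sigma T k) (chi_sin T k) Cp Cm \<and>
      RH2_ball T ?p \<rho> \<inter> (connected_component_of_set (subtopology (RH2_top T) (SS_odd T a)) ?p - {?p}) = Cp \<union> Cm \<and>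
      Cp \<inter> Cm = {} \<and> neg_set Cp = Cm \<and>
      (\<forall>(l, u)\<in>Cp. \<exists>s>0. od.on_branch \<delta> s l u) \<and> (\<forall>(l, u)\<in>Cm. \<exists>s<0. od.on_branch \<delta> s l u) \<and>
      ?p \<in> RH2_top T closure_of (connected_component_of_set (subtopology (RH2_top T) (SS_odd T a)) ?p - trivial_branch)"
  proof (rule od.bifurcating_curves[where S = "SS_odd T a", OF \<delta>(1)], goal_cases)
    case 1 show ?case using SS_subset(3) zeros_subset by blast
  next
    case 2 show ?case by (rule SS_trivial(4)[OF k])
  next
    case (3 l u) show ?case by (rule SS_nontrivial(3)[OF 3(2)])
  next
    case (4 l) show ?case by (rule SS_gap[OF 4(2) SS_sub(2) 4(3) \<delta>(2)])
  next
    case (5 \<rho>m) show ?case by (rule 5(1)[OF 5(2,3)])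
  qed
  \<comment> \<open>Each curve is available for every smaller radius, so the minimum serves
    both.\<close>
  define \<rho> where "\<rho> = min \<rho>e \<rho>o"
  have \<rho>: "0 < \<rho>" "\<rho> \<le> \<rho>e" "\<rho> \<le> \<rho>o" using e(1) o(1) by (auto simp: \<rho>_def)
  obtain Ep Em where E: "local_curves T (H2_ev T) (sigma T k) (chi_cos T k) Ep Em"
      "RH2_ball T ?p \<rho> \<inter> (CC_ev T a k - {?p}) = Ep \<union> Em" "Ep \<inter> Em = {}" "neg_set Ep = Em"
      "\<forall>(l, u)\<in>Ep. \<exists>s>0. ev.on_branch \<delta> s l u" "\<forall>(l, u)\<in>Em. \<exists>s<0. ev.on_branch \<delta> s l u"
      "?p \<in> RH2_top T closure_of (CC_ev T a k - trivial_branch)"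
    using e(2)[OF \<rho>(1,2)] unfolding H2_symE[OF T] CC_ev_def by blast
  obtain Op Om where O: "local_curves T (H2_odd T) (sigma T k) (chi_sin T k) Op Om"
      "RH2_ball T ?p \<rho> \<inter> (CC_odd T a k - {?p}) = Op \<union> Om" "Op \<inter> Om = {}" "neg_set Op = Om"
      "\<forall>(l, u)\<in>Op. \<exists>s>0. od.on_branch \<delta> s l u" "\<forall>(l, u)\<in>Om. \<exists>s<0. od.on_branch \<delta> s l u"
    using o(2)[OF \<rho>(1,3)] unfolding H2_symE[OF T] CC_odd_def by blast
  show thesis
  proof (rule that[OF \<rho>(1) E(1) O(1) E(2,3) O(2,3) _ _ E(4) O(4) E(7)])
    fix l u assume "(l, u) \<in> Ep \<union> Em"
    then have "(\<exists>s>0. ev.on_branch \<delta> s l u) \<or> (\<exists>s<0. ev.on_branch \<delta> s l u)"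
      using E(5,6) by (elim UnE) (blast dest: bspec)+
    then obtain s where "s \<noteq> 0" "ev.on_branch \<delta> s l u" by (metis less_irrefl)
    then show "(l, u) \<in> zeros_FF T a \<and> even_fun T u \<and> card {t \<in> {0..<T}. u t = 0} = 2 * k" by (rule count_ev)
  next
    fix l u assume "(l, u) \<in> Op \<union> Om"
    then have "(\<exists>s>0. od.on_branch \<delta> s l u) \<or> (\<exists>s<0. od.on_branch \<delta> s l u)"
      using O(5,6) by (elim UnE) (blast dest: bspec)+
    then obtain s where "s \<noteq> 0" "od.on_branch \<delta> s l u" by (metis less_irrefl)
    then show "(l, u) \<in> zeros_FF T a \<and> odd_fun T u \<and> card {t \<in> {0..<T}. u t = 0} = 2 * k" by (rule count_odd)
  qed
qed

lemma constant_bifurcation: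
  obtains \<rho> Cp Cm where "\<rho> > 0" "local_curves T (H2 T) (sigma T 0) (chi_const T) Cp Cm"
    "RH2_ball T (sigma T 0, zero_fun) \<rho> \<inter> (CC T a 0 - {(sigma T 0, zero_fun)}) = Cp \<union> Cm" "Cp \<inter> Cm = {}"
    "\<And>l u. (l, u) \<in> Cp \<Longrightarrow> (l, u) \<in> zeros_FF T a \<and> even_fun T u \<and> (\<forall>t\<in>{0..T}. u t > 0)"
    "\<And>l u. (l, u) \<in> Cm \<Longrightarrow> (l, u) \<in> zeros_FF T a \<and> even_fun T u \<and> (\<forall>t\<in>{0..T}. u t < 0)"
    "neg_set Cp = Cm" "(sigma T 0, zero_fun) \<in> RH2_top T closure_of (CC T a 0 - trivial_branch)"
proof -
  interpret simple_bifurcation T "sigma T 0" A "2 * T + 2 * T * T" "{}" a "chi_const T" "\<lambda>_. 0"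
    by (rule bifurcation_const[OF T a_meas a_bdd a_even])
  \<comment> \<open>With a remainder of at most 1/2 the factor 1 + \<gamma> stays positive, so u has
    the sign of s.\<close>
  define \<delta> where "\<delta> = min ((2 * pi / T)\<^sup>2) (1 / 2)"
  have \<delta>: "\<delta> > 0" "\<delta> \<le> (2 * pi / T)\<^sup>2" "\<delta> < 1" using T by (auto simp: \<delta>_def)
  let ?p = "(sigma T 0, zero_fun)"
  have br: "(l, u) \<in> zeros_FF T a \<and> even_fun T u \<and> (\<forall>t\<in>{0..T}. \<exists>x>0. u t = s * x)"
    if b: "on_branch \<delta> s l u" for s l u
  proof -
    have "symE T {1} (chi_const T)" by (simp add: symE_def chi_const_def)
    with b obtain \<gamma> where z: "(l, u) \<in> zeros_FF T a" "symE T {1} u" and g: "\<forall>t\<in>{0..T}. \<bar>\<gamma> t\<bar> \<le> \<delta>"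
      and u: "u = (\<lambda>t. s * (chi_const T t + \<gamma> t))" unfolding on_branch_def by blast
    have "\<exists>x>0. u t = s * x" if t: "t \<in> {0..T}" for t
    proof (intro exI conjI)
      show "chi_const T t + \<gamma> t > 0" using bspec[OF g t] \<delta>(3) t by (simp add: chi_const_def abs_le_iff)
    qed (simp add: u)
    then show ?thesis using z even_fun_iff[OF T zeros_H2[OF z(1)]] by simp
  qed
  obtain \<rho> where r: "\<rho> > 0" "\<And>r. 0 < r \<Longrightarrow> r \<le> \<rho> \<Longrightarrow>
    \<exists>Cp Cm. local_curves T {u \<in> H2 T. symE T {} u} (sigma T 0) (chi_const T) Cp Cm \<and>
      RH2_ball T ?p r \<inter> (connected_component_of_set (subtopology (RH2_top T) (SS T a)) ?p - {?p}) = Cp \<union> Cm \<and>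
      Cp \<inter> Cm = {} \<and> neg_set Cp = Cm \<and>
      (\<forall>(l, u)\<in>Cp. \<exists>s>0. on_branch \<delta> s l u) \<and> (\<forall>(l, u)\<in>Cm. \<exists>s<0. on_branch \<delta> s l u) \<and>
      ?p \<in> RH2_top T closure_of (connected_component_of_set (subtopology (RH2_top T) (SS T a)) ?p - trivial_branch)"
  proof (rule bifurcating_curves[where S = "SS T a", OF \<delta>(1)], goal_cases)
    case 1 show ?case using SS_subset(1) zeros_subset by blast
  next
    case 2 show ?case by (rule SS_trivial(2))
  next
    case (3 l u) show ?case by (rule SS_nontrivial(1)[OF 3(2)])
  next
    case (4 l) show ?case by (rule SS_gap[OF 4(2) order_refl 4(3) \<delta>(2)])
  next
    case (5 \<rho>m) show ?case by (rule 5(1)[OF 5(2,3)])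
  qed
  obtain Cp Cm where C: "local_curves T (H2 T) (sigma T 0) (chi_const T) Cp Cm"
      "RH2_ball T ?p \<rho> \<inter> (CC T a 0 - {?p}) = Cp \<union> Cm" "Cp \<inter> Cm = {}" "neg_set Cp = Cm"
      "\<forall>(l, u)\<in>Cp. \<exists>s>0. on_branch \<delta> s l u" "\<forall>(l, u)\<in>Cm. \<exists>s<0. on_branch \<delta> s l u"
      "?p \<in> RH2_top T closure_of (CC T a 0 - trivial_branch)"
    using r(2)[OF r(1) order_refl] unfolding H2_symE[OF T] CC_def by blast
  show thesis
  proof (rule that[OF r(1) C(1-3) _ _ C(4,7)])
    fix l u assume "(l, u) \<in> Cp"
    then obtain s where s: "s > 0" "on_branch \<delta> s l u" using C(5) by (blast dest: bspec)
    have "u t > 0" if "t \<in> {0..T}" for t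
      using br[OF s(2)] that s(1) by (metis mult_pos_pos)
    then show "(l, u) \<in> zeros_FF T a \<and> even_fun T u \<and> (\<forall>t\<in>{0..T}. u t > 0)" using br[OF s(2)] by blast
  next
    fix l u assume "(l, u) \<in> Cm"
    then obtain s where s: "s < 0" "on_branch \<delta> s l u" using C(6) by (blast dest: bspec)
    have "u t < 0" if "t \<in> {0..T}" for t
      using br[OF s(2)] that s(1) by (metis mult_neg_pos)
    then show "(l, u) \<in> zeros_FF T a \<and> even_fun T u \<and> (\<forall>t\<in>{0..T}. u t < 0)" using br[OF s(2)] by blast
  qed
qed

lemma CC_sub: "CC_ev T a k \<subseteq> CC T a k" "CC_odd T a k \<subseteq> CC T a k"
  unfolding CC_ev_def CC_odd_def CC_def
  by (rule subsetI, simp only: mem_Collect_eq, erule connected_component_of_mono, rule SS_sub)+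

lemma CC_subset: "CC T a k \<subseteq> SS T a" "CC_ev T a k \<subseteq> SS_ev T a" "CC_odd T a k \<subseteq> SS_odd T a"
  unfolding CC_def CC_ev_def CC_odd_def
  using connected_component_of_subset_topspace[of "subtopology (RH2_top T) _" "(sigma T k, zero_fun)"] by auto

lemma sigma_in_topspace: "(sigma T k, zero_fun) \<in> topspace (subtopology (RH2_top T) (SS T a))"
  using zero_fun_H2[OF T] SS_trivial(2) by (simp add: topspace_RH2_top[OF T])

text \<open>For k \<ge> 1 the even subcomponent already contains nontrivial points arbitrarily close
  to the bifurcation point.\<close>

lemma CC_emanates: "emanates_at T (CC T a k) (sigma T k)"
proof -
  have "(sigma T k, zero_fun) \<in> CC T a k"
    unfolding CC_def using sigma_in_topspace by (simp add: connected_component_of_refl)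
  moreover have "(sigma T k, zero_fun) \<in> RH2_top T closure_of (CC T a k - trivial_branch)"
  proof (cases "k = 0")
    case True
    show ?thesis unfolding True by (rule constant_bifurcation)
  next
    case False
    then have k: "k \<ge> 1" by simp
    have "(sigma T k, zero_fun) \<in> RH2_top T closure_of (CC_ev T a k - trivial_branch)"
      by (rule even_odd_bifurcation[OF k])
    moreover have "CC_ev T a k - trivial_branch \<subseteq> CC T a k - trivial_branch" using CC_sub(1) by blast
    ultimately show ?thesis using closure_of_mono by blast
  qed
  ultimately show ?thesis by (simp add: emanates_at_def)
qed

text \<open>Bifurcation at an eigenvalue follows from \<open>CC_emanates\<close>. Off the spectrum,
  a small ball makes (\<lambda> - l0) u + a u^3 at most \<theta> |u| in modulus, and
  \<open>nonresonance\<close> leaves only the zero solution.\<close>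

lemma bifurcation_point_iff: "bifurcation_point T a l0 \<longleftrightarrow> (\<exists>k. l0 = sigma T k)"
proof
  assume "\<exists>k. l0 = sigma T k"
  then obtain k where k: "l0 = sigma T k" ..
  show "bifurcation_point T a l0"
    unfolding bifurcation_point_def
  proof (intro allI impI, elim conjE)
    fix U assume "openin (RH2_top T) U" "(l0, zero_fun) \<in> U"
    moreover have "(l0, zero_fun) \<in> RH2_top T closure_of (CC T a k - trivial_branch)"
      using CC_emanates[of k] by (simp add: emanates_at_def k)
    ultimately obtain q where q: "q \<in> CC T a k - trivial_branch" "q \<in> U" unfolding in_closure_of by blast
    obtain l u where lu: "q = (l, u)" by force
    have "(l, u) \<in> zeros_FF T a" "u \<noteq> zero_fun"
      using q CC_subset(1)[of k] SS_subset(1) unfolding lu trivial_branch_def by auto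
    then show "\<exists>l u. (l, u) \<in> U \<and> (l, u) \<in> zeros_FF T a \<and> u \<noteq> zero_fun" using q(2) lu by blast
  qed
next
  assume bp: "bifurcation_point T a l0"
  show "\<exists>k. l0 = sigma T k"
  proof (rule ccontr)
    assume "\<nexists>k. l0 = sigma T k"
    then obtain \<theta> where \<theta>: "\<theta> > 0" "\<And>u u1 f t. H2rep T u u1 (\<lambda>t. f t - l0 * u t) \<Longrightarrow>
      (\<And>t. t \<in> {0..T} \<Longrightarrow> \<bar>f t\<bar> \<le> \<theta> * \<bar>u t\<bar>) \<Longrightarrow> t \<in> {0..T} \<Longrightarrow> u t = 0"
      using nonresonance[OF T, of l0] by blast
    define c where "c = sqrt T / T + sqrt T"
    have c: "c \<ge> 0" using T by (simp add: c_def)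
    have A0: "A \<ge> 0" using a_bdd[of 0] T by auto
    have q: "1 + A * c\<^sup>2 > 0" using A0 by (simp add: add_pos_nonneg)
    \<comment> \<open>Since r \<le> 1 gives r^2 \<le> r, one linear condition on r bounds both
      perturbation terms.\<close>
    define r where "r = min 1 (\<theta> / (1 + A * c\<^sup>2))"
    have r: "r > 0" "r \<le> 1" "r * (1 + A * c\<^sup>2) \<le> \<theta>"
    proof -
      show "r > 0" "r \<le> 1" using \<theta>(1) q by (auto simp: r_def)
      have "r \<le> \<theta> / (1 + A * c\<^sup>2)" by (simp add: r_def)
      then show "r * (1 + A * c\<^sup>2) \<le> \<theta>" using q by (simp add: pos_le_divide_eq)
    qed
    interpret M: Metric_space "(UNIV :: real set) \<times> H2 T" "prod_dist dist (H2_dist T)" by (rule RH2_Metric_space[OF T])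
    have "openin (RH2_top T) (RH2_ball T (l0, zero_fun) r)" unfolding RH2_top_def RH2_ball_def by (rule M.openin_mball)
    moreover have "(l0, zero_fun) \<in> RH2_ball T (l0, zero_fun) r"
      unfolding RH2_ball_def using r(1) zero_fun_H2[OF T] by (simp only: M.centre_in_mball_iff) simp
    ultimately obtain l u where b: "(l, u) \<in> RH2_ball T (l0, zero_fun) r" and z: "(l, u) \<in> zeros_FF T a" and nz: "u \<noteq> zero_fun"
      using bp unfolding bifurcation_point_def by blast
    have d: "sqrt ((l - l0)\<^sup>2 + (H2_norm T u)\<^sup>2) < r" using b by (simp add: in_RH2_ball[OF T])
    have "\<bar>l - l0\<bar> \<le> sqrt ((l - l0)\<^sup>2 + (H2_norm T u)\<^sup>2)"
      using real_sqrt_le_mono[of "(l - l0)\<^sup>2" "(l - l0)\<^sup>2 + (H2_norm T u)\<^sup>2"] by simp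
    then have l: "\<bar>l - l0\<bar> \<le> r" using d by linarith
    have n: "H2_norm T u \<le> r" using real_sqrt_sum_squares_ge2[where x = "l - l0" and y = "H2_norm T u"] d by linarith
    obtain u1 where off: "\<And>t. t \<notin> {0..T} \<Longrightarrow> u t = 0" and rep: "H2rep T u u1 (\<lambda>t. - l * u t - a t * (u t * (u t * u t)))"
      using z unfolding zeros_iff by blast
    define f where "f t = - (l - l0) * u t - a t * (u t * (u t * u t))" for t
    have "H2rep T u u1 (\<lambda>t. f t - l0 * u t)"
      by (rule H2rep_cong[OF rep T]) (simp_all add: f_def algebra_simps)
    moreover have "\<bar>f t\<bar> \<le> \<theta> * \<bar>u t\<bar>" if t: "t \<in> {0..T}" for t
    proof -
      have "\<bar>u t\<bar> \<le> c * H2_norm T u" unfolding c_def by (rule H2_sup_bound(1)[OF T rep t])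
      also have "\<dots> \<le> c * r" using n c by (rule mult_left_mono)
      finally have ut: "\<bar>u t\<bar> \<le> c * r" .
      have "\<bar>u t\<bar> * \<bar>u t\<bar> \<le> (c * r) * (c * r)" by (rule mult_mono[OF ut ut]) (use c r in auto)
      also have "\<dots> = c\<^sup>2 * (r * r)" by (simp add: power2_eq_square)
      also have "\<dots> \<le> c\<^sup>2 * (r * 1)" using r by (intro mult_left_mono) auto
      finally have uu: "\<bar>u t\<bar> * \<bar>u t\<bar> \<le> c\<^sup>2 * (r * 1)" .
      have "\<bar>a t\<bar> * (\<bar>u t\<bar> * \<bar>u t\<bar>) \<le> A * (c\<^sup>2 * (r * 1))" by (rule mult_mono[OF a_bdd[OF t] uu A0]) simp
      then have "\<bar>l - l0\<bar> + \<bar>a t\<bar> * (\<bar>u t\<bar> * \<bar>u t\<bar>) \<le> \<theta>" using l r(3) by (simp add: algebra_simps)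
      then have "(\<bar>l - l0\<bar> + \<bar>a t\<bar> * (\<bar>u t\<bar> * \<bar>u t\<bar>)) * \<bar>u t\<bar> \<le> \<theta> * \<bar>u t\<bar>" by (rule mult_right_mono) simp
      moreover have "\<bar>f t\<bar> \<le> (\<bar>l - l0\<bar> + \<bar>a t\<bar> * (\<bar>u t\<bar> * \<bar>u t\<bar>)) * \<bar>u t\<bar>"
      proof -
        have "\<bar>f t\<bar> \<le> \<bar>- (l - l0) * u t\<bar> + \<bar>a t * (u t * (u t * u t))\<bar>" unfolding f_def by (rule abs_triangle_ineq4)
        also have "\<dots> = (\<bar>l - l0\<bar> + \<bar>a t\<bar> * (\<bar>u t\<bar> * \<bar>u t\<bar>)) * \<bar>u t\<bar>" 
          unfolding abs_mult abs_minus_cancel by (simp only: distrib_right mult.assoc)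
        finally show ?thesis .
      qed
      ultimately show ?thesis by linarith
    qed
    ultimately have "u t = 0" if "t \<in> {0..T}" for t using \<theta>(2) that by blast
    then show False using off nz unfolding zero_fun_def by blast
  qed
qed

end

section \<open>Passage to a general coefficient\<close>

theorem theorem3p11:
  fixes T :: real and a :: "real \<Rightarrow> real"
  assumes "T > 0"
    and "a \<in> Linf T"
    and "AE t in lebesgue_on {0..T}. a t \<ge> 0"
    and "\<not> (AE t in lebesgue_on {0..T}. a t = 0)"
    and "even_fun T a"
  shows
    "(\<forall>l0. bifurcation_point T a l0 \<longleftrightarrow> (\<exists>k. l0 = sigma T k)) \<and>
     (\<forall>k. CC T a k \<in> connected_components_of (subtopology (RH2_top T) (SS T a)) \<and>
        CC T a k \<subseteq> SS T a \<and> emanates_at T (CC T a k) (sigma T k)) \<and>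
     (\<exists>\<rho>>0. \<exists>Cp Cm. local_curves T (H2 T) (sigma T 0) (chi_const T) Cp Cm \<and>
        RH2_ball T (sigma T 0, zero_fun) \<rho> \<inter> (CC T a 0 - {(sigma T 0, zero_fun)}) = Cp \<union> Cm \<and>
        Cp \<inter> Cm = {} \<and>
        (\<forall>(l, u)\<in>Cp. (l, u) \<in> zeros_FF T a \<and> even_fun T u \<and> (\<forall>t\<in>{0..T}. u t > 0)) \<and>
        (\<forall>(l, u)\<in>Cm. (l, u) \<in> zeros_FF T a \<and> even_fun T u \<and> (\<forall>t\<in>{0..T}. u t < 0)) \<and>
        neg_set Cp = Cm) \<and>
     (\<forall>k\<ge>1.
        CC_ev T a k \<subseteq> CC T a k \<and> CC_ev T a k \<subseteq> zeros_FF T a \<inter> (UNIV \<times> H2_ev T) \<and>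
        CC_odd T a k \<subseteq> CC T a k \<and> CC_odd T a k \<subseteq> zeros_FF T a \<inter> (UNIV \<times> H2_odd T) \<and>
        (\<exists>\<rho>>0. \<exists>Ep Em Op Om.
           local_curves T (H2_ev T) (sigma T k) (chi_cos T k) Ep Em \<and>
           local_curves T (H2_odd T) (sigma T k) (chi_sin T k) Op Om \<and>
           RH2_ball T (sigma T k, zero_fun) \<rho> \<inter> (CC_ev T a k - {(sigma T k, zero_fun)}) = Ep \<union> Em \<and>
           Ep \<inter> Em = {} \<and>
           RH2_ball T (sigma T k, zero_fun) \<rho> \<inter> (CC_odd T a k - {(sigma T k, zero_fun)}) = Op \<union> Om \<and>
           Op \<inter> Om = {} \<and>
           (\<forall>(l, u)\<in>Ep \<union> Em. (l, u) \<in> zeros_FF T a \<and> even_fun T u \<and>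
              card {t \<in> {0..<T}. u t = 0} = 2 * k) \<and>
           (\<forall>(l, u)\<in>Op \<union> Om. (l, u) \<in> zeros_FF T a \<and> odd_fun T u \<and>
              card {t \<in> {0..<T}. u t = 0} = 2 * k) \<and>
           neg_set Ep = Em \<and> neg_set Op = Om))"
proof -
  note T = assms(1)
  obtain A b where b: "b \<in> borel_measurable (lebesgue_on {0..T})" "\<And>t. t \<in> {0..T} \<Longrightarrow> \<bar>b t\<bar> \<le> A"
    "\<And>t. t \<in> {0..T} \<Longrightarrow> b (T - t) = b t" and ab: "AE t in lebesgue_on {0..T}. a t = b t"
  proof (rule coefficient_representative[OF T assms(2,5)], goal_cases)
    case (1 A b) from 1(2-5) show ?case by (rule 1(1))
  qed
  \<comment> \<open>All objects in the statement depend on the coefficient only through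
    \<open>zeros_FF\<close>, which sees it up to null sets.\<close>
  note z = zeros_FF_cong[OF ab]
  have SS: "SS T a = SS T b" "SS_ev T a = SS_ev T b" "SS_odd T a = SS_odd T b"
    by (simp_all add: SS_def SS_ev_def SS_odd_def z)
  have CC: "CC T a = CC T b" "CC_ev T a = CC_ev T b" "CC_odd T a = CC_odd T b"
    by (simp_all add: fun_eq_iff CC_def CC_ev_def CC_odd_def SS)
  have bp: "bifurcation_point T a = bifurcation_point T b"
    by (simp add: fun_eq_iff bifurcation_point_def z)
  note ctx = T b
  show ?thesis
    unfolding z SS CC bp
  proof (intro conjI allI impI)
    show "bifurcation_point T b l0 \<longleftrightarrow> (\<exists>k. l0 = sigma T k)" for l0 by (rule bifurcation_point_iff[OF ctx])
    show "CC T b k \<in> connected_components_of (subtopology (RH2_top T) (SS T b))" for k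
      unfolding CC_def connected_component_in_connected_components_of by (rule sigma_in_topspace[OF ctx])
    show "CC T b k \<subseteq> SS T b" for k by (rule CC_subset(1)[OF ctx])
    show "emanates_at T (CC T b k) (sigma T k)" for k by (rule CC_emanates[OF ctx])
    obtain \<rho> Cp Cm where C: "\<rho> > 0" "local_curves T (H2 T) (sigma T 0) (chi_const T) Cp Cm"
      "RH2_ball T (sigma T 0, zero_fun) \<rho> \<inter> (CC T b 0 - {(sigma T 0, zero_fun)}) = Cp \<union> Cm" "Cp \<inter> Cm = {}"
      "\<And>l u. (l, u) \<in> Cp \<Longrightarrow> (l, u) \<in> zeros_FF T b \<and> even_fun T u \<and> (\<forall>t\<in>{0..T}. u t > 0)"
      "\<And>l u. (l, u) \<in> Cm \<Longrightarrow> (l, u) \<in> zeros_FF T b \<and> even_fun T u \<and> (\<forall>t\<in>{0..T}. u t < 0)"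
      "neg_set Cp = Cm"
    proof (rule constant_bifurcation[OF ctx], goal_cases)
      case (1 t) show ?case by (rule 1(2))
    next
      case (2 t) show ?case by (rule 2(2))
    next
      case (3 \<rho> Cp Cm) from 3(2-8) show ?case by (rule 3(1))
    qed
    have p: "\<forall>(l, u)\<in>Cp. (l, u) \<in> zeros_FF T b \<and> even_fun T u \<and> (\<forall>t\<in>{0..T}. u t > 0)"
      "\<forall>(l, u)\<in>Cm. (l, u) \<in> zeros_FF T b \<and> even_fun T u \<and> (\<forall>t\<in>{0..T}. u t < 0)"
      using C(5,6) by blast+
    show "\<exists>\<rho>>0. \<exists>Cp Cm. local_curves T (H2 T) (sigma T 0) (chi_const T) Cp Cm \<and>
        RH2_ball T (sigma T 0, zero_fun) \<rho> \<inter> (CC T b 0 - {(sigma T 0, zero_fun)}) = Cp \<union> Cm \<and>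
        Cp \<inter> Cm = {} \<and>
        (\<forall>(l, u)\<in>Cp. (l, u) \<in> zeros_FF T b \<and> even_fun T u \<and> (\<forall>t\<in>{0..T}. u t > 0)) \<and>
        (\<forall>(l, u)\<in>Cm. (l, u) \<in> zeros_FF T b \<and> even_fun T u \<and> (\<forall>t\<in>{0..T}. u t < 0)) \<and>
        neg_set Cp = Cm"
      by (rule exI[of _ \<rho>], intro conjI C(1), rule exI[of _ Cp], rule exI[of _ Cm]) (intro conjI C p)
    fix k :: nat assume k: "1 \<le> k"
    show "CC_ev T b k \<subseteq> CC T b k" by (rule CC_sub(1)[OF ctx])
    show "CC_odd T b k \<subseteq> CC T b k" by (rule CC_sub(2)[OF ctx])
    show "CC_ev T b k \<subseteq> zeros_FF T b \<inter> (UNIV \<times> H2_ev T)"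
      by (rule order_trans[OF CC_subset(2)[OF ctx] SS_subset(2)[OF ctx]])
    show "CC_odd T b k \<subseteq> zeros_FF T b \<inter> (UNIV \<times> H2_odd T)"
      by (rule order_trans[OF CC_subset(3)[OF ctx] SS_subset(3)[OF ctx]])
    obtain \<rho> Ep Em Op Om where C: "\<rho> > 0"
      "local_curves T (H2_ev T) (sigma T k) (chi_cos T k) Ep Em"
      "local_curves T (H2_odd T) (sigma T k) (chi_sin T k) Op Om"
      "RH2_ball T (sigma T k, zero_fun) \<rho> \<inter> (CC_ev T b k - {(sigma T k, zero_fun)}) = Ep \<union> Em" "Ep \<inter> Em = {}"
      "RH2_ball T (sigma T k, zero_fun) \<rho> \<inter> (CC_odd T b k - {(sigma T k, zero_fun)}) = Op \<union> Om" "Op \<inter> Om = {}"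
      "\<And>l u. (l, u) \<in> Ep \<union> Em \<Longrightarrow> (l, u) \<in> zeros_FF T b \<and> even_fun T u \<and> card {t \<in> {0..<T}. u t = 0} = 2 * k"
      "\<And>l u. (l, u) \<in> Op \<union> Om \<Longrightarrow> (l, u) \<in> zeros_FF T b \<and> odd_fun T u \<and> card {t \<in> {0..<T}. u t = 0} = 2 * k"
      "neg_set Ep = Em" "neg_set Op = Om"
    proof (rule even_odd_bifurcation[OF ctx k], goal_cases)
      case (1 t) show ?case by (rule 1(2))
    next
      case (2 t) show ?case by (rule 2(2))
    next
      case (3 \<rho> Ep Em Op Om) from 3(2-12) show ?case by (rule 3(1))
    qed
    have p: "\<forall>(l, u)\<in>Ep \<union> Em. (l, u) \<in> zeros_FF T b \<and> even_fun T u \<and> card {t \<in> {0..<T}. u t = 0} = 2 * k"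
      "\<forall>(l, u)\<in>Op \<union> Om. (l, u) \<in> zeros_FF T b \<and> odd_fun T u \<and> card {t \<in> {0..<T}. u t = 0} = 2 * k"
      using C(8,9) by blast+
    show "\<exists>\<rho>>0. \<exists>Ep Em Op Om.
           local_curves T (H2_ev T) (sigma T k) (chi_cos T k) Ep Em \<and>
           local_curves T (H2_odd T) (sigma T k) (chi_sin T k) Op Om \<and>
           RH2_ball T (sigma T k, zero_fun) \<rho> \<inter> (CC_ev T b k - {(sigma T k, zero_fun)}) = Ep \<union> Em \<and>
           Ep \<inter> Em = {} \<and>
           RH2_ball T (sigma T k, zero_fun) \<rho> \<inter> (CC_odd T b k - {(sigma T k, zero_fun)}) = Op \<union> Om \<and>
           Op \<inter> Om = {} \<and>
           (\<forall>(l, u)\<in>Ep \<union> Em. (l, u) \<in> zeros_FF T b \<and> even_fun T u \<and>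
              card {t \<in> {0..<T}. u t = 0} = 2 * k) \<and>
           (\<forall>(l, u)\<in>Op \<union> Om. (l, u) \<in> zeros_FF T b \<and> odd_fun T u \<and>
              card {t \<in> {0..<T}. u t = 0} = 2 * k) \<and>
           neg_set Ep = Em \<and> neg_set Op = Om"
      by (rule exI[of _ \<rho>], intro conjI C(1), rule exI[of _ Ep], rule exI[of _ Em], rule exI[of _ Op], rule exI[of _ Om])
        (intro conjI C p)
  qed
qed

end
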